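(* For every integer $m\ge 1$, $$\mathfrak{c}^{\mathrm p}(2,m)=\begin{cases}\mathfrak{c}(1,m)+m, & \text{if } m\in\{3,5\},\\ \mathfrak{c}(1,m)+m-1, & \text{otherwise.}\end{cases}$$
   Context: A matrix is treated as the multiset of its columns. Two vectors $\mathbf{a},\overline{\mathbf{a}}\in\mathbb{R}^d$ differ if $\mathbf{a}\neq\pm\overline{\mathbf{a}}$. A multiset $X\subseteq\mathbb{R}^d$ has differing columns if every pair of vectors in $X$ differs and $\mathbf{0}\notin X$. The number of differing columns of a matrix $A$, i.e. the largest cardinality of a subset of the columns of $A$ that has differing columns, is denoted $|A|$. For an integer matrix $A$ with $m$ rows and $\operatorname{rank} A=m$, let $\Delta(A):=\max\{|\det B| : B \text{ is an } m\times m \text{ submatrix of } A\}$; $A$ is $\Delta$-modular if $\Delta(A)\le\Delta$. For integers $\Delta,m\ge 1$, $$\mathfrak{c}(\Delta,m):=\max\{|A| : A \text{ is an integer matrix with } m \text{ rows},\ \operatorname{rank}A=m,\ \Delta(A)\le\Delta\}.$$ An integer vector is primitive if the gcd of its entries is $1$. $\mathfrak{c}^{\mathrm p}(\Delta,m)$ denotes the maximum number of differing primitive columns in a $\Delta$-modular integer matrix with $m$ rows and rank $m$. (By a theorem of Heller, $\mathfrak{c}(1,m)=\frac12(m^2+m)$.) *)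

theory Defs
  imports
    "Jordan_Normal_Form.DL_Rank"
    "Jordan_Normal_Form.DL_Submatrix"
    "HOL-Library.Multiset"
begin

definition differ :: "'a::group_add vec \<Rightarrow> 'a vec \<Rightarrow> bool" where
  "differ a b \<longleftrightarrow> a \<noteq> b \<and> a \<noteq> - b"

(* Pairs are sub-multisets of size two, so a vector of multiplicity at least two
   forms a pair with itself, and that pair does not differ. *)
definition differing_columns :: "'a::group_add vec multiset \<Rightarrow> bool" where
  "differing_columns X \<longleftrightarrow>
     (\<forall>a b. {#a, b#} \<subseteq># X \<longrightarrow> differ a b) \<and> (\<forall>a \<in># X. a \<noteq> 0\<^sub>v (dim_vec a))"

definition num_differing :: "'a::group_add mat \<Rightarrow> nat" where
  "num_differing A = Max {size X |X. X \<subseteq># mset (cols A) \<and> differing_columns X}"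

definition primitive_vec :: "int vec \<Rightarrow> bool" where
  "primitive_vec v \<longleftrightarrow> Gcd (set\<^sub>v v) = 1"

definition num_differing_primitive :: "int mat \<Rightarrow> nat" where
  "num_differing_primitive A =
     Max {size X |X. X \<subseteq># mset (cols A) \<and> differing_columns X \<and> (\<forall>a \<in># X. primitive_vec a)}"

definition full_row_rank :: "int mat \<Rightarrow> bool" where
  "full_row_rank A \<longleftrightarrow> vec_space.rank (dim_row A) (map_mat real_of_int A) = dim_row A"

(* The maximum is over a nonempty set only if A has at least as many columns as rows,
   in particular if A has full row rank; it is used only in that case. *)
definition max_minor :: "int mat \<Rightarrow> int" where
  "max_minor A =
     Max {\<bar>det B\<bar> |B I J. B = submatrix A I J \<and> B \<in> carrier_mat (dim_row A) (dim_row A)}"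

definition modular_mats :: "int \<Rightarrow> nat \<Rightarrow> int mat set" where
  "modular_mats \<Delta> m = {A. dim_row A = m \<and> full_row_rank A \<and> max_minor A \<le> \<Delta>}"

definition max_differing :: "int \<Rightarrow> nat \<Rightarrow> nat" where
  "max_differing \<Delta> m = Max {num_differing A |A. A \<in> modular_mats \<Delta> m}"

definition max_differing_primitive :: "int \<Rightarrow> nat \<Rightarrow> nat" where
  "max_differing_primitive \<Delta> m = Max {num_differing_primitive A |A. A \<in> modular_mats \<Delta> m}"

end

theory Submission
  imports Defs "Jordan_Normal_Form.DL_Rank_Submatrix" "HOL-Library.Function_Algebras"
begin

text \<open>Columns are counted up to sign, so a set of differing columns is replaced by its symmetric closure
  \<open>A = - A\<close> in a real vector space, with twice as many elements; the claim becomes that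
  a primitive bimodular \<open>A\<close> of dimension \<open>m\<close> has at most \<open>m^2 + 3 m\<close> elements, and at least two
  fewer unless \<open>m\<close> is 3 or 5. Determinants enter only through the absolute volume of a basis and
  its behaviour under exchange of one vector (locales \<open>lattice_vol\<close> and \<open>bimodular\<close>).

  If no nonempty independent subset of \<open>A\<close> has its sum in twice the lattice, all coordinates with
  respect to bases in \<open>A\<close> are 0 or \<plusminus>1, and Heller's bound \<open>m (m + 1)\<close> applies (\<open>unimod_of_no_even\<close>,
  \<open>heller\<close>). Otherwise let \<open>S\<close> be a smallest such subset. It has at least two elements because
  the vectors are primitive. If it has five or more, contracting any element of \<open>A\<close> gives again a
  primitive bimodular set, and at most \<open>2 (m - 1) + 2\<close> elements are lost beyond it
  (\<open>contract_bimodular\<close>, \<open>card_A_contract\<close>); induction on \<open>m\<close> then suffices.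

  There remain the sizes \<open>s\<close> = 2, 3, 4. Every basis through \<open>S\<close> has volume 2, so the projection along
  \<open>span S\<close> maps \<open>A\<close> onto a unimodular set \<open>U\<close> of dimension \<open>r = m - s\<close>, together with the origin, and
  Heller's theorem bounds \<open>U\<close>. The fibres are small subsets of an \<open>s\<close>-dimensional space in which
  two points differ by at most 1 in each coordinate. By minimality of \<open>S\<close>, the integral points of a
  fibre exceed the number of coordinates in which they vary by at most 1, and so do the half-integral ones; the exceptions are unit squares
  (\<open>card_P\<close>, \<open>card_fibre\<close>). In each coordinate the widths of the fibres add up to at most 2 along
  every circuit of \<open>U\<close>, and a weighted version of Heller's argument (\<open>weight_bound\<close>) bounds their
  total over \<open>U\<close> by \<open>2 r (s + 1)\<close>. Squares and points over the origin restrict one another, since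
  otherwise a sequence of exchanges produces a basis of volume more than 2 (\<open>two_diag\<close>, \<open>square_share\<close>,
  \<open>square_disjoint_flip\<close>), so both together contribute at most \<open>s^2 + 3 s\<close> (\<open>Q_bound\<close>). The three bounds
  add up to \<open>m^2 + 3 m\<close>. Equality forces some \<open>u\<close> whose squares use all coordinates in \<open>S\<close>, and such
  a \<open>u\<close> adds up to an element of \<open>U\<close> with none of the other directions of wide fibres
  (\<open>covered_isolated\<close>). This leaves \<open>U\<close> too small when \<open>r \<ge> 2\<close>, and \<open>r\<close> = 1 occurs
  only for \<open>m\<close> = 3 and \<open>m\<close> = 5 (\<open>not_tight\<close>, \<open>flat_card\<close>).

  For the lower bounds, the edges of the complete graph on \<open>m + 1\<close> vertices are unimodular, and
  \<open>m - 1\<close> further columns raise minors to 2 at most since they differ from edges in one row only. In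
  dimension 3 the roots of type B, and in dimension 5 the roots of type D written in a basis of their
  lattice, do better by one.\<close>

section \<open>Unimodular sets and Heller's theorem\<close>

lemma span_lift:
  fixes p :: "'a::real_vector \<Rightarrow> 'a"
  assumes lin: "linear p" and ker: "\<And>v. p v = 0 \<Longrightarrow> v \<in> span E" and x: "p x \<in> span (p ` T)"
  shows "x \<in> span (E \<union> T)"
proof -
  have "p x \<in> p ` span T" using x linear_span_image[OF lin] by simp
  then obtain t where t: "t \<in> span T" "p x = p t" by auto
  have "p (x - t) = 0" using t lin by (simp add: linear_diff)
  hence "x - t \<in> span E" by (rule ker)
  hence "(x - t) + t \<in> span (E \<union> T)"
    using t(1) span_mono[of E "E \<union> T"] span_mono[of T "E \<union> T"] by (intro span_add) auto
  thus ?thesis by simp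
qed

lemma span_push:
  fixes p :: "'a::real_vector \<Rightarrow> 'a"
  assumes lin: "linear p" and ker: "\<And>v. v \<in> E \<Longrightarrow> p v = 0" and x: "x \<in> span (E \<union> T)"
  shows "p x \<in> span (p ` T)"
proof -
  have "p x \<in> span (p ` (E \<union> T))" using x linear_span_image[OF lin] by blast
  also have "p ` (E \<union> T) \<subseteq> insert 0 (p ` T)" using ker by auto
  hence "span (p ` (E \<union> T)) \<subseteq> span (insert 0 (p ` T))" by (rule span_mono)
  also have "span (insert 0 (p ` T)) = span (p ` T)" by (rule span_insert_0)
  finally show ?thesis .
qed

lemma indep_iff: "independent B \<longleftrightarrow> (\<forall>b\<in>B. b \<notin> span (B - {b}))"
  unfolding dependent_def by blast

lemma indep_lift:
  fixes p :: "'a::real_vector \<Rightarrow> 'a"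
  assumes lin: "linear p" and ker: "\<And>v. v \<in> E \<Longrightarrow> p v = 0"
    and E: "independent E" and T: "independent (p ` T)" and inj: "inj_on p T"
  shows "independent (E \<union> T)" "E \<inter> T = {}"
proof -
  have pT: "p t \<noteq> 0" if "t \<in> T" for t using T that dependent_zero by (metis image_eqI)
  show disj: "E \<inter> T = {}" using ker pT by blast
  have T1: "t \<notin> span (E \<union> (T - {t}))" if "t \<in> T" for t
  proof
    assume "t \<in> span (E \<union> (T - {t}))"
    hence "p t \<in> span (p ` (T - {t}))" using lin ker by (rule span_push[rotated 2])
    also have "p ` (T - {t}) = p ` T - {p t}" using inj that by (auto simp: inj_on_def)
    finally show False using T that unfolding indep_iff by blast
  qed
  have finI: "independent (E \<union> T')" if "finite T'" "T' \<subseteq> T" for T' using that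
  proof (induction T' rule: finite_induct)
    case empty show ?case using E by simp
  next
    case (insert t T')
    have "t \<notin> span (E \<union> T')" using T1[of t] insert span_mono[of "E \<union> T'" "E \<union> (T - {t})"] by blast
    thus ?case using insert by (simp add: independent_insertI)
  qed
  show "independent (E \<union> T)"
    unfolding indep_iff
  proof (intro ballI notI)
    fix b assume b: "b \<in> E \<union> T" "b \<in> span (E \<union> T - {b})"
    have "\<exists>B r. finite B \<and> B \<subseteq> E \<union> T - {b} \<and> b = (\<Sum>a\<in>B. r a *\<^sub>R a)"
      using b(2) unfolding span_explicit mem_Collect_eq by metis
    then obtain B r where B: "finite B" "B \<subseteq> E \<union> T - {b}" "b = (\<Sum>a\<in>B. r a *\<^sub>R a)" by blast
    have "(\<Sum>a\<in>B. r a *\<^sub>R a) \<in> span B" by (intro span_sum span_scale span_base)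
    hence B3_roots: "b \<in> span B" using B(3) by metis
    have "independent (E \<union> (insert b B \<inter> T))" using B by (intro finI) auto
    moreover have "insert b B \<subseteq> E \<union> (insert b B \<inter> T)" using B b by auto
    ultimately have "independent (insert b B)" using independent_mono by blast
    moreover have "insert b B - {b} = B" using B(2) by auto
    ultimately show False using B3_roots unfolding indep_iff by auto
  qed
qed

text \<open>The symmetric version of total unimodularity, free of a choice of basis: the coordinates of every element in every independent subset that spans it are 0 or \<plusminus>1.\<close>

definition unimod :: "'a::real_vector set \<Rightarrow> bool" where
  "unimod U \<longleftrightarrow> finite U \<and> 0 \<notin> U \<and> (\<forall>u\<in>U. - u \<in> U) \<and>
     (\<forall>Z u z c. Z \<subseteq> U \<longrightarrow> independent Z \<longrightarrow> u \<in> U \<longrightarrow> z \<in> Z \<longrightarrow>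
        u - c *\<^sub>R z \<in> span (Z - {z}) \<longrightarrow> c \<in> {-1, 0, 1})"

lemma unimodD:
  assumes "unimod U"
  shows "finite U" "0 \<notin> U" "\<And>u. u \<in> U \<Longrightarrow> - u \<in> U"
    "\<And>Z u z c. \<lbrakk>Z \<subseteq> U; independent Z; u \<in> U; z \<in> Z; u - c *\<^sub>R z \<in> span (Z - {z})\<rbrakk> \<Longrightarrow> c \<in> {-1, 0, 1}"
  using assms unfolding unimod_def by blast+

lemma unimod_restrict:
  assumes U: "unimod U" and sub: "subspace W"
  shows "unimod (U \<inter> W)"
  unfolding unimod_def
proof (intro conjI allI impI ballI)
  show "finite (U \<inter> W)" "0 \<notin> U \<inter> W" using unimodD[OF U] by auto
  show "- u \<in> U \<inter> W" if "u \<in> U \<inter> W" for u using unimodD(3)[OF U] sub that by (simp add: subspace_neg)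
  fix Z u z c assume "Z \<subseteq> U \<inter> W" "independent Z" "u \<in> U \<inter> W" "z \<in> Z" "u - c *\<^sub>R z \<in> span (Z - {z})"
  thus "c \<in> {-1, 0, 1}" using unimodD(4)[OF U, of Z u z c] by blast
qed

lemma exists_functional:
  fixes e :: "'a::real_vector"
  assumes "independent B"
  obtains g :: "'a \<Rightarrow> 'b::real_vector" where "linear g" "\<And>x. x \<in> B \<Longrightarrow> g x = f x"
  using linear_independent_extend[OF assms, of f] by blast

lemma exists_projection:
  fixes e :: "'a::real_vector"
  assumes "e \<noteq> 0"
  shows "\<exists>p :: 'a \<Rightarrow> 'a. linear p \<and> (\<forall>v. p v = 0 \<longleftrightarrow> v \<in> span {e})"
proof -
  have "independent {e}" using assms by (simp add: independent_insert)
  then obtain g :: "'a \<Rightarrow> real" where g: "linear g" "g e = 1"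
    using exists_functional[of "{e}" "\<lambda>_. 1::real"] by auto
  define p where "p v = v - g v *\<^sub>R e" for v
  have "linear p" unfolding p_def using g
    by (intro linearI) (auto simp: linear_add linear_scale algebra_simps)
  moreover have "p v = 0 \<longleftrightarrow> v \<in> span {e}" for v
    using g unfolding p_def span_singleton by (auto simp: linear_scale)
  ultimately show ?thesis by blast
qed

lemma span_singleton_iff: "v \<in> span {e} \<longleftrightarrow> (\<exists>c. v = c *\<^sub>R e)"
  unfolding span_singleton by auto

lemma unimod_parallel:
  assumes U: "unimod U" and "u \<in> U" "v \<in> U" "v \<in> span {u}"
  shows "v = u \<or> v = - u"
proof -
  obtain c where c: "v = c *\<^sub>R u" using assms by (auto simp: span_singleton)
  have "independent {u}" using unimodD(2)[OF U] assms by (auto simp: independent_insert)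
  hence "c \<in> {-1, 0, 1}" using unimodD(4)[OF U, of "{u}" v u c] assms c by (auto simp: span_empty)
  moreover have "v \<noteq> 0" using unimodD(2)[OF U] assms by auto
  ultimately show ?thesis using c by auto
qed

lemma indep_pair:
  fixes u v :: "'a::real_vector"
  assumes "u \<noteq> 0" "v \<notin> span {u}"
  shows "independent {u, v}" "u \<noteq> v"
  using assms by (auto simp: independent_insert span_base insert_commute[of u v])

lemma unimod_indep_pair:
  assumes U: "unimod U" and "u \<in> U" "v \<in> U" "v \<noteq> u" "v \<noteq> - u"
  shows "independent {u, v}" 
  using indep_pair[of u v] unimod_parallel[OF U] assms unimodD(2)[OF U] by auto

lemma span_finite_coeff:
  assumes "finite S" "x \<in> span S"
  obtains c where "x = (\<Sum>s\<in>S. c s *\<^sub>R s)"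
  using assms span_finite[OF assms(1)] by auto

lemma indep_signs:
  fixes T :: "'a::real_vector set"
  assumes T: "independent T" and R: "R \<subseteq> T" "finite R" and s: "\<And>t. t \<in> R \<Longrightarrow> s t = 1 \<or> s t = -1"
  shows "independent ((\<lambda>t. s t *\<^sub>R t) ` R)" "inj_on (\<lambda>t. s t *\<^sub>R t) R"
proof -
  have iR: "independent R" using T R independent_mono by blast
  show inj: "inj_on (\<lambda>t. s t *\<^sub>R t) R"
  proof (rule inj_onI, rule ccontr)
    fix x y assume xy: "x \<in> R" "y \<in> R" "s x *\<^sub>R x = s y *\<^sub>R y" "x \<noteq> y"
    have "x = s x *\<^sub>R (s x *\<^sub>R x)" using s[OF xy(1)] by auto
    hence "x = (s x * s y) *\<^sub>R y" using xy(3) by simp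
    hence "x \<in> span (R - {x})" using xy by (metis span_base span_scale Diff_iff singletonD)
    thus False using iR xy(1) unfolding indep_iff by blast
  qed
  have sp: "span ((\<lambda>t. s t *\<^sub>R t) ` Q) = span Q" if "Q \<subseteq> R" for Q
  proof (rule antisym; rule span_minimal)
    show "(\<lambda>t. s t *\<^sub>R t) ` Q \<subseteq> span Q" by (auto intro: span_scale span_base)
    show "Q \<subseteq> span ((\<lambda>t. s t *\<^sub>R t) ` Q)"
    proof
      fix t assume t: "t \<in> Q"
      have "s t *\<^sub>R (s t *\<^sub>R t) \<in> span ((\<lambda>t. s t *\<^sub>R t) ` Q)" using t by (intro span_scale span_base) simp
      moreover have "s t = 1 \<or> s t = -1" using s[of t] that t by blast
      ultimately show "t \<in> span ((\<lambda>t. s t *\<^sub>R t) ` Q)" by auto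
    qed
  qed auto
  show "independent ((\<lambda>t. s t *\<^sub>R t) ` R)"
    unfolding indep_iff
  proof (intro ballI notI)
    fix b assume "b \<in> (\<lambda>t. s t *\<^sub>R t) ` R" and b: "b \<in> span ((\<lambda>t. s t *\<^sub>R t) ` R - {b})"
    then obtain t where t: "t \<in> R" "b = s t *\<^sub>R t" by auto
    have "(\<lambda>t. s t *\<^sub>R t) ` R - {b} = (\<lambda>t. s t *\<^sub>R t) ` (R - {t})"
      using inj t by (auto simp: inj_on_def)
    hence "b \<in> span (R - {t})" using sp[of "R - {t}"] b by auto
    hence "s t *\<^sub>R b \<in> span (R - {t})" by (rule span_scale)
    hence "t \<in> span (R - {t})" using t s[of t] by auto
    thus False using iR t unfolding indep_iff by blast
  qed
qed

lemma unimod_signed_sum: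
  assumes U: "unimod U" and T: "T \<subseteq> U" "independent T" and y: "y \<in> U" "y \<in> span T"
  shows "\<exists>R s. R \<subseteq> T \<and> R \<noteq> {} \<and> (\<forall>t\<in>R. s t = (1::real) \<or> s t = -1) \<and> y = (\<Sum>t\<in>R. s t *\<^sub>R t)"
proof -
  have fT: "finite T" using finite_subset[OF T(1) unimodD(1)[OF U]] .
  obtain c where c: "y = (\<Sum>t\<in>T. c t *\<^sub>R t)" using span_finite_coeff[OF fT y(2)] by blast
  have cc: "c t \<in> {-1,0,1}" if "t \<in> T" for t
  proof (rule unimodD(4)[OF U T y(1) that])
    have "y - c t *\<^sub>R t = (\<Sum>t\<in>T - {t}. c t *\<^sub>R t)"
      using fT that unfolding c by (subst sum.remove[of T t]) auto
    moreover have "(\<Sum>t\<in>T - {t}. c t *\<^sub>R t) \<in> span (T - {t})" by (intro span_sum span_scale span_base)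
    ultimately show "y - c t *\<^sub>R t \<in> span (T - {t})" by simp
  qed
  define R where "R = {t\<in>T. c t \<noteq> 0}"
  have "y = (\<Sum>t\<in>R. c t *\<^sub>R t)" unfolding c R_def using fT by (intro sum.mono_neutral_right) auto
  moreover from this have "R \<noteq> {}" using y(1) unimodD(2)[OF U] by auto
  ultimately show ?thesis using cc by (intro exI[of _ R] exI[of _ c]) (auto simp: R_def)
qed

text \<open>Take a basis \<open>T\<close> of \<open>N\<close> inside \<open>N\<close>. An element of \<open>N\<close> outside \<open>T\<close> and \<open>- T\<close> is a signed sum of at least two elements of \<open>T\<close>; absorbing the signs gives one of the excluded circuits.\<close>

lemma card_acyclic:
  assumes U: "unimod U" and N: "N \<subseteq> U" "\<And>u. u \<in> N \<Longrightarrow> - u \<in> N"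
    and nc: "\<And>T y. \<lbrakk>T \<subseteq> N; independent T; card T \<ge> 2; y \<in> N; y = \<Sum>T\<rbrakk> \<Longrightarrow> False"
  shows "card N \<le> 2 * dim U" and "\<exists>T\<subseteq>N. independent T \<and> N = T \<union> uminus ` T"
proof -
  obtain T where T: "T \<subseteq> N" "independent T" "N \<subseteq> span T" "card T = dim N"
    using basis_exists[of N] by metis
  have TU: "T \<subseteq> U" using T(1) N(1) by (rule order_trans)
  have fT: "finite T" using finite_subset[OF TU unimodD(1)[OF U]] .
  have sub: "N \<subseteq> T \<union> uminus ` T"
  proof
    fix y assume y: "y \<in> N"
    have yU: "y \<in> U" "y \<in> span T" using y N(1) T(3) by auto
    obtain R s where R: "R \<subseteq> T" "R \<noteq> {}" "\<And>t. t \<in> R \<Longrightarrow> s t = (1::real) \<or> s t = -1" "y = (\<Sum>t\<in>R. s t *\<^sub>R t)"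
      using unimod_signed_sum[OF U TU T(2) yU] by blast
    have fR: "finite R" using finite_subset[OF R(1) fT] .
    note IS = indep_signs[OF T(2) R(1) fR, of s, OF R(3)]
    have sub: "(\<lambda>t. s t *\<^sub>R t) ` R \<subseteq> N"
    proof
      fix x assume "x \<in> (\<lambda>t. s t *\<^sub>R t) ` R"
      then obtain t where t: "t \<in> R" "x = s t *\<^sub>R t" by auto
      thus "x \<in> N" using R(1) R(3)[of t] T(1) N(2)[of t] by auto
    qed
    have sm: "y = \<Sum>((\<lambda>t. s t *\<^sub>R t) ` R)" using R(4) sum.reindex[OF IS(2), of id] by simp
    have "card ((\<lambda>t. s t *\<^sub>R t) ` R) = card R" by (rule card_image[OF IS(2)])
    hence "\<not> card R \<ge> 2" using nc[OF sub IS(1) _ y sm] by auto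
    moreover have "card R \<noteq> 0" using R fR by auto
    ultimately have "card R = 1" by linarith
    then obtain t where "R = {t}" by (auto simp: card_1_singleton_iff)
    thus "y \<in> T \<union> uminus ` T" using R(1) R(3)[of t] R(4) by auto
  qed
  have "card N \<le> card (T \<union> uminus ` T)" using sub fT by (intro card_mono) auto
  also have "\<dots> \<le> card T + card (uminus ` T)" by (rule card_Un_le)
  also have "\<dots> \<le> 2 * card T" using card_image_le[OF fT, of uminus] by simp
  finally have "card N \<le> 2 * card T" .
  moreover have "card T \<le> dim U"
  proof -
    obtain B where B: "B \<subseteq> U" "independent B" "U \<subseteq> span B" "card B = dim U" using basis_exists[of U] by metis
    have "finite B" using finite_subset[OF B(1) unimodD(1)[OF U]] .
    moreover have "T \<subseteq> span B" using B T N by auto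
    ultimately show ?thesis using independent_span_bound[of B T] T B by auto
  qed
  ultimately show "card N \<le> 2 * dim U" by linarith
  show "\<exists>T\<subseteq>N. independent T \<and> N = T \<union> uminus ` T"
    using sub T N(2) by (intro exI[of _ T]) auto
qed

lemma lift_set:
  assumes "Z' \<subseteq> f ` A"
  shows "\<exists>T. T \<subseteq> A \<and> f ` T = Z' \<and> inj_on f T"
proof -
  define T where "T = inv_into A f ` Z'"
  have "f ` T = Z'" using assms unfolding T_def by (force simp: image_image f_inv_into_f subset_iff)
  moreover have "T \<subseteq> A" using assms unfolding T_def by (auto intro: inv_into_into)
  moreover have "inj_on f T" using assms unfolding T_def by (auto intro!: inj_onI simp: f_inv_into_f subset_iff)
  ultimately show ?thesis by blast
qed

lemma basis_lift:
  fixes p :: "'a::real_vector \<Rightarrow> 'a"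
  assumes lin: "linear p" and ker: "\<And>v. p v = 0 \<longleftrightarrow> v \<in> span E" and E: "independent E"
    and Z: "Z' \<subseteq> p ` A" "independent Z'"
  shows "\<exists>T. T \<subseteq> A \<and> p ` T = Z' \<and> inj_on p T \<and> independent (E \<union> T) \<and> E \<inter> T = {}"
proof -
  obtain T where T: "T \<subseteq> A" "p ` T = Z'" "inj_on p T" using lift_set[OF Z(1)] by blast
  have "p v = 0" if "v \<in> E" for v using ker that by (simp add: span_base)
  hence "independent (E \<union> T)" "E \<inter> T = {}" using indep_lift[OF lin, of E T] E T Z by auto
  thus ?thesis using T by blast
qed

lemma dim_quot:
  fixes p :: "'a::real_vector \<Rightarrow> 'a"
  assumes lin: "linear p" and ker: "\<And>v. p v = 0 \<longleftrightarrow> v \<in> span E" and E: "independent E" "finite E"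
    and A: "E \<subseteq> span A" "finite A"
  shows "dim A = card E + dim (p ` A - {0})"
proof -
  obtain Z' where Z': "Z' \<subseteq> p ` A - {0}" "independent Z'" "p ` A - {0} \<subseteq> span Z'" "card Z' = dim (p ` A - {0})"
    using basis_exists[of "p ` A - {0}"] by metis
  obtain T where T: "T \<subseteq> A" "p ` T = Z'" "inj_on p T" "independent (E \<union> T)" "E \<inter> T = {}"
    using basis_lift[OF lin ker E(1) _ Z'(2), of A] Z'(1) by blast
  have "A \<subseteq> span (E \<union> T)"
  proof
    fix x assume x: "x \<in> A"
    have "p x \<in> span (p ` T)" using Z'(3) T(2) x span_0 by (cases "p x = 0") auto
    thus "x \<in> span (E \<union> T)" using ker by (intro span_lift[OF lin]) auto
  qed
  moreover have "E \<union> T \<subseteq> span A" using A T span_superset by blast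
  ultimately have "span (E \<union> T) = span A" by (meson span_minimal subspace_span subset_antisym)
  hence "dim A = card (E \<union> T)" using T(4) by (rule dim_eq_card)
  also have "\<dots> = card E + card T" using E T A finite_subset by (intro card_Un_disjoint) auto
  also have "card T = dim (p ` A - {0})" using card_image[OF T(3)] T(2) Z'(4) by simp
  finally show ?thesis .
qed

text \<open>Projecting along \<open>e\<close> joins elements that differ by \<open>e\<close>. At most two meet: if \<open>x + e\<close> and \<open>x - e\<close> both were in \<open>U\<close>, the first would have coefficient 2 at \<open>e\<close> with respect to \<open>{x - e, e}\<close>.\<close>

lemma unimod_contract:
  fixes p :: "'a::real_vector \<Rightarrow> 'a"
  assumes U: "unimod U" and e: "e \<in> U" and lin: "linear p" and ker: "\<And>v. p v = 0 \<longleftrightarrow> v \<in> span {e}"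
  shows "unimod (p ` U - {0})" "dim U = Suc (dim (p ` U - {0}))"
    "\<And>x y. \<lbrakk>x \<in> U; y \<in> U; p x = p y; p x \<noteq> 0\<rbrakk> \<Longrightarrow> y = x \<or> y = x + e \<or> y = x - e"
    "\<And>x. \<lbrakk>p x \<noteq> 0; x + e \<in> U; x - e \<in> U\<rbrakk> \<Longrightarrow> False"
    "p e = 0" "\<And>u. u \<in> U \<Longrightarrow> p u = 0 \<longleftrightarrow> u = e \<or> u = - e"
proof -
  note D = unimodD[OF U]
  have e0: "e \<noteq> 0" using e D(2) by blast
  have ie: "independent {e}" using e0 by (simp add: independent_insert)
  show pe: "p e = 0" using ker by (simp add: span_base)
  show "p u = 0 \<longleftrightarrow> u = e \<or> u = - e" if "u \<in> U" for u
    using ker[of u] unimod_parallel[OF U e that] pe lin by (auto simp: linear_neg)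
  show "unimod (p ` U - {0})"
    unfolding unimod_def
  proof (intro conjI allI impI ballI)
    show "finite (p ` U - {0})" "0 \<notin> p ` U - {0}" using D by auto
    show "- u \<in> p ` U - {0}" if u: "u \<in> p ` U - {0}" for u
    proof -
      obtain x where "x \<in> U" "u = p x" "u \<noteq> 0" using u by auto
      thus ?thesis using D(3)[of x] linear_neg[OF lin, of x] by (auto intro!: image_eqI[of _ _ "- x"])
    qed
    fix Z' u' z' c
    assume Z': "Z' \<subseteq> p ` U - {0}" "independent Z'" "u' \<in> p ` U - {0}" "z' \<in> Z'" "u' - c *\<^sub>R z' \<in> span (Z' - {z'})"
    obtain T where T: "T \<subseteq> U" "p ` T = Z'" "inj_on p T" "independent ({e} \<union> T)" "{e} \<inter> T = {}"
      using basis_lift[OF lin ker ie _ Z'(2), of U] Z'(1) by blast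
    obtain u z where uz: "u \<in> U" "u' = p u" "z \<in> T" "z' = p z" using Z' T by blast
    have "p (u - c *\<^sub>R z) \<in> span (p ` (T - {z}))"
    proof -
      have "p ` (T - {z}) = Z' - {z'}" using T uz by (auto simp: inj_on_def)
      thus ?thesis using Z'(5) uz lin by (simp add: linear_diff linear_scale)
    qed
    hence "u - c *\<^sub>R z \<in> span ({e} \<union> (T - {z}))" using ker by (intro span_lift[OF lin]) auto
    also have "{e} \<union> (T - {z}) = {e} \<union> T - {z}" using T(5) uz by auto
    finally show "c \<in> {-1, 0, 1}" using D(4)[of "{e} \<union> T" u z c] T uz e by auto
  qed
  show "dim U = Suc (dim (p ` U - {0}))"
    using dim_quot[OF lin ker ie, of U] e D(1) by (simp add: span_base)
  show "y = x \<or> y = x + e \<or> y = x - e" if xy: "x \<in> U" "y \<in> U" "p x = p y" "p x \<noteq> 0" for x y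
  proof -
    have "p (y - x) = 0" using xy lin by (simp add: linear_diff)
    then obtain c where c: "y - x = c *\<^sub>R e" using ker span_singleton_iff by blast
    have "independent {e, x}" using indep_pair[OF e0, of x] ker[of x] xy by auto
    moreover have "y - c *\<^sub>R e \<in> span ({e, x} - {e})" using c xy pe
      by (auto simp: algebra_simps intro!: span_base)
    ultimately have "c \<in> {-1, 0, 1}" using D(4)[of "{e, x}" y e c] e xy by auto
    thus ?thesis using c by (auto simp: algebra_simps)
  qed
  show False if x: "p x \<noteq> 0" "x + e \<in> U" "x - e \<in> U" for x
  proof -
    have "independent {e, x - e}" using indep_pair[OF e0, of "x - e"] ker[of "x - e"] x pe lin by (auto simp: linear_diff)
    moreover have "(x + e) - 2 *\<^sub>R e \<in> span ({e, x - e} - {e})"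
    proof -
      have "x - e \<noteq> e" using x(1) pe lin by (metis diff_add_cancel linear_add add_0)
      thus ?thesis by (auto simp: scaleR_2 algebra_simps intro!: span_base)
    qed
    ultimately have "(2::real) \<in> {-1, 0, 1}" using D(4)[of "{e, x - e}" "x + e" e 2] e x by auto
    thus False by simp
  qed
qed

text \<open>The directions over which the contraction of \<open>e\<close> loses an element.\<close>

definition doubled :: "('a::real_vector \<Rightarrow> 'a) \<Rightarrow> 'a set \<Rightarrow> 'a \<Rightarrow> 'a set" where
  "doubled p U e = {p x |x. x \<in> U \<and> x + e \<in> U \<and> p x \<noteq> 0}"

lemma doubled_sub: "doubled p U e \<subseteq> p ` U - {0}"
  unfolding doubled_def by auto

text \<open>A circuit among the doubled directions lifts to the lower end points of its fibres and also to the upper ones. Passing from one lift to the other changes the coordinate at \<open>e\<close> by the number of summands, which the coordinate range from -1 to 1 does not allow.\<close>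

lemma heller_no_circuit:
  fixes p :: "'a::real_vector \<Rightarrow> 'a"
  assumes U: "unimod U" and e: "e \<in> U" and lin: "linear p" and ker: "\<And>v. p v = 0 \<longleftrightarrow> v \<in> span {e}"
    and T: "T \<subseteq> doubled p U e" "independent T" "card T \<ge> 2" and y: "y \<in> doubled p U e" "y = \<Sum>T"
  shows False
proof -
  note C = unimod_contract[OF U e lin ker]
  have ie: "independent {e}" using unimodD(2)[OF U] e by (auto simp: independent_insert)
  have fT: "finite T" using T(3) by (metis card.infinite not_numeral_le_zero)
  define A where "A = {x \<in> U. x + e \<in> U}"
  have "T \<subseteq> p ` A" using T unfolding doubled_def A_def by auto
  then obtain S where S: "S \<subseteq> A" "p ` S = T" "inj_on p S" "independent ({e} \<union> S)" "{e} \<inter> S = {}"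
    using basis_lift[OF lin ker ie _ T(2), of A] by blast
  obtain x where x: "x \<in> U" "x + e \<in> U" "y = p x" "p x \<noteq> 0" using y unfolding doubled_def by auto
  have fS: "finite S" using S(3) fT S(2) finite_image_iff by blast
  have cS: "card S \<ge> 2" using T(3) S card_image by metis
  have "p x = p (\<Sum>S)" using y x S(2,3) sum.reindex[OF S(3), of id] lin by (simp add: linear_sum)
  hence "p (x - \<Sum>S) = 0" using lin by (simp add: linear_diff)
  then obtain c where c: "x - \<Sum>S = c *\<^sub>R e" using ker span_singleton_iff by blast
  have eS: "{e} \<union> S - {e} = S" using S by auto
  have k1: "c + 1 \<in> {-1, 0, 1}"
  proof (rule unimodD(4)[OF U, of "{e} \<union> S" "x + e" e])
    have "x + e - (c + 1) *\<^sub>R e = \<Sum>S" using c by (simp add: algebra_simps)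
    moreover have "\<Sum>S \<in> span S" by (intro span_sum span_base)
    ultimately show "x + e - (c + 1) *\<^sub>R e \<in> span ({e} \<union> S - {e})" unfolding eS by simp
  qed (use S e x A_def in auto)
  define S' where "S' = (\<lambda>s. s + e) ` S"
  have ps: "p (s + e) = p s" for s using C(5) lin by (simp add: linear_add)
  have inj: "inj_on (\<lambda>s. s + e) S" by (auto intro: inj_onI)
  have pS': "p ` S' = T" "inj_on p S'" using S unfolding S'_def by (auto simp: ps image_image inj_on_def)
  have S'i: "independent ({e} \<union> S')" "{e} \<inter> S' = {}"
    using indep_lift[OF lin, of "{e}" S'] C(5) ie T(2) pS' by auto
  have eS': "{e} \<union> S' - {e} = S'" using S'i by auto
  have "\<Sum>S' = \<Sum>S + real (card S) *\<^sub>R e" unfolding S'_def using sum.reindex[OF inj, of id]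
    by (simp add: sum.distrib sum_constant_scaleR)
  hence "x - (c - real (card S)) *\<^sub>R e = \<Sum>S'" using c by (simp add: algebra_simps)
  moreover have "\<Sum>S' \<in> span S'" by (intro span_sum span_base)
  ultimately have "x - (c - real (card S)) *\<^sub>R e \<in> span ({e} \<union> S' - {e})" unfolding eS' by simp
  moreover have "{e} \<union> S' \<subseteq> U" using S(1) e by (auto simp: S'_def A_def)
  ultimately have "c - real (card S) \<in> {-1, 0, 1}"
    using unimodD(4)[OF U _ S'i(1) x(1)] by blast
  thus False using k1 cS by auto
qed

lemma doubled_sym:
  assumes U: "unimod U" and lin: "linear p" and pe: "p e = 0" and v: "v \<in> doubled p U e"
  shows "- v \<in> doubled p U e"
proof -
  obtain x where x: "x \<in> U" "x + e \<in> U" "v = p x" "p x \<noteq> 0" using v unfolding doubled_def by auto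
  have "- (x + e) \<in> U" using unimodD(3)[OF U x(2)] .
  moreover have "- (x + e) + e \<in> U" using unimodD(3)[OF U x(1)] by simp
  moreover have v': "- v = p (- (x + e))" using x(3) linear_neg[OF lin, of "x + e"] linear_add[OF lin, of x e] pe by simp
  moreover have "p (- (x + e)) \<noteq> 0" using v' x by auto
  ultimately show ?thesis unfolding doubled_def by blast
qed

lemma card_fibres:
  assumes "finite A"
  shows "card A = (\<Sum>v\<in>f ` A. card {x \<in> A. f x = v})"
  unfolding card_eq_sum using sum.image_gen[OF assms, of "\<lambda>_. 1::nat" f] by simp

lemma card_indicator:
  assumes "finite A"
  shows "(\<Sum>v\<in>A. if v \<in> B then 1 else (0::nat)) = card (A \<inter> B)"
  using assms by (simp add: sum.If_cases)

lemma unimod_fibre: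
  fixes p :: "'a::real_vector \<Rightarrow> 'a"
  assumes U: "unimod U" and e: "e \<in> U" and lin: "linear p" and ker: "\<And>v. p v = 0 \<longleftrightarrow> v \<in> span {e}"
    and v: "v \<in> p ` U - {0}"
  shows "\<exists>x\<in>U. p x = v \<and> ((v \<in> doubled p U e \<and> x + e \<in> U \<and> {y \<in> U. p y = v} = {x, x + e}) \<or> (v \<notin> doubled p U e \<and> {y \<in> U. p y = v} = {x}))"
proof -
  note C = unimod_contract[OF U e lin ker]
  have pe: "p (x + e) = p x" "p (x - e) = p x" for x using C(5) lin by (simp_all add: linear_add linear_diff)
  show ?thesis
  proof (cases "v \<in> doubled p U e")
    case True
    then obtain x where x: "x \<in> U" "x + e \<in> U" "v = p x" "p x \<noteq> 0" unfolding doubled_def by auto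
    have "y = x \<or> y = x + e" if "y \<in> U" "p y = v" for y
      using C(3)[of x y] C(4)[of x] that x by auto
    hence "{y \<in> U. p y = v} = {x, x + e}" using x pe by auto
    thus ?thesis using x True by auto
  next
    case False
    obtain x where x: "x \<in> U" "v = p x" "p x \<noteq> 0" using v by auto
    have "x + e \<notin> U" using False x unfolding doubled_def by auto
    moreover have "x - e \<notin> U"
    proof
      assume "x - e \<in> U"
      hence "p (x - e) \<in> doubled p U e" using x pe unfolding doubled_def by (auto intro!: exI[of _ "x - e"])
      thus False using False pe x by simp
    qed
    ultimately have "y = x" if "y \<in> U" "p y = v" for y using C(3)[of x y] that x by auto
    hence "{y \<in> U. p y = v} = {x}" using x by auto
    thus ?thesis using x False by auto
  qed
qed

lemma unimod_dim_0:
  assumes U: "unimod U" and d: "dim U = 0"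
  shows "U = {}"
proof -
  obtain B where B: "B \<subseteq> U" "independent B" "U \<subseteq> span B" "card B = dim U" using basis_exists[of U] by metis
  have "finite B" using finite_subset[OF B(1) unimodD(1)[OF U]] .
  hence "B = {}" using B(4) d by simp
  thus ?thesis using B(3) unimodD(2)[OF U] by (auto simp: span_empty)
qed

text \<open>By contraction of one element: the contraction is counted by induction, and the elements lost correspond to doubled directions, which contain no circuit and so form a basis up to sign.\<close>

theorem heller:
  assumes "unimod U"
  shows "card U \<le> dim U * (dim U + 1)"
  using assms
proof (induction "dim U" arbitrary: U)
  case 0
  have "U = {}" using unimod_dim_0[OF 0(2)] 0(1) by simp
  thus ?case by simp
next
  case (Suc r)
  note U = Suc.prems
  have "U \<noteq> {}" using Suc(2) dim_eq_card_independent[of "{}::'a set"] independent_empty by auto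
  then obtain e where e: "e \<in> U" by blast
  have "e \<noteq> 0" using unimodD(2)[OF U] e by blast
  then obtain p :: "'a \<Rightarrow> 'a" where p: "linear p" "\<And>v. p v = 0 \<longleftrightarrow> v \<in> span {e}"
    using exists_projection[of e] by blast
  note C = unimod_contract[OF U e p]
  let ?U = "p ` U - {0}" let ?N = "doubled p U e"
  have r: "r = dim ?U" using C(2) Suc(2) by simp
  have fU: "finite U" using unimodD[OF U] by blast
  have N: "card ?N \<le> 2 * dim ?U"
  proof (rule card_acyclic[OF C(1) doubled_sub])
    show "- u \<in> ?N" if "u \<in> ?N" for u using doubled_sym[OF U p(1) C(5) that] .
    show False if "T \<subseteq> ?N" "independent T" "2 \<le> card T" "y \<in> ?N" "y = \<Sum> T" for T y
      using heller_no_circuit[OF U e p that] .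
  qed
  have "card U \<le> card {e, - e} + card (U - {e, - e})" using fU
    by (metis card_Un_le card_mono Un_Diff_cancel Un_upper2 finite.emptyI finite_Diff finite_UnI finite_insert le_trans)
  also have "card {e, - e} \<le> 2" by (simp add: card_insert_if)
  also have "card (U - {e, - e}) = (\<Sum>v\<in>p ` (U - {e, - e}). card {x \<in> U - {e, - e}. p x = v})"
    using fU by (intro card_fibres) auto
  also have "p ` (U - {e, - e}) = ?U" using C(6) by force
  also have "(\<Sum>v\<in>?U. card {x \<in> U - {e, - e}. p x = v}) \<le> (\<Sum>v\<in>?U. 1 + (if v \<in> ?N then 1 else 0))"
  proof (rule sum_mono)
    fix v assume v: "v \<in> ?U"
    have "card {x \<in> U - {e, - e}. p x = v} \<le> card {x \<in> U. p x = v}" using fU by (intro card_mono) auto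
    also have "\<dots> \<le> 1 + (if v \<in> ?N then 1 else 0)"
      using unimod_fibre[OF U e p v] by (auto simp: card_insert_if)
    finally show "card {x \<in> U - {e, - e}. p x = v} \<le> 1 + (if v \<in> ?N then 1 else 0)" .
  qed
  also have "(\<Sum>v\<in>?U. 1 + (if v \<in> ?N then 1 else 0)) = card ?U + card ?N"
  proof -
    have "?U \<inter> ?N = ?N" using doubled_sub[of p U e] by auto
    moreover have "(\<Sum>v\<in>?U. if v \<in> ?N then 1 else (0::nat)) = card (?U \<inter> ?N)" using fU by (intro card_indicator) auto
    ultimately show ?thesis unfolding sum.distrib by simp
  qed
  also have "\<dots> \<le> r * (r + 1) + 2 * r" using Suc(1)[OF r C(1)] N r by simp
  finally have "card U \<le> 2 + (r * (r + 1) + 2 * r)" by simp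
  thus ?case unfolding Suc(2)[symmetric] by (simp add: algebra_simps)
qed

section \<open>Weights on unimodular sets\<close>

lemma indep_triple:
  fixes a :: "'a::real_vector"
  assumes "c \<noteq> 0" "b \<notin> span {c}" "a \<notin> span {b, c}"
  shows "independent {a, b, c}" "card {a, b, c} = 3" "\<Sum>{a, b, c} = a + b + c" "sum w {a, b, c} = w a + w b + (w c::nat)"
proof -
  have n: "b \<noteq> c" "a \<noteq> b" "a \<noteq> c" using assms by (auto simp: span_base)
  show "independent {a, b, c}" using assms n by (simp add: independent_insert)
  show "card {a, b, c} = 3" "\<Sum>{a, b, c} = a + b + c" "sum w {a, b, c} = w a + w b + w c" using n by auto
qed

lemma indep_quad:
  fixes a :: "'a::real_vector"
  assumes "d \<noteq> 0" "c \<notin> span {d}" "b \<notin> span {c, d}" "a \<notin> span {b, c, d}"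
  shows "independent {a, b, c, d}" "card {a, b, c, d} = 4" "\<Sum>{a, b, c, d} = a + b + c + d" 
    "sum w {a, b, c, d} = w a + w b + w c + (w d::nat)"
proof -
  have n: "c \<noteq> d" "b \<noteq> c" "b \<noteq> d" "a \<noteq> b" "a \<noteq> c" "a \<noteq> d" using assms by (auto simp: span_base)
  show "independent {a, b, c, d}" using assms n by (simp add: independent_insert)
  show "card {a, b, c, d} = 4" "\<Sum>{a, b, c, d} = a + b + c + d" "sum w {a, b, c, d} = w a + w b + w c + w d" using n by auto
qed

lemma span_singleton_sym:
  assumes "f \<in> span {z}" "(f::'a::real_vector) \<noteq> 0"
  shows "z \<in> span {f}"
proof -
  obtain c where c: "f = c *\<^sub>R z" using assms by (auto simp: span_singleton)
  hence "z = (1 / c) *\<^sub>R f" using assms by auto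
  thus ?thesis by (metis span_base span_scale singletonI)
qed

text \<open>An element of weight 2 counts three times. In \<open>N_M_bound\<close> the directions of weight 2 occur \<open>card S + 1 \<ge> 3\<close> times, and those of weight 1 once.\<close>

definition wt :: "nat \<Rightarrow> nat" where "wt n = (if n = 2 then 3 else n)"

text \<open>The weight of a direction stands for twice the width of its fibre in a fixed coordinate.\<close>

definition circuit_bounded :: "'a::real_vector set \<Rightarrow> ('a \<Rightarrow> nat) \<Rightarrow> bool" where
  "circuit_bounded U w \<longleftrightarrow> (\<forall>u\<in>U. w (- u) = w u \<and> w u \<le> 2) \<and>
     (\<forall>T y. T \<subseteq> U \<longrightarrow> independent T \<longrightarrow> card T \<ge> 2 \<longrightarrow> y \<in> U \<longrightarrow> y = \<Sum>T \<longrightarrow> w y + sum w T \<le> 4)"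

lemma circuit_boundedD:
  assumes "circuit_bounded U w"
  shows "\<And>u. u \<in> U \<Longrightarrow> w (- u) = w u" "\<And>u. u \<in> U \<Longrightarrow> w u \<le> 2"
    "\<And>T y. T \<subseteq> U \<Longrightarrow> independent T \<Longrightarrow> card T \<ge> 2 \<Longrightarrow> y \<in> U \<Longrightarrow> y = \<Sum>T \<Longrightarrow> w y + sum w T \<le> 4"
  using assms unfolding circuit_bounded_def by blast+

definition contract_wt :: "('a::real_vector \<Rightarrow> 'a) \<Rightarrow> 'a set \<Rightarrow> ('a \<Rightarrow> nat) \<Rightarrow> 'a \<Rightarrow> nat" where
  "contract_wt p U w v = Max (w ` {u \<in> U. p u = v})"

lemma contract_wt:
  assumes "finite U" "v \<in> p ` U"
  shows "\<exists>u\<in>U. p u = v \<and> w u = contract_wt p U w v" "\<And>u. u \<in> U \<Longrightarrow> p u = v \<Longrightarrow> w u \<le> contract_wt p U w v"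
proof -
  have f: "finite (w ` {u \<in> U. p u = v})" using assms by simp
  have "w ` {u \<in> U. p u = v} \<noteq> {}" using assms by auto
  from Max_in[OF f this] show "\<exists>u\<in>U. p u = v \<and> w u = contract_wt p U w v" unfolding contract_wt_def by auto
  show "w u \<le> contract_wt p U w v" if "u \<in> U" "p u = v" for u
    unfolding contract_wt_def using f that by (intro Max_ge) auto
qed

text \<open>Lift a circuit to elements of maximal weight. Its sum is the lifted left-hand side or differs from it by \<open>e\<close> or \<open>- e\<close>; in the second case that element joins the circuit, and dropping its weight preserves the inequality.\<close>

lemma circuit_bounded_contract:
  fixes p :: "'a::real_vector \<Rightarrow> 'a"
  assumes U: "unimod U" and e: "e \<in> U" and lin: "linear p" and ker: "\<And>v. p v = 0 \<longleftrightarrow> v \<in> span {e}"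
    and w: "circuit_bounded U w"
  shows "circuit_bounded (p ` U - {0}) (contract_wt p U w)"
proof -
  note C = unimod_contract[OF U e lin ker] and W = circuit_boundedD[OF w]
  have fU: "finite U" using unimodD[OF U] by blast
  let ?w = "contract_wt p U w"
  note M = contract_wt[OF fU]
  have le: "?w (- v) \<le> ?w v \<and> ?w v \<le> 2 \<and> - v \<in> p ` U" if v: "v \<in> p ` U" for v
  proof -
    obtain x where x: "x \<in> U" "p x = v" using v by auto
    have nv: "- v \<in> p ` U" using x unimodD(3)[OF U x(1)] linear_neg[OF lin, of x] by (metis imageI)
    obtain u where u: "u \<in> U" "p u = - v" "w u = ?w (- v)" using M(1)[OF nv] by blast
    have "p (- u) = v" using u linear_neg[OF lin, of u] by simp
    hence "w (- u) \<le> ?w v" using M(2)[OF v] unimodD(3)[OF U u(1)] by blast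
    moreover obtain u' where "u' \<in> U" "w u' = ?w v" using M(1)[OF v] by blast
    ultimately show ?thesis using W(1)[OF u(1)] u(3) nv W(2) by metis
  qed
  have ie: "independent {e}" using unimodD(2)[OF U] e by (auto simp: independent_insert)
  show ?thesis
    unfolding circuit_bounded_def
  proof (intro conjI ballI allI impI)
    fix u assume u: "u \<in> p ` U - {0}"
    show "?w (- u) = ?w u" using le[of u] le[of "- u"] u by simp
    show "?w u \<le> 2" using le[of u] u by simp
  next
    fix T' y' assume T': "T' \<subseteq> p ` U - {0}" "independent T'" "2 \<le> card T'" "y' \<in> p ` U - {0}" "y' = \<Sum>T'"
    define A where "A = {u \<in> U. w u = ?w (p u)}"
    have sub: "T' \<subseteq> p ` A"
    proof
      fix v assume "v \<in> T'"
      then obtain u where "u \<in> U" "p u = v" "w u = ?w v" using M(1)[of v] T'(1) by blast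
      thus "v \<in> p ` A" unfolding A_def by (intro image_eqI[of _ _ u]) auto
    qed
    obtain T where T: "T \<subseteq> A" "p ` T = T'" "inj_on p T" "independent ({e} \<union> T)" "{e} \<inter> T = {}"
      using basis_lift[OF lin ker ie sub T'(2)] by blast
    obtain y where y: "y \<in> U" "p y = y'" "w y = ?w y'" using M(1)[of y'] T'(4) by blast
    have cT: "card T = card T'" using card_image[OF T(3)] T(2) by simp
    have TU: "T \<subseteq> U" using T(1) unfolding A_def by auto
    have fT: "finite T" using finite_subset[OF TU fU] .
    have sT: "sum w T = sum ?w T'"
    proof -
      have "sum ?w T' = sum (?w \<circ> p) T" using sum.reindex[OF T(3), of ?w] T(2) by simp
      also have "\<dots> = sum w T" using T(1) unfolding A_def by (intro sum.cong) auto
      finally show ?thesis by simp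
    qed
    have "p (\<Sum>T) = \<Sum>T'" using sum.reindex[OF T(3), of id] T(2) linear_sum[OF lin, of id T] by simp
    hence "p (y - \<Sum>T) = 0" using y(2) T'(5) linear_diff[OF lin] by simp
    then obtain c where c: "y - \<Sum>T = c *\<^sub>R e" using ker span_singleton_iff by blast
    have "y - c *\<^sub>R e = \<Sum>T" using c by (simp add: algebra_simps)
    moreover have "\<Sum>T \<in> span T" by (intro span_sum span_base)
    moreover have "{e} \<union> T - {e} = T" using T(5) by auto
    ultimately have yc: "y - c *\<^sub>R e \<in> span ({e} \<union> T - {e})" by simp
    have "{e} \<union> T \<subseteq> U" using TU e by simp
    hence "c \<in> {-1, 0, 1}" using unimodD(4)[OF U _ T(4) y(1) _ yc] by blast
    then consider "c = 0" | "c = 1 \<or> c = -1" by blast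
    thus "?w y' + sum ?w T' \<le> 4"
    proof cases
      case 1
      have "independent T" using T(4) by (rule independent_mono) blast
      moreover have "y = \<Sum>T" using c 1 by simp
      ultimately show ?thesis using W(3)[OF TU _ _ y(1)] T'(3) cT sT y(3) by simp
    next
      case 2
      define d where "d = c *\<^sub>R e"
      have d: "d \<in> U" "p d = 0" "independent {d}" using 2 e unimodD(2,3)[OF U] C(5) linear_neg[OF lin]
        unfolding d_def by (auto simp: independent_insert)
      have "independent ({d} \<union> T)" "{d} \<inter> T = {}"
        using indep_lift[OF lin, of "{d}" T] d T(2,3) T'(2) by auto
      hence I: "independent (insert d T)" "d \<notin> T" by auto
      have "y = \<Sum>(insert d T)" using c I(2) fT unfolding d_def by (simp add: algebra_simps)
      hence "w y + sum w (insert d T) \<le> 4" using W(3)[OF _ I(1) _ y(1)] TU d(1) I(2) fT T'(3) cT by simp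
      thus ?thesis using I(2) fT sT y(3) by simp
    qed
  qed
qed

definition wdoubled :: "('a::real_vector \<Rightarrow> 'a) \<Rightarrow> 'a set \<Rightarrow> ('a \<Rightarrow> nat) \<Rightarrow> 'a \<Rightarrow> 'a set" where
  "wdoubled p U w e = {p x |x. x \<in> U \<and> x + e \<in> U \<and> p x \<noteq> 0 \<and> w x \<ge> 1 \<and> w (x + e) \<ge> 1}"

text \<open>The circuit consisting of \<open>x + e\<close>, \<open>x\<close> and \<open>e\<close> leaves weight at most 3 for the two ends \<open>x\<close> and \<open>x + e\<close>. So the sum of their modified weights exceeds the larger one by at most 1.\<close>

lemma wt_contract:
  fixes p :: "'a::real_vector \<Rightarrow> 'a"
  assumes U: "unimod U" and e: "e \<in> U" and lin: "linear p" and ker: "\<And>v. p v = 0 \<longleftrightarrow> v \<in> span {e}"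
    and w: "circuit_bounded U w" and we: "w e \<ge> 1"
  shows "(\<Sum>u\<in>U. wt (w u)) \<le> 2 * wt (w e) + card (wdoubled p U w e) + (\<Sum>v\<in>p ` U - {0}. wt (contract_wt p U w v))"
proof -
  note C = unimod_contract[OF U e lin ker] and W = circuit_boundedD[OF w]
  have fU: "finite U" using unimodD[OF U] by blast
  let ?w = "contract_wt p U w" and ?U = "p ` U - {0}" and ?D = "wdoubled p U w e"
  note M = contract_wt[OF fU]
  have e0: "e \<noteq> 0" using e unimodD(2)[OF U] by blast
  have ne: "- e \<in> U" using unimodD(3)[OF U e] .
  have "(\<Sum>u\<in>U. wt (w u)) = (\<Sum>u\<in>{e, - e}. wt (w u)) + (\<Sum>u\<in>U - {e, - e}. wt (w u))"
    using fU e ne by (subst sum.subset_diff[of "{e, - e}" U]) auto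
  also have "(\<Sum>u\<in>{e, - e}. wt (w u)) \<le> 2 * wt (w e)" using W(1)[OF e] by (cases "e = - e") auto
  also have "(\<Sum>u\<in>U - {e, - e}. wt (w u)) = (\<Sum>v\<in>p ` (U - {e, - e}). \<Sum>x\<in>{x \<in> U - {e, - e}. p x = v}. wt (w x))"
    using sum.image_gen[of "U - {e, - e}" "\<lambda>u. wt (w u)" p] fU by simp
  also have "p ` (U - {e, - e}) = ?U" using C(6) by force
  also have "(\<Sum>v\<in>?U. \<Sum>x\<in>{x \<in> U - {e, - e}. p x = v}. wt (w x)) \<le> (\<Sum>v\<in>?U. wt (?w v) + (if v \<in> ?D then 1 else 0))"
  proof (rule sum_mono)
    fix v assume v: "v \<in> ?U"
    have "p e = 0" "p (- e) = 0" using C(6)[OF e] C(6)[OF ne] by auto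
    hence eq: "{x \<in> U - {e, - e}. p x = v} = {x \<in> U. p x = v}" using v by auto
    obtain x where x: "x \<in> U" "p x = v" and alt: "(x + e \<in> U \<and> {y \<in> U. p y = v} = {x, x + e}) \<or> {y \<in> U. p y = v} = {x}"
      using unimod_fibre[OF U e lin ker v] by blast
    have px: "p x \<noteq> 0" using x v by auto
    from alt show "(\<Sum>x\<in>{x \<in> U - {e, - e}. p x = v}. wt (w x)) \<le> wt (?w v) + (if v \<in> ?D then 1 else 0)"
    proof
      assume "{y \<in> U. p y = v} = {x}"
      thus ?thesis unfolding eq contract_wt_def by simp
    next
      assume xe: "x + e \<in> U \<and> {y \<in> U. p y = v} = {x, x + e}"
      have nx: "x \<noteq> x + e" using e0 by simp
      have "x \<notin> span {e}" using px ker by blast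
      hence I: "independent {e, x}" "e \<noteq> x" using indep_pair[OF e0] by auto
      have "{e, x} \<subseteq> U" "card {e, x} \<ge> 2" "x + e \<in> U" "x + e = \<Sum>{e, x}" using I(2) e x(1) xe by auto
      hence "w (x + e) + sum w {e, x} \<le> 4" using W(3)[OF _ I(1)] by blast
      hence b: "w (x + e) + w e + w x \<le> 4" using I(2) by simp
      have m: "?w v = max (w x) (w (x + e))" unfolding contract_wt_def using xe by simp
      have "v \<in> ?D" if "w x \<ge> 1" "w (x + e) \<ge> 1" using that x xe px unfolding wdoubled_def by blast
      hence "wt (w x) + wt (w (x + e)) \<le> wt (?w v) + (if v \<in> ?D then 1 else 0)"
        using b we m unfolding wt_def
        by (cases "w x = 0"; cases "w (x + e) = 0") (auto simp: max_def)
      thus ?thesis unfolding eq using xe nx by simp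
    qed
  qed
  also have "(\<Sum>v\<in>?U. wt (?w v) + (if v \<in> ?D then 1 else 0)) = (\<Sum>v\<in>?U. wt (?w v)) + card ?D"
  proof -
    have "?U \<inter> ?D = ?D" unfolding wdoubled_def by auto
    moreover have "(\<Sum>v\<in>?U. if v \<in> ?D then 1 else (0::nat)) = card (?U \<inter> ?D)" using fU by (intro card_indicator) auto
    ultimately show ?thesis unfolding sum.distrib by simp
  qed
  finally show ?thesis by simp
qed

text \<open>The hypothesis excludes every direction that is not a multiple of the one of \<open>e\<close>.\<close>

lemma wdoubled_small:
  fixes p :: "'a::real_vector \<Rightarrow> 'a"
  assumes U: "unimod U" and f: "f \<in> U" and lin: "linear p" and ker: "\<And>v. p v = 0 \<longleftrightarrow> v \<in> span {f}"
    and e: "e \<in> U" "e \<notin> span {f}"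
    and bad: "\<And>z. \<lbrakk>z \<in> U; z + f \<in> U; w z \<ge> 1; w (z + f) \<ge> 1; f \<noteq> 0; z \<notin> span {f}; e \<notin> span {f, z}\<rbrakk> \<Longrightarrow> False"
  shows "card (wdoubled p U w f) \<le> 2"
proof -
  note C = unimod_contract[OF U f lin ker]
  have f0: "f \<noteq> 0" using f unimodD(2)[OF U] by blast
  have pe: "p e \<in> p ` U - {0}" using e ker by auto
  have "wdoubled p U w f \<subseteq> {p e, - p e}"
  proof
    fix v assume "v \<in> wdoubled p U w f"
    then obtain z where z: "z \<in> U" "z + f \<in> U" "v = p z" "p z \<noteq> 0" "w z \<ge> 1" "w (z + f) \<ge> 1"
      unfolding wdoubled_def by auto
    show "v \<in> {p e, - p e}"
    proof (rule ccontr)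
      assume v: "v \<notin> {p e, - p e}"
      have pz: "p z \<in> p ` U - {0}" using z by auto
      have "p e \<noteq> p z" "p e \<noteq> - p z" using v z by auto
      hence "p e \<notin> span {p z}" using unimod_parallel[OF C(1) pz pe] by auto
      hence "e \<notin> span ({f} \<union> {z})" using span_push[OF lin, of "{f}" e "{z}"] C(5) by auto
      moreover have "z \<notin> span {f}" using z ker by auto
      ultimately show False using bad[OF z(1,2,5,6) f0] by (simp add: insert_commute)
    qed
  qed
  hence "card (wdoubled p U w f) \<le> card {p e, - p e}" by (intro card_mono) auto
  also have "\<dots> \<le> 2" by (simp add: card_insert_if)
  finally show ?thesis .
qed

lemma pick_three:
  fixes D :: "'a::real_vector set"
  assumes "finite D" "card D \<ge> 5"
  obtains v1 v2 v3 where "v1 \<in> D" "v2 \<in> D" "v3 \<in> D" "v2 \<notin> {v1, - v1}" "v3 \<notin> {v1, - v1, v2, - v2}"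
proof -
  have nz: "\<exists>v. v \<in> D - {}" using assms by (metis Diff_empty card.empty ex_in_conv not_numeral_le_zero)
  then obtain v1 where v1: "v1 \<in> D" by auto
  have "card {v1, - v1} \<le> 2" by (simp add: card_insert_if)
  hence "card (D - {v1, - v1}) \<ge> 3" using assms diff_card_le_card_Diff[of "{v1, - v1}" D] by simp
  hence "D - {v1, - v1} \<noteq> {}" by (metis card.empty not_numeral_le_zero)
  then obtain v2 where v2: "v2 \<in> D" "v2 \<notin> {v1, - v1}" by auto
  have "card {v1, - v1, v2, - v2} \<le> 4" using card_length[of "[v1, - v1, v2, - v2]"] by simp
  hence "card (D - {v1, - v1, v2, - v2}) \<ge> 1" using assms diff_card_le_card_Diff[of "{v1, - v1, v2, - v2}" D] by simp
  hence "D - {v1, - v1, v2, - v2} \<noteq> {}" by (metis card.empty not_one_le_zero)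
  then obtain v3 where "v3 \<in> D" "v3 \<notin> {v1, - v1, v2, - v2}" by auto
  thus ?thesis using that v1 v2 by blast
qed

lemma span_sub3:
  fixes a :: "'a::real_vector"
  assumes "x \<notin> span {a, b, c}" "a' \<in> span {a, b, c}" "b' \<in> span {a, b, c}" "c' \<in> span {a, b, c}"
  shows "x \<notin> span {a', b', c'}"
  using assms span_minimal[of "{a', b', c'}" "span {a, b, c}"] by auto

text \<open>Inside \<open>span {e, f, z}\<close> the three directions lie in a plane. Being pairwise not parallel they form a circuit up to sign, in contradiction to \<open>heller_no_circuit\<close>.\<close>

lemma three_doubled:
  fixes p :: "'a::real_vector \<Rightarrow> 'a"
  assumes U: "unimod U" and e: "e \<in> U" and lin: "linear p" and ker: "\<And>v. p v = 0 \<longleftrightarrow> v \<in> span {e}"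
    and x: "x1 \<in> U" "x1 + e \<in> U" "x2 \<in> U" "x2 + e \<in> U" "x3 \<in> U" "x3 + e \<in> U"
    and v: "p x1 \<noteq> 0" "p x2 \<noteq> 0" "p x3 \<noteq> 0" "p x2 \<notin> {p x1, - p x1}" "p x3 \<notin> {p x1, - p x1, p x2, - p x2}"
    and sp: "x1 \<in> span {e, f, z}" "x2 \<in> span {e, f, z}" "x3 \<in> span {e, f, z}"
  shows False
proof -
  note C = unimod_contract[OF U e lin ker]
  let ?N = "doubled p U e"
  have N: "p x1 \<in> ?N" "p x2 \<in> ?N" "p x3 \<in> ?N" using x v unfolding doubled_def by auto
  have NU: "?N \<subseteq> p ` U - {0}" by (rule doubled_sub)
  have "{e, f, z} = {e} \<union> {f, z}" by auto
  hence ps: "p x \<in> span {p f, p z}" if "x \<in> span {e, f, z}" for x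
    using span_push[OF lin, of "{e}" x "{f, z}"] C(5) that by auto
  have I: "independent {p x1, p x2}" "p x1 \<noteq> p x2"
    using unimod_indep_pair[OF C(1), of "p x1" "p x2"] N NU v by auto
  have "p x3 \<in> span {p x1, p x2}"
  proof (rule ccontr)
    assume "p x3 \<notin> span {p x1, p x2}"
    hence "independent {p x3, p x1, p x2}" using I independent_insertI by blast
    moreover have "{p x3, p x1, p x2} \<subseteq> span {p f, p z}" using ps sp by auto
    ultimately have "card {p x3, p x1, p x2} \<le> card {p f, p z}"
      using independent_span_bound[of "{p f, p z}"] by auto
    also have "\<dots> \<le> 2" by (simp add: card_insert_if)
    finally show False using I(2) v by (auto simp: card_insert_if split: if_splits)
  qed
  hence sp3: "p x3 \<in> span {p x1, p x2}" .
  have sN: "{p x1, p x2} \<subseteq> p ` U - {0}" and x3N: "p x3 \<in> p ` U - {0}" using N NU by auto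
  obtain R s where R: "R \<subseteq> {p x1, p x2}" "R \<noteq> {}" "\<forall>t\<in>R. s t = (1::real) \<or> s t = -1" "p x3 = (\<Sum>t\<in>R. s t *\<^sub>R t)"
    using unimod_signed_sum[OF C(1) sN I(1) x3N sp3] by blast
  have "R \<noteq> {p x1}" "R \<noteq> {p x2}" using R(3,4) v by auto
  hence R2: "R = {p x1, p x2}" using R(1,2) by blast
  have fR: "finite R" using R2 by simp
  note IS = indep_signs[OF I(1), of R s] 
  let ?T = "(\<lambda>t. s t *\<^sub>R t) ` R"
  have "independent ?T" "inj_on (\<lambda>t. s t *\<^sub>R t) R" using IS R fR by auto
  moreover from this have "card ?T = 2" using R2 I(2) card_image by fastforce
  moreover have "p x3 = \<Sum>?T" using R(4) sum.reindex[OF \<open>inj_on (\<lambda>t. s t *\<^sub>R t) R\<close>, of id] by simp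
  moreover have "?T \<subseteq> ?N"
  proof
    fix y assume "y \<in> ?T"
    then obtain t where t: "t \<in> R" "y = s t *\<^sub>R t" by auto
    have "t \<in> ?N" using t R2 N by auto
    thus "y \<in> ?N" using t R(3) doubled_sym[OF U lin C(5), of t] by auto
  qed
  ultimately show False using heller_no_circuit[OF U e lin ker, of ?T "p x3"] N by auto
qed

text \<open>Induction by contraction, the point being to find an element \<open>e\<close> to contract for which few weighted directions are doubled.
  If \<open>w e = 2\<close> and there is none, \<open>e\<close> itself serves. If there is a pair \<open>f\<close>, \<open>f + e\<close>, contract \<open>f\<close> instead: a further pair \<open>z\<close>, \<open>z + f\<close> would yield the circuit \<open>f + e = e + (z + f) - z\<close> of weight 5.
  If all weights are at most 1, up to four directions are affordable. When an element \<open>e\<close> has more, take a pair \<open>f\<close>, \<open>f + e\<close> and contract \<open>f\<close>: for a further pair \<open>z\<close>, \<open>z + f\<close> and a pair \<open>x\<close>, \<open>x + e\<close> independent of them,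
  \<open>x + e = x + (f + e) - (z + f) + z\<close> has weight 5.\<close>

theorem weight_bound:
  assumes "unimod U" "circuit_bounded U w"
  shows "(\<Sum>u\<in>U. wt (w u)) + (if \<exists>u\<in>U. w u = 1 then 1 else 0) \<le> 6 * dim U"
  using assms
proof (induction "dim U" arbitrary: U w)
  case 0
  thus ?case using unimod_dim_0[of U] by simp
next
  case (Suc r)
  note U = Suc.prems(1) and W = circuit_boundedD[OF Suc.prems(2)]
  have fU: "finite U" using unimodD[OF U] by blast
  note M = contract_wt[OF fU]
  have IH: "(\<Sum>v\<in>p ` U - {0}. wt (contract_wt p U w v)) + (if \<exists>v\<in>p ` U - {0}. contract_wt p U w v = 1 then 1 else 0) \<le> 6 * r"
    and dU: "dim (p ` U - {0}) = r"
    if "e \<in> U" "linear p" "\<And>v. p v = 0 \<longleftrightarrow> v \<in> span {e}" for e p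
  proof -
    note C = unimod_contract[OF U that]
    show d: "dim (p ` U - {0}) = r" using C(2) Suc(2) by simp
    show "(\<Sum>v\<in>p ` U - {0}. wt (contract_wt p U w v)) + (if \<exists>v\<in>p ` U - {0}. contract_wt p U w v = 1 then 1 else 0) \<le> 6 * r"
      using Suc(1)[OF d[symmetric] C(1) circuit_bounded_contract[OF U that Suc.prems(2)]] d by simp
  qed
  have proj: "\<exists>p :: 'a \<Rightarrow> 'a. linear p \<and> (\<forall>v. p v = 0 \<longleftrightarrow> v \<in> span {e})" if "e \<in> U" for e
    using exists_projection[of e] unimodD(2)[OF U] that by auto
  consider (zero) "\<forall>u\<in>U. w u = 0" | (two) "\<exists>e\<in>U. w e = 2" | (one) "\<forall>u\<in>U. w u \<le> 1" "\<exists>e\<in>U. w e = 1"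
    using W(2) by (metis One_nat_def Suc_1 le_SucE le_zero_eq)
  thus ?case
  proof cases
    case zero
    thus ?thesis by (simp add: wt_def)
  next
    case two
    then obtain e where e: "e \<in> U" "w e = 2" by blast
    obtain p :: "'a \<Rightarrow> 'a" where p: "linear p" "\<And>v. p v = 0 \<longleftrightarrow> v \<in> span {e}" using proj[OF e(1)] by blast
    note C = unimod_contract[OF U e(1) p]
    have B: "(\<Sum>u\<in>U. wt (w u)) \<le> 6 + card (wdoubled p U w e) + (\<Sum>v\<in>p ` U - {0}. wt (contract_wt p U w v))"
      using wt_contract[OF U e(1) p Suc.prems(2)] e(2) by (simp add: wt_def)
    show ?thesis
    proof (cases "wdoubled p U w e = {}")
      case True
      have "\<exists>v\<in>p ` U - {0}. contract_wt p U w v = 1" if ex: "\<exists>u\<in>U. w u = 1"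
      proof -
        obtain u where u: "u \<in> U" "w u = 1" using ex by blast
        have pu: "p u \<noteq> 0" using C(6)[OF u(1)] W(1)[OF e(1)] u(2) e(2) by auto
        hence v: "p u \<in> p ` U - {0}" using u by auto
        obtain y where y: "y \<in> U" "p y = p u" "w y = contract_wt p U w (p u)" using M(1)[of "p u"] u(1) by blast
        have "contract_wt p U w (p u) \<ge> 1" using M(2)[of "p u" p u w] u by auto
        moreover have "w y \<le> 1"
        proof (rule ccontr)
          assume ny: "\<not> w y \<le> 1"
          hence "y \<noteq> u" using u by auto
          obtain x where x: "x \<in> U" "p x = p u" "(x + e \<in> U \<and> {y \<in> U. p y = p u} = {x, x + e}) \<or> {y \<in> U. p y = p u} = {x}"
            using unimod_fibre[OF U e(1) p v] by blast
          have uy: "u \<in> {y \<in> U. p y = p u}" "y \<in> {y \<in> U. p y = p u}" using u y by simp_all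
          have nsing: "{y \<in> U. p y = p u} \<noteq> {x}"
          proof
            assume eq: "{y \<in> U. p y = p u} = {x}"
            have "u = x" "y = x" using uy unfolding eq by simp_all
            thus False using \<open>y \<noteq> u\<close> by simp
          qed
          hence x2: "x + e \<in> U" and eq: "{y \<in> U. p y = p u} = {x, x + e}" using x(3) by blast+
          have "u \<in> {x, x + e}" "y \<in> {x, x + e}" using uy unfolding eq by simp_all
          hence "w x \<ge> 1 \<and> w (x + e) \<ge> 1" using \<open>y \<noteq> u\<close> ny u(2) by auto
          moreover have "p x \<noteq> 0" using x(2) pu by simp
          ultimately have "p x \<in> wdoubled p U w e" using x(1) x2(1) unfolding wdoubled_def by blast
          thus False using True by simp
        qed
        ultimately show ?thesis using y v by (metis le_antisym)
      qed
      thus ?thesis using B IH[OF e(1) p] True Suc(2)[symmetric] by (auto split: if_splits)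
    next
      case False
      then obtain f where f: "f \<in> U" "f + e \<in> U" "p f \<noteq> 0" "w f \<ge> 1" "w (f + e) \<ge> 1" unfolding wdoubled_def by auto
      have e0: "e \<noteq> 0" using e unimodD(2)[OF U] by blast
      have "f \<notin> span {e}" using f(3) p(2) by blast
      hence I: "independent {e, f}" "e \<noteq> f" using indep_pair[OF e0] by auto
      have "{e, f} \<subseteq> U" "card {e, f} \<ge> 2" "f + e = \<Sum>{e, f}" using I(2) e f by auto
      hence "w (f + e) + sum w {e, f} \<le> 4" using W(3)[OF _ I(1) _ f(2)] by blast
      hence w1: "w f = 1" "w (f + e) = 1" using f e(2) I(2) by auto
      obtain q :: "'a \<Rightarrow> 'a" where q: "linear q" "\<And>v. q v = 0 \<longleftrightarrow> v \<in> span {f}" using proj[OF f(1)] by blast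
      have ef: "e \<notin> span {f}" using unimod_parallel[OF U f(1) e(1)] f(3) C(5) linear_neg[OF p(1), of f] by auto
      have "card (wdoubled q U w f) \<le> 2"
      proof (rule wdoubled_small[OF U f(1) q e(1) ef])
        fix z assume z: "z \<in> U" "z + f \<in> U" "1 \<le> w z" "1 \<le> w (z + f)" "f \<noteq> 0" "z \<notin> span {f}" "e \<notin> span {f, z}"
        have z0: "z \<noteq> 0" using z unimodD(2)[OF U] by blast
        have nz: "- z \<in> U" "w (- z) = w z" using unimodD(3)[OF U z(1)] W(1)[OF z(1)] by auto
        have fz: "f \<notin> span {z}" using span_singleton_sym[OF _ z(5)] z(6) by blast
        have 1: "z + f \<notin> span {- z}"
        proof
          assume "z + f \<in> span {- z}"
          hence "z + f \<in> span {z}" using span_minimal[of "{- z}" "span {z}"] by (auto simp: span_base span_neg)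
          hence "z + f - z \<in> span {z}" by (intro span_diff) (auto simp: span_base)
          thus False using fz by simp
        qed
        have 2: "e \<notin> span {z + f, - z}"
          using z(7) span_minimal[of "{z + f, - z}" "span {f, z}"] by (auto simp: span_base span_neg span_add)
        note T = indep_triple[of "- z" "z + f" e, OF _ 1 2]
        have "w (f + e) + sum w {e, z + f, - z} \<le> 4"
          using W(3)[OF _ T(1) _ f(2)] T(2,3) z0 e(1) z(2) nz(1) by (auto simp: algebra_simps)
        thus False using T(4)[of w] z0 e(2) w1 z(3,4) nz(2) by simp
      qed
      moreover have "(\<Sum>u\<in>U. wt (w u)) \<le> 2 + card (wdoubled q U w f) + (\<Sum>v\<in>q ` U - {0}. wt (contract_wt q U w v))"
        using wt_contract[OF U f(1) q Suc.prems(2)] w1 by (simp add: wt_def)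
      ultimately show ?thesis using IH[OF f(1) q] Suc(2)[symmetric] by (auto split: if_splits)
    qed
  next
    case one
    have "\<exists>e\<in>U. \<exists>p::'a \<Rightarrow> 'a. w e = 1 \<and> linear p \<and> (\<forall>v. p v = 0 \<longleftrightarrow> v \<in> span {e}) \<and> card (wdoubled p U w e) \<le> 4"
    proof -
      obtain e where e: "e \<in> U" "w e = 1" using one by blast
      obtain p :: "'a \<Rightarrow> 'a" where p: "linear p" "\<And>v. p v = 0 \<longleftrightarrow> v \<in> span {e}" using proj[OF e(1)] by blast
      note C = unimod_contract[OF U e(1) p]
      show ?thesis
      proof (cases "card (wdoubled p U w e) \<le> 4")
        case True thus ?thesis using e p by blast
      next
        case False
        have "finite (wdoubled p U w e)" using fU unfolding wdoubled_def by (rule_tac finite_subset[of _ "p ` U"]) auto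
        moreover have "card (wdoubled p U w e) \<ge> 5" using False by simp
        ultimately obtain v1 v2 v3 where v: "v1 \<in> wdoubled p U w e" "v2 \<in> wdoubled p U w e" "v3 \<in> wdoubled p U w e"
          "v2 \<notin> {v1, - v1}" "v3 \<notin> {v1, - v1, v2, - v2}" using pick_three by blast
        obtain f where f: "v1 = p f" "f \<in> U" "f + e \<in> U" "p f \<noteq> 0" "w f \<ge> 1" "w (f + e) \<ge> 1" using v(1) unfolding wdoubled_def by auto
        obtain x2 where x2: "v2 = p x2" "x2 \<in> U" "x2 + e \<in> U" "p x2 \<noteq> 0" "w x2 \<ge> 1" "w (x2 + e) \<ge> 1" using v(2) unfolding wdoubled_def by auto
        obtain x3 where x3: "v3 = p x3" "x3 \<in> U" "x3 + e \<in> U" "p x3 \<noteq> 0" "w x3 \<ge> 1" "w (x3 + e) \<ge> 1" using v(3) unfolding wdoubled_def by auto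
        obtain q :: "'a \<Rightarrow> 'a" where q: "linear q" "\<And>v. q v = 0 \<longleftrightarrow> v \<in> span {f}" using proj[OF f(2)] by blast
        have ef: "e \<notin> span {f}" using unimod_parallel[OF U f(2) e(1)] f(4) C(5) linear_neg[OF p(1), of f] by auto
        have "card (wdoubled q U w f) \<le> 2"
        proof (rule wdoubled_small[OF U f(2) q e(1) ef])
          fix z assume z: "z \<in> U" "z + f \<in> U" "1 \<le> w z" "1 \<le> w (z + f)" "f \<noteq> 0" "z \<notin> span {f}" "e \<notin> span {f, z}"
          have z0: "z \<noteq> 0" using z unimodD(2)[OF U] by blast
          have nz: "- (z + f) \<in> U" "w (- (z + f)) = w (z + f)" using unimodD(3)[OF U z(2)] W(1)[OF z(2)] by auto
          have fz: "f \<notin> span {z}" using span_singleton_sym[OF _ z(5)] z(6) by blast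
          have 1: "- (z + f) \<notin> span {z}"
          proof
            assume a: "- (z + f) \<in> span {z}"
            have "- (- (z + f)) - z \<in> span {z}" by (rule span_diff[OF span_neg[OF a] span_base]) simp
            thus False using fz by simp
          qed
          have 2: "f + e \<notin> span {- (z + f), z}"
          proof
            assume "f + e \<in> span {- (z + f), z}"
            moreover have "span {- (z + f), z} \<subseteq> span {f, z}" by (intro span_minimal) (auto simp: span_base span_neg span_add span_diff)
            ultimately have "f + e - f \<in> span {f, z}" by (intro span_diff) (auto simp: span_base)
            thus False using z(7) by simp
          qed
          have 3: "x \<in> span {e, f, z}" if x: "x \<in> U" "x + e \<in> U" "w x \<ge> 1" "w (x + e) \<ge> 1" for x
          proof (rule ccontr)
            assume nx: "x \<notin> span {e, f, z}"
            have "x \<notin> span {f + e, - (z + f), z}"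
              by (rule span_sub3[OF nx]; intro span_add span_neg span_base) auto
            note T = indep_quad[OF z0 1 2 this]
            have "w (x + e) + sum w {x, f + e, - (z + f), z} \<le> 4"
              using W(3)[OF _ T(1) _ x(2)] T(2,3) x(1) f(3) nz(1) z(1) by (auto simp: algebra_simps)
            thus False using T(4)[of w] x(3,4) f(6) z(3,4) nz(2) by simp
          qed
          show False
            using three_doubled[OF U e(1) p f(2,3) x2(2,3) x3(2,3) f(4) x2(4) x3(4), of f z] v(4,5) f(1) x2(1) x3(1)
              3[OF x2(2,3,5,6)] 3[OF x3(2,3,5,6)] by (auto simp: span_base)
        qed
        hence "card (wdoubled q U w f) \<le> 4" by simp
        moreover have "w f = 1" using f one by (metis le_antisym)
        ultimately show ?thesis using f(2) q by blast
      qed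
    qed
    then obtain e and p :: "'a \<Rightarrow> 'a" where e: "e \<in> U" "w e = 1" and p: "linear p" "\<And>v. p v = 0 \<longleftrightarrow> v \<in> span {e}"
      and c: "card (wdoubled p U w e) \<le> 4" by blast
    have B: "(\<Sum>u\<in>U. wt (w u)) \<le> 2 + card (wdoubled p U w e) + (\<Sum>v\<in>p ` U - {0}. wt (contract_wt p U w v))"
      using wt_contract[OF U e(1) p Suc.prems(2)] e(2) by (simp add: wt_def)
    show ?thesis
    proof (cases "\<exists>v\<in>p ` U - {0}. contract_wt p U w v = 1")
      case True
      thus ?thesis using B c IH[OF e(1) p] Suc(2)[symmetric] by auto
    next
      case False
      have "contract_wt p U w v = 0" if v: "v \<in> p ` U - {0}" for v
      proof -
        obtain y where "y \<in> U" "w y = contract_wt p U w v" using M(1)[of v] v by blast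
        thus ?thesis using one(1) False v by (metis le_SucE le_zero_eq One_nat_def)
      qed
      hence S0: "(\<Sum>v\<in>p ` U - {0}. wt (contract_wt p U w v)) = 0" by (simp add: wt_def)
      show ?thesis
      proof (cases "r = 0")
        case True
        hence "p ` U - {0} = {}" using unimod_dim_0[OF unimod_contract(1)[OF U e(1) p]] dU[OF e(1) p] by simp
        hence "wdoubled p U w e = {}" unfolding wdoubled_def by auto
        thus ?thesis using B S0 Suc(2)[symmetric] by auto
      next
        case False
        thus ?thesis using B S0 c Suc(2)[symmetric] by auto
      qed
    qed
  qed
qed

section \<open>Bases of a lattice and their volumes\<close>

definition lattice_basis :: "'a::real_vector set \<Rightarrow> 'a set \<Rightarrow> bool" where
  "lattice_basis L Y \<longleftrightarrow> Y \<subseteq> L \<and> independent Y \<and> L \<subseteq> span Y"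

lemma span_exchange_coeff:
  fixes x :: "'a::real_vector"
  assumes Y: "independent Y" "y \<in> Y" and x: "x - c *\<^sub>R y \<in> span (Y - {y})" and c: "c \<noteq> 0"
  shows "independent (insert x (Y - {y}))" "span (insert x (Y - {y})) = span Y" "x \<notin> Y - {y}"
    "y - (1 / c) *\<^sub>R x \<in> span (Y - {y})"
proof -
  have i: "independent (Y - {y})" using Y(1) independent_mono by blast
  have y: "y \<notin> span (Y - {y})" using Y unfolding indep_iff by blast
  have sc: "(1 / c) *\<^sub>R (x - c *\<^sub>R y) \<in> span (Y - {y})" using x by (rule span_scale)
  have eq: "(1 / c) *\<^sub>R (x - c *\<^sub>R y) = (1 / c) *\<^sub>R x - y" using c by (simp add: scaleR_diff_right)
  have ns: "x \<notin> span (Y - {y})"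
  proof
    assume "x \<in> span (Y - {y})"
    hence "(1 / c) *\<^sub>R x \<in> span (Y - {y})" by (rule span_scale)
    from span_diff[OF this sc] show False using eq y by simp
  qed
  show "x \<notin> Y - {y}" using ns span_base[of x "Y - {y}"] by metis
  show "independent (insert x (Y - {y}))" by (rule independent_insertI[OF ns i])
  show yx: "y - (1 / c) *\<^sub>R x \<in> span (Y - {y})" using span_neg[OF sc] eq by simp
  show "span (insert x (Y - {y})) = span Y"
  proof (rule antisym; rule span_minimal)
    have "x - c *\<^sub>R y \<in> span Y" using x span_mono[of "Y - {y}" Y] by blast
    hence "x - c *\<^sub>R y + c *\<^sub>R y \<in> span Y" using Y(2) by (rule span_add[OF _ span_scale[OF span_base]])
    thus "insert x (Y - {y}) \<subseteq> span Y" by (auto simp: span_base)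
    have "y - (1 / c) *\<^sub>R x \<in> span (insert x (Y - {y}))" using yx span_mono[of "Y - {y}" "insert x (Y - {y})"] by blast
    hence "y - (1 / c) *\<^sub>R x + (1 / c) *\<^sub>R x \<in> span (insert x (Y - {y}))"
      by (rule span_add[OF _ span_scale[OF span_base]]) simp
    hence "y \<in> span (insert x (Y - {y}))" by simp
    moreover have "Y - {y} \<subseteq> span (insert x (Y - {y}))" using span_superset[of "insert x (Y - {y})"] by blast
    ultimately show "Y \<subseteq> span (insert x (Y - {y}))" by blast
  qed auto
qed

lemma coeff_unique:
  fixes x :: "'a::real_vector"
  assumes "independent Y" "y \<in> Y" "x - c *\<^sub>R y \<in> span (Y - {y})" "x - d *\<^sub>R y \<in> span (Y - {y})"
  shows "c = d"
proof (rule ccontr)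
  assume n: "c \<noteq> d"
  have "(x - c *\<^sub>R y) - (x - d *\<^sub>R y) \<in> span (Y - {y})" using assms(3,4) by (rule span_diff)
  hence "(d - c) *\<^sub>R y \<in> span (Y - {y})" by (simp add: scaleR_diff_left)
  hence "(1 / (d - c)) *\<^sub>R ((d - c) *\<^sub>R y) \<in> span (Y - {y})" by (rule span_scale)
  hence "y \<in> span (Y - {y})" using n by simp
  thus False using assms(1,2) unfolding indep_iff by blast
qed

text \<open>The function \<open>vol\<close> abstracts the absolute value of the determinant of the matrix formed by a basis. Its rule under exchange of one vector replaces all matrix computations.\<close>

locale lattice_vol =
  fixes L :: "'a::real_vector set" and vol :: "'a set \<Rightarrow> nat" and A :: "'a set"
  assumes L_zero: "0 \<in> L" and L_add: "\<And>x y. x \<in> L \<Longrightarrow> y \<in> L \<Longrightarrow> x + y \<in> L" and L_neg: "\<And>x. x \<in> L \<Longrightarrow> - x \<in> L"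
    and A_L: "A \<subseteq> L" and finA: "finite A" and symA: "\<And>a. a \<in> A \<Longrightarrow> - a \<in> A" and zeroA: "0 \<notin> A" and L_span: "L \<subseteq> span A"
    and vol_pos: "\<And>Y. lattice_basis L Y \<Longrightarrow> vol Y > 0"
    and exch: "\<And>Y y x c. \<lbrakk>lattice_basis L Y; y \<in> Y; x \<in> L; x - c *\<^sub>R y \<in> span (Y - {y}); c \<noteq> 0\<rbrakk> \<Longrightarrow>
       real (vol (insert x (Y - {y}))) = \<bar>c\<bar> * real (vol Y)"
begin

abbreviation "bas \<equiv> lattice_basis L"

lemma L_diff: "x \<in> L \<Longrightarrow> y \<in> L \<Longrightarrow> x - y \<in> L"
  using L_add[OF _ L_neg] by simp

lemma L_nat: "x \<in> L \<Longrightarrow> real n *\<^sub>R x \<in> L"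
  by (induction n) (auto simp: L_zero L_add scaleR_add_left)

lemma L_int: assumes "x \<in> L" "c \<in> \<int>" shows "c *\<^sub>R x \<in> L"
proof -
  obtain k where k: "c = of_int k" using assms(2) by (auto elim: Ints_cases)
  show ?thesis
  proof (cases "k \<ge> 0")
    case True
    thus ?thesis using L_nat[OF assms(1), of "nat k"] k by simp
  next
    case False
    hence "c *\<^sub>R x = - (real (nat (- k)) *\<^sub>R x)" using k by simp
    thus ?thesis using L_neg[OF L_nat[OF assms(1), of "nat (- k)"]] by simp
  qed
qed

lemma L_sum: "finite S \<Longrightarrow> (\<And>s. s \<in> S \<Longrightarrow> f s \<in> L) \<Longrightarrow> sum f S \<in> L"
  by (induction S rule: finite_induct) (auto simp: L_zero L_add)

lemma bas_exch:
  assumes "bas Y" "y \<in> Y" "x \<in> L" "x - c *\<^sub>R y \<in> span (Y - {y})" "c \<noteq> 0"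
  shows "bas (insert x (Y - {y}))"
  using assms span_exchange_coeff[of Y y x c] unfolding lattice_basis_def by auto

lemma bas_extend:
  assumes "T \<subseteq> A" "independent T"
  shows "\<exists>Y. T \<subseteq> Y \<and> Y \<subseteq> A \<and> bas Y"
proof -
  obtain Y where Y: "T \<subseteq> Y" "Y \<subseteq> A" "independent Y" "A \<subseteq> span Y"
    using maximal_independent_subset_extend[OF assms] by metis
  have "L \<subseteq> span Y" using L_span span_minimal[OF Y(4)] by auto
  thus ?thesis using Y(1-3) A_L unfolding lattice_basis_def by (intro exI[of _ Y]) auto
qed

lemma bas_fin:
  assumes "bas Y" shows "finite Y" "card Y = dim A" "A \<subseteq> span Y"
proof -
  have Y: "independent Y" "Y \<subseteq> span A" "A \<subseteq> span Y" using assms A_L L_span unfolding lattice_basis_def by auto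
  show "A \<subseteq> span Y" by fact
  show "finite Y" using independent_span_bound[OF finA Y(1,2)] by blast
  have "span Y = span A" using Y by (meson span_minimal subspace_span subset_antisym)
  thus "card Y = dim A" using dim_eq_card[of Y A] Y(1) by simp
qed

lemma coeff_ex:
  assumes "bas Y" "x \<in> L"
  shows "\<exists>c. x = (\<Sum>y\<in>Y. c y *\<^sub>R y) \<and> (\<forall>y\<in>Y. x - c y *\<^sub>R y \<in> span (Y - {y}))"
proof -
  have "x \<in> span Y" using assms unfolding lattice_basis_def by blast
  then obtain c where c: "x = (\<Sum>y\<in>Y. c y *\<^sub>R y)" using bas_fin(1)[OF assms(1)] span_finite_coeff by metis
  have "x - c y *\<^sub>R y \<in> span (Y - {y})" if "y \<in> Y" for y
  proof -
    have "x - c y *\<^sub>R y = (\<Sum>y\<in>Y - {y}. c y *\<^sub>R y)"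
      using bas_fin(1)[OF assms(1)] that unfolding c by (subst sum.remove[of Y y]) auto
    moreover have "(\<Sum>y\<in>Y - {y}. c y *\<^sub>R y) \<in> span (Y - {y})" by (intro span_sum span_scale span_base)
    ultimately show ?thesis by simp
  qed
  thus ?thesis using c by blast
qed

text \<open>A nonzero coordinate is, up to sign, the ratio of the volumes of two bases.\<close>

lemma unimod_of_const:
  assumes "\<And>Y. Y \<subseteq> A \<Longrightarrow> bas Y \<Longrightarrow> vol Y = k"
  shows "unimod A"
  unfolding unimod_def
proof (intro conjI allI impI ballI)
  fix Z u z c
  assume Z: "Z \<subseteq> A" "independent Z" "u \<in> A" "z \<in> Z" "u - c *\<^sub>R z \<in> span (Z - {z})"
  show "c \<in> {-1, 0, 1}"
  proof (cases "c = 0")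
    case False
    obtain Y where Y: "Z \<subseteq> Y" "Y \<subseteq> A" "bas Y" using bas_extend[OF Z(1,2)] by blast
    have "u - c *\<^sub>R z \<in> span (Y - {z})" using Z(5) span_mono[of "Z - {z}" "Y - {z}"] Y(1) by auto
    hence "bas (insert u (Y - {z}))" "real (vol (insert u (Y - {z}))) = \<bar>c\<bar> * real (vol Y)"
      using bas_exch[OF Y(3), of z u c] exch[OF Y(3), of z u c] False Y(1) Z A_L by auto
    moreover have "insert u (Y - {z}) \<subseteq> A" using Y Z by auto
    ultimately have "real k = \<bar>c\<bar> * real k" "k > 0" using assms Y vol_pos by metis+
    thus ?thesis by (auto simp: abs_if split: if_splits)
  qed simp
qed (use finA symA zeroA in auto)

end

text \<open>For columns of a matrix, the second assumption is primitivity.\<close>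

locale bimodular = lattice_vol +
  assumes vol2: "\<And>Y. Y \<subseteq> A \<Longrightarrow> bas Y \<Longrightarrow> vol Y \<le> 2"
    and prim: "\<And>a l. a \<in> A \<Longrightarrow> l \<in> L \<Longrightarrow> a \<noteq> 2 *\<^sub>R l"
begin

text \<open>Such a set witnesses the failure of unimodularity: half its sum is a lattice vector with coordinates 1/2.\<close>

definition even_indep :: "'a set \<Rightarrow> bool" where
  "even_indep S \<longleftrightarrow> S \<subseteq> A \<and> independent S \<and> S \<noteq> {} \<and> (\<exists>l\<in>L. \<Sum>S = 2 *\<^sub>R l)"

lemma vol12: "Y \<subseteq> A \<Longrightarrow> bas Y \<Longrightarrow> vol Y = 1 \<or> vol Y = 2"
  using vol2[of Y] vol_pos[of Y] by linarith

lemma coeff_vals: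
  assumes Y: "Y \<subseteq> A" "bas Y" and x: "x \<in> A" and y: "y \<in> Y" "x - c *\<^sub>R y \<in> span (Y - {y})"
  shows "\<bar>c\<bar> * real (vol Y) \<in> {0, 1, 2}"
    "vol Y = 1 \<Longrightarrow> c \<in> {-2, -1, 0, 1, 2}" "vol Y = 2 \<Longrightarrow> c \<in> {-1, -1/2, 0, 1/2, 1}"
proof -
  show *: "\<bar>c\<bar> * real (vol Y) \<in> {0, 1, 2}"
  proof (cases "c = 0")
    case False
    have "bas (insert x (Y - {y}))" "real (vol (insert x (Y - {y}))) = \<bar>c\<bar> * real (vol Y)"
      using bas_exch[OF Y(2) y(1) _ y(2) False] exch[OF Y(2) y(1) _ y(2) False] x A_L by auto
    moreover have "insert x (Y - {y}) \<subseteq> A" using Y x by auto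
    ultimately show ?thesis using vol12[of "insert x (Y - {y})"] by auto
  qed simp
  show "vol Y = 1 \<Longrightarrow> c \<in> {-2, -1, 0, 1, 2}" using * by (auto simp: abs_if split: if_splits)
  show "vol Y = 2 \<Longrightarrow> c \<in> {-1, -1/2, 0, 1/2, 1}" using * by (auto simp: abs_if split: if_splits)
qed

text \<open>The elements with coefficient \<plusminus>1/2 do: modulo integral combinations, half of their sum is the given vector.\<close>

lemma even_indep_of_half:
  assumes Y: "Y \<subseteq> A" "bas Y" and x: "x \<in> A" and y0: "y0 \<in> Y" "x - c0 *\<^sub>R y0 \<in> span (Y - {y0})" "\<bar>c0\<bar> = 1/2"
  shows "\<exists>S. even_indep S"
proof -
  have v: "vol Y = 2" using coeff_vals(2)[OF Y x y0(1,2)] vol12[OF Y] y0(3) by auto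
  obtain c where c: "x = (\<Sum>y\<in>Y. c y *\<^sub>R y)" "\<forall>y\<in>Y. x - c y *\<^sub>R y \<in> span (Y - {y})"
    using coeff_ex[OF Y(2), of x] x A_L by blast
  have cv: "c y \<in> {-1, -1/2, 0, 1/2, 1}" if "y \<in> Y" for y using coeff_vals(3)[OF Y x that _ v] c(2) that by blast
  have fY: "finite Y" using bas_fin[OF Y(2)] by blast
  define S where "S = {y\<in>Y. \<bar>c y\<bar> = 1/2}"
  have "y0 \<in> S"
  proof -
    have "x - c y0 *\<^sub>R y0 \<in> span (Y - {y0})" using y0(1) c(2) by blast
    hence "c y0 = c0" using coeff_unique[OF _ y0(1) _ y0(2)] Y(2) unfolding lattice_basis_def by blast
    thus ?thesis unfolding S_def using y0 by simp
  qed
  define d where "d y = (if y \<in> S then 1/2 else 0) - c y" for y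
  have dv: "d y \<in> \<int>" if "y \<in> Y" for y
  proof -
    from cv[OF that] consider "c y = -1" | "c y = -1/2" | "c y = 0" | "c y = 1/2" | "c y = 1" by blast
    moreover have "d y = (if \<bar>c y\<bar> = 1/2 then 1/2 else 0) - c y" using that by (simp add: d_def S_def)
    ultimately show ?thesis by cases (erule ssubst, erule ssubst, simp)+
  qed
  have "\<Sum>S = (\<Sum>y\<in>Y. (if y \<in> S then 1 else 0) *\<^sub>R y)"
    unfolding S_def using fY by (simp add: sum.inter_filter[symmetric] if_distrib[of "\<lambda>c. c *\<^sub>R _"] cong: if_cong) 
  also have "\<dots> = (\<Sum>y\<in>Y. 2 *\<^sub>R (d y *\<^sub>R y)) + 2 *\<^sub>R x"
    unfolding c(1) scaleR_sum_right sum.distrib[symmetric] d_def by (intro sum.cong) (auto simp: algebra_simps scaleR_2)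
  finally have "\<Sum>S = 2 *\<^sub>R ((\<Sum>y\<in>Y. d y *\<^sub>R y) + x)" by (simp add: scaleR_sum_right scaleR_add_right)
  moreover have "(\<Sum>y\<in>Y. d y *\<^sub>R y) + x \<in> L"
    using Y x A_L dv fY by (intro L_add L_sum L_int) auto
  moreover have "S \<subseteq> A" "independent S" using Y independent_mono[of Y S] unfolding S_def lattice_basis_def by auto
  ultimately show ?thesis using \<open>y0 \<in> S\<close> unfolding even_indep_def by blast
qed

text \<open>Volumes 1 and 2 allow only the further coordinates \<plusminus>1/2 and \<plusminus>2, and exchanging the two vectors turns the coordinate 2 into 1/2.\<close>

lemma unimod_of_no_even:
  assumes "\<nexists>S. even_indep S"
  shows "unimod A"
  unfolding unimod_def
proof (intro conjI allI impI ballI)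
  fix Z u z c
  assume Z: "Z \<subseteq> A" "independent Z" "u \<in> A" "z \<in> Z" "u - c *\<^sub>R z \<in> span (Z - {z})"
  show "c \<in> {-1, 0, 1}"
  proof (cases "c = 0")
    case False
    obtain Y where Y: "Z \<subseteq> Y" "Y \<subseteq> A" "bas Y" using bas_extend[OF Z(1,2)] by blast
    have u: "u - c *\<^sub>R z \<in> span (Y - {z})" using Z(5) span_mono[of "Z - {z}" "Y - {z}"] Y(1) by auto
    have zY: "z \<in> Y" using Y Z by auto
    have 1: "\<bar>c\<bar> \<noteq> 1/2" using even_indep_of_half[OF Y(2,3) Z(3) zY u] assms by blast
    have 2: "\<bar>c\<bar> \<noteq> 2"
    proof
      assume c: "\<bar>c\<bar> = 2"
      let ?Y = "insert u (Y - {z})"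
      have B: "bas ?Y" using bas_exch[OF Y(3) zY _ u False] Z A_L by auto
      have "u \<notin> Y - {z}" "z - (1 / c) *\<^sub>R u \<in> span (Y - {z})"
        using span_exchange_coeff[OF _ zY u False] Y(3) unfolding lattice_basis_def by auto
      moreover from this have "?Y - {u} = Y - {z}" by auto
      ultimately have "z - (1 / c) *\<^sub>R u \<in> span (?Y - {u})" by simp
      moreover have "\<bar>1 / c\<bar> = 1/2" using c by simp
      moreover have "?Y \<subseteq> A" "z \<in> A" using Y Z by auto
      ultimately show False using even_indep_of_half[OF _ B, of z u "1 / c"] assms by blast
    qed
    show ?thesis using coeff_vals(2,3)[OF Y(2,3) Z(3) zY u] vol12[OF Y(2,3)] 1 2 by auto
  qed simp
qed (use finA symA zeroA in auto)

lemma even_indepI: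
  assumes "S \<subseteq> A" "independent S" "S \<noteq> {}" "\<Sum>S = 2 *\<^sub>R l" "l \<in> L"
  shows "even_indep S"
  using assms unfolding even_indep_def by blast

text \<open>The only denominator that volume 2 leaves room for is 2, and it contradicts primitivity.\<close>

lemma scale_int:
  assumes a: "a \<in> A" and t: "t *\<^sub>R a \<in> L"
  shows "t \<in> \<int>"
proof (rule ccontr)
  assume nt: "t \<notin> \<int>"
  hence t0: "t \<noteq> 0" by auto
  have "independent {a}" using a zeroA by (auto simp: independent_insert)
  then obtain Y where Y: "{a} \<subseteq> Y" "Y \<subseteq> A" "bas Y" using bas_extend[of "{a}"] a by auto
  have "real (vol (insert (t *\<^sub>R a) (Y - {a}))) = \<bar>t\<bar> * real (vol Y)"
    using exch[OF Y(3) _ t, of a t] Y t0 by (simp add: span_zero)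
  hence n: "\<bar>t\<bar> * real (vol Y) \<in> \<int>" by (metis Ints_of_nat)
  have "vol Y \<noteq> 1" using n nt by (auto simp: abs_if split: if_splits)
  hence "vol Y = 2" using vol12[OF Y(2,3)] by blast
  hence "2 * t \<in> \<int>" using n by (auto simp: abs_if mult.commute split: if_splits)
  then obtain k :: int where k: "2 * t = of_int k" by (auto elim: Ints_cases)
  have "odd k"
  proof
    assume "even k"
    then obtain j where "k = 2 * j" by blast
    hence "t = of_int j" using k by simp
    thus False using nt by simp
  qed
  then obtain j where "k = 2 * j + 1" by (elim oddE)
  hence "t = of_int j + 1/2" using k by simp
  hence "t *\<^sub>R a - of_int j *\<^sub>R a = (1/2) *\<^sub>R a" by (simp add: scaleR_add_left)
  moreover have "t *\<^sub>R a - of_int j *\<^sub>R a \<in> L" using L_diff[OF t L_int[of a "of_int j"]] a A_L by auto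
  ultimately have "(1/2) *\<^sub>R a \<in> L" by simp
  thus False using prim[OF a, of "(1/2) *\<^sub>R a"] by simp
qed

end

section \<open>Contraction of an element\<close>

lemma half_not_int: "(1/2::real) \<notin> \<int>" "(-1/2::real) \<notin> \<int>"
proof -
  have "real_of_int (2 * k) \<noteq> real_of_int 1" "real_of_int (2 * k) \<noteq> real_of_int (-1)" for k :: int
    by (simp_all only: of_int_eq_iff) presburger+
  thus "(1/2::real) \<notin> \<int>" "(-1/2::real) \<notin> \<int>" by (auto elim!: Ints_cases simp: field_simps)
qed

context bimodular
begin

lemma indep_insert_shift:
  assumes S: "independent ({a} \<union> S)" "{a} \<inter> S = {}" "finite S" and z: "z = \<Sum>S + k *\<^sub>R a" "k \<noteq> 0"
  shows "independent (insert z S)" "z \<notin> S"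
proof -
  have aS: "a \<notin> span S"
  proof -
    have "{a} \<union> S - {a} = S" using S(2) by auto
    thus ?thesis using S(1) unfolding indep_iff by (metis UnI1 insertI1)
  qed
  have "z \<notin> span S"
  proof
    assume "z \<in> span S"
    moreover have "\<Sum>S \<in> span S" by (intro span_sum span_base)
    ultimately have "z - \<Sum>S \<in> span S" by (rule span_diff)
    hence "(1 / k) *\<^sub>R (z - \<Sum>S) \<in> span S" by (rule span_scale)
    thus False using aS z by simp
  qed
  thus "z \<notin> S" using span_base[of z S] by metis
  have "independent S" using S(1) by (rule independent_mono) blast
  thus "independent (insert z S)" by (rule independent_insertI[OF \<open>z \<notin> span S\<close>])
qed

end

text \<open>Contraction of one element. Without small even independent sets, \<open>A\<close> behaves near \<open>a\<close> like a unimodular set.\<close>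

locale bimodular_contract = bimodular +
  fixes a :: 'a and p :: "'a \<Rightarrow> 'a"
  assumes a: "a \<in> A" and lin: "linear p" and ker: "\<And>v. p v = 0 \<longleftrightarrow> v \<in> span {a}"
    and large: "\<And>S. even_indep S \<Longrightarrow> card S \<ge> 5"
begin

lemma a0: "a \<noteq> 0" and aL: "a \<in> L"
  using a zeroA A_L by auto

lemma pa: "p a = 0"
  using ker by (simp add: span_base)

lemma ia: "independent {a}"
  using a0 by (simp add: independent_insert)

lemma p_shift: "p (x + k *\<^sub>R a) = p x" "p (x + a) = p x" "p (x - a) = p x"
  using lin pa by (simp_all add: linear_add linear_diff linear_scale)

lemma no_pair:
  assumes "x \<in> A" "y \<in> A" "y \<notin> span {x}" "x + y = 2 *\<^sub>R l" "l \<in> L"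
  shows False
proof -
  have x0: "x \<noteq> 0" using assms zeroA by blast
  have I: "independent {x, y}" "x \<noteq> y" using indep_pair[OF x0 assms(3)] by auto
  have "even_indep {x, y}" using I assms by (intro even_indepI[of _ l]) auto
  from large[OF this] show False using I(2) by simp
qed

lemma lift_diff:
  assumes x: "x \<in> A" "y \<in> L" "p x = p y" 
  shows "\<exists>k. k \<in> \<int> \<and> y = x + k *\<^sub>R a"
proof -
  have "p (y - x) = 0" using x lin by (simp add: linear_diff)
  then obtain k where k: "y - x = k *\<^sub>R a" using ker span_singleton_iff by blast
  have "k *\<^sub>R a \<in> L" using L_diff[of y x] x A_L k by auto
  hence "k \<in> \<int>" by (rule scale_int[OF a])
  thus ?thesis using k by (intro exI[of _ k]) (auto simp: algebra_simps)
qed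

lemma kernel_A:
  assumes x: "x \<in> A" "p x = 0"
  shows "x = a \<or> x = - a"
proof -
  obtain t where t: "x = t *\<^sub>R a" using ker x span_singleton_iff by blast
  obtain Y where Y: "{a} \<subseteq> Y" "Y \<subseteq> A" "bas Y" using bas_extend[of "{a}"] a ia by auto
  have "x - t *\<^sub>R a \<in> span (Y - {a})" using t by (simp add: span_zero)
  hence "t \<in> {-2, -1, -1/2, 0, 1/2, 1, 2}" using coeff_vals(2,3)[OF Y(2,3) x(1), of a t] vol12[OF Y(2,3)] Y(1) by auto
  moreover have "t \<in> \<int>" using scale_int[OF a, of t] t x A_L by auto
  hence "t \<noteq> 1/2" "t \<noteq> -1/2" using half_not_int by metis+
  moreover have "t \<noteq> 0" using t x zeroA by auto
  moreover have "t \<noteq> 2" using t prim[OF x(1) aL] by auto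
  moreover have "t \<noteq> -2" using t prim[OF x(1), of "- a"] L_neg[OF aL] by auto
  ultimately show ?thesis using t by auto
qed

lemma notin_span_a: "x \<in> A \<Longrightarrow> p x \<noteq> 0 \<Longrightarrow> x \<notin> span {a}" "x \<in> A \<Longrightarrow> p x \<noteq> 0 \<Longrightarrow> a \<notin> span {x}"
  using ker span_singleton_sym[OF _ a0, of x] by blast+

text \<open>An integral distance 2 along \<open>a\<close> would make \<open>{x, y}\<close> an even independent set.\<close>

lemma fibre_A:
  assumes x: "x \<in> A" "y \<in> A" "p x = p y" "p x \<noteq> 0"
  shows "y = x \<or> y = x + a \<or> y = x - a"
proof -
  obtain k where k: "k \<in> \<int>" "y = x + k *\<^sub>R a" using lift_diff[of x y] x A_L by blast
  have ax: "a \<notin> span {x}" using notin_span_a x by blast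
  have I: "independent {x, a}" "x \<noteq> a" using indep_pair[of x a] x zeroA ax by auto
  obtain Y where Y: "{x, a} \<subseteq> Y" "Y \<subseteq> A" "bas Y" using bas_extend[of "{x, a}"] a x I by auto
  have "y - k *\<^sub>R a \<in> span (Y - {a})" using k Y(1) I(2) by (simp add: span_base)
  hence "k \<in> {-2, -1, -1/2, 0, 1/2, 1, 2}" using coeff_vals(2,3)[OF Y(2,3) x(2), of a k] vol12[OF Y(2,3)] Y(1) by auto
  moreover have "k \<noteq> 1/2" "k \<noteq> -1/2" using k(1) half_not_int by metis+
  moreover have "k \<noteq> 2 \<and> k \<noteq> -2"
  proof (rule ccontr)
    assume k2: "\<not> (k \<noteq> 2 \<and> k \<noteq> -2)"
    have "y \<notin> span {x}"
    proof
      assume "y \<in> span {x}"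
      hence "y - x \<in> span {x}" by (rule span_diff) (simp add: span_base)
      hence "(1 / k) *\<^sub>R (y - x) \<in> span {x}" by (rule span_scale)
      thus False using ax k k2 by auto
    qed
    moreover have "x + y = 2 *\<^sub>R (x + (k / 2) *\<^sub>R a)" using k(2) by (simp add: scaleR_2 algebra_simps)
    moreover have "x + (k / 2) *\<^sub>R a \<in> L" using k2 x a A_L by (intro L_add L_int) auto
    ultimately show False using no_pair[OF x(1,2)] by blast
  qed
  ultimately show ?thesis using k by auto
qed

lemma fibre_A2:
  assumes x: "p x \<noteq> 0" "x + a \<in> A" "x - a \<in> A"
  shows False
proof -
  have xL: "x \<in> L" using L_diff[of "x + a" a] x A_L aL by auto
  have "x + a \<notin> span {x - a}"
  proof
    assume "x + a \<in> span {x - a}"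
    hence "(x + a) - (x - a) \<in> span {x - a}" by (rule span_diff) (simp add: span_base)
    hence "(1/2) *\<^sub>R ((x + a) - (x - a)) \<in> span {x - a}" by (rule span_scale)
    moreover have "(1/2) *\<^sub>R ((x + a) - (x - a)) = a" by (simp add: scaleR_2[symmetric])
    ultimately show False using notin_span_a(2)[OF x(3)] p_shift(3) x(1) by simp
  qed
  moreover have "(x - a) + (x + a) = 2 *\<^sub>R x" by (simp add: scaleR_2)
  ultimately show False using no_pair[OF x(3,2)] xL by blast
qed

text \<open>The counterpart of \<open>doubled\<close>.\<close>

definition N :: "'a set" where
  "N = {p x |x. x \<in> A \<and> x + a \<in> A \<and> p x \<noteq> 0}"

lemma N_sub: "N \<subseteq> p ` A - {0}"
  unfolding N_def by auto

lemma N_sym: assumes v: "v \<in> N" shows "- v \<in> N"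
proof -
  obtain x where x: "x \<in> A" "x + a \<in> A" "v = p x" "p x \<noteq> 0" using v unfolding N_def by auto
  have "- (x + a) \<in> A" using symA[OF x(2)] .
  moreover have "- (x + a) + a \<in> A" using symA[OF x(1)] by simp
  moreover have v': "- v = p (- (x + a))" using x(3) linear_neg[OF lin, of "x + a"] p_shift(2) by simp
  moreover have "p (- (x + a)) \<noteq> 0" using v' x by auto
  ultimately show ?thesis unfolding N_def by blast
qed

lemma fin: "finite (p ` A)"
  using finA by simp

lemma sum_in_span_minus:
  fixes d :: "'a \<Rightarrow> real"
  assumes S: "finite S" "s0 \<in> S" "S \<subseteq> Y" and a: "a \<in> Y" "a \<notin> S"
  shows "(\<Sum>s\<in>S. d s *\<^sub>R s) + k *\<^sub>R a - d s0 *\<^sub>R s0 \<in> span (Y - {s0})"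
    "(\<Sum>s\<in>S. d s *\<^sub>R s) + k *\<^sub>R a - k *\<^sub>R a \<in> span (Y - {a})"
proof -
  have "(\<Sum>s\<in>S. d s *\<^sub>R s) + k *\<^sub>R a - d s0 *\<^sub>R s0 = (\<Sum>s\<in>S - {s0}. d s *\<^sub>R s) + k *\<^sub>R a"
    using S by (subst sum.remove[of S s0]) auto
  also have "\<dots> \<in> span (Y - {s0})"
    using S a by (intro span_add span_sum span_scale span_base) auto
  finally show "(\<Sum>s\<in>S. d s *\<^sub>R s) + k *\<^sub>R a - d s0 *\<^sub>R s0 \<in> span (Y - {s0})" .
  have "(\<Sum>s\<in>S. d s *\<^sub>R s) \<in> span (Y - {a})" using S a by (intro span_sum span_scale span_base) auto
  thus "(\<Sum>s\<in>S. d s *\<^sub>R s) + k *\<^sub>R a - k *\<^sub>R a \<in> span (Y - {a})" by simp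
qed

lemma indep_drop:
  assumes "independent ({a} \<union> S)" "{a} \<inter> S = {}"
  shows "independent S" "a \<notin> span S"
proof -
  show "independent S" using assms(1) by (rule independent_mono) blast
  have "{a} \<union> S - {a} = S" using assms(2) by auto
  thus "a \<notin> span S" using assms(1) unfolding indep_iff by (metis UnI1 insertI1)
qed

text \<open>Lift the circuit to the lower ends \<open>S\<close> and to the upper ends of its fibres. The coordinate of \<open>a\<close> changes between the two lifts by the sum of the coefficients \<open>c\<close>, and volumes 1 and 2 keep both values in a bounded range.
  So there are few summands. For each of the remaining patterns of coefficients, some of the lifts, possibly with one of them moved to the other end or with a lift of \<open>y\<close> added, form an even independent set with at most four elements.\<close>

lemma no_circuit_pos:
  assumes R: "R \<subseteq> N" "independent R" and y: "y \<in> N" "y = (\<Sum>t\<in>R. c t *\<^sub>R t)" and pos: "\<And>t. t \<in> R \<Longrightarrow> c t > (0::real)"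
  shows "y \<in> R"
proof (rule ccontr)
  assume ny: "y \<notin> R"
  have fR: "finite R" using finite_subset[OF R(1) finite_subset[OF N_sub]] fin by auto
  define B where "B = {s \<in> A. s + a \<in> A}"
  have RB: "R \<subseteq> p ` B" using R(1) unfolding N_def B_def by auto
  obtain S where S: "S \<subseteq> B" "p ` S = R" "inj_on p S" "independent ({a} \<union> S)" "{a} \<inter> S = {}"
    using basis_lift[OF lin ker ia RB R(2)] by blast
  have fS: "finite S" using S(2,3) fR finite_image_iff by blast
  have SA: "S \<subseteq> A" and S'A: "(\<lambda>s. s + a) ` S \<subseteq> A" using S(1) unfolding B_def by auto
  obtain x where x: "x \<in> A" "x + a \<in> A" "y = p x" "p x \<noteq> 0" using y(1) unfolding N_def by auto
  define d where "d s = c (p s)" for s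
  have dpos: "d s > 0" if "s \<in> S" for s using pos[of "p s"] S(2) that unfolding d_def by auto
  have "y = (\<Sum>s\<in>S. d s *\<^sub>R p s)" using y(2) sum.reindex[OF S(3), of "\<lambda>t. c t *\<^sub>R t"] S(2) unfolding d_def by simp
  also have "\<dots> = p (\<Sum>s\<in>S. d s *\<^sub>R s)" using lin by (simp add: linear_sum linear_scale)
  finally have "p (x - (\<Sum>s\<in>S. d s *\<^sub>R s)) = 0" using x(3) lin by (simp add: linear_diff)
  then obtain k where k: "x - (\<Sum>s\<in>S. d s *\<^sub>R s) = k *\<^sub>R a" using ker span_singleton_iff by blast
  hence xe: "x = (\<Sum>s\<in>S. d s *\<^sub>R s) + k *\<^sub>R a" by (simp add: algebra_simps)
  define D where "D = (\<Sum>s\<in>S. d s)"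
  have "S \<noteq> {}" using xe x(1) x(4) pa p_shift(1)[of 0 k] lin by (auto simp: linear_0)
  have aS: "a \<notin> S" using S(5) by auto
  obtain Y where Y: "{a} \<union> S \<subseteq> Y" "Y \<subseteq> A" "bas Y" using bas_extend[of "{a} \<union> S"] S(4) SA a by auto
  define S' where "S' = (\<lambda>s. s + a) ` S"
  have injs: "inj_on (\<lambda>s. s + a) S" by (auto intro: inj_onI)
  have pS': "p ` S' = R" "inj_on p S'" using S(2,3) unfolding S'_def by (auto simp: p_shift image_image inj_on_def)
  have S'i: "independent ({a} \<union> S')" "{a} \<inter> S' = {}"
    using indep_lift[OF lin, of "{a}" S'] pa ia R(2) pS' by auto
  have fS': "finite S'" and S'A': "S' \<subseteq> A" using fS S'A unfolding S'_def by auto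
  obtain Y' where Y': "{a} \<union> S' \<subseteq> Y'" "Y' \<subseteq> A" "bas Y'" using bas_extend[of "{a} \<union> S'"] S'i S'A' a by auto
  have xe': "x = (\<Sum>s\<in>S'. d (s - a) *\<^sub>R s) + (k - D) *\<^sub>R a"
  proof -
    have "(\<Sum>s\<in>S'. d (s - a) *\<^sub>R s) = (\<Sum>s\<in>S. d s *\<^sub>R (s + a))" unfolding S'_def sum.reindex[OF injs] by simp
    also have "\<dots> = (\<Sum>s\<in>S. d s *\<^sub>R s) + D *\<^sub>R a" unfolding D_def by (simp add: scaleR_add_right sum.distrib scaleR_sum_left)
    finally show ?thesis using xe by (simp add: algebra_simps)
  qed
  have coefS: "d s * real (vol Y) \<in> {1, 2}" "d s * real (vol Y') \<in> {1, 2}" if s: "s \<in> S" for s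
  proof -
    have "x - d s *\<^sub>R s \<in> span (Y - {s})" using sum_in_span_minus(1)[OF fS s _ _ aS, of Y d k] Y(1) xe by auto
    from coeff_vals(1)[OF Y(2,3) x(1) _ this] show "d s * real (vol Y) \<in> {1, 2}" using Y(1) s dpos[OF s] vol_pos[OF Y(3)] by auto
    have s': "s + a \<in> S'" using s unfolding S'_def by simp
    have "x - d s *\<^sub>R (s + a) \<in> span (Y' - {s + a})"
      using sum_in_span_minus(1)[OF fS' s', of Y' "\<lambda>s. d (s - a)" "k - D"] Y'(1) S'i(2) xe' by auto
    from coeff_vals(1)[OF Y'(2,3) x(1) _ this] show "d s * real (vol Y') \<in> {1, 2}" using Y'(1) s' dpos[OF s] vol_pos[OF Y'(3)] by auto
  qed
  obtain s0 where s0: "s0 \<in> S" using \<open>S \<noteq> {}\<close> by blast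
  have bound: "(k + 1) * real (vol Y) \<le> 2" "(k - D) * real (vol Y') \<ge> -2"
  proof -
    have "x + a = (\<Sum>s\<in>S. d s *\<^sub>R s) + (k + 1) *\<^sub>R a" using xe by (simp add: algebra_simps)
    hence "x + a - (k + 1) *\<^sub>R a \<in> span (Y - {a})" using sum_in_span_minus(2)[OF fS s0 _ _ aS, of Y d "k + 1"] Y(1) by auto
    from coeff_vals(1)[OF Y(2,3) x(2) _ this] have "\<bar>k + 1\<bar> * real (vol Y) \<in> {0, 1, 2}" using Y(1) by auto
    moreover have "(k + 1) * real (vol Y) \<le> \<bar>k + 1\<bar> * real (vol Y)" by (intro mult_right_mono) auto
    ultimately show "(k + 1) * real (vol Y) \<le> 2" by auto
    have "s0 + a \<in> S'" using s0 unfolding S'_def by simp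
    hence "x - (k - D) *\<^sub>R a \<in> span (Y' - {a})" using sum_in_span_minus(2)[OF fS', of "s0 + a" Y' "\<lambda>s. d (s - a)" "k - D"] Y'(1) S'i(2) xe' by auto
    from coeff_vals(1)[OF Y'(2,3) x(1) _ this] have "\<bar>k - D\<bar> * real (vol Y') \<in> {0, 1, 2}" using Y'(1) by auto
    moreover have "- (k - D) * real (vol Y') \<le> \<bar>k - D\<bar> * real (vol Y')" by (intro mult_right_mono) auto
    ultimately show "(k - D) * real (vol Y') \<ge> -2" by auto
  qed
  have v: "vol Y = 1 \<or> vol Y = 2" "vol Y' = 1 \<or> vol Y' = 2" using vol12 Y Y' by auto
  have axS: "x \<notin> span S" if "k \<noteq> 0"
  proof
    assume "x \<in> span S"
    moreover have "(\<Sum>s\<in>S. d s *\<^sub>R s) \<in> span S" by (intro span_sum span_scale span_base)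
    ultimately have "x - (\<Sum>s\<in>S. d s *\<^sub>R s) \<in> span S" by (rule span_diff)
    hence "(1 / k) *\<^sub>R (x - (\<Sum>s\<in>S. d s *\<^sub>R s)) \<in> span S" by (rule span_scale)
    thus False using k that indep_drop(2)[OF S(4,5)] by simp
  qed
  have kL: "k \<in> \<int>" if "\<And>s. s \<in> S \<Longrightarrow> d s \<in> \<int>"
  proof (rule scale_int[OF a])
    have "(\<Sum>s\<in>S. d s *\<^sub>R s) \<in> L" using fS SA A_L that by (intro L_sum L_int) auto
    thus "k *\<^sub>R a \<in> L" using k L_diff[of x "\<Sum>s\<in>S. d s *\<^sub>R s"] x(1) A_L by auto
  qed
  have cS: "card S \<noteq> 0" using fS \<open>S \<noteq> {}\<close> by simp
  consider (half) s where "s \<in> S" "d s = 1/2" | (two) s where "s \<in> S" "d s = 2" "\<And>s. s \<in> S \<Longrightarrow> d s \<in> {1, 2}" | (all1) "\<And>s. s \<in> S \<Longrightarrow> d s = 1"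
  proof -
    have "d s \<in> {1/2, 1, 2}" if "s \<in> S" for s using coefS(1)[OF that] v(1) by auto
    thus ?thesis using that by (metis insertE singletonD insertI1 insertI2)
  qed
  thus False
  proof cases
    case half
    hence v2: "vol Y = 2" "vol Y' = 2" using coefS[OF half(1)] v by auto
    have d: "d s \<in> {1/2, 1}" if "s \<in> S" for s using coefS(1)[OF that] v2 by auto
    have D1: "D \<le> 1" using bound v2 by simp
    have all: "d s = 1/2" if s: "s \<in> S" for s
    proof (rule ccontr)
      assume "d s \<noteq> 1/2"
      hence ds: "d s = 1" using d[OF s] by auto
      hence "s \<noteq> half_s" if "d half_s = 1/2" for half_s using that by auto
      obtain h where h: "h \<in> S" "d h = 1/2" using half by blast
      have "d s + d h \<le> D" unfolding D_def using ds h s fS dpos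
        by (subst sum.remove[OF fS s], intro add_left_mono member_le_sum) (auto intro: less_imp_le)
      thus False using ds h D1 by simp
    qed
    have "D = (\<Sum>s\<in>S. 1/2)" unfolding D_def by (intro sum.cong refl all)
    hence "D = real (card S) / 2" by simp
    hence c2: "card S \<le> 2" using D1 by simp
    have x2: "2 *\<^sub>R x = \<Sum>S + (2 * k) *\<^sub>R a"
    proof -
      have "(\<Sum>s\<in>S. d s *\<^sub>R s) = (\<Sum>s\<in>S. (1/2) *\<^sub>R s)" by (intro sum.cong refl) (simp only: all)
      hence "(\<Sum>s\<in>S. d s *\<^sub>R s) = (1/2) *\<^sub>R \<Sum>S" by (simp add: scaleR_sum_right)
      thus ?thesis unfolding xe by (simp add: scaleR_add_right)
    qed
    have "(2 * k) *\<^sub>R a = 2 *\<^sub>R x - \<Sum>S" using x2 by simp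
    moreover have "2 *\<^sub>R x - \<Sum>S \<in> L" using x(1) SA A_L fS by (intro L_diff L_int L_sum) auto
    ultimately have "2 * k \<in> \<int>" using scale_int[OF a] by metis
    then obtain n :: int where n: "2 * k = of_int n" by (auto elim: Ints_cases)
    show False
    proof (cases "even n")
      case True
      then obtain j where j: "n = 2 * j" by blast
      have "\<Sum>S = 2 *\<^sub>R (x - of_int j *\<^sub>R a)" using x2 n j by (simp add: scaleR_diff_right algebra_simps)
      moreover have "x - of_int j *\<^sub>R a \<in> L" using x(1) A_L aL by (intro L_diff L_int) auto
      ultimately have "even_indep S" using even_indepI[OF SA indep_drop(1)[OF S(4,5)] \<open>S \<noteq> {}\<close>] by blast
      from large[OF this] show False using c2 by simp
    next
      case False
      then obtain j where j: "n = 2 * j + 1" by (elim oddE)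
      \<comment> \<open>Here \<open>2 k\<close> is odd. Moving one element of \<open>S\<close> to the upper end of its fibre changes the parity.\<close>
      define T where "T = insert (s0 + a) (S - {s0})"
      have pT: "p ` T = R"
      proof -
        have "p ` T = p ` insert s0 (S - {s0})" unfolding T_def image_insert p_shift ..
        also have "insert s0 (S - {s0}) = S" using s0 by auto
        finally show ?thesis using S(2) by simp
      qed
      have nin: "s0 + a \<notin> S - {s0}"
      proof
        assume h: "s0 + a \<in> S - {s0}"
        have "p (s0 + a) = p s0" by (rule p_shift)
        hence "s0 + a = s0" using S(3) h s0 unfolding inj_on_def by blast
        thus False using h by simp
      qed
      have cT: "card T = card S" unfolding T_def using nin fS card.remove[OF fS s0] by (simp add: card_insert_disjoint)
      have "card (p ` T) = card T" using pT cT card_image[OF S(3)] S(2) by simp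
      hence injT: "inj_on p T" using fS by (intro eq_card_imp_inj_on) (auto simp: T_def)
      have "independent ({a} \<union> T)" "{a} \<inter> T = {}" using indep_lift[OF lin, of "{a}" T] pa ia R(2) pT injT by auto
      hence iT: "independent T" by (rule indep_drop(1))
      have TA: "T \<subseteq> A" using SA S'A s0 unfolding T_def by auto
      have "\<Sum>T = \<Sum>S + a" unfolding T_def using nin fS s0 by (simp add: sum.remove[OF fS s0, of id, simplified] algebra_simps)
      also have "\<dots> = 2 *\<^sub>R (x - of_int j *\<^sub>R a)"
      proof -
        have "\<Sum>S = 2 *\<^sub>R x - (2 * of_int j + 1) *\<^sub>R a" using x2 n j by (simp add: algebra_simps)
        thus ?thesis by (simp add: scaleR_diff_right scaleR_add_left)
      qed
      finally have "\<Sum>T = 2 *\<^sub>R (x - of_int j *\<^sub>R a)" .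
      moreover have "x - of_int j *\<^sub>R a \<in> L" using x(1) A_L aL by (intro L_diff L_int) auto
      ultimately have "even_indep T" using even_indepI[OF TA iT] T_def by blast
      from large[OF this] show False using c2 cT by simp
    qed
  next
    case two
    have v1: "vol Y = 1" "vol Y' = 1" using coefS[OF two(1)] two(2) v by auto
    have D3: "D \<le> 3" using bound v1 by simp
    have "k \<in> \<int>" using two(3) by (intro kL) force
    then obtain n :: int where n: "k = of_int n" by (auto elim: Ints_cases)
    define S1 where "S1 = {s \<in> S. d s = 1}"
    have S1: "S1 \<subseteq> S" "finite S1" unfolding S1_def using fS by auto
    have card1: "card S1 \<le> 1"
    proof -
      obtain h where h: "h \<in> S" "d h = 2" using two by blast
      have "real (card S1) = (\<Sum>s\<in>S1. d s)" unfolding S1_def by simp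
      also have "\<dots> \<le> (\<Sum>s\<in>S - {h}. d s)" using h fS dpos unfolding S1_def by (intro sum_mono2) (auto intro: less_imp_le)
      also have "\<dots> = D - 2" unfolding D_def using sum.remove[OF fS h(1), of d] h(2) by simp
      finally show ?thesis using D3 by simp
    qed
    \<comment> \<open>The parity of \<open>k\<close> decides which end of the fibre over \<open>y\<close> completes \<open>S1\<close> to an even set.\<close>
    define z where "z = (if even n then x else x + a)"
    have zA: "z \<in> A" "p z = y" using x p_shift unfolding z_def by auto
    have "\<exists>l\<in>L. z + \<Sum>S1 = 2 *\<^sub>R l"
    proof -
      have "(\<Sum>s\<in>S. d s *\<^sub>R s) + \<Sum>S1 = 2 *\<^sub>R \<Sum>S"
      proof -
        have "\<Sum>S1 = (\<Sum>s\<in>S. (if d s = 1 then 1 else 0) *\<^sub>R s)" unfolding S1_def using fS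
          by (simp add: sum.inter_filter[symmetric] if_distrib[of "\<lambda>c. c *\<^sub>R _"] cong: if_cong)
        hence "(\<Sum>s\<in>S. d s *\<^sub>R s) + \<Sum>S1 = (\<Sum>s\<in>S. (d s + (if d s = 1 then 1 else 0)) *\<^sub>R s)" by (simp add: sum.distrib scaleR_add_left)
        also have "\<dots> = (\<Sum>s\<in>S. 2 *\<^sub>R s)" using two(3) by (intro sum.cong) auto
        finally show ?thesis by (simp add: scaleR_sum_right)
      qed
      hence e: "x + \<Sum>S1 = 2 *\<^sub>R \<Sum>S + of_int n *\<^sub>R a" using xe n by (simp add: algebra_simps)
      have SL: "\<Sum>S \<in> L" using fS SA A_L by (intro L_sum) auto
      show ?thesis
      proof (cases "even n")
        case True
        then obtain j where "n = 2 * j" by blast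
        hence "z + \<Sum>S1 = 2 *\<^sub>R (\<Sum>S + of_int j *\<^sub>R a)" using e True by (simp add: z_def scaleR_add_right)
        moreover have "\<Sum>S + of_int j *\<^sub>R a \<in> L" using SL aL by (intro L_add L_int) auto
        ultimately show ?thesis by blast
      next
        case False
        then obtain j where "n = 2 * j + 1" by (elim oddE)
        hence "z + \<Sum>S1 = 2 *\<^sub>R (\<Sum>S + of_int (j + 1) *\<^sub>R a)" using e False
          by (simp add: z_def scaleR_add_right algebra_simps scaleR_2)
        moreover have "\<Sum>S + of_int (j + 1) *\<^sub>R a \<in> L" using SL aL by (intro L_add L_int) auto
        ultimately show ?thesis by blast
      qed
    qed
    then obtain l where l: "l \<in> L" "z + \<Sum>S1 = 2 *\<^sub>R l" by blast
    have zS1: "z \<notin> span S1"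
    proof
      assume "z \<in> span S1"
      hence "y \<in> p ` span S1" using zA by auto
      hence ys: "y \<in> span (p ` S1)" using linear_span_image[OF lin] by simp
      obtain h where h: "h \<in> S" "d h = 2" using two by blast
      have hS1: "h \<notin> S1" using h unfolding S1_def by auto
      have sub: "p ` S1 \<subseteq> R - {p h}" using S1(1) S(2,3) h hS1 by (auto simp: inj_on_def)
      have "y - 2 *\<^sub>R p h \<in> span (R - {p h})"
      proof -
        have "y = (\<Sum>s\<in>S. d s *\<^sub>R p s)" by fact
        hence "y - 2 *\<^sub>R p h = (\<Sum>s\<in>S - {h}. d s *\<^sub>R p s)" using sum.remove[OF fS h(1), of "\<lambda>s. d s *\<^sub>R p s"] h(2) by simp
        moreover have "p s \<in> R - {p h}" if "s \<in> S - {h}" for s using that S(2,3) h by (auto simp: inj_on_def)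
        moreover have "(\<Sum>s\<in>S - {h}. d s *\<^sub>R p s) \<in> span (R - {p h})"
          using calculation(2) by (intro span_sum span_scale span_base)
        ultimately show ?thesis by simp
      qed
      moreover have "y - 0 *\<^sub>R p h \<in> span (R - {p h})" using ys span_mono[OF sub] by auto
      ultimately have "2 = (0::real)" using coeff_unique[OF R(2), of "p h" y 2 0] h S(2) by auto
      thus False by simp
    qed
    have iS1: "independent S1" using indep_drop(1)[OF S(4,5)] S1(1) independent_mono by blast
    have zn: "z \<notin> S1" using zS1 span_base[of z S1] by metis
    have "even_indep (insert z S1)"
      using l zn S1 SA zA by (intro even_indepI[of _ l] independent_insertI[OF zS1 iS1]) auto
    from large[OF this] show False using card1 zn S1(2) by simp
  next
    case all1
    have xs: "x = \<Sum>S + k *\<^sub>R a" using xe all1 by simp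
    have D: "D = real (card S)" unfolding D_def using all1 by simp
    have "k \<in> \<int>" using all1 by (intro kL) auto
    then obtain n :: int where n: "k = of_int n" by (auto elim: Ints_cases)
    \<comment> \<open>Hence \<open>D \<le> 3\<close>, so \<open>S\<close> together with a lift of \<open>y\<close> has at most four elements.\<close>
    have k1: "k \<le> 1" "k - D \<ge> -2"
    proof -
      show "k \<le> 1"
      proof (rule ccontr)
        assume "\<not> k \<le> 1"
        thus False using bound(1) v(1) by auto
      qed
      show "k - D \<ge> -2"
      proof (rule ccontr)
        assume h: "\<not> k - D \<ge> -2"
        thus False using bound(2) v(2) by auto
      qed
    qed
    have "card S \<noteq> 1"
    proof
      assume "card S = 1"
      then obtain s where s: "S = {s}" by (auto simp: card_1_singleton_iff)
      hence "y = p s" using xs x(3) p_shift(1) by simp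
      thus False using ny S(2) s by auto
    qed
    hence c23: "(card S = 2 \<and> n = 0) \<or> (card S \<le> 3 \<and> n = 1)" using k1 D n cS by linarith
    thus False
    proof
      assume h: "card S \<le> 3 \<and> n = 1"
      have z: "x + a = \<Sum>S + 2 *\<^sub>R a" using xs h n by (simp add: scaleR_2)
      note I = indep_insert_shift[OF S(4,5) fS z]
      have "\<Sum>(insert (x + a) S) = 2 *\<^sub>R (\<Sum>S + a)" using I(2) fS z by (simp add: scaleR_2 algebra_simps)
      moreover have "\<Sum>S + a \<in> L" using fS SA A_L aL by (intro L_add L_sum) auto
      ultimately have "even_indep (insert (x + a) S)" using I(1) SA x(2) by (intro even_indepI[of _ "\<Sum>S + a"]) auto
      from large[OF this] show False using h I(2) fS by simp
    next
      assume h: "card S = 2 \<and> n = 0"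
      have "\<Sum>S' = \<Sum>S + 2 *\<^sub>R a" unfolding S'_def using sum.reindex[OF injs, of id] h
        by (simp add: sum.distrib sum_constant_scaleR)
      hence z: "x = \<Sum>S' + (-2) *\<^sub>R a" using xs h n by simp
      note I = indep_insert_shift[OF S'i fS' z]
      have "\<Sum>(insert x S') = x + \<Sum>S'" using I(2) fS' by simp
      also have "\<dots> = 2 *\<^sub>R (\<Sum>S' - a)" unfolding z by (simp add: scaleR_2 algebra_simps)
      finally have "\<Sum>(insert x S') = 2 *\<^sub>R (\<Sum>S' - a)" .
      moreover have "\<Sum>S' - a \<in> L" using fS' S'A' A_L aL by (intro L_diff L_sum) auto
      ultimately have "even_indep (insert x S')" using I(1) S'A' x(1) by (intro even_indepI[of _ "\<Sum>S' - a"]) auto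
      from large[OF this] show False using h I(2) fS' card_image[OF injs] S'_def by simp
    qed
  qed
qed

text \<open>With the signs of the coefficients absorbed, \<open>no_circuit_pos\<close> shows that a basis of \<open>N\<close> exhausts it up to sign.\<close>

lemma card_N: "card N \<le> 2 * dim (p ` A - {0})"
proof -
  obtain T where T: "T \<subseteq> N" "independent T" "N \<subseteq> span T" "card T = dim N" using basis_exists[of N] by metis
  have fT: "finite T" using finite_subset[OF T(1) finite_subset[OF N_sub]] fin by auto
  have sub: "N \<subseteq> T \<union> uminus ` T"
  proof
    fix y assume y: "y \<in> N"
    have "y \<in> span T" using y T(3) by auto
    then obtain c where c: "y = (\<Sum>t\<in>T. c t *\<^sub>R t)" using span_finite_coeff[OF fT] by metis
    define R where "R = {t \<in> T. c t \<noteq> 0}"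
    define s where "s t = (if c t > 0 then 1 else -1 :: real)" for t
    have R: "R \<subseteq> T" "finite R" unfolding R_def using fT by auto
    have sv: "s t = 1 \<or> s t = -1" for t unfolding s_def by auto
    note I = indep_signs[OF T(2) R, of s, OF sv]
    let ?R = "(\<lambda>t. s t *\<^sub>R t) ` R"
    have RN: "?R \<subseteq> N"
    proof
      fix x assume "x \<in> ?R"
      then obtain t where "t \<in> R" "x = s t *\<^sub>R t" by auto
      thus "x \<in> N" using sv[of t] R(1) T(1) N_sym[of t] by auto
    qed
    define g where "g x = \<bar>c (inv_into R (\<lambda>t. s t *\<^sub>R t) x)\<bar>" for x
    have g: "g (s t *\<^sub>R t) = \<bar>c t\<bar>" if "t \<in> R" for t unfolding g_def using inv_into_f_f[OF I(2) that] by simp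
    have "y = (\<Sum>t\<in>R. c t *\<^sub>R t)" unfolding c R_def using fT by (intro sum.mono_neutral_right) auto
    also have "\<dots> = (\<Sum>t\<in>R. g (s t *\<^sub>R t) *\<^sub>R (s t *\<^sub>R t))"
      by (intro sum.cong refl) (simp add: g, simp add: s_def)
    also have "\<dots> = (\<Sum>x\<in>?R. g x *\<^sub>R x)" using sum.reindex[OF I(2), of "\<lambda>x. g x *\<^sub>R x"] by simp
    finally have "y = (\<Sum>x\<in>?R. g x *\<^sub>R x)" .
    moreover have "g x > 0" if "x \<in> ?R" for x using that g by (auto simp: R_def)
    ultimately have "y \<in> ?R" using no_circuit_pos[OF RN I(1) y] by blast
    then obtain t where "t \<in> R" "y = s t *\<^sub>R t" by auto
    thus "y \<in> T \<union> uminus ` T" using sv[of t] R(1) by auto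
  qed
  have "card N \<le> card (T \<union> uminus ` T)" using sub fT by (intro card_mono) auto
  also have "\<dots> \<le> card T + card (uminus ` T)" by (rule card_Un_le)
  also have "\<dots> \<le> 2 * card T" using card_image_le[OF fT, of uminus] by simp
  finally have "card N \<le> 2 * card T" .
  moreover have "card T \<le> dim (p ` A - {0})"
  proof -
    obtain B where B: "B \<subseteq> p ` A - {0}" "independent B" "p ` A - {0} \<subseteq> span B" "card B = dim (p ` A - {0})"
      using basis_exists[of "p ` A - {0}"] by metis
    have "finite B" using finite_subset[OF B(1)] fin by auto
    moreover have "T \<subseteq> span B" using B(3) T(1) N_sub by auto
    ultimately show ?thesis using independent_span_bound[of B T] T(2) B(4) by auto
  qed
  ultimately show ?thesis by linarith
qed

lemma card_A_contract: "card A \<le> 2 + card (p ` A - {0}) + 2 * dim (p ` A - {0})"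
proof -
  let ?U = "p ` A - {0}"
  have "card A \<le> card {a, - a} + card (A - {a, - a})" using finA
    by (metis card_Un_le card_mono Un_Diff_cancel Un_upper2 finite.emptyI finite_Diff finite_UnI finite_insert le_trans)
  also have "card {a, - a} \<le> 2" by (simp add: card_insert_if)
  also have "card (A - {a, - a}) = (\<Sum>v\<in>p ` (A - {a, - a}). card {x \<in> A - {a, - a}. p x = v})"
    using finA by (intro card_fibres) auto
  also have "p ` (A - {a, - a}) = ?U"
  proof -
    have "p (- a) = 0" using linear_neg[OF lin, of a] pa by simp
    thus ?thesis using kernel_A pa by force
  qed
  also have "(\<Sum>v\<in>?U. card {x \<in> A - {a, - a}. p x = v}) \<le> (\<Sum>v\<in>?U. 1 + (if v \<in> N then 1 else 0))"
  proof (rule sum_mono)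
    fix v assume v: "v \<in> ?U"
    have le: "card {x \<in> A - {a, - a}. p x = v} \<le> card {x \<in> A. p x = v}" using finA by (intro card_mono) auto
    obtain x where x: "x \<in> A" "p x = v" "p x \<noteq> 0" using v by auto
    show "card {x \<in> A - {a, - a}. p x = v} \<le> 1 + (if v \<in> N then 1 else 0)"
    proof (cases "v \<in> N")
      case True
      then obtain z where z: "z \<in> A" "z + a \<in> A" "v = p z" "p z \<noteq> 0" unfolding N_def by auto
      have "{x \<in> A. p x = v} \<subseteq> {z, z + a}"
      proof
        fix y assume y: "y \<in> {x \<in> A. p x = v}"
        hence "y = z \<or> y = z + a \<or> y = z - a" using fibre_A[of z y] z by auto
        thus "y \<in> {z, z + a}" using fibre_A2[of z] z y by auto
      qed
      hence "card {x \<in> A. p x = v} \<le> card {z, z + a}" by (intro card_mono) auto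
      also have "\<dots> \<le> 2" by (simp add: card_insert_if)
      finally show ?thesis using le True by simp
    next
      case False
      have "{x \<in> A. p x = v} \<subseteq> {x}"
      proof
        fix y assume y: "y \<in> {x \<in> A. p x = v}"
        hence d: "y = x \<or> y = x + a \<or> y = x - a" using fibre_A[of x y] x by auto
        have "y \<noteq> x + a"
        proof
          assume "y = x + a"
          hence "p x \<in> N" using x y unfolding N_def by blast
          thus False using False x by simp
        qed
        moreover have "y \<noteq> x - a"
        proof
          assume h: "y = x - a"
          hence "p y \<in> N" using x y unfolding N_def by (auto intro!: exI[of _ y])
          thus False using False y by simp
        qed
        ultimately show "y \<in> {x}" using d by blast
      qed
      hence "card {x \<in> A. p x = v} \<le> card {x}" by (intro card_mono) auto
      thus ?thesis using le False by simp
    qed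
  qed
  also have "(\<Sum>v\<in>?U. 1 + (if v \<in> N then 1 else 0)) = card ?U + card N"
  proof -
    have "?U \<inter> N = N" using N_sub by auto
    moreover have "(\<Sum>v\<in>?U. if v \<in> N then 1 else (0::nat)) = card (?U \<inter> N)" using finA by (intro card_indicator) auto
    ultimately show ?thesis unfolding sum.distrib by simp
  qed
  finally show ?thesis using card_N by simp
qed

text \<open>Representatives are taken in \<open>A\<close> whenever possible, so that a basis consisting of images of elements of \<open>A\<close> lifts to a basis inside \<open>A\<close>.\<close>

definition sec :: "'a \<Rightarrow> 'a" where
  "sec v = (if v \<in> p ` A then inv_into A p v else inv_into L p v)"

lemma sec: assumes "v \<in> p ` L" shows "p (sec v) = v" "sec v \<in> L" "v \<in> p ` A \<Longrightarrow> sec v \<in> A"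
proof -
  show "p (sec v) = v" using assms unfolding sec_def by (auto simp: f_inv_into_f)
  show "sec v \<in> L" using assms A_L inv_into_into[of v p A] inv_into_into[of v p L] unfolding sec_def by auto
  show "v \<in> p ` A \<Longrightarrow> sec v \<in> A" using inv_into_into[of v p A] unfolding sec_def by auto
qed

definition cvol :: "'a set \<Rightarrow> nat" where
  "cvol Y = vol (insert a (sec ` Y))"

lemma bas_sec:
  assumes Y: "lattice_basis (p ` L) Y"
  shows "bas (insert a (sec ` Y))" "inj_on sec Y" "a \<notin> sec ` Y" "\<And>T. T \<subseteq> Y \<Longrightarrow> p ` sec ` T = T"
proof -
  have YL: "Y \<subseteq> p ` L" and iY: "independent Y" and sp: "p ` L \<subseteq> span Y" using Y unfolding lattice_basis_def by auto
  show inj: "inj_on sec Y"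
  proof (rule inj_onI)
    fix x y assume h: "x \<in> Y" "y \<in> Y" "sec x = sec y"
    have "p (sec x) = x" "p (sec y) = y" by (rule sec(1)[OF subsetD[OF YL h(1)]], rule sec(1)[OF subsetD[OF YL h(2)]])
    thus "x = y" unfolding h(3) by simp
  qed
  show pT: "p ` sec ` T = T" if "T \<subseteq> Y" for T
  proof -
    have "p ` sec ` T = (\<lambda>v. v) ` T" unfolding image_image using that YL by (intro image_cong refl sec(1)) auto
    thus ?thesis by simp
  qed
  have injp: "inj_on p (sec ` Y)"
  proof (rule inj_onI)
    fix x y assume "x \<in> sec ` Y" "y \<in> sec ` Y" and e: "p x = p y"
    then obtain u v where uv: "u \<in> Y" "v \<in> Y" "x = sec u" "y = sec v" by auto
    have "p (sec u) = u" "p (sec v) = v" by (rule sec(1)[OF subsetD[OF YL uv(1)]], rule sec(1)[OF subsetD[OF YL uv(2)]])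
    with e uv(3,4) have "u = v" by metis
    with uv(3,4) show "x = y" by metis
  qed
  have I: "independent ({a} \<union> sec ` Y)" "{a} \<inter> sec ` Y = {}"
    using indep_lift[OF lin, of "{a}" "sec ` Y"] pa ia iY pT[OF subset_refl] injp by auto
  show "a \<notin> sec ` Y" using I(2) by auto
  have "L \<subseteq> span ({a} \<union> sec ` Y)"
  proof
    fix x assume "x \<in> L"
    hence "p x \<in> span (p ` sec ` Y)" using sp unfolding pT[OF subset_refl] by auto
    thus "x \<in> span ({a} \<union> sec ` Y)" using ker by (intro span_lift[OF lin]) auto
  qed
  moreover have "sec ` Y \<subseteq> L" using sec(2) YL by auto
  ultimately show "bas (insert a (sec ` Y))" using I(1) aL unfolding lattice_basis_def by auto
qed

text \<open>Primitivity survives: if \<open>p x = 2 p l\<close> then \<open>x - 2 l\<close> is an integral multiple of \<open>a\<close>, and \<open>x\<close> or \<open>x + a\<close> is twice a lattice vector. The former contradicts primitivity and the latter makes \<open>{x, a}\<close> even.\<close>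

lemma contract_bimodular: "bimodular (p ` L) cvol (p ` A - {0})"
proof
  show "0 \<in> p ` L" using L_zero linear_0[OF lin] by force
  show "x + y \<in> p ` L" if "x \<in> p ` L" "y \<in> p ` L" for x y
    using that L_add linear_add[OF lin] by (metis (no_types, lifting) image_iff)
  show "- x \<in> p ` L" if "x \<in> p ` L" for x
    using that L_neg linear_neg[OF lin] by (metis (no_types, lifting) image_iff)
  show "p ` A - {0} \<subseteq> p ` L" using A_L by auto
  show "finite (p ` A - {0})" using finA by simp
  show "- v \<in> p ` A - {0}" if v: "v \<in> p ` A - {0}" for v
  proof -
    obtain x where "x \<in> A" "v = p x" "v \<noteq> 0" using v by auto
    thus ?thesis using symA[of x] linear_neg[OF lin, of x] by (auto intro!: image_eqI[of _ _ "- x"])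
  qed
  show "0 \<notin> p ` A - {0}" by simp
  show "p ` L \<subseteq> span (p ` A - {0})"
  proof
    fix v assume "v \<in> p ` L"
    then obtain x where x: "x \<in> L" "v = p x" by auto
    hence "v \<in> span (p ` A)" using L_span linear_span_image[OF lin, of A] by auto
    also have "span (p ` A) \<subseteq> span (insert 0 (p ` A - {0}))" by (intro span_mono) auto
    finally show "v \<in> span (p ` A - {0})" by (simp only: span_insert_0)
  qed
  show "cvol Y > 0" if "lattice_basis (p ` L) Y" for Y
    unfolding cvol_def using vol_pos[OF bas_sec(1)[OF that]] .
  show "real (cvol (insert x' (Y - {y}))) = \<bar>c\<bar> * real (cvol Y)"
    if h: "lattice_basis (p ` L) Y" "y \<in> Y" "x' \<in> p ` L" "x' - c *\<^sub>R y \<in> span (Y - {y})" "c \<noteq> 0" for Y y x' c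
  proof -
    note B = bas_sec[OF h(1)]
    have yL: "y \<in> p ` L" using h(1,2) unfolding lattice_basis_def by auto
    let ?Y = "insert a (sec ` Y)"
    have "p (sec x' - c *\<^sub>R sec y) \<in> span (p ` sec ` (Y - {y}))"
    proof -
      have "p ` sec ` (Y - {y}) = Y - {y}" by (rule B(4)) blast
      moreover have "p (sec x' - c *\<^sub>R sec y) = x' - c *\<^sub>R y" using sec(1)[OF h(3)] sec(1)[OF yL] lin by (simp add: linear_diff linear_scale)
      ultimately show ?thesis using h(4) by metis
    qed
    hence "sec x' - c *\<^sub>R sec y \<in> span ({a} \<union> sec ` (Y - {y}))" using ker by (intro span_lift[OF lin]) auto
    moreover have e: "{a} \<union> sec ` (Y - {y}) = ?Y - {sec y}" using B(2,3) h(2) by (auto simp: inj_on_def)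
    ultimately have "sec x' - c *\<^sub>R sec y \<in> span (?Y - {sec y})" by simp
    hence "real (vol (insert (sec x') (?Y - {sec y}))) = \<bar>c\<bar> * real (vol ?Y)"
      using exch[OF B(1) _ sec(2)[OF h(3)] _ h(5)] h(2) by auto
    moreover have "insert (sec x') (?Y - {sec y}) = insert a (sec ` (insert x' (Y - {y})))" unfolding e[symmetric] by auto
    ultimately show ?thesis unfolding cvol_def by simp
  qed
  show "cvol Y \<le> 2" if h: "Y \<subseteq> p ` A - {0}" "lattice_basis (p ` L) Y" for Y
  proof -
    have "sec ` Y \<subseteq> A"
    proof (rule image_subsetI)
      fix v assume "v \<in> Y"
      hence "v \<in> p ` A" "v \<in> p ` L" using h(1) A_L by auto
      thus "sec v \<in> A" using sec(3) by blast
    qed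
    thus ?thesis unfolding cvol_def using vol2[OF _ bas_sec(1)[OF h(2)]] a by simp
  qed
  show "v \<noteq> 2 *\<^sub>R l" if v: "v \<in> p ` A - {0}" and l: "l \<in> p ` L" for v l
  proof
    assume e: "v = 2 *\<^sub>R l"
    obtain x m where x: "x \<in> A" "v = p x" "v \<noteq> 0" and m: "m \<in> L" "l = p m" using v l by auto
    have "p (2 *\<^sub>R m) = p x" using e x m lin by (simp add: linear_scale)
    moreover have "2 *\<^sub>R m \<in> L" using m by (intro L_int) auto
    ultimately obtain k where k: "k \<in> \<int>" "2 *\<^sub>R m = x + k *\<^sub>R a" using lift_diff[OF x(1)] by metis
    then obtain n :: int where n: "k = of_int n" by (auto elim: Ints_cases)
    show False
    proof (cases "even n")
      case True
      then obtain j where "n = 2 * j" by blast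
      hence "x = 2 *\<^sub>R (m - of_int j *\<^sub>R a)" using k n by (simp add: scaleR_diff_right algebra_simps)
      moreover have "m - of_int j *\<^sub>R a \<in> L" using m aL by (intro L_diff L_int) auto
      ultimately show False using prim[OF x(1)] by blast
    next
      case False
      then obtain j where "n = 2 * j + 1" by (elim oddE)
      hence "a + x = 2 *\<^sub>R (m - of_int j *\<^sub>R a)" using k n by (simp add: scaleR_diff_right scaleR_add_left algebra_simps)
      moreover have "m - of_int j *\<^sub>R a \<in> L" using m aL by (intro L_diff L_int) auto
      moreover have "x \<notin> span {a}" using notin_span_a x by auto
      ultimately show False using no_pair[OF a x(1)] by blast
    qed
  qed
qed

lemma dim_contract: "dim A = Suc (dim (p ` A - {0}))"
  using dim_quot[OF lin ker ia, of A] a finA by (simp add: span_base)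

end

section \<open>Projection along a smallest even set\<close>

text \<open>All members have at most two elements, and members with two elements meet every nonempty member. So these form a star or a triangle, and only the four subsets of a pair exceed the count \<open>card I + 1\<close>.\<close>

lemma family_diameter_two:
  fixes I :: "'b set"
  assumes I: "finite I" and F: "F \<subseteq> Pow I" "{} \<in> F"
    and d: "\<And>X Y. X \<in> F \<Longrightarrow> Y \<in> F \<Longrightarrow> card ((X - Y) \<union> (Y - X)) \<le> 2"
  shows "card F \<le> card I + 1 \<or> (card I = 2 \<and> F = Pow I)"
proof -
  have fF: "finite F" using F(1) I finite_subset by blast
  have fX: "finite X" if "X \<in> F" for X using that F(1) I finite_subset by blast
  have c2: "card X \<le> 2" if "X \<in> F" for X using d[OF that F(2)] by simp
  define F1 where "F1 = {X \<in> F. card X = 1}"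
  define F2 where "F2 = {X \<in> F. card X = 2}"
  have split: "F = {{}} \<union> F1 \<union> F2"
  proof -
    have "X = {} \<or> card X = 1 \<or> card X = 2" if "X \<in> F" for X
      using c2[OF that] fX[OF that] card_0_eq[of X] by linarith
    thus ?thesis using F(2) unfolding F1_def F2_def by auto
  qed
  have F1I: "F1 \<subseteq> (\<lambda>x. {x}) ` I" using F(1) unfolding F1_def by (auto simp: card_1_singleton_iff)
  have cF: "card F \<le> 1 + card F1 + card F2"
    unfolding split using card_Un_le[of "{{}} \<union> F1" F2] card_Un_le[of "{{}}" F1] by simp
  have cF1: "card F1 \<le> card I" using card_mono[OF _ F1I] I card_image_le[OF I, of "\<lambda>x. {x}"] by auto
  have inter: "X \<inter> Y \<noteq> {}" if "X \<in> F2" "Y \<in> F1 \<union> F2" for X Y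
  proof
    assume e: "X \<inter> Y = {}"
    have XY: "X \<in> F" "Y \<in> F" "card X = 2" "card Y \<ge> 1" using that unfolding F1_def F2_def by auto
    have "(X - Y) \<union> (Y - X) = X \<union> Y" using e by auto
    moreover have "card (X \<union> Y) = card X + card Y" using e fX XY by (intro card_Un_disjoint) auto
    ultimately show False using d[OF XY(1,2)] XY by simp
  qed
  show ?thesis
  proof (cases "F2 = {}")
    case True
    thus ?thesis using cF cF1 by simp
  next
    case False
    then obtain X where X: "X \<in> F2" by blast
    then obtain a b where ab: "X = {a, b}" "a \<noteq> b" unfolding F2_def by (auto simp: card_2_iff)
    have abI: "a \<in> I" "b \<in> I" using X ab F(1) unfolding F2_def by auto
    have F1ab: "F1 \<subseteq> {{a}, {b}}" using inter[OF X] F1I ab by auto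
    show ?thesis
    proof (cases "F2 = {X}")
      case True
      have Fsub: "F \<subseteq> Pow {a, b}" using split F1ab True ab by auto
      have c4: "card F \<le> 4" using card_mono[OF _ Fsub] card_Pow[of "{a, b}"] ab by simp
      show ?thesis
      proof (cases "card F \<le> card I + 1")
        case False
        have ab2: "{a, b} \<subseteq> I" "card {a, b} = 2" using abI ab by auto
        have "card I \<ge> 2" using card_mono[OF I ab2(1)] ab2(2) by simp
        hence "card I = 2" "card F = 4" using False c4 by auto
        moreover from this have "I = {a, b}" using card_subset_eq[OF I ab2(1)] ab2(2) by simp
        moreover from calculation have "F = Pow I" using Fsub card_subset_eq[of "Pow I" F] card_Pow[of I] I by simp
        ultimately show ?thesis by simp
      qed simp
    next
      case False
      then obtain Y where Y: "Y \<in> F2" "Y \<noteq> X" using X by blast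
      have cY: "card Y = 2" using Y unfolding F2_def by simp
      have "\<exists>x y z. X = {x, y} \<and> Y = {x, z} \<and> x \<noteq> y \<and> x \<noteq> z \<and> y \<noteq> z"
      proof -
        obtain c e where ce: "Y = {c, e}" "c \<noteq> e" using cY by (auto simp: card_2_iff)
        have "X \<inter> Y \<noteq> {}" using inter[OF X] Y by blast
        thus ?thesis using ab ce Y(2) by (auto simp: doubleton_eq_iff)
      qed
      then obtain x y z where xyz: "X = {x, y}" "Y = {x, z}" "x \<noteq> y" "x \<noteq> z" "y \<noteq> z" by blast
      have xI: "x \<in> I" "y \<in> I" "z \<in> I" using X Y xyz F(1) unfolding F2_def by auto
      have F1x: "F1 \<subseteq> {{x}}"
      proof
        fix Z assume Z: "Z \<in> F1"
        then obtain t where "Z = {t}" unfolding F1_def by (auto simp: card_1_singleton_iff)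
        thus "Z \<in> {{x}}" using inter[OF X, of Z] inter[OF Y(1), of Z] Z xyz by auto
      qed
      show ?thesis
      proof (cases "\<forall>Z\<in>F2. x \<in> Z")
        case True
        have "F2 \<subseteq> (\<lambda>t. {x, t}) ` (I - {x})"
        proof
          fix Z assume Z: "Z \<in> F2"
          hence xZ: "x \<in> Z" "card Z = 2" "Z \<subseteq> I" using True F(1) unfolding F2_def by auto
          then obtain t where "Z = {x, t}" "t \<noteq> x" by (metis card_2_iff doubleton_eq_iff insertE singletonD)
          thus "Z \<in> (\<lambda>t. {x, t}) ` (I - {x})" using xZ by auto
        qed
        hence "card F2 \<le> card (I - {x})" using surj_card_le[of "I - {x}" F2] I by auto
        hence "card F2 + 1 \<le> card I" using card.remove[OF I xI(1)] by simp
        moreover have "card F1 \<le> 1" using card_mono[OF _ F1x] by simp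
        ultimately show ?thesis using cF by simp
      next
        case False
        then obtain Z where Z: "Z \<in> F2" "x \<notin> Z" by blast
        have cZ: "card Z = 2" using Z unfolding F2_def by simp
        have "Z = {y, z}"
        proof -
          have "y \<in> Z" "z \<in> Z" using inter[OF X, of Z] inter[OF Y(1), of Z] Z xyz by auto
          moreover obtain c e where "Z = {c, e}" using cZ by (auto simp: card_2_iff)
          ultimately show ?thesis using xyz(5) by auto
        qed
        have F1e: "F1 = {}" using F1x inter[OF Z(1), of "{x}"] Z(2) by auto
        have "F2 \<subseteq> {{x, y}, {x, z}, {y, z}}"
        proof
          fix W assume W: "W \<in> F2"
          then obtain c e where ce: "W = {c, e}" "c \<noteq> e" unfolding F2_def by (auto simp: card_2_iff)
          show "W \<in> {{x, y}, {x, z}, {y, z}}"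
            using inter[OF X, of W] inter[OF Y(1), of W] inter[OF Z(1), of W] W ce xyz \<open>Z = {y, z}\<close> by auto
        qed
        hence "card F2 \<le> card {{x, y}, {x, z}, {y, z}}" by (intro card_mono) auto
        also have "\<dots> \<le> 3" using card_length[of "[{x, y}, {x, z}, {y, z}]"] by simp
        finally have "card F2 \<le> 3" .
        moreover have "card I \<ge> 3"
        proof -
          have "card {x, y, z} = 3" using xyz by auto
          thus ?thesis using card_mono[OF I, of "{x, y, z}"] xI by simp
        qed
        ultimately show ?thesis using cF F1e by simp
      qed
    qed
  qed
qed

lemma add_diff_sub: "X + (B - C) - B = X - (C::'b::ab_group_add)"
  by simp

text \<open>The smallest even independent set \<open>S\<close> is completed to a basis \<open>Y0\<close> with dual coordinates \<open>q\<close>. Modulo \<open>span S\<close>, the set \<open>A\<close> becomes unimodular.\<close>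

locale flat = bimodular +
  fixes S Y0 :: "'a set" and q :: "'a \<Rightarrow> 'a \<Rightarrow> real"
  assumes S: "even_indep S" and smin: "\<And>T. even_indep T \<Longrightarrow> card S \<le> card T"
    and Y0: "S \<subseteq> Y0" "Y0 \<subseteq> A" "bas Y0"
    and qlin: "\<And>i. linear (q i)" and qdual: "\<And>i y. i \<in> Y0 \<Longrightarrow> y \<in> Y0 \<Longrightarrow> q i y = (if y = i then 1 else 0)"
begin

lemma S_sub: "S \<subseteq> A" and S_ind: "independent S" and S_ne: "S \<noteq> {}" and S_fin: "finite S"
  using S finA finite_subset unfolding even_indep_def by blast+

lemma S_half: "\<exists>l\<in>L. \<Sum>S = 2 *\<^sub>R l"
  using S unfolding even_indep_def by blast

lemma Y0_fin: "finite Y0" using bas_fin(1)[OF Y0(3)] .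

lemma qsum: "q i (\<Sum>x\<in>T. f x) = (\<Sum>x\<in>T. q i (f x))"
  using linear_sum[OF qlin] by blast

lemma qsimps: "q i (x + y) = q i x + q i y" "q i (x - y) = q i x - q i y" "q i (- x) = - q i x" "q i (c *\<^sub>R x) = c * q i x" "q i 0 = 0"
  using qlin[of i] by (simp_all add: linear_add linear_diff linear_neg linear_scale linear_0)

definition p :: "'a \<Rightarrow> 'a" where "p v = v - (\<Sum>i\<in>S. q i v *\<^sub>R i)"

lemma plin: "linear p"
  unfolding p_def by (intro linearI) (auto simp: qsimps sum.distrib algebra_simps scaleR_sum_right)

lemma decomp: "v = p v + (\<Sum>i\<in>S. q i v *\<^sub>R i)"
  unfolding p_def by simp

lemma q_comb: assumes "T \<subseteq> Y0" "finite T" "i \<in> Y0" shows "q i (\<Sum>j\<in>T. c j *\<^sub>R j) = (if i \<in> T then c i else 0)"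
proof -
  have "q i (\<Sum>j\<in>T. c j *\<^sub>R j) = (\<Sum>j\<in>T. c j * q i j)" by (simp add: qsum qsimps)
  also have "\<dots> = (\<Sum>j\<in>T. if j = i then c i else 0)" using assms qdual by (intro sum.cong) auto
  also have "\<dots> = (if i \<in> T then c i else 0)" using assms(2) by (simp add: sum.delta)
  finally show ?thesis .
qed

lemma pS: "i \<in> S \<Longrightarrow> p i = 0"
proof -
  assume i: "i \<in> S"
  have "(\<Sum>j\<in>S. q j i *\<^sub>R j) = (\<Sum>j\<in>S. if j = i then i else 0)" using i subsetD[OF Y0(1)] qdual by (intro sum.cong) auto
  thus "p i = 0" unfolding p_def using S_fin i by (simp add: sum.delta)
qed

lemma ker: "p v = 0 \<longleftrightarrow> v \<in> span S"
proof
  assume "p v = 0"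
  hence "v = (\<Sum>i\<in>S. q i v *\<^sub>R i)" using decomp[of v] by simp
  moreover have "(\<Sum>i\<in>S. q i v *\<^sub>R i) \<in> span S" by (intro span_sum span_scale span_base)
  ultimately show "v \<in> span S" by metis
next
  assume "v \<in> span S"
  hence "p v \<in> span (p ` S)" using linear_span_image[OF plin, of S] by blast
  moreover have "p ` S \<subseteq> {0}" using pS by auto
  ultimately show "p v = 0" using span_mono[of "p ` S" "{0}"] by auto
qed

lemma kerD: "p v = 0 \<Longrightarrow> v = (\<Sum>i\<in>S. q i v *\<^sub>R i)"
  using decomp[of v] by simp

lemma same_fibre: "p a = p b \<Longrightarrow> a - b = (\<Sum>i\<in>S. (q i a - q i b) *\<^sub>R i)"
proof -
  assume "p a = p b"
  hence "p (a - b) = 0" using plin by (simp add: linear_diff)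
  from kerD[OF this] show ?thesis by (simp add: qsimps)
qed

text \<open>Replacing an element of \<open>S\<close> by half the sum of \<open>S\<close> halves the volume. So the volume is 2 and becomes 1.\<close>

lemma vol_S: assumes Y: "Y \<subseteq> A" "bas Y" "S \<subseteq> Y"
  shows "vol Y = 2"
    and "\<And>s0 l. s0 \<in> S \<Longrightarrow> l \<in> L \<Longrightarrow> \<Sum>S = 2 *\<^sub>R l \<Longrightarrow> bas (insert l (Y - {s0})) \<and> vol (insert l (Y - {s0})) = 1 \<and> l \<notin> Y - {s0}"
proof -
  have *: "bas (insert l (Y - {s0})) \<and> real (vol (insert l (Y - {s0}))) = real (vol Y) / 2 \<and> l \<notin> Y - {s0}" 
    if h: "s0 \<in> S" "l \<in> L" "\<Sum>S = 2 *\<^sub>R l" for s0 l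
  proof -
    have "l - (1/2) *\<^sub>R s0 = (1/2) *\<^sub>R (\<Sum>(S - {s0}))" 
    proof -
      have "l = (1/2) *\<^sub>R \<Sum>S" using h(3) by simp
      also have "\<Sum>S = s0 + \<Sum>(S - {s0})" using sum.remove[OF S_fin h(1), of id] by simp
      finally show ?thesis by (simp add: scaleR_add_right)
    qed
    moreover have "(1/2) *\<^sub>R (\<Sum>(S - {s0})) \<in> span (Y - {s0})" using Y(3) by (intro span_scale span_sum span_base) auto
    ultimately have m: "l - (1/2) *\<^sub>R s0 \<in> span (Y - {s0})" by simp
    have s0Y: "s0 \<in> Y" using h Y by auto
    have i: "independent Y" using Y(2) unfolding lattice_basis_def by auto
    show ?thesis using bas_exch[OF Y(2) s0Y h(2) m] exch[OF Y(2) s0Y h(2) m] span_exchange_coeff(3)[OF i s0Y m] by simp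
  qed
  obtain s0 l where h: "s0 \<in> S" "l \<in> L" "\<Sum>S = 2 *\<^sub>R l" using S_half S_ne by blast
  have "vol (insert l (Y - {s0})) > 0" using vol_pos[OF conjunct1[OF *[OF h]]] .
  hence "real (vol Y) / 2 \<ge> 1" using *[OF h] by linarith
  thus v: "vol Y = 2" using vol2[OF Y(1,2)] by simp
  show "bas (insert l (Y - {s0})) \<and> vol (insert l (Y - {s0})) = 1 \<and> l \<notin> Y - {s0}" if h: "s0 \<in> S" "l \<in> L" "\<Sum>S = 2 *\<^sub>R l" for s0 l
    using *[OF h] v by simp
qed

lemma coeff_int_vol1:
  assumes "bas Y" "vol Y = 1" "y \<in> Y" "x \<in> L" "x - c *\<^sub>R y \<in> span (Y - {y})"
  shows "c \<in> \<int>"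
proof (cases "c = 0")
  case False
  have "real (vol (insert x (Y - {y}))) = \<bar>c\<bar>" using exch[OF assms(1,3,4,5) False] assms(2) by simp
  hence "\<bar>c\<bar> \<in> \<int>" by (metis Ints_of_nat)
  thus ?thesis by (auto simp: abs_if split: if_splits)
qed simp

text \<open>The exchanged basis of volume 1 generates the lattice, and the exchange does not affect coordinates outside \<open>S\<close>.\<close>

lemma coeff_off_S:
  assumes Y: "Y \<subseteq> A" "bas Y" "S \<subseteq> Y" and y: "y \<in> Y - S" and x: "x \<in> L" "x - c *\<^sub>R y \<in> span (Y - {y})"
  shows "c \<in> \<int>"
proof -
  obtain s0 l where h: "s0 \<in> S" "l \<in> L" "\<Sum>S = 2 *\<^sub>R l" using S_half S_ne by blast
  let ?Y = "insert l (Y - {s0})"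
  note V = vol_S(2)[OF Y h]
  have yl: "y \<noteq> s0" "y \<noteq> l" using y h V by auto
  have "Y - {y} \<subseteq> span (?Y - {y})"
  proof
    fix z assume z: "z \<in> Y - {y}"
    show "z \<in> span (?Y - {y})"
    proof (cases "z = s0")
      case True
      have "s0 = 2 *\<^sub>R l - \<Sum>(S - {s0})" using h(3) sum.remove[OF S_fin h(1), of id] by simp
      moreover have "2 *\<^sub>R l - \<Sum>(S - {s0}) \<in> span (?Y - {y})"
      proof (rule span_diff)
        show "2 *\<^sub>R l \<in> span (?Y - {y})" using yl by (intro span_scale span_base) auto
        show "\<Sum>(S - {s0}) \<in> span (?Y - {y})" using y Y(3) by (intro span_sum span_base) auto
      qed
      ultimately show ?thesis using True by simp
    qed (use z in \<open>auto intro: span_base\<close>)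
  qed
  hence "x - c *\<^sub>R y \<in> span (?Y - {y})" using x(2) span_minimal[OF _ subspace_span] by blast
  thus ?thesis using coeff_int_vol1[of ?Y y x c] V x(1) y yl by auto
qed

lemma Y0_expand: assumes "x \<in> L" shows "x = (\<Sum>y\<in>Y0. q y x *\<^sub>R y)"
proof -
  obtain c where c: "x = (\<Sum>y\<in>Y0. c y *\<^sub>R y)" using coeff_ex[OF Y0(3) assms] by blast
  have "q y x = c y" if "y \<in> Y0" for y unfolding c using q_comb[OF subset_refl Y0_fin that] that by simp
  thus ?thesis using c by simp
qed

text \<open>Expand in the basis of volume 1 that contains half the sum of \<open>S\<close> in place of \<open>j\<close>.\<close>

lemma q_int: assumes x: "x \<in> L" and i: "i \<in> S" and j: "j \<in> S"
  shows "2 * q j x \<in> \<int>" "q i x - q j x \<in> \<int>"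
proof -
  obtain l where h: "l \<in> L" "\<Sum>S = 2 *\<^sub>R l" using S_half by blast
  let ?Y = "insert l (Y0 - {j})"
  note V = vol_S(2)[OF Y0(2,3,1) j h]
  have jY: "j \<in> Y0" "i \<in> Y0" using Y0 i j by auto
  have j2: "j = 2 *\<^sub>R l - \<Sum>(S - {j})" using h(2) sum.remove[OF S_fin j, of id] by simp
  have x1: "x = (\<Sum>y\<in>Y0 - {j}. q y x *\<^sub>R y) + q j x *\<^sub>R j" using Y0_expand[OF x] sum.remove[OF Y0_fin jY(1), of "\<lambda>y. q y x *\<^sub>R y"] add.commute by metis
  have eq: "?Y - {l} = Y0 - {j}" using V by auto
  have x2: "x - (2 * q j x) *\<^sub>R l = (\<Sum>y\<in>Y0 - {j}. q y x *\<^sub>R y) - q j x *\<^sub>R \<Sum>(S - {j})"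
  proof -
    have "q j x *\<^sub>R j = q j x *\<^sub>R (2 *\<^sub>R l - \<Sum>(S - {j}))" using j2 by simp
    also have "\<dots> = (2 * q j x) *\<^sub>R l - q j x *\<^sub>R \<Sum>(S - {j})" by (simp add: scaleR_diff_right mult.commute)
    finally have e: "q j x *\<^sub>R j = (2 * q j x) *\<^sub>R l - q j x *\<^sub>R \<Sum>(S - {j})" .
    have "x - (2 * q j x) *\<^sub>R l = ((\<Sum>y\<in>Y0 - {j}. q y x *\<^sub>R y) + q j x *\<^sub>R j) - (2 * q j x) *\<^sub>R l"
      using arg_cong[OF x1, of "\<lambda>v. v - (2 * q j x) *\<^sub>R l"] .
    thus ?thesis unfolding e add_diff_sub .
  qed
  have "x - (2 * q j x) *\<^sub>R l \<in> span (?Y - {l})" unfolding x2 eq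
    using Y0(1) by (intro span_diff span_sum span_scale) (auto intro!: span_base)
  thus "2 * q j x \<in> \<int>" using coeff_int_vol1[of ?Y l x] V x by blast
  show "q i x - q j x \<in> \<int>"
  proof (cases "i = j")
    case False
    have "x - (q i x - q j x) *\<^sub>R i = (\<Sum>y\<in>Y0 - {j} - {i}. q y x *\<^sub>R y) + q j x *\<^sub>R (2 *\<^sub>R l - \<Sum>(S - {j} - {i}))"
    proof -
      have "(\<Sum>y\<in>Y0 - {j}. q y x *\<^sub>R y) = q i x *\<^sub>R i + (\<Sum>y\<in>Y0 - {j} - {i}. q y x *\<^sub>R y)"
        using sum.remove[of "Y0 - {j}" i "\<lambda>y. q y x *\<^sub>R y"] Y0_fin jY False by simp
      moreover have "\<Sum>(S - {j}) = i + \<Sum>(S - {j} - {i})" using sum.remove[of "S - {j}" i id] S_fin i False by simp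
      ultimately show ?thesis using x2 by (simp add: algebra_simps)
    qed
    moreover have "\<dots> \<in> span (?Y - {i})"
    proof -
      have li: "l \<noteq> i" using V jY False by auto
      show ?thesis using Y0(1) li
        by (intro span_add span_diff span_sum span_scale) (auto intro!: span_base)
    qed
    ultimately have "x - (q i x - q j x) *\<^sub>R i \<in> span (?Y - {i})" by metis
    thus ?thesis using coeff_int_vol1[of ?Y i x] V x jY False by blast
  qed simp
qed

text \<open>By \<open>q_int\<close> the coordinates on \<open>S\<close> of a lattice vector are all integers or all half-integers.\<close>

definition int_coords :: "'a \<Rightarrow> bool" where "int_coords x \<longleftrightarrow> (\<forall>i\<in>S. q i x \<in> \<int>)"

lemma int_coords_iff: assumes "x \<in> L" "i \<in> S" shows "int_coords x \<longleftrightarrow> q i x \<in> \<int>"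
proof -
  have "q j x \<in> \<int>" if "q i x \<in> \<int>" "j \<in> S" for j
    using q_int(2)[OF assms(1) that(2) assms(2)] that(1) by (metis Ints_add diff_add_cancel)
  thus ?thesis unfolding int_coords_def using assms(2) by blast
qed

lemma q_half: assumes "x \<in> L" "i \<in> S" shows "\<not> int_coords x \<longleftrightarrow> q i x - 1/2 \<in> \<int>"
proof -
  obtain n :: int where n: "2 * q i x = of_int n" using q_int(1)[OF assms assms(2)] by (auto elim: Ints_cases)
  show ?thesis
  proof (cases "even n")
    case True
    then obtain k where "n = 2 * k" by blast
    hence k: "q i x = of_int k" using n by simp
    have "q i x - 1/2 \<notin> \<int>"
    proof
      assume "q i x - 1/2 \<in> \<int>"
      hence "q i x - (q i x - 1/2) \<in> \<int>" using k by (intro Ints_diff) auto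
      thus False using half_not_int by simp
    qed
    thus ?thesis using int_coords_iff[OF assms] k by simp
  next
    case False
    then obtain k where "n = 2 * k + 1" by (elim oddE)
    hence k: "q i x = of_int k + 1/2" using n by simp
    have "q i x \<notin> \<int>"
    proof
      assume "q i x \<in> \<int>"
      hence "q i x - of_int k \<in> \<int>" by (intro Ints_diff) auto
      thus False using half_not_int k by simp
    qed
    thus ?thesis using int_coords_iff[OF assms] k by simp
  qed
qed

lemma int_coords_diff: assumes "x \<in> L" "y \<in> L" "i \<in> S" shows "int_coords x = int_coords y \<longleftrightarrow> q i x - q i y \<in> \<int>"
proof
  assume "int_coords x = int_coords y"
  thus "q i x - q i y \<in> \<int>"
  proof (cases "int_coords x")
    case True
    thus ?thesis using \<open>int_coords x = int_coords y\<close> int_coords_iff assms by (metis Ints_diff)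
  next
    case False
    hence "(q i x - 1/2) - (q i y - 1/2) \<in> \<int>" using \<open>int_coords x = int_coords y\<close> q_half assms by (metis Ints_diff)
    thus ?thesis by simp
  qed
next
  assume d: "q i x - q i y \<in> \<int>"
  have "q i x \<in> \<int> \<longleftrightarrow> q i y \<in> \<int>" using d by (metis Ints_add Ints_diff diff_add_cancel add_diff_cancel_left' minus_diff_eq Ints_minus)
  thus "int_coords x = int_coords y" using int_coords_iff assms by blast
qed

text \<open>Lifts of a circuit extend with \<open>S\<close> to a basis of volume 2, in which the coefficients are at most 1 in absolute value.\<close>

lemma circ_bound:
  assumes T: "T \<subseteq> A" "inj_on p T" "independent (p ` T)" and a: "a \<in> A" "p a = \<Sum>(p ` T)" and i: "i \<in> S"
  shows "\<bar>q i a - (\<Sum>t\<in>T. q i t)\<bar> \<le> 1"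
proof -
  have I: "independent (S \<union> T)" "S \<inter> T = {}" using indep_lift[OF plin pS S_ind T(3,2)] by auto
  obtain Y where Y: "S \<union> T \<subseteq> Y" "Y \<subseteq> A" "bas Y" using bas_extend[OF _ I(1)] S_sub T(1) by auto
  have v: "vol Y = 2" using vol_S(1)[OF Y(2,3)] Y(1) by auto
  define c where "c = q i (a - \<Sum>T)"
  have "p (a - \<Sum>T) = 0" using a(2) plin sum.reindex[OF T(2), of id] by (simp add: linear_diff linear_sum)
  from kerD[OF this] have e: "a - \<Sum>T = (\<Sum>j\<in>S. q j (a - \<Sum>T) *\<^sub>R j)" .
  also have "\<dots> = c *\<^sub>R i + (\<Sum>j\<in>S - {i}. q j (a - \<Sum>T) *\<^sub>R j)" unfolding c_def by (rule sum.remove[OF S_fin i])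
  finally have "a - c *\<^sub>R i = \<Sum>T + (\<Sum>j\<in>S - {i}. q j (a - \<Sum>T) *\<^sub>R j)" by (simp add: algebra_simps)
  moreover have "\<dots> \<in> span (Y - {i})"
    using Y(1) I(2) i by (intro span_add span_sum span_scale) (auto intro!: span_base)
  ultimately have "a - c *\<^sub>R i \<in> span (Y - {i})" by metis
  moreover have "i \<in> Y" using Y(1) i by blast
  ultimately have "c \<in> {-1, -1/2, 0, 1/2, 1}" using coeff_vals(3)[OF Y(2,3) a(1) _ _ v] by blast
  hence "\<bar>c\<bar> \<le> 1" by auto
  thus ?thesis unfolding c_def by (simp add: qsimps qsum)
qed

lemma base_bound: assumes "a \<in> A" "p a = 0" "i \<in> S" shows "\<bar>q i a\<bar> \<le> 1"
  using circ_bound[of "{}" a i] assms independent_empty by simp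

lemma fibre_bound: assumes "a \<in> A" "b \<in> A" "p a = p b" "p a \<noteq> 0" "i \<in> S" shows "\<bar>q i a - q i b\<bar> \<le> 1"
  using circ_bound[of "{b}" a i] assms by (simp add: independent_insert)

definition U :: "'a set" where "U = p ` A - {0}"

text \<open>Coordinates outside \<open>S\<close> are integral by \<open>coeff_off_S\<close> and at most 1 in absolute value because bases through \<open>S\<close> have volume 2.\<close>

lemma U_unimod: "unimod U"
  unfolding unimod_def
proof (intro conjI allI impI ballI)
  show "finite U" "0 \<notin> U" unfolding U_def using finA by auto
  show "- u \<in> U" if u: "u \<in> U" for u
  proof -
    obtain x where "x \<in> A" "u = p x" "u \<noteq> 0" using u unfolding U_def by auto
    thus ?thesis using symA[of x] linear_neg[OF plin, of x] unfolding U_def by (auto intro!: image_eqI[of _ _ "- x"])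
  qed
  fix Z' u' z' c
  assume Z': "Z' \<subseteq> U" "independent Z'" "u' \<in> U" "z' \<in> Z'" "u' - c *\<^sub>R z' \<in> span (Z' - {z'})"
  have "Z' \<subseteq> p ` A" using Z'(1) unfolding U_def by auto
  then obtain T where T: "T \<subseteq> A" "p ` T = Z'" "inj_on p T" "independent (S \<union> T)" "S \<inter> T = {}"
    using basis_lift[OF plin ker S_ind _ Z'(2)] by blast
  obtain u z where uz: "u \<in> A" "u' = p u" "z \<in> T" "z' = p z" using Z' T unfolding U_def by blast
  obtain Y where Y: "S \<union> T \<subseteq> Y" "Y \<subseteq> A" "bas Y" using bas_extend[OF _ T(4)] S_sub T(1) by auto
  have v: "vol Y = 2" using vol_S(1)[OF Y(2,3)] Y(1) by auto
  have "p (u - c *\<^sub>R z) \<in> span (p ` (T - {z}))"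
  proof -
    have "p ` (T - {z}) = Z' - {z'}" using T uz by (auto simp: inj_on_def)
    thus ?thesis using Z'(5) uz plin by (simp add: linear_diff linear_scale)
  qed
  hence "u - c *\<^sub>R z \<in> span (S \<union> (T - {z}))" using ker by (intro span_lift[OF plin]) auto
  also have "\<dots> \<subseteq> span (Y - {z})" using Y(1) T(5) uz by (intro span_mono) auto
  finally have m: "u - c *\<^sub>R z \<in> span (Y - {z})" .
  have "z \<in> Y - S" using T(5) uz Y(1) by auto
  hence "c \<in> \<int>" using coeff_off_S[OF Y(2,3) _ _ _ m] Y(1) uz A_L by auto
  moreover have "c \<in> {-1, -1/2, 0, 1/2, 1}" using coeff_vals(3)[OF Y(2,3) uz(1) _ m v] Y(1) uz by auto
  ultimately have "c \<noteq> 1/2" "c \<noteq> -1/2" "c \<in> {-1, -1/2, 0, 1/2, 1}" using half_not_int by metis+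
  thus "c \<in> {-1, 0, 1}" by blast
qed

lemma dimA: "dim A = card S + dim U"
proof -
  have "S \<subseteq> span A" using S_sub span_superset by blast
  thus ?thesis unfolding U_def using dim_quot[OF plin ker S_ind S_fin _ finA] by blast
qed

end

section \<open>Fibres of the projection\<close>

lemma sum_odd_shift:
  fixes D :: "'b::real_vector set"
  shows "(\<Sum>i\<in>D. c i *\<^sub>R i) - \<Sum>D = 2 *\<^sub>R (\<Sum>i\<in>D. ((c i - 1) / 2) *\<^sub>R i)"
proof -
  have "2 *\<^sub>R (\<Sum>i\<in>D. ((c i - 1) / 2) *\<^sub>R i) = (\<Sum>i\<in>D. (2 * ((c i - 1) / 2)) *\<^sub>R i)" by (simp only: scaleR_sum_right scaleR_scaleR)
  also have "\<dots> = (\<Sum>i\<in>D. (c i - 1) *\<^sub>R i)"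
  proof -
    have e: "2 * ((c i - 1) / 2) = c i - 1" for i by (simp only: times_divide_eq_right nonzero_mult_div_cancel_left zero_neq_numeral not_False_eq_True)
    show ?thesis unfolding e ..
  qed
  also have "\<dots> = (\<Sum>i\<in>D. c i *\<^sub>R i - i)" by (simp add: scaleR_diff_left)
  finally show ?thesis by (simp add: sum_subtractf)
qed

lemma Ints_abs_le_1:
  assumes "(x::real) \<in> \<int>" "\<bar>x\<bar> \<le> 1" shows "x \<in> {-1, 0, 1}"
proof -
  obtain n :: int where n: "x = of_int n" using assms(1) by (auto elim: Ints_cases)
  have "n = -1 \<or> n = 0 \<or> n = 1" using assms(2) unfolding n by linarith
  thus ?thesis unfolding n by auto
qed

context flat
begin

lemma AL: "a \<in> A \<Longrightarrow> a \<in> L"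
  using A_L by blast

lemma eq_of_pq: assumes "p a = p b" "\<And>i. i \<in> S \<Longrightarrow> q i a = q i b" shows "a = b"
  using same_fibre[OF assms(1)] assms(2) by simp

lemma q_span: assumes "T \<subseteq> S" "v \<in> span T" "i \<in> S" "i \<notin> T" shows "q i v = 0"
proof -
  have fT: "finite T" using assms(1) S_fin finite_subset by blast
  obtain c where "v = (\<Sum>t\<in>T. c t *\<^sub>R t)" using span_finite_coeff[OF fT assms(2)] by blast
  thus ?thesis using q_comb[of T i c] assms Y0(1) fT by auto
qed

text \<open>Let \<open>D\<close> be the set of nonzero coordinates of \<open>a\<close>. Replacing \<open>D\<close> by \<open>a\<close> in \<open>S\<close> leaves an even independent set, so minimality of \<open>S\<close> gives \<open>card D = 1\<close>.\<close>

lemma base_int: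
  assumes a: "a \<in> A" "p a = 0" "int_coords a"
  shows "a \<in> S \<union> uminus ` S"
proof -
  define D where "D = {i \<in> S. q i a \<noteq> 0}"
  have v: "q i a \<in> {-1, 1}" if "i \<in> D" for i
    using base_bound[OF a(1,2), of i] Ints_abs_le_1[of "q i a"] a(3) that unfolding int_coords_def D_def by auto
  have ae: "a = (\<Sum>i\<in>D. q i a *\<^sub>R i)"
  proof -
    have "a = (\<Sum>i\<in>S. q i a *\<^sub>R i)" by (rule kerD[OF a(2)])
    also have "\<dots> = (\<Sum>i\<in>D. q i a *\<^sub>R i)" unfolding D_def using S_fin by (intro sum.mono_neutral_right) auto
    finally show ?thesis .
  qed
  have DS: "D \<subseteq> S" "finite D" unfolding D_def using S_fin by auto
  have Dne: "D \<noteq> {}" using ae a(1) zeroA by auto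
  have nsp: "a \<notin> span (S - D)"
  proof
    assume h: "a \<in> span (S - D)"
    obtain i where "i \<in> D" using Dne by blast
    hence "q i a = 0" using q_span[of "S - D" a i] h DS by auto
    thus False using \<open>i \<in> D\<close> unfolding D_def by simp
  qed
  have an: "a \<notin> S - D" using nsp span_base[of a "S - D"] by metis
  obtain l where l: "l \<in> L" "\<Sum>S = 2 *\<^sub>R l" using S_half by blast
  have "even_indep (insert a (S - D))"
  proof (rule even_indepI)
    show "insert a (S - D) \<subseteq> A" using S_sub a by auto
    show "independent (insert a (S - D))" using nsp S_ind independent_mono[of S "S - D"] by (intro independent_insertI) auto
    have a1: "a - \<Sum>D = 2 *\<^sub>R (\<Sum>i\<in>D. ((q i a - 1) / 2) *\<^sub>R i)"
      using sum_odd_shift[of "\<lambda>i. q i a" D] ae by metis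
    have "\<Sum>(insert a (S - D)) = a + \<Sum>(S - D)" using an S_fin by simp
    also have "\<dots> = (a - \<Sum>D) + \<Sum>S" using sum_diff[OF S_fin DS(1), of id] by simp
    also have "\<dots> = 2 *\<^sub>R (l + (\<Sum>i\<in>D. ((q i a - 1) / 2) *\<^sub>R i))"
      unfolding a1 l(2) by (simp add: scaleR_add_right)
    finally show "\<Sum>(insert a (S - D)) = 2 *\<^sub>R (l + (\<Sum>i\<in>D. ((q i a - 1) / 2) *\<^sub>R i))" .
    have "(q i a - 1) / 2 \<in> \<int>" if "i \<in> D" for i using v[OF that] by auto
    thus "l + (\<Sum>i\<in>D. ((q i a - 1) / 2) *\<^sub>R i) \<in> L" using l DS S_sub A_L
      by (intro L_add L_sum L_int) auto
  qed auto
  from smin[OF this] have "card S \<le> Suc (card (S - D))" using an S_fin by simp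
  also have "card (S - D) = card S - card D" using DS by (simp add: card_Diff_subset)
  finally have "card D \<le> 1" using card_mono[OF S_fin DS(1)] by linarith
  moreover have "card D \<noteq> 0" using Dne DS by simp
  ultimately obtain i where "D = {i}" using card_1_singletonE[of D] by (metis le_neq_implies_less less_one)
  thus ?thesis using ae v[of i] DS by auto
qed

definition P :: "'a \<Rightarrow> bool \<Rightarrow> 'a set" where "P u \<tau> = {a \<in> A. p a = u \<and> (int_coords a \<longleftrightarrow> \<tau>)}"

lemma P_fin: "finite (P u \<tau>)" unfolding P_def using finA by simp

lemma P_D: assumes "a \<in> P u \<tau>" shows "a \<in> A" "p a = u" "int_coords a \<longleftrightarrow> \<tau>" "a \<in> L"
  using assms A_L unfolding P_def by auto

lemma U0: "u \<in> U \<Longrightarrow> u \<noteq> 0" unfolding U_def by simp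

lemma P_diff: assumes "a \<in> P u \<tau>" "b \<in> P u \<tau>" "u \<in> U" "i \<in> S"
  shows "q i a - q i b \<in> {-1, 0, 1}"
  using fibre_bound[of a b i] P_D[OF assms(1)] P_D[OF assms(2)] int_coords_diff[of a b i] assms(4) U0[OF assms(3)]
  by (intro Ints_abs_le_1) auto

text \<open>Replacing the set of coordinates in which \<open>a\<close> and \<open>b\<close> differ by the two elements \<open>a\<close> and \<open>b\<close> leaves an even independent set, so minimality of \<open>S\<close> bounds it by 2.\<close>

lemma P_diff_card:
  assumes u: "u \<in> U" and a: "a \<in> P u \<tau>" "b \<in> P u \<tau>"
  shows "card {i \<in> S. q i a \<noteq> q i b} \<le> 2"
proof -
  define D where "D = {i \<in> S. q i a \<noteq> q i b}"
  note Pa = P_D[OF a(1)] and Pb = P_D[OF a(2)]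
  have v: "q i a - q i b \<in> {-1, 1}" if "i \<in> D" for i using P_diff[OF a u, of i] that unfolding D_def by auto
  have DS: "D \<subseteq> S" "finite D" unfolding D_def using S_fin by auto
  have ae: "a = b + (\<Sum>i\<in>D. (q i a - q i b) *\<^sub>R i)"
  proof -
    have "a - b = (\<Sum>i\<in>S. (q i a - q i b) *\<^sub>R i)" using same_fibre[of a b] Pa Pb by simp
    also have "\<dots> = (\<Sum>i\<in>D. (q i a - q i b) *\<^sub>R i)" unfolding D_def using S_fin by (intro sum.mono_neutral_right) auto
    finally show ?thesis by (simp add: algebra_simps)
  qed
  show ?thesis
  proof (cases "D = {}")
    case True thus ?thesis unfolding D_def[symmetric] by simp
  next
    case False
    have b1: "b \<notin> span (S - D)"
    proof
      assume "b \<in> span (S - D)"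
      hence "b \<in> span S" using span_mono[of "S - D" S] by auto
      thus False using ker[of b] Pb(2) U0[OF u] by simp
    qed
    have a1: "a \<notin> span (insert b (S - D))"
    proof
      assume "a \<in> span (insert b (S - D))"
      then obtain k where k: "a - k *\<^sub>R b \<in> span (S - D)" using span_breakdown[of b "insert b (S - D)" a] span_mono[of "insert b (S - D) - {b}" "S - D"] by blast
      hence "p (a - k *\<^sub>R b) = 0" using ker span_mono[of "S - D" S] by blast
      hence "(1 - k) *\<^sub>R u = 0" using plin Pa Pb by (simp add: linear_diff linear_scale scaleR_diff_left)
      hence k1: "k = 1" using U0[OF u] by simp
      obtain i where "i \<in> D" using False by blast
      hence "q i (a - b) = 0" using q_span[of "S - D" "a - b" i] k k1 DS by auto
      thus False using \<open>i \<in> D\<close> unfolding D_def by (simp add: qsimps)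
    qed
    have bn: "b \<notin> S - D" using b1 span_base[of b "S - D"] by metis
    have an: "a \<notin> insert b (S - D)" using a1 span_base[of a "insert b (S - D)"] by metis
    obtain l where l: "l \<in> L" "\<Sum>S = 2 *\<^sub>R l" using S_half by blast
    have "even_indep (insert a (insert b (S - D)))"
    proof (rule even_indepI)
      show "insert a (insert b (S - D)) \<subseteq> A" using S_sub Pa Pb by auto
      show "independent (insert a (insert b (S - D)))" using a1 b1 S_ind independent_mono[of S "S - D"] by (intro independent_insertI) auto
      have "a - b = (\<Sum>i\<in>D. (q i a - q i b) *\<^sub>R i)" using ae by (metis add_diff_cancel_left')
      hence a1: "a - b - \<Sum>D = 2 *\<^sub>R (\<Sum>i\<in>D. ((q i a - q i b - 1) / 2) *\<^sub>R i)"
        using sum_odd_shift[of "\<lambda>i. q i a - q i b" D] by metis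
      have "\<Sum>(insert a (insert b (S - D))) = a + (b + \<Sum>(S - D))" using an bn S_fin by simp
      also have "\<dots> = (a - b - \<Sum>D) + \<Sum>S + (b + b)" using sum_diff[OF S_fin DS(1), of id] by simp
      also have "\<dots> = 2 *\<^sub>R (b + l + (\<Sum>i\<in>D. ((q i a - q i b - 1) / 2) *\<^sub>R i))"
        unfolding a1 l(2) by (simp add: scaleR_add_right scaleR_2)
      finally show "\<Sum>(insert a (insert b (S - D))) = 2 *\<^sub>R (b + l + (\<Sum>i\<in>D. ((q i a - q i b - 1) / 2) *\<^sub>R i))" .
      have "(q i a - q i b - 1) / 2 \<in> \<int>" if "i \<in> D" for i using v[OF that] by auto
      thus "b + l + (\<Sum>i\<in>D. ((q i a - q i b - 1) / 2) *\<^sub>R i) \<in> L" using l DS S_sub A_L Pb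
        by (intro L_add L_sum L_int) auto
    qed auto
    from smin[OF this] have "card S \<le> Suc (Suc (card (S - D)))" using an bn S_fin by simp
    also have "card (S - D) = card S - card D" using DS by (simp add: card_Diff_subset)
    finally show ?thesis using card_mono[OF S_fin DS(1)] unfolding D_def by linarith
  qed
qed

definition I :: "'a \<Rightarrow> bool \<Rightarrow> 'a set" where
  "I u \<tau> = {i \<in> S. \<exists>a\<in>P u \<tau>. \<exists>b\<in>P u \<tau>. q i a \<noteq> q i b}"

text \<open>By \<open>P_family\<close> such a part consists of the four corners of a unit square.\<close>

definition square :: "'a \<Rightarrow> bool \<Rightarrow> bool" where
  "square u \<tau> \<longleftrightarrow> card (I u \<tau>) = 2 \<and> card (P u \<tau>) = 4"

lemma I_sub: "I u \<tau> \<subseteq> S" and I_fin: "finite (I u \<tau>)"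
  unfolding I_def using S_fin by auto

text \<open>Each coordinate takes at most two values, so points are determined by the set of coordinates in which they differ from \<open>a0\<close>; \<open>family_diameter_two\<close> applies to these sets.\<close>

lemma P_family:
  assumes u: "u \<in> U" and a0: "a0 \<in> P u \<tau>"
  defines "F \<equiv> \<lambda>a. {i \<in> S. q i a \<noteq> q i a0}"
  shows "inj_on F (P u \<tau>)" "card (P u \<tau>) \<le> card (I u \<tau>) + 1 \<or> (card (I u \<tau>) = 2 \<and> F ` P u \<tau> = Pow (I u \<tau>))"
proof -
  have three: "q i a = q i b" if "a \<in> P u \<tau>" "b \<in> P u \<tau>" "i \<in> S" "q i a \<noteq> q i a0" "q i b \<noteq> q i a0" for a b i
    using P_diff[OF that(1) a0 u that(3)] P_diff[OF that(2) a0 u that(3)] P_diff[OF that(1,2) u that(3)] that(4,5) by auto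
  have sd: "(F a - F b) \<union> (F b - F a) = {i \<in> S. q i a \<noteq> q i b}" if "a \<in> P u \<tau>" "b \<in> P u \<tau>" for a b
    using three[OF that] unfolding F_def by auto
  show inj: "inj_on F (P u \<tau>)"
  proof (rule inj_onI)
    fix a b assume ab: "a \<in> P u \<tau>" "b \<in> P u \<tau>" "F a = F b"
    hence "{i \<in> S. q i a \<noteq> q i b} = {}" using sd[OF ab(1,2)] by auto
    hence h1: "q i a = q i b" if "i \<in> S" for i using that by blast
    have h2: "p a = p b" using P_D(2)[OF ab(1)] P_D(2)[OF ab(2)] by simp
    show "a = b" by (rule eq_of_pq[OF h2 h1])
  qed
  have "F ` P u \<tau> \<subseteq> Pow (I u \<tau>)" unfolding F_def I_def using a0 by auto
  moreover have "{} \<in> F ` P u \<tau>" using a0 unfolding F_def by (intro image_eqI[of _ _ a0]) auto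
  moreover have "card ((X - Y) \<union> (Y - X)) \<le> 2" if "X \<in> F ` P u \<tau>" "Y \<in> F ` P u \<tau>" for X Y
    using that sd P_diff_card[OF u] by auto
  ultimately have "card (F ` P u \<tau>) \<le> card (I u \<tau>) + 1 \<or> (card (I u \<tau>) = 2 \<and> F ` P u \<tau> = Pow (I u \<tau>))"
    by (rule family_diameter_two[OF I_fin])
  thus "card (P u \<tau>) \<le> card (I u \<tau>) + 1 \<or> (card (I u \<tau>) = 2 \<and> F ` P u \<tau> = Pow (I u \<tau>))"
    using card_image[OF inj] by simp
qed

lemma card_P: assumes u: "u \<in> U" and ne: "P u \<tau> \<noteq> {}"
  shows "card (P u \<tau>) \<le> card (I u \<tau>) + 1 + (if square u \<tau> then 1 else 0)"
proof -
  obtain a0 where a0: "a0 \<in> P u \<tau>" using ne by blast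
  from P_family(2)[OF u a0] show ?thesis
  proof
    assume h: "card (I u \<tau>) = 2 \<and> (\<lambda>a. {i \<in> S. q i a \<noteq> q i a0}) ` P u \<tau> = Pow (I u \<tau>)"
    hence "card (P u \<tau>) = card (Pow (I u \<tau>))" using card_image[OF P_family(1)[OF u a0]] by metis
    also have "\<dots> = 4" using h card_Pow[OF I_fin, of u \<tau>] by simp
    finally show ?thesis using h unfolding square_def by simp
  qed simp
qed

lemma square_diag:
  assumes u: "u \<in> U" and s: "square u \<tau>" and I: "I u \<tau> = {i, j}" "i \<noteq> j" and \<alpha>: "\<alpha> = 1 \<or> \<alpha> = (-1::real)"
  shows "\<exists>a\<in>A. \<exists>b\<in>A. p a = u \<and> p b = u \<and> a = b + i + \<alpha> *\<^sub>R j"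
proof -
  have "P u \<tau> \<noteq> {}" using s unfolding square_def by auto
  then obtain a0 where a0: "a0 \<in> P u \<tau>" by blast
  define F where "F a = {i \<in> S. q i a \<noteq> q i a0}" for a
  have FP: "F ` P u \<tau> = Pow {i, j}" using P_family(2)[OF u a0] s I unfolding square_def F_def by auto
  have ijS: "i \<in> S" "j \<in> S" using I_sub[of u \<tau>] I by auto
  have pt: "\<exists>a\<in>P u \<tau>. F a = X" if "X \<subseteq> {i, j}" for X using FP that by (metis Pow_iff imageE)
  obtain a1 where a1: "a1 \<in> P u \<tau>" "F a1 = {i}" using pt[of "{i}"] by auto
  obtain a2 where a2: "a2 \<in> P u \<tau>" "F a2 = {j}" using pt[of "{j}"] by auto
  obtain a3 where a3: "a3 \<in> P u \<tau>" "F a3 = {i, j}" using pt[of "{i, j}"] by auto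
  have f: "q k a = q k a0 \<longleftrightarrow> k \<notin> F a" if "k \<in> S" for k a using that unfolding F_def by auto
  have three: "q k a = q k b" if "a \<in> P u \<tau>" "b \<in> P u \<tau>" "k \<in> S" "k \<in> F a" "k \<in> F b" for a b k
    using P_diff[OF that(1) a0 u that(3)] P_diff[OF that(2) a0 u that(3)] P_diff[OF that(1,2) u that(3)] that(4,5) f[OF that(3), of a] f[OF that(3), of b] by auto
  define e where "e = q i a1 - q i a0"
  define g where "g = q j a2 - q j a0"
  have e: "e = 1 \<or> e = -1" using P_diff[OF a1(1) a0 u ijS(1)] f[OF ijS(1), of a1] a1(2) unfolding e_def by auto
  have g: "g = 1 \<or> g = -1" using P_diff[OF a2(1) a0 u ijS(2)] f[OF ijS(2), of a2] a2(2) unfolding g_def by auto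
  have expand: "a - b = (q i a - q i b) *\<^sub>R i + (q j a - q j b) *\<^sub>R j" if ab: "a \<in> P u \<tau>" "b \<in> P u \<tau>" for a b
  proof -
    have "F a \<subseteq> {i, j}" "F b \<subseteq> {i, j}" using FP ab by auto
    hence z: "q k a - q k b = 0" if "k \<in> S - {i, j}" for k using f[of k a] f[of k b] that by auto
    have "a - b = (\<Sum>k\<in>S. (q k a - q k b) *\<^sub>R k)" using same_fibre[of a b] P_D[OF ab(1)] P_D[OF ab(2)] by simp
    also have "\<dots> = (\<Sum>k\<in>{i, j}. (q k a - q k b) *\<^sub>R k)" using S_fin ijS z by (intro sum.mono_neutral_right) auto
    finally show ?thesis using I(2) by simp
  qed
  have d3: "a3 - a0 = e *\<^sub>R i + g *\<^sub>R j"
    using expand[OF a3(1) a0] three[OF a3(1) a1(1) ijS(1)] three[OF a3(1) a2(1) ijS(2)] a1(2) a2(2) a3(2) unfolding e_def g_def by simp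
  have d12: "a1 - a2 = e *\<^sub>R i - g *\<^sub>R j"
    using expand[OF a1(1) a2(1)] f[OF ijS(1), of a2] f[OF ijS(2), of a1] a1(2) a2(2) I(2) unfolding e_def g_def by (simp add: scaleR_diff_left)
  have PA: "x \<in> A \<and> p x = u" if "x \<in> P u \<tau>" for x using P_D[OF that] by simp
  have *: "a = b + i + \<alpha> *\<^sub>R j \<or> b = a + i + \<alpha> *\<^sub>R j" if "a - b = e *\<^sub>R i + (e * \<alpha>) *\<^sub>R j" for a b
  proof -
    have "a = b + e *\<^sub>R i + (e * \<alpha>) *\<^sub>R j" using that by (simp add: algebra_simps)
    thus ?thesis using e by auto
  qed
  show ?thesis
  proof (cases "g = e * \<alpha>")
    case True
    hence "a3 = a0 + i + \<alpha> *\<^sub>R j \<or> a0 = a3 + i + \<alpha> *\<^sub>R j" using *[of a3 a0] d3 by simp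
    thus ?thesis using PA[OF a0] PA[OF a3(1)] by blast
  next
    case False
    hence "- g = e * \<alpha>" using e g \<alpha> by auto
    hence "a1 - a2 = e *\<^sub>R i + (e * \<alpha>) *\<^sub>R j" using d12 by (simp add: scaleR_minus_left[symmetric])
    hence "a1 = a2 + i + \<alpha> *\<^sub>R j \<or> a2 = a1 + i + \<alpha> *\<^sub>R j" by (rule *)
    thus ?thesis using PA[OF a1(1)] PA[OF a2(1)] by blast
  qed
qed

lemma I_attained: assumes u: "u \<in> U" and i: "i \<in> I u \<tau>"
  shows "\<exists>a\<in>P u \<tau>. \<exists>b\<in>P u \<tau>. q i a = q i b + 1"
proof -
  obtain a b where ab: "a \<in> P u \<tau>" "b \<in> P u \<tau>" "q i a \<noteq> q i b" using i unfolding I_def by blast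
  have "q i a - q i b \<in> {-1, 0, 1}" using P_diff[OF ab(1,2) u] i I_sub by blast
  hence "q i a = q i b + 1 \<or> q i b = q i a + 1" using ab(3) by auto
  thus ?thesis using ab by blast
qed

text \<open>Two intervals of length 1 with endpoints in \<open>\<int>\<close> and in \<open>1/2 + \<int>\<close> cover a width of at least 3/2, more than a fibre has.\<close>

lemma I_disjoint: assumes u: "u \<in> U" shows "I u True \<inter> I u False = {}"
proof (rule ccontr)
  assume "I u True \<inter> I u False \<noteq> {}"
  then obtain i where i: "i \<in> I u True" "i \<in> I u False" by blast
  obtain a b where ab: "a \<in> P u True" "b \<in> P u True" "q i a = q i b + 1" using I_attained[OF u i(1)] by blast
  obtain c d where cd: "c \<in> P u False" "d \<in> P u False" "q i c = q i d + 1" using I_attained[OF u i(2)] by blast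
  have iS: "i \<in> S" using i I_sub by blast
  note D = P_D[OF ab(1)] P_D[OF ab(2)] P_D[OF cd(1)] P_D[OF cd(2)]
  have b: "\<bar>q i a - q i d\<bar> \<le> 1" "\<bar>q i b - q i c\<bar> \<le> 1" using fibre_bound[of a d i] fibre_bound[of b c i] D U0[OF u] iS by auto
  have "q i a - q i c \<notin> \<int>" using int_coords_diff[of a c i] D iS by auto
  moreover have "\<bar>q i a - q i c\<bar> \<le> 0" using b ab(3) cd(3) by linarith
  ultimately show False by simp
qed

definition lo :: "'a \<Rightarrow> 'a \<Rightarrow> real" where "lo i u = Min (q i ` {a \<in> A. p a = u})"
definition hi :: "'a \<Rightarrow> 'a \<Rightarrow> real" where "hi i u = Max (q i ` {a \<in> A. p a = u})"
text \<open>Twice the width, so that the values are natural numbers.\<close>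

definition w :: "'a \<Rightarrow> 'a \<Rightarrow> nat" where "w i u = nat \<lfloor>2 * (hi i u - lo i u)\<rfloor>"

lemma lohi: assumes u: "u \<in> U" 
  shows "\<exists>a\<in>A. p a = u \<and> q i a = lo i u" "\<exists>a\<in>A. p a = u \<and> q i a = hi i u"
    "\<And>a. a \<in> A \<Longrightarrow> p a = u \<Longrightarrow> lo i u \<le> q i a \<and> q i a \<le> hi i u"
proof -
  have f: "finite (q i ` {a \<in> A. p a = u})" and ne: "q i ` {a \<in> A. p a = u} \<noteq> {}" using finA u unfolding U_def by auto
  show "\<exists>a\<in>A. p a = u \<and> q i a = lo i u" using Min_in[OF f ne] unfolding lo_def by auto
  show "\<exists>a\<in>A. p a = u \<and> q i a = hi i u" using Max_in[OF f ne] unfolding hi_def by auto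
  show "lo i u \<le> q i a \<and> q i a \<le> hi i u" if "a \<in> A" "p a = u" for a
    unfolding lo_def hi_def using f that by (auto intro!: Min_le Max_ge)
qed

lemma w_real: assumes u: "u \<in> U" and i: "i \<in> S" shows "real (w i u) = 2 * (hi i u - lo i u)" "w i u \<le> 2"
proof -
  obtain a b where ab: "a \<in> A" "p a = u" "q i a = lo i u" "b \<in> A" "p b = u" "q i b = hi i u" using lohi(1,2)[OF u] by metis
  have "2 * q i b \<in> \<int>" "2 * q i a \<in> \<int>" using q_int(1)[OF AL[OF ab(4)] i i] q_int(1)[OF AL[OF ab(1)] i i] by auto
  hence "2 * q i b - 2 * q i a \<in> \<int>" by (rule Ints_diff)
  then obtain n :: int where n: "2 * (hi i u - lo i u) = of_int n" using ab by (auto elim!: Ints_cases simp: algebra_simps)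
  have "real_of_int n \<ge> 0" using lohi(3)[OF u ab(1,2), of i] unfolding n[symmetric] by simp
  hence nn: "n \<ge> 0" by simp
  show w: "real (w i u) = 2 * (hi i u - lo i u)" unfolding w_def n using nn by simp
  have "\<bar>q i b - q i a\<bar> \<le> 1" using fibre_bound[of b a i] ab U0[OF u] i by auto
  hence "real (w i u) \<le> 2" using w ab by simp
  thus "w i u \<le> 2" by simp
qed

lemma w_sym: assumes u: "u \<in> U" shows "lo i (- u) = - hi i u" "hi i (- u) = - lo i u" "w i (- u) = w i u"
proof -
  have nu: "- u \<in> U" using unimodD(3)[OF U_unimod u] .
  have pn: "p (- a) = - p a" for a using linear_neg[OF plin, of a] .
  obtain a where a: "a \<in> A" "p a = - u" "q i a = lo i (- u)" using lohi(1)[OF nu] by blast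
  obtain b where b: "b \<in> A" "p b = - u" "q i b = hi i (- u)" using lohi(2)[OF nu] by blast
  obtain c where c: "c \<in> A" "p c = u" "q i c = lo i u" using lohi(1)[OF u] by blast
  obtain d where d: "d \<in> A" "p d = u" "q i d = hi i u" using lohi(2)[OF u] by blast
  have "lo i u \<le> q i (- b)" "q i (- a) \<le> hi i u" using lohi(3)[OF u, of "- b" i] lohi(3)[OF u, of "- a" i] symA a b pn by auto
  moreover have "q i (- c) \<le> hi i (- u)" "lo i (- u) \<le> q i (- d)" using lohi(3)[OF nu, of "- c" i] lohi(3)[OF nu, of "- d" i] symA c d pn by auto
  ultimately show 1: "lo i (- u) = - hi i u" "hi i (- u) = - lo i u" using a b c d by (auto simp: qsimps)
  show "w i (- u) = w i u" unfolding w_def 1 by simp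
qed

text \<open>\<open>circ_bound\<close> for the lifts that are extremal in coordinate \<open>i\<close>.\<close>

lemma circuit_lohi:
  assumes T: "T \<subseteq> U" "independent T" and y: "y \<in> U" "y = \<Sum>T" and i: "i \<in> S"
  shows "hi i y - sum (lo i) T \<le> 1" "lo i y - sum (hi i) T \<ge> -1"
proof -
  have key: "\<bar>q i a - sum f T\<bar> \<le> 1" if a: "a \<in> A" "p a = y" and f: "\<And>u. u \<in> U \<Longrightarrow> \<exists>a\<in>A. p a = u \<and> q i a = f u" for a f
  proof -
    define B where "B = {a \<in> A. q i a = f (p a)}"
    have "T \<subseteq> p ` B"
    proof
      fix u assume "u \<in> T"
      then obtain a where "a \<in> A" "p a = u" "q i a = f u" using f T(1) by blast
      thus "u \<in> p ` B" unfolding B_def by (intro image_eqI[of _ _ a]) auto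
    qed
    then obtain R where R: "R \<subseteq> B" "p ` R = T" "inj_on p R" using lift_set by metis
    have "sum f T = (\<Sum>t\<in>R. f (p t))" using sum.reindex[OF R(3), of f] R(2) by simp
    also have "\<dots> = (\<Sum>t\<in>R. q i t)" using R(1) unfolding B_def by (intro sum.cong) auto
    finally show ?thesis using circ_bound[of R a i] R T(2) a y(2) i unfolding B_def by auto
  qed
  obtain a where a: "a \<in> A" "p a = y" "q i a = hi i y" using lohi(2)[OF y(1)] by blast
  show "hi i y - sum (lo i) T \<le> 1" using key[OF a(1,2), of "lo i"] lohi(1) a(3) by auto
  obtain b where b: "b \<in> A" "p b = y" "q i b = lo i y" using lohi(1)[OF y(1)] by blast
  show "lo i y - sum (hi i) T \<ge> -1" using key[OF b(1,2), of "hi i"] lohi(2) b(3) by auto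
qed

lemma w_circuit: assumes i: "i \<in> S" shows "circuit_bounded U (w i)"
  unfolding circuit_bounded_def
proof (intro conjI ballI allI impI)
  show "w i (- u) = w i u" if "u \<in> U" for u using w_sym[OF that] by blast
  show "w i u \<le> 2" if "u \<in> U" for u using w_real[OF that i] by blast
  fix T y assume T: "T \<subseteq> U" "independent T" "2 \<le> card T" "y \<in> U" "y = \<Sum>T"
  have "real (sum (w i) T) = (\<Sum>t\<in>T. 2 * (hi i t - lo i t))" using w_real(1)[OF _ i] T(1) by (auto intro!: sum.cong)
  also have "\<dots> = 2 * (sum (hi i) T - sum (lo i) T)" by (simp add: sum_distrib_left sum_subtractf)
  finally have "real (w i y + sum (w i) T) \<le> 4" using circuit_lohi[OF T(1,2,4,5) i] w_real(1)[OF T(4) i] by simp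
  thus "w i y + sum (w i) T \<le> 4" by linarith
qed

lemma w_two_iff: assumes u: "u \<in> U" and i: "i \<in> S" shows "w i u = 2 \<longleftrightarrow> i \<in> I u True \<union> I u False"
proof
  assume "w i u = 2"
  hence h: "hi i u - lo i u = 1" using w_real(1)[OF u i] by simp
  obtain a b where ab: "a \<in> A" "p a = u" "q i a = lo i u" "b \<in> A" "p b = u" "q i b = hi i u" using lohi(1,2)[OF u] by metis
  have "q i b - q i a \<in> \<int>" using h ab by simp
  hence "int_coords a = int_coords b" using int_coords_diff[of b a i] AL ab i by auto
  hence "a \<in> P u (int_coords a)" "b \<in> P u (int_coords a)" using ab unfolding P_def by auto
  moreover have "q i a \<noteq> q i b" using ab h by simp
  ultimately have "i \<in> I u (int_coords a)" unfolding I_def using i by blast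
  thus "i \<in> I u True \<union> I u False" by (cases "int_coords a") auto
next
  assume "i \<in> I u True \<union> I u False"
  then obtain \<tau> where "i \<in> I u \<tau>" by blast
  then obtain a b where ab: "a \<in> P u \<tau>" "b \<in> P u \<tau>" "q i a = q i b + 1" using I_attained[OF u] by blast
  have "hi i u - lo i u \<ge> 1" using lohi(3)[OF u, of a i] lohi(3)[OF u, of b i] P_D[OF ab(1)] P_D[OF ab(2)] ab(3) by linarith
  hence "real (w i u) \<ge> 2" using w_real(1)[OF u i] by simp
  thus "w i u = 2" using w_real(2)[OF u i] by linarith
qed

definition M :: "'a set" where "M = {u \<in> U. P u True \<noteq> {} \<and> P u False \<noteq> {}}"

lemma w_M: assumes u: "u \<in> M" and i: "i \<in> S" shows "w i u \<ge> 1"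
proof -
  have uU: "u \<in> U" using u unfolding M_def by auto
  obtain a b where ab: "a \<in> P u True" "b \<in> P u False" using u unfolding M_def by auto
  have "q i a \<noteq> q i b" using int_coords_diff[of a b i] P_D[OF ab(1)] P_D[OF ab(2)] i by auto
  hence "hi i u - lo i u > 0" using lohi(3)[OF uU, of a i] lohi(3)[OF uU, of b i] P_D[OF ab(1)] P_D[OF ab(2)] by linarith
  hence "real (w i u) > 0" using w_real(1)[OF uU i] by simp
  thus ?thesis by simp
qed

lemma card_fibre: assumes u: "u \<in> U"
  shows "card {a \<in> A. p a = u} \<le> 1 + card {i \<in> S. w i u = 2} + (if u \<in> M then 1 else 0)
     + ((if square u True then 1 else 0) + (if square u False then 1 else 0))"
proof -
  have split: "{a \<in> A. p a = u} = P u True \<union> P u False" "P u True \<inter> P u False = {}" unfolding P_def by auto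
  have c: "card {a \<in> A. p a = u} = card (P u True) + card (P u False)" unfolding split(1) using split(2) P_fin by (intro card_Un_disjoint)
  have "{i \<in> S. w i u = 2} = I u True \<union> I u False" using w_two_iff[OF u] I_sub by blast
  hence ci: "card {i \<in> S. w i u = 2} = card (I u True) + card (I u False)" using I_disjoint[OF u] I_fin by (simp add: card_Un_disjoint)
  have ne: "P u True \<noteq> {} \<or> P u False \<noteq> {}" using u split(1) unfolding U_def by blast
  consider "u \<in> M" | "P u True = {}" "P u False \<noteq> {}" | "P u False = {}" "P u True \<noteq> {}" using ne u unfolding M_def by blast
  thus ?thesis
  proof cases
    case 1
    hence "P u True \<noteq> {}" "P u False \<noteq> {}" unfolding M_def by auto
    from card_P[OF u this(1)] card_P[OF u this(2)] show ?thesis using c ci 1 by simp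
  next
    case 2
    thus ?thesis using card_P[OF u 2(2)] c ci by simp
  next
    case 3
    thus ?thesis using card_P[OF u 3(2)] c ci by simp
  qed
qed

end

section \<open>Squares and half-integral points\<close>

lemma half_prod:
  assumes "x = 1/2 \<or> x = -1/2" "y = 1/2 \<or> y = -1/(2::real)"
  shows "- 4 * x * y = 1 \<or> - 4 * x * y = -1" "y * (- 4 * x * y) = - x"
proof -
  consider "x = 1/2" "y = 1/2" | "x = 1/2" "y = -1/2" | "x = -1/2" "y = 1/2" | "x = -1/2" "y = -1/2" using assms by blast
  hence "(- 4 * x * y = 1 \<or> - 4 * x * y = -1) \<and> y * (- 4 * x * y) = - x"
    by cases (simp_all only:, simp_all)
  thus "- 4 * x * y = 1 \<or> - 4 * x * y = -1" "y * (- 4 * x * y) = - x" by auto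
qed

lemma scaleR_double: "(2 * c) *\<^sub>R x = c *\<^sub>R x + c *\<^sub>R x" and scaleR_triple: "(3 * c) *\<^sub>R x = c *\<^sub>R x + c *\<^sub>R x + c *\<^sub>R (x::'a::real_vector)"
  by (simp_all flip: scaleR_add_left)

text \<open>Negation has no fixed points.\<close>

lemma even_card_sym:
  fixes A :: "'a::real_vector set"
  assumes "finite A" "0 \<notin> A" "\<And>a. a \<in> A \<Longrightarrow> - a \<in> A"
  shows "even (card A)"
  using assms
proof (induction "card A" arbitrary: A rule: less_induct)
  case less
  show ?case
  proof (cases "A = {}")
    case False
    then obtain a where a: "a \<in> A" by blast
    have "a \<noteq> - a"
    proof
      assume "a = - a"
      hence "2 *\<^sub>R a = 0" by (metis add.right_inverse scaleR_2)
      thus False using a less(3) by simp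
    qed
    have n: "- a \<in> A" using less(4) a by blast
    let ?B = "A - {a, - a}"
    have c: "card A = card ?B + 2"
      using card_Diff_subset[of "{a, - a}" A] a n \<open>a \<noteq> - a\<close> card_mono[OF less(2), of "{a, - a}"] by auto
    have "even (card ?B)"
    proof (rule less(1))
      show "card ?B < card A" using c by simp
      show "finite ?B" "0 \<notin> ?B" using less(2,3) by auto
      show "- x \<in> ?B" if "x \<in> ?B" for x using that less(4)[of x] by (metis Diff_iff empty_iff insert_iff minus_minus)
    qed
    thus ?thesis using c by simp
  qed simp
qed

context flat
begin

text \<open>Bases for which coordinates are bounded by 1. An exchange with coordinate \<plusminus>1 preserves this, and contradictions arise when some coordinate becomes larger after a few such exchanges.\<close>

definition vol2_basis :: "'a set \<Rightarrow> bool" where "vol2_basis Y \<longleftrightarrow> Y \<subseteq> A \<and> bas Y \<and> vol Y = 2"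

lemma vol2_basis_coeff: assumes "vol2_basis Y" "x \<in> A" "y \<in> Y" "x - c *\<^sub>R y \<in> span (Y - {y})" shows "\<bar>c\<bar> \<le> 1"
proof -
  have "c \<in> {-1, -1/2, 0, 1/2, 1}" using coeff_vals(3)[of Y x y c] assms unfolding vol2_basis_def by blast
  thus ?thesis by auto
qed

lemma vol2_basis_exch: assumes "vol2_basis Y" "x \<in> A" "y \<in> Y" "x - c *\<^sub>R y \<in> span (Y - {y})" "\<bar>c\<bar> = 1" shows "vol2_basis (insert x (Y - {y}))"
proof -
  have c0: "c \<noteq> 0" using assms(5) by auto
  have Y: "Y \<subseteq> A" "bas Y" "vol Y = 2" using assms(1) unfolding vol2_basis_def by auto
  have "bas (insert x (Y - {y}))" using bas_exch[OF Y(2) assms(3) AL[OF assms(2)] assms(4) c0] .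
  moreover have "real (vol (insert x (Y - {y}))) = 2" using exch[OF Y(2) assms(3) AL[OF assms(2)] assms(4) c0] assms(5) Y(3) by simp
  ultimately show ?thesis using Y(1) assms(2) unfolding vol2_basis_def by auto
qed

lemma vol2_basis_start:
  assumes u: "u \<in> U" "u' \<in> U" "u' \<noteq> u" "u' \<noteq> - u" and a: "a \<in> A" "p a = u" and b: "b \<in> A" "p b = u'"
  shows "\<exists>Y. vol2_basis Y \<and> S \<subseteq> Y \<and> a \<in> Y \<and> b \<in> Y \<and> a \<notin> S \<and> b \<notin> S \<and> a \<noteq> b"
proof -
  have I: "independent (p ` {a, b})" using unimod_indep_pair[OF U_unimod u] a b by simp
  have inj: "inj_on p {a, b}" using a b u by auto
  have J: "independent (S \<union> {a, b})" "S \<inter> {a, b} = {}" using indep_lift[OF plin pS S_ind I inj] by auto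
  obtain Y where Y: "S \<union> {a, b} \<subseteq> Y" "Y \<subseteq> A" "bas Y" using bas_extend[OF _ J(1)] S_sub a b by auto
  have "vol Y = 2" using vol_S(1)[OF Y(2,3)] Y(1) by auto
  hence "vol2_basis Y" using Y unfolding vol2_basis_def by blast
  moreover have "a \<noteq> b" using a b u by auto
  ultimately show ?thesis using Y(1) J(2) by (intro exI[of _ Y]) auto
qed

lemma notS: "p a \<noteq> 0 \<Longrightarrow> a \<notin> S"
  using pS by blast

text \<open>After exchanging \<open>i\<close> for \<open>a\<close>, the element \<open>c\<close> has the coordinate \<plusminus>2 at \<open>j\<close>.\<close>

lemma two_diag:
  assumes u: "u \<in> U" "u' \<in> U" "u' \<noteq> u" "u' \<noteq> - u" and ij: "i \<in> S" "j \<in> S" "i \<noteq> j" and \<alpha>: "\<alpha> = 1 \<or> \<alpha> = (-1::real)"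
    and a: "a \<in> A" "b \<in> A" "p a = u" "p b = u" "a = b + i + \<alpha> *\<^sub>R j"
    and c: "c \<in> A" "d \<in> A" "p c = u'" "p d = u'" "c = d + i - \<alpha> *\<^sub>R j"
  shows False
proof -
  obtain Y where Y: "vol2_basis Y" "S \<subseteq> Y" "b \<in> Y" "d \<in> Y" "b \<notin> S" "d \<notin> S" "b \<noteq> d" using vol2_basis_start[OF u a(2,4) c(2,4)] by blast
  have "a - 1 *\<^sub>R i = b + \<alpha> *\<^sub>R j" using a(5) by simp
  moreover have "b + \<alpha> *\<^sub>R j \<in> span (Y - {i})" using Y ij by (intro span_add span_scale span_base) auto
  ultimately have "a - 1 *\<^sub>R i \<in> span (Y - {i})" by metis
  hence Y1: "vol2_basis (insert a (Y - {i}))" by (rule vol2_basis_exch[OF Y(1) a(1) subsetD[OF Y(2) ij(1)]]) simp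
  have aS: "a \<notin> S" using notS a(3) U0[OF u(1)] by blast
  have e: "(-2 * \<alpha>) *\<^sub>R j = - (\<alpha> *\<^sub>R j) - \<alpha> *\<^sub>R j" by (simp flip: scaleR_minus_left scaleR_diff_left)
  have "c - (-2 * \<alpha>) *\<^sub>R j = d + a - b" unfolding e a(5) c(5) by simp
  moreover have "d + a - b \<in> span (insert a (Y - {i}) - {j})"
    using Y ij aS by (intro span_diff span_add span_base) auto
  ultimately have "c - (-2 * \<alpha>) *\<^sub>R j \<in> span (insert a (Y - {i}) - {j})" by metis
  moreover have "j \<in> insert a (Y - {i})" using Y(2) ij by auto
  ultimately have "\<bar>-2 * \<alpha>\<bar> \<le> 1" using vol2_basis_coeff[OF Y1 c(1)] by blast
  thus False using \<alpha> by auto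
qed

text \<open>By \<open>base_int\<close>, the points over the origin other than \<open>S\<close> and \<open>- S\<close>.\<close>

definition half_points :: "'a set" where "half_points = {a \<in> A. p a = 0 \<and> \<not> int_coords a}"

lemma half_points_q: assumes h: "h \<in> half_points" and i: "i \<in> S" shows "q i h = 1/2 \<or> q i h = -1/2"
proof -
  have hA: "h \<in> A" "p h = 0" "\<not> int_coords h" using h unfolding half_points_def by auto
  have b: "\<bar>q i h\<bar> \<le> 1" using base_bound hA i by blast
  have "q i h - 1/2 \<in> \<int>" using q_half[OF AL[OF hA(1)] i] hA by blast
  then obtain n :: int where n: "q i h - 1/2 = of_int n" by (auto elim: Ints_cases)
  hence "n = 0 \<or> n = -1" using b by linarith
  thus ?thesis using n by auto
qed

lemma half_points_expand: "h \<in> half_points \<Longrightarrow> h = (\<Sum>i\<in>S. q i h *\<^sub>R i)"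
  using kerD[of h] unfolding half_points_def by blast

lemma sum_split3:
  fixes f :: "'a \<Rightarrow> 'a"
  assumes "i \<in> S" "j \<in> S" "k \<in> S" "i \<noteq> j" "i \<noteq> k" "j \<noteq> k"
  shows "(\<Sum>m\<in>S. f m) = f i + (f j + (f k + (\<Sum>m\<in>S - {i} - {j} - {k}. f m)))"
  using assms S_fin sum.remove[of S i f] sum.remove[of "S - {i}" j f] sum.remove[of "S - {i} - {j}" k f] by simp

text \<open>For the diagonals \<open>i + \<alpha> j\<close> and \<open>i + \<beta> k\<close> of the squares choose signs such that subtracting suitable multiples of them from \<open>h\<close> cancels \<open>j\<close> and \<open>k\<close> but adds up at \<open>i\<close>. After exchanging \<open>j\<close> for \<open>a\<close> and \<open>k\<close> for \<open>c\<close>, the coordinate of \<open>h\<close> at \<open>i\<close> grows from \<plusminus>1/2 to \<plusminus>3/2.\<close>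

lemma square_share:
  assumes u: "u \<in> U" "u' \<in> U" "u' \<noteq> u" "u' \<noteq> - u" and s: "square u \<tau>" "square u' \<tau>'"
    and I: "I u \<tau> = {i, j}" "I u' \<tau>' = {i, k}" "i \<noteq> j" "i \<noteq> k" "j \<noteq> k" and h: "h \<in> half_points"
  shows False
proof -
  have S3: "i \<in> S" "j \<in> S" "k \<in> S" using I_sub[of u \<tau>] I_sub[of u' \<tau>'] I by auto
  define \<alpha> where "\<alpha> = - 4 * q i h * q j h"
  define \<beta> where "\<beta> = - 4 * q i h * q k h"
  note qv = half_points_q[OF h S3(1)] half_points_q[OF h S3(2)] half_points_q[OF h S3(3)]
  have \<alpha>: "\<alpha> = 1 \<or> \<alpha> = -1" and \<beta>: "\<beta> = 1 \<or> \<beta> = -1" unfolding \<alpha>_def \<beta>_def by (rule half_prod(1); fact qv)+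
  obtain a b where a: "a \<in> A" "b \<in> A" "p a = u" "p b = u" "a = b + i + \<alpha> *\<^sub>R j" using square_diag[OF u(1) s(1) I(1,3) \<alpha>] by blast
  obtain c d where c: "c \<in> A" "d \<in> A" "p c = u'" "p d = u'" "c = d + i + \<beta> *\<^sub>R k" using square_diag[OF u(2) s(2) I(2,4) \<beta>] by blast
  obtain Y where Y: "vol2_basis Y" "S \<subseteq> Y" "b \<in> Y" "d \<in> Y" "b \<notin> S" "d \<notin> S" "b \<noteq> d" using vol2_basis_start[OF u a(2,4) c(2,4)] by blast
  have aS: "a \<notin> S" and cS: "c \<notin> S" using notS a(3) c(3) U0 u by auto
  have e1: "a - \<alpha> *\<^sub>R j = b + i" using a(5) by simp
  have "b + i \<in> span (Y - {j})" using Y S3 I by (intro span_add span_base) auto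
  hence Y1: "vol2_basis (insert a (Y - {j}))" unfolding e1[symmetric] by (rule vol2_basis_exch[OF Y(1) a(1) subsetD[OF Y(2) S3(2)]]) (use \<alpha> in auto)
  let ?Y1 = "insert a (Y - {j})"
  have e2: "c - \<beta> *\<^sub>R k = d + i" using c(5) by simp
  have "d + i \<in> span (?Y1 - {k})" using Y S3 I by (intro span_add span_base) auto
  moreover have "k \<in> ?Y1" using Y(2) S3 I by auto
  ultimately have Y2: "vol2_basis (insert c (?Y1 - {k}))" unfolding e2[symmetric] by (intro vol2_basis_exch[OF Y1 c(1)]) (use \<beta> in auto)
  let ?Y2 = "insert c (?Y1 - {k})"
  have j: "j = \<alpha> *\<^sub>R (a - b - i)" and k: "k = \<beta> *\<^sub>R (c - d - i)" using a(5) c(5) \<alpha> \<beta> by auto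
  have R: "h - (3 * q i h) *\<^sub>R i = (q j h * \<alpha>) *\<^sub>R (a - b) + (q k h * \<beta>) *\<^sub>R (c - d) + (\<Sum>m\<in>S - {i} - {j} - {k}. q m h *\<^sub>R m)"
  proof -
    define X where "X = (\<Sum>m\<in>S - {i} - {j} - {k}. q m h *\<^sub>R m)"
    have "h = q i h *\<^sub>R i + (q j h *\<^sub>R j + (q k h *\<^sub>R k + X))"
      unfolding X_def using half_points_expand[OF h] sum_split3[OF S3 I(3,4,5), of "\<lambda>m. q m h *\<^sub>R m"] by metis
    moreover have "q j h *\<^sub>R j = (q j h * \<alpha>) *\<^sub>R (a - b) - (q j h * \<alpha>) *\<^sub>R i" using j by (metis scaleR_scaleR scaleR_diff_right)
    moreover have "q k h *\<^sub>R k = (q k h * \<beta>) *\<^sub>R (c - d) - (q k h * \<beta>) *\<^sub>R i" using k by (metis scaleR_scaleR scaleR_diff_right)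
    moreover have "q j h * \<alpha> = - q i h" "q k h * \<beta> = - q i h" unfolding \<alpha>_def \<beta>_def by (rule half_prod(2); fact qv)+
    ultimately have "h = q i h *\<^sub>R i + (((q j h * \<alpha>) *\<^sub>R (a - b) + q i h *\<^sub>R i) + (((q k h * \<beta>) *\<^sub>R (c - d) + q i h *\<^sub>R i) + X))" by (metis diff_minus_eq_add scaleR_minus_left)
    hence "h - (3 * q i h) *\<^sub>R i = q i h *\<^sub>R i + (((q j h * \<alpha>) *\<^sub>R (a - b) + q i h *\<^sub>R i) + (((q k h * \<beta>) *\<^sub>R (c - d) + q i h *\<^sub>R i) + X)) - (3 * q i h) *\<^sub>R i" by (rule arg_cong)
    also have "(3 * q i h) *\<^sub>R i = q i h *\<^sub>R i + q i h *\<^sub>R i + q i h *\<^sub>R i" by (rule scaleR_triple)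
    finally show ?thesis unfolding X_def[symmetric] by (simp add: scaleR_triple)
  qed
  have "(q j h * \<alpha>) *\<^sub>R (a - b) + (q k h * \<beta>) *\<^sub>R (c - d) + (\<Sum>m\<in>S - {i} - {j} - {k}. q m h *\<^sub>R m) \<in> span (?Y2 - {i})"
  proof (intro span_add span_scale span_sum)
    show "a - b \<in> span (?Y2 - {i})" using Y S3 aS by (intro span_diff span_base) auto
    show "c - d \<in> span (?Y2 - {i})" using Y S3 cS by (intro span_diff span_base) auto
    show "m \<in> span (?Y2 - {i})" if "m \<in> S - {i} - {j} - {k}" for m using that Y(2) by (intro span_base) auto
  qed
  hence "h - (3 * q i h) *\<^sub>R i \<in> span (?Y2 - {i})" using R by metis
  moreover have "h \<in> A" using h unfolding half_points_def by auto
  moreover have "i \<in> ?Y2" using Y(2) S3 I by auto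
  ultimately have "\<bar>3 * q i h\<bar> \<le> 1" using vol2_basis_coeff[OF Y2] by blast
  thus False using qv(1) by auto
qed

text \<open>For the diagonals \<open>i + \<alpha> j\<close> and \<open>k + \<beta> l\<close> of the squares choose signs such that cancelling \<open>j\<close> and \<open>l\<close> in \<open>h\<close> doubles the coordinates at \<open>i\<close> and \<open>k\<close>. After exchanging \<open>j\<close> for \<open>a\<close>, \<open>l\<close> for \<open>c\<close> and \<open>i\<close> for \<open>h\<close>, the coordinate of \<open>h'\<close> at \<open>k\<close> is \<plusminus>2.\<close>

lemma square_disjoint_flip:
  assumes u: "u \<in> U" "u' \<in> U" "u' \<noteq> u" "u' \<noteq> - u" and s: "square u \<tau>" "square u' \<tau>'"
    and I: "I u \<tau> = {i, j}" "I u' \<tau>' = {k, l}" "i \<noteq> j" "k \<noteq> l" "{i, j} \<inter> {k, l} = {}" and S4: "S = {i, j, k, l}"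
    and h: "h \<in> half_points" "h' \<in> half_points" "q i h' = q i h" "q j h' = q j h" "q k h' = - q k h" "q l h' = - q l h"
  shows False
proof -
  have mem: "i \<in> S" "j \<in> S" "k \<in> S" "l \<in> S" and ne: "i \<noteq> k" "i \<noteq> l" "j \<noteq> k" "j \<noteq> l" using S4 I by auto
  define \<alpha> where "\<alpha> = - 4 * q i h * q j h"
  define \<beta> where "\<beta> = - 4 * q k h * q l h"
  note qv = half_points_q[OF h(1) mem(1)] half_points_q[OF h(1) mem(2)] half_points_q[OF h(1) mem(3)] half_points_q[OF h(1) mem(4)]
  have \<alpha>: "\<alpha> = 1 \<or> \<alpha> = -1" and \<beta>: "\<beta> = 1 \<or> \<beta> = -1" unfolding \<alpha>_def \<beta>_def by (rule half_prod(1); fact qv)+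
  obtain a b where a: "a \<in> A" "b \<in> A" "p a = u" "p b = u" "a = b + i + \<alpha> *\<^sub>R j" using square_diag[OF u(1) s(1) I(1,3) \<alpha>] by blast
  obtain c d where c: "c \<in> A" "d \<in> A" "p c = u'" "p d = u'" "c = d + k + \<beta> *\<^sub>R l" using square_diag[OF u(2) s(2) I(2,4) \<beta>] by blast
  obtain Y where Y: "vol2_basis Y" "S \<subseteq> Y" "b \<in> Y" "d \<in> Y" "b \<notin> S" "d \<notin> S" "b \<noteq> d" using vol2_basis_start[OF u a(2,4) c(2,4)] by blast
  have aS: "a \<notin> S" and cS: "c \<notin> S" using notS a(3) c(3) U0 u by auto
  have e1: "a - \<alpha> *\<^sub>R j = b + i" using a(5) by simp
  have "b + i \<in> span (Y - {j})" using Y mem I ne by (intro span_add span_base) auto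
  hence Y1: "vol2_basis (insert a (Y - {j}))" unfolding e1[symmetric] by (rule vol2_basis_exch[OF Y(1) a(1) subsetD[OF Y(2) mem(2)]]) (use \<alpha> in auto)
  let ?Y1 = "insert a (Y - {j})"
  have e2: "c - \<beta> *\<^sub>R l = d + k" using c(5) by simp
  have "d + k \<in> span (?Y1 - {l})" using Y mem I ne by (intro span_add span_base) auto
  moreover have "l \<in> ?Y1" using Y(2) mem ne by auto
  ultimately have Y2: "vol2_basis (insert c (?Y1 - {l}))" unfolding e2[symmetric] by (intro vol2_basis_exch[OF Y1 c(1)]) (use \<beta> in auto)
  let ?Y2 = "insert c (?Y1 - {l})"
  have j: "j = \<alpha> *\<^sub>R (a - b - i)" and l: "l = \<beta> *\<^sub>R (c - d - k)" using a(5) c(5) \<alpha> \<beta> by auto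
  have hh: "x = q i x *\<^sub>R i + (q j x *\<^sub>R j + (q k x *\<^sub>R k + q l x *\<^sub>R l))" if "x \<in> half_points" for x
    using half_points_expand[OF that] ne I S4 by simp
  have hj: "q j h *\<^sub>R j = (q j h * \<alpha>) *\<^sub>R (a - b) + q i h *\<^sub>R i" 
  proof -
    have "q j h *\<^sub>R j = (q j h * \<alpha>) *\<^sub>R (a - b) - (q j h * \<alpha>) *\<^sub>R i" using j by (metis scaleR_scaleR scaleR_diff_right)
    moreover have "q j h * \<alpha> = - q i h" unfolding \<alpha>_def by (rule half_prod(2); fact qv)
    ultimately show ?thesis by (metis diff_minus_eq_add scaleR_minus_left)
  qed
  have hl: "q l h *\<^sub>R l = (q l h * \<beta>) *\<^sub>R (c - d) + q k h *\<^sub>R k" 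
  proof -
    have "q l h *\<^sub>R l = (q l h * \<beta>) *\<^sub>R (c - d) - (q l h * \<beta>) *\<^sub>R k" using l by (metis scaleR_scaleR scaleR_diff_right)
    moreover have "q l h * \<beta> = - q k h" unfolding \<beta>_def by (rule half_prod(2); fact qv)
    ultimately show ?thesis by (metis diff_minus_eq_add scaleR_minus_left)
  qed
  have R1: "h - (2 * q i h) *\<^sub>R i = (q j h * \<alpha>) *\<^sub>R (a - b) + (q k h *\<^sub>R k + ((q l h * \<beta>) *\<^sub>R (c - d) + q k h *\<^sub>R k))"
  proof -
    have "h = q i h *\<^sub>R i + (((q j h * \<alpha>) *\<^sub>R (a - b) + q i h *\<^sub>R i) + (q k h *\<^sub>R k + ((q l h * \<beta>) *\<^sub>R (c - d) + q k h *\<^sub>R k)))"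
      using hh[OF h(1)] unfolding hj hl .
    hence "h - (2 * q i h) *\<^sub>R i = q i h *\<^sub>R i + (((q j h * \<alpha>) *\<^sub>R (a - b) + q i h *\<^sub>R i) + (q k h *\<^sub>R k + ((q l h * \<beta>) *\<^sub>R (c - d) + q k h *\<^sub>R k))) - (2 * q i h) *\<^sub>R i" by (rule arg_cong)
    also have "(2 * q i h) *\<^sub>R i = q i h *\<^sub>R i + q i h *\<^sub>R i" by (rule scaleR_double)
    finally show ?thesis by (simp add: scaleR_double)
  qed
  have hA: "h \<in> A" "h' \<in> A" "p h = 0" using h unfolding half_points_def by auto
  have "(q j h * \<alpha>) *\<^sub>R (a - b) + (q k h *\<^sub>R k + ((q l h * \<beta>) *\<^sub>R (c - d) + q k h *\<^sub>R k)) \<in> span (?Y2 - {i})"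
  proof (intro span_add span_scale)
    show "a - b \<in> span (?Y2 - {i})" using Y mem aS by (intro span_diff span_base) auto
    show "c - d \<in> span (?Y2 - {i})" using Y mem cS by (intro span_diff span_base) auto
    show "k \<in> span (?Y2 - {i})" "k \<in> span (?Y2 - {i})" using Y(2) mem ne I by (auto intro!: span_base)
  qed
  hence "h - (2 * q i h) *\<^sub>R i \<in> span (?Y2 - {i})" using R1 by metis
  moreover have "i \<in> ?Y2" using Y(2) mem ne I by auto
  ultimately have Y3: "vol2_basis (insert h (?Y2 - {i}))" by (intro vol2_basis_exch[OF Y2 hA(1)]) (use qv(1) in auto)
  let ?Y3 = "insert h (?Y2 - {i})"
  have hh2: "h' = q i h *\<^sub>R i + (q j h *\<^sub>R j + (- (q k h *\<^sub>R k) - q l h *\<^sub>R l))"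
    using hh[OF h(2)] unfolding h(3-6) by simp
  have "h' = h - (q k h *\<^sub>R k + q k h *\<^sub>R k) - (q l h *\<^sub>R l + q l h *\<^sub>R l)"
    by (subst hh2, subst (5) hh[OF h(1)]) (simp add: algebra_simps)
  also have "\<dots> = h - (2 * (q l h * \<beta>)) *\<^sub>R (c - d) - (4 * q k h) *\<^sub>R k"
  proof -
    have "(4 * q k h) *\<^sub>R k = q k h *\<^sub>R k + q k h *\<^sub>R k + q k h *\<^sub>R k + q k h *\<^sub>R k" by (simp flip: scaleR_add_left)
    moreover have "(2 * (q l h * \<beta>)) *\<^sub>R (c - d) = (q l h * \<beta>) *\<^sub>R (c - d) + (q l h * \<beta>) *\<^sub>R (c - d)" by (simp only: mult_2 scaleR_add_left)
    ultimately show ?thesis unfolding hl by simp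
  qed
  finally have R2: "h' - (- (4 * q k h)) *\<^sub>R k = h - (2 * (q l h * \<beta>)) *\<^sub>R (c - d)" by simp
  have "q i k = 0" using qdual[of i k] subsetD[OF Y0(1)] mem ne by auto
  hence kh: "k \<noteq> h" using qv(1) by auto
  have kn: "k \<noteq> c" "k \<noteq> d" using mem(3) Y(6) cS by auto
  have cdY: "c \<in> ?Y3" "d \<in> ?Y3" using Y cS aS mem by auto
  have "h - (2 * (q l h * \<beta>)) *\<^sub>R (c - d) \<in> span (?Y3 - {k})"
    using kh kn cdY by (intro span_diff span_scale span_base) auto
  hence "h' - (- (4 * q k h)) *\<^sub>R k \<in> span (?Y3 - {k})" unfolding R2 .
  moreover have "k \<in> ?Y3" using Y(2) mem ne I by auto
  ultimately have "\<bar>- (4 * q k h)\<bar> \<le> 1" using vol2_basis_coeff[OF Y3 hA(2)] by blast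
  thus False using qv(3) by auto
qed

end

section \<open>Counting over the fibres\<close>

lemma card_two_fibres:
  assumes X: "finite X" and D: "f ` X \<subseteq> D" "finite D" and f: "\<And>d. d \<in> D \<Longrightarrow> card {x \<in> X. f x = d} \<le> 2"
  shows "card X \<le> 2 * card D"
proof -
  have "card X = (\<Sum>v\<in>f ` X. card {x \<in> X. f x = v})" by (rule card_fibres[OF X])
  also have "\<dots> \<le> (\<Sum>v\<in>f ` X. 2)" using f D(1) by (intro sum_mono) auto
  also have "\<dots> \<le> 2 * card D" using card_mono[OF D(2,1)] by simp
  finally show ?thesis .
qed

context flat
begin

definition squares :: "('a \<times> bool) set" where "squares = {x \<in> U \<times> UNIV. square (fst x) (snd x)}"
text \<open>The directions whose fibre has width 1 in coordinate \<open>i\<close>.\<close>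

definition N :: "'a \<Rightarrow> 'a set" where "N i = {u \<in> U. w i u = 2}"

lemma U_fin: "finite U" and U_sym: "u \<in> U \<Longrightarrow> - u \<in> U"
  using unimodD[OF U_unimod] by auto

lemma squares_fin: "finite squares"
  unfolding squares_def using U_fin by simp

lemma card_A_le:
  "card A \<le> card {a \<in> A. p a = 0} + card U + ((\<Sum>i\<in>S. card (N i)) + card M) + card squares"
proof -
  have z: "0 \<in> p ` A"
  proof -
    obtain i where "i \<in> S" using S_ne by blast
    thus ?thesis using pS[of i] S_sub by (intro image_eqI[of _ _ i]) auto
  qed
  have MU: "M \<subseteq> U" unfolding M_def by auto
  have f: "finite (p ` A)" using finA by simp
  have ind: "(\<Sum>u\<in>U. if u \<in> M then 1 else (0::nat)) = card M" using card_indicator[OF U_fin, of M] MU by (simp only: Int_absorb1)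
  have c: "card A = card {a \<in> A. p a = 0} + (\<Sum>u\<in>U. card {a \<in> A. p a = u})"
    unfolding U_def card_fibres[OF finA, of p] by (rule sum.remove[OF f z])
  have N: "(\<Sum>u\<in>U. card {i \<in> S. w i u = 2}) = (\<Sum>i\<in>S. card (N i))"
  proof -
    have e: "card {x \<in> Y. P x} = (\<Sum>x\<in>Y. if P x then 1 else 0)" if "finite Y" for P and Y :: "'a set"
      using that by (simp add: sum.If_cases Int_def)
    show ?thesis unfolding N_def e[OF S_fin] e[OF U_fin] by (rule sum.swap)
  qed
  have Q: "(\<Sum>u\<in>U. (if square u True then 1 else 0) + (if square u False then 1 else 0)) = card squares"
  proof -
    have "card squares = (\<Sum>x\<in>U \<times> UNIV. if square (fst x) (snd x) then 1 else 0)"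
      unfolding squares_def using U_fin by (simp add: sum.If_cases Int_def)
    moreover have "\<dots> = (\<Sum>u\<in>U. \<Sum>\<tau>\<in>UNIV. if square u \<tau> then 1 else 0)"
      by (subst sum.cartesian_product) (simp add: split_beta)
    moreover have "\<dots> = (\<Sum>u\<in>U. (if square u True then 1 else 0) + (if square u False then 1 else 0))"
      by (intro sum.cong refl) (simp add: UNIV_bool)
    ultimately show ?thesis by simp
  qed
  have "(\<Sum>u\<in>U. card {a \<in> A. p a = u}) \<le> (\<Sum>u\<in>U. 1 + card {i \<in> S. w i u = 2} + (if u \<in> M then 1 else 0)
     + ((if square u True then 1 else 0) + (if square u False then 1 else 0)))" (is "?l \<le> ?r") by (rule sum_mono) (rule card_fibre)
  moreover have "?r = card U + (\<Sum>u\<in>U. card {i \<in> S. w i u = 2}) + card M + (\<Sum>u\<in>U. (if square u True then 1 else 0) + (if square u False then 1 else 0))"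
    by (simp only: sum.distrib ind) simp
  ultimately show ?thesis using c N Q by linarith
qed

text \<open>A direction in \<open>M - N i\<close> has width 1/2, so it is counted by \<open>weight_bound\<close> with weight 1.\<close>

lemma weight_N: assumes i: "i \<in> S"
  shows "3 * card (N i) + card (M - N i) + (if M - N i = {} then 0 else 1) \<le> 6 * dim U"
proof -
  have MU: "M \<subseteq> U" unfolding M_def by auto
  have NU: "N i \<subseteq> U" unfolding N_def by auto
  have one: "w i u = 1" if "u \<in> M - N i" for u
    using that MU w_M[of u i] w_real(2)[of u i] i unfolding N_def by fastforce
  have f: "finite (N i)" "finite (M - N i)" using U_fin NU MU finite_subset by blast+
  have s1: "(\<Sum>u\<in>N i. wt (w i u)) = 3 * card (N i)" by (simp add: wt_def N_def)
  have s2: "(\<Sum>u\<in>M - N i. wt (w i u)) = card (M - N i)" by (simp add: wt_def one)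
  have "3 * card (N i) + card (M - N i) = (\<Sum>u\<in>N i. wt (w i u)) + (\<Sum>u\<in>M - N i. wt (w i u))"
    unfolding s1 s2 ..
  also have "\<dots> = (\<Sum>u\<in>N i \<union> (M - N i). wt (w i u))" using f by (intro sum.union_disjoint[symmetric]) auto
  also have "\<dots> \<le> (\<Sum>u\<in>U. wt (w i u))" using MU NU U_fin by (intro sum_mono2) auto
  finally have a: "3 * card (N i) + card (M - N i) \<le> (\<Sum>u\<in>U. wt (w i u))" .
  have b: "(if M - N i = {} then 0 else 1) \<le> (if \<exists>u\<in>U. w i u = 1 then 1 else (0::nat))"
    using one MU by auto
  show ?thesis using weight_bound[OF U_unimod w_circuit[OF i]] a b by linarith
qed

text \<open>Compare all coordinates with one for which \<open>N i\<close> is largest. Since \<open>card S + 1\<close> is at least 3, trading elements of \<open>N i\<close> for elements of \<open>M - N i\<close> does not increase the total.\<close>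

lemma N_M_bound:
  assumes s: "card S \<ge> 2"
  shows "(\<Sum>i\<in>S. card (N i)) + card M \<le> 2 * dim U * (card S + 1)"
    and "\<lbrakk>(\<Sum>i\<in>S. card (N i)) + card M = 2 * dim U * (card S + 1); i \<in> S\<rbrakk> \<Longrightarrow> N i = M \<and> card M = 2 * dim U"
proof -
  define s' where "s' = card S"
  define r where "r = dim U"
  have fM: "finite M" "finite (N i)" for i using U_fin unfolding M_def N_def by auto
  obtain i0 where i0: "i0 \<in> S" "\<And>i. i \<in> S \<Longrightarrow> card (N i) \<le> card (N i0)"
  proof -
    have "finite ((\<lambda>i. card (N i)) ` S)" "(\<lambda>i. card (N i)) ` S \<noteq> {}" using S_fin S_ne by auto
    from Max_in[OF this] obtain i0 where "i0 \<in> S" "card (N i0) = Max ((\<lambda>i. card (N i)) ` S)" by auto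
    moreover from this have "card (N i) \<le> card (N i0)" if "i \<in> S" for i using that S_fin by (auto intro: Max_ge)
    ultimately show ?thesis using that by blast
  qed
  define n where "n = card (N i0)"
  define d where "d = card (M - N i0)"
  have sum_le: "(\<Sum>i\<in>S. card (N i)) \<le> s' * n" using sum_bounded_above[of S "\<lambda>i. card (N i)" n] i0(2) unfolding n_def s'_def by simp
  have cM: "card M \<le> n + d"
  proof -
    have "card M \<le> card (N i0 \<union> (M - N i0))" using fM by (intro card_mono) auto
    also have "\<dots> \<le> n + d" unfolding n_def d_def by (rule card_Un_le)
    finally show ?thesis .
  qed
  have wb: "3 * n + d \<le> 6 * r" "d > 0 \<Longrightarrow> 3 * n + d < 6 * r"
  proof -
    show "3 * n + d \<le> 6 * r" using weight_N[OF i0(1)] unfolding n_def d_def r_def by linarith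
    assume "d > 0"
    hence "M - N i0 \<noteq> {}" unfolding d_def by (metis card.empty less_irrefl)
    thus "3 * n + d < 6 * r" using weight_N[OF i0(1)] unfolding n_def d_def r_def by simp
  qed
  have s2: "s' \<ge> 2" using s unfolding s'_def .
  then obtain t where t: "s' = t + 2" by (metis add.commute le_Suc_ex)
  have n2: "n \<le> 2 * r" using wb by linarith
  have tn: "t * n \<le> t * (2 * r)" using n2 by simp
  have main: "(\<Sum>i\<in>S. card (N i)) + card M \<le> t * n + 3 * n + d" using sum_le cM unfolding t by (simp add: algebra_simps)
  have rhs: "2 * r * (s' + 1) = t * (2 * r) + 6 * r" unfolding t by (simp add: algebra_simps)
  show "(\<Sum>i\<in>S. card (N i)) + card M \<le> 2 * dim U * (card S + 1)"
    using main rhs tn wb(1) unfolding r_def s'_def by linarith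
  assume eq: "(\<Sum>i\<in>S. card (N i)) + card M = 2 * dim U * (card S + 1)" and i: "i \<in> S"
  have d0: "d = 0" using main rhs tn wb eq unfolding r_def[symmetric] s'_def[symmetric] by linarith
  have nr: "n = 2 * r" using main rhs tn wb(1) eq d0 n2 unfolding r_def[symmetric] s'_def[symmetric] by linarith
  have "s' * n + n = 2 * r * (s' + 1)" unfolding nr by (simp add: algebra_simps)
  hence all: "(\<Sum>i\<in>S. card (N i)) = s' * n" "card M = n" using sum_le cM d0 eq unfolding r_def[symmetric] s'_def[symmetric] by linarith+
  have eqn: "card (N i) = n"
  proof (rule ccontr)
    assume "card (N i) \<noteq> n"
    hence "card (N i) < n" using i0(2)[OF i] unfolding n_def by simp
    hence "(\<Sum>i\<in>S. card (N i)) < (\<Sum>i\<in>S. n)" using i0(2) i S_fin unfolding n_def by (intro sum_strict_mono_ex1) auto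
    thus False using all(1) unfolding s'_def by simp
  qed
  have "card (M - N i) = 0" using weight_N[OF i] nr eqn unfolding r_def by simp
  hence "M \<subseteq> N i" using fM by simp
  hence "M = N i" using card_subset_eq[OF fM(2)] eqn all(2) by simp
  thus "N i = M \<and> card M = 2 * dim U" using all(2) nr unfolding r_def by simp
qed

lemma int_coords_neg: "int_coords (- a) \<longleftrightarrow> int_coords a"
  unfolding int_coords_def by (simp add: qsimps)

lemma P_neg: "P (- u) \<tau> = uminus ` P u \<tau>"
proof -
  have sub: "uminus ` P u \<tau> \<subseteq> P (- u) \<tau>" for u
    unfolding P_def using symA int_coords_neg linear_neg[OF plin] by auto
  show ?thesis
  proof
    show "P (- u) \<tau> \<subseteq> uminus ` P u \<tau>"
    proof
      fix x assume "x \<in> P (- u) \<tau>"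
      hence "- x \<in> P u \<tau>" using sub[of "- u"] by auto
      thus "x \<in> uminus ` P u \<tau>" by (intro image_eqI[of _ _ "- x"]) auto
    qed
  qed (rule sub)
qed

lemma square_neg: "I (- u) \<tau> = I u \<tau>" "square (- u) \<tau> \<longleftrightarrow> square u \<tau>"
proof -
  show 1: "I (- u) \<tau> = I u \<tau>" unfolding I_def P_neg by (simp add: qsimps)
  have "card (P (- u) \<tau>) = card (P u \<tau>)" unfolding P_neg by (rule card_image) simp
  thus "square (- u) \<tau> \<longleftrightarrow> square u \<tau>" unfolding square_def 1 by simp
qed

text \<open>A square contains both of its diagonals, so two squares in the same coordinates provide the configuration excluded by \<open>two_diag\<close>.\<close>

lemma square_ne:
  assumes u: "u \<in> U" "u' \<in> U" "u' \<noteq> u" "u' \<noteq> - u" and s: "square u \<tau>" "square u' \<tau>'"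
  shows "I u \<tau> \<noteq> I u' \<tau>'"
proof
  assume e: "I u \<tau> = I u' \<tau>'"
  obtain i j where I: "I u \<tau> = {i, j}" "i \<noteq> j" using s(1) unfolding square_def card_2_iff by blast
  have ij: "i \<in> S" "j \<in> S" using I_sub[of u \<tau>] I by auto
  obtain a b where a: "a \<in> A" "b \<in> A" "p a = u" "p b = u" "a = b + i + 1 *\<^sub>R j" using square_diag[OF u(1) s(1) I, of 1] by blast
  obtain c d where c: "c \<in> A" "d \<in> A" "p c = u'" "p d = u'" "c = d + i + (-1) *\<^sub>R j" using square_diag[OF u(2) s(2), of i j "-1"] I e by auto
  have "c = d + i - 1 *\<^sub>R j" using c(5) by simp
  from two_diag[OF u ij I(2) _ a c(1-4) this] show False by simp
qed

lemma square_disjoint: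
  assumes u: "u \<in> U" "u' \<in> U" "u' \<noteq> u" "u' \<noteq> - u" and s: "square u \<tau>" "square u' \<tau>'" and h: "h \<in> half_points"
  shows "I u \<tau> \<inter> I u' \<tau>' = {}"
proof (rule ccontr)
  assume "I u \<tau> \<inter> I u' \<tau>' \<noteq> {}"
  then obtain i where i: "i \<in> I u \<tau>" "i \<in> I u' \<tau>'" by blast
  have "\<exists>j. I u \<tau> = {i, j} \<and> i \<noteq> j" "\<exists>k. I u' \<tau>' = {i, k} \<and> i \<noteq> k" using s i unfolding square_def card_2_iff by auto
  then obtain j k where jk: "I u \<tau> = {i, j}" "i \<noteq> j" "I u' \<tau>' = {i, k}" "i \<noteq> k" by blast
  have "j \<noteq> k" using square_ne[OF u s] jk by auto
  from square_share[OF u s jk(1,3,2,4) this h] show False .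
qed

text \<open>Two squares are parallel of the same type, parallel of different types, or not parallel.\<close>

lemma squares_cases:
  assumes x: "(u, \<tau>) \<in> squares" "(u', \<tau>') \<in> squares"
  obtains "u' = u \<or> u' = - u" "\<tau>' = \<tau>" "I u' \<tau>' = I u \<tau>"
    | "u' = u \<or> u' = - u" "\<tau>' \<noteq> \<tau>" "I u \<tau> \<inter> I u' \<tau>' = {}"
    | "u' \<noteq> u" "u' \<noteq> - u" "I u' \<tau>' \<noteq> I u \<tau>" "half_points \<noteq> {} \<Longrightarrow> I u \<tau> \<inter> I u' \<tau>' = {}"
proof -
  have D: "u \<in> U" "u' \<in> U" "square u \<tau>" "square u' \<tau>'" using x unfolding squares_def by auto
  consider "u' = u \<or> u' = - u" "\<tau>' = \<tau>" | "u' = u \<or> u' = - u" "\<tau>' \<noteq> \<tau>" | "u' \<noteq> u" "u' \<noteq> - u" by blast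
  thus thesis
  proof cases
    case 1
    hence "I u' \<tau>' = I u \<tau>" using square_neg(1)[of u \<tau>] by auto
    thus thesis using that(1) 1 by blast
  next
    case 2
    hence "I u' \<tau>' = I u \<tau>'" using square_neg(1)[of u \<tau>'] by auto
    moreover have "I u \<tau> \<inter> I u \<tau>' = {}" using 2(2) I_disjoint[OF D(1)] by (cases \<tau>; cases \<tau>') auto
    ultimately show thesis using that(2)[OF 2] by simp
  next
    case 3
    show thesis
    proof (rule that(3)[OF 3])
      show "I u' \<tau>' \<noteq> I u \<tau>" using square_ne[OF D(1,2) 3 D(3,4)] by simp
      show "I u \<tau> \<inter> I u' \<tau>' = {}" if "half_points \<noteq> {}" using square_disjoint[OF D(1,2) 3 D(3,4)] that by blast
    qed
  qed
qed

lemma squares_fibre: "card {x \<in> squares. I (fst x) (snd x) = X} \<le> 2"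
proof (cases "{x \<in> squares. I (fst x) (snd x) = X} = {}")
  case True thus ?thesis by (metis card.empty zero_le)
next
  case False
  then obtain u \<tau> where u: "(u, \<tau>) \<in> squares" "I u \<tau> = X" by auto
  have ne: "X \<noteq> {}" using u unfolding squares_def square_def by auto
  have "{x \<in> squares. I (fst x) (snd x) = X} \<subseteq> {(u, \<tau>), (- u, \<tau>)}"
  proof
    fix x assume x: "x \<in> {x \<in> squares. I (fst x) (snd x) = X}"
    obtain u' \<tau>' where x': "x = (u', \<tau>')" by (cases x)
    have "(u', \<tau>') \<in> squares" "I u' \<tau>' = X" using x x' by auto
    from squares_cases[OF u(1) this(1)] this(2) u(2) ne show "x \<in> {(u, \<tau>), (- u, \<tau>)}" unfolding x' by cases auto
  qed
  from card_mono[OF _ this] show ?thesis using card_length[of "[(u, \<tau>), (- u, \<tau>)]"] by simp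
qed

lemma squares_I: assumes "x \<in> squares" shows "I (fst x) (snd x) \<subseteq> S" "card (I (fst x) (snd x)) = 2"
  using assms I_sub unfolding squares_def square_def by auto

lemma squares_bound: "card squares \<le> card S * (card S - 1)"
proof -
  let ?D = "{X. X \<subseteq> S \<and> card X = 2}"
  have "card squares \<le> 2 * card ?D"
    using squares_I squares_fin S_fin squares_fibre by (intro card_two_fibres[of squares "\<lambda>x. I (fst x) (snd x)"]) auto
  also have "\<dots> = 2 * (card S choose 2)" using n_subsets[OF S_fin] by simp
  also have "\<dots> = card S * (card S - 1)"
  proof -
    have "even (card S * (card S - 1))" by (cases "card S") auto
    thus ?thesis unfolding choose_two by (rule dvd_mult_div_cancel)
  qed
  finally show ?thesis .
qed

lemma squares_bound_half_points: assumes h: "half_points \<noteq> {}" shows "card squares \<le> 2 * (card S div 2)"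
proof -
  let ?D = "(\<lambda>x. I (fst x) (snd x)) ` squares"
  have "card squares \<le> 2 * card ?D"
    using squares_fin squares_fibre by (intro card_two_fibres[of squares "\<lambda>x. I (fst x) (snd x)"]) auto
  moreover have "2 * card ?D = card (\<Union>?D)"
  proof (rule card_partition)
    show "finite ?D" using squares_fin by simp
    show "finite (\<Union>?D)" using squares_fin I_fin by auto
    show "card c = 2" if "c \<in> ?D" for c using that squares_I(2) by auto
    show "X \<inter> Y = {}" if XY: "X \<in> ?D" "Y \<in> ?D" "X \<noteq> Y" for X Y
    proof -
      obtain x y where "x \<in> squares" "y \<in> squares" "X = I (fst x) (snd x)" "Y = I (fst y) (snd y)" using XY(1,2) by blast
      then obtain u \<tau> u' \<tau>' where u: "(u, \<tau>) \<in> squares" "(u', \<tau>') \<in> squares" "X = I u \<tau>" "Y = I u' \<tau>'" by (metis prod.collapse)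
      from squares_cases[OF u(1,2)] u(3,4) XY(3) h show ?thesis by cases auto
    qed
  qed
  moreover have "card (\<Union>?D) \<le> card S" using squares_I(1) by (intro card_mono[OF S_fin]) blast
  ultimately have "2 * card ?D \<le> card S" "card squares \<le> 2 * card ?D" by simp_all
  moreover have "c \<le> 2 * (s div 2)" if "2 * d \<le> s" "c \<le> 2 * d" for c d s :: nat
  proof -
    have "d \<le> s div 2" using that(1) by simp
    thus ?thesis using that(2) by linarith
  qed
  ultimately show ?thesis by blast
qed

definition pos_set :: "'a \<Rightarrow> 'a set" where "pos_set h = {i \<in> S. q i h > 0}"

lemma pos_set_inj: "inj_on pos_set half_points"
proof (rule inj_onI)
  fix h h' assume h: "h \<in> half_points" "h' \<in> half_points" "pos_set h = pos_set h'"
  have "q i h = q i h'" if i: "i \<in> S" for i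
  proof -
    have "q i h > 0 \<longleftrightarrow> q i h' > 0" using h(3) i unfolding pos_set_def by blast
    thus ?thesis using half_points_q[OF h(1) i] half_points_q[OF h(2) i] by auto
  qed
  thus "h = h'" using eq_of_pq h unfolding half_points_def by auto
qed

lemma card_half_points: "card half_points \<le> 2 ^ card S"
proof -
  have "card half_points \<le> card (Pow S)" using pos_set_inj S_fin by (intro card_inj_on_le[of pos_set]) (auto simp: pos_set_def)
  thus ?thesis using S_fin by (simp add: card_Pow)
qed

lemma card_base: "card {a \<in> A. p a = 0} \<le> 2 * card S + card half_points"
proof -
  have "{a \<in> A. p a = 0} \<subseteq> (S \<union> uminus ` S) \<union> half_points" using base_int unfolding half_points_def by blast
  moreover have "finite half_points" unfolding half_points_def using finA by simp
  ultimately have "card {a \<in> A. p a = 0} \<le> card ((S \<union> uminus ` S) \<union> half_points)" using S_fin by (intro card_mono) auto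
  also have "\<dots> \<le> card (S \<union> uminus ` S) + card half_points" by (rule card_Un_le)
  also have "card (S \<union> uminus ` S) \<le> card S + card (uminus ` S)" by (rule card_Un_le)
  also have "card (uminus ` S) = card S" by (rule card_image) simp
  finally show ?thesis by simp
qed

text \<open>By \<open>square_disjoint_flip\<close>, the sign patterns of half-integral points are disjoint from their images under the flip of two coordinates, so at most half of the sixteen patterns occur.\<close>

lemma card_half_points_flip:
  assumes s: "card S = 4" and x: "(u, \<tau>) \<in> squares" "(u', \<tau>') \<in> squares" "u' \<noteq> u" "u' \<noteq> - u" and h0: "half_points \<noteq> {}"
  shows "card half_points \<le> 8"
proof -
  have D: "u \<in> U" "u' \<in> U" "square u \<tau>" "square u' \<tau>'" using x unfolding squares_def by auto
  have dis: "I u \<tau> \<inter> I u' \<tau>' = {}" using square_disjoint[OF D(1,2) x(3,4) D(3,4)] h0 by blast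
  obtain i j k l where I: "I u \<tau> = {i, j}" "i \<noteq> j" "I u' \<tau>' = {k, l}" "k \<noteq> l" using D(3,4) unfolding square_def card_2_iff by metis
  have sub: "{i, j, k, l} \<subseteq> S" using I_sub[of u \<tau>] I_sub[of u' \<tau>'] I by auto
  have ne: "i \<noteq> k" "i \<noteq> l" "j \<noteq> k" "j \<noteq> l" using dis I by auto
  have S4: "S = {i, j, k, l}" using card_subset_eq[OF S_fin sub] s I ne by simp
  define \<phi> where "\<phi> X = (X - {k, l}) \<union> ({k, l} - X)" for X
  have inj: "inj_on \<phi> (Pow S)" unfolding inj_on_def \<phi>_def by blast
  let ?G = "pos_set ` half_points"
  have G: "?G \<subseteq> Pow S" unfolding pos_set_def by auto
  have "\<phi> ` ?G \<inter> ?G = {}"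
  proof (rule ccontr)
    assume "\<phi> ` ?G \<inter> ?G \<noteq> {}"
    then obtain h h' where h: "h \<in> half_points" "h' \<in> half_points" "pos_set h' = \<phi> (pos_set h)" by auto
    have pos: "y = x" if "x = 1/2 \<or> x = -1/2" "y = 1/2 \<or> y = -1/2" "0 < y \<longleftrightarrow> 0 < x" for x y :: real using that by auto
    have pos': "y = - x" if "x = 1/2 \<or> x = -1/2" "y = 1/2 \<or> y = -1/2" "0 < y \<longleftrightarrow> \<not> 0 < x" for x y :: real using that by auto
    have m: "m \<in> S \<Longrightarrow> 0 < q m h' \<longleftrightarrow> m \<in> \<phi> (pos_set h)" "m \<in> S \<Longrightarrow> m \<in> pos_set h \<longleftrightarrow> 0 < q m h" for m using h(3) unfolding pos_set_def by blast+
    have mem: "i \<in> S" "j \<in> S" "k \<in> S" "l \<in> S" using S4 by auto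
    have "0 < q i h' \<longleftrightarrow> 0 < q i h" "0 < q j h' \<longleftrightarrow> 0 < q j h" "0 < q k h' \<longleftrightarrow> \<not> 0 < q k h" "0 < q l h' \<longleftrightarrow> \<not> 0 < q l h"
      using m(1) m(2) mem ne unfolding \<phi>_def by auto
    hence "q i h' = q i h" "q j h' = q j h" "q k h' = - q k h" "q l h' = - q l h"
      using pos[OF half_points_q[OF h(1) mem(1)] half_points_q[OF h(2) mem(1)]] pos[OF half_points_q[OF h(1) mem(2)] half_points_q[OF h(2) mem(2)]]
        pos'[OF half_points_q[OF h(1) mem(3)] half_points_q[OF h(2) mem(3)]] pos'[OF half_points_q[OF h(1) mem(4)] half_points_q[OF h(2) mem(4)]] by blast+
    from square_disjoint_flip[OF D(1,2) x(3,4) D(3,4) I(1,3,2,4) _ S4 h(1,2) this] dis I show False by simp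
  qed
  hence "card (\<phi> ` ?G \<union> ?G) = card (\<phi> ` ?G) + card ?G" using finA unfolding half_points_def by (intro card_Un_disjoint) auto
  moreover have "card (\<phi> ` ?G) = card ?G" using inj_on_subset[OF inj G] by (rule card_image)
  moreover have "card ?G = card half_points" by (rule card_image[OF pos_set_inj])
  moreover have "\<phi> ` ?G \<union> ?G \<subseteq> Pow S" using G S4 unfolding \<phi>_def by auto
  hence "card (\<phi> ` ?G \<union> ?G) \<le> card (Pow S)" using S_fin by (intro card_mono) auto
  moreover have "card (Pow S) = 16" using S_fin s by (simp add: card_Pow)
  ultimately show ?thesis by linarith
qed

text \<open>All coordinates on \<open>S\<close> vary along squares over \<open>u\<close>. A tight count produces such a direction.\<close>

definition covered :: "'a \<Rightarrow> bool" where "covered u \<longleftrightarrow> u \<in> U \<and> (\<forall>i\<in>S. \<exists>\<tau>. square u \<tau> \<and> i \<in> I u \<tau>)"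

text \<open>The part of the count that does not depend on the dimension of \<open>U\<close>. For \<open>card S = 4\<close>, two nonparallel squares exclude half of the half-integral points over the origin, and parallel squares are either at most two or use all of \<open>S\<close>.\<close>

lemma Q_bound:
  assumes s: "card S \<in> {2, 3, 4}"
  shows "card {a \<in> A. p a = 0} + card squares + 2 \<le> card S * card S + 3 * card S \<or>
    (card S \<noteq> 3 \<and> (\<exists>u. covered u) \<and> card {a \<in> A. p a = 0} + card squares \<le> card S * card S + 3 * card S)"
proof (cases "half_points = {}")
  case True
  hence "card {a \<in> A. p a = 0} \<le> 2 * card S" using card_base by simp
  thus ?thesis using s squares_bound by auto
next
  case False
  note B = card_base card_half_points squares_bound_half_points[OF False]
  consider "card S = 2" "squares = {}" | "card S = 2" "squares \<noteq> {}" | "card S = 3" | "card S = 4" using s by blast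
  thus ?thesis
  proof cases
    case 1
    thus ?thesis using B by simp
  next
    case 2
    then obtain u \<tau> where u: "(u, \<tau>) \<in> squares" by auto
    have "I u \<tau> = S" using squares_I[OF u] 2 card_subset_eq[OF S_fin] by simp
    hence "covered u" using u unfolding covered_def squares_def by auto
    thus ?thesis using B 2 by auto
  next
    case 3
    thus ?thesis using B by simp
  next
    case 4
    consider "card squares \<le> 2" | u \<tau> u' \<tau>' where "(u, \<tau>) \<in> squares" "(u', \<tau>') \<in> squares" "u' \<noteq> u" "u' \<noteq> - u"
      | u \<tau> u' \<tau>' where "(u, \<tau>) \<in> squares" "(u', \<tau>') \<in> squares" "u' = u \<or> u' = - u" "\<tau>' \<noteq> \<tau>" "I u \<tau> \<inter> I u' \<tau>' = {}"
    proof (cases "squares = {}")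
      case True thus ?thesis using that(1) by simp
    next
      case ne: False
      then obtain u \<tau> where u: "(u, \<tau>) \<in> squares" by auto
      show ?thesis
      proof (cases "\<exists>x\<in>squares. I (fst x) (snd x) \<noteq> I u \<tau>")
        case True
        then obtain x where "x \<in> squares" "I (fst x) (snd x) \<noteq> I u \<tau>" by blast
        then obtain u' \<tau>' where u': "(u', \<tau>') \<in> squares" "I u' \<tau>' \<noteq> I u \<tau>" by (metis prod.collapse)
        from squares_cases[OF u u'(1)] u'(2) that(2,3)[OF u u'(1)] show ?thesis by cases auto
      next
        case c: False
        hence "squares = {x \<in> squares. I (fst x) (snd x) = I u \<tau>}" by blast
        hence "card squares \<le> 2" using squares_fibre[of "I u \<tau>"] by metis
        thus ?thesis using that(1) by blast
      qed
    qed
    thus ?thesis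
    proof cases
      case 1
      thus ?thesis using B 4 by simp
    next
      case 2
      thus ?thesis using B card_half_points_flip[OF 4 2 False] 4 by simp
    next
      case (3 u \<tau> u' \<tau>')
      have uU: "u \<in> U" and square: "square u \<tau>" "square u' \<tau>'" using 3 unfolding squares_def by auto
      have su: "I u' \<tau>' = I u \<tau>'" "square u \<tau>'" using 3(3) square_neg[of u \<tau>'] square(2) by auto
      have "card (I u \<tau> \<union> I u \<tau>') = 4" using 3(5) square su I_fin unfolding square_def by (simp add: card_Un_disjoint)
      hence "I u \<tau> \<union> I u \<tau>' = S" using card_subset_eq[OF S_fin, of "I u \<tau> \<union> I u \<tau>'"] I_sub 4 by simp
      hence "covered u" unfolding covered_def using uU square su by blast
      thus ?thesis using B 4 by auto
    qed
  qed
qed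

lemma differ_both:
  assumes v: "v \<in> U" and ij: "i \<in> I v \<tau>" "j \<in> I v \<tau>" "i \<noteq> j"
  shows "\<exists>\<alpha> a b. (\<alpha> = 1 \<or> \<alpha> = (-1::real)) \<and> a \<in> A \<and> b \<in> A \<and> p a = v \<and> p b = v \<and> a = b + i + \<alpha> *\<^sub>R j"
proof -
  obtain x x' where x: "x \<in> P v \<tau>" "x' \<in> P v \<tau>" "q i x \<noteq> q i x'" using ij(1) unfolding I_def by blast
  obtain y y' where y: "y \<in> P v \<tau>" "y' \<in> P v \<tau>" "q j y \<noteq> q j y'" using ij(2) unfolding I_def by blast
  have "\<exists>a\<in>P v \<tau>. \<exists>b\<in>P v \<tau>. q i a \<noteq> q i b \<and> q j a \<noteq> q j b"
  proof (cases "q j x = q j x'")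
    case False thus ?thesis using x by blast
  next
    case True
    obtain z where z: "z \<in> P v \<tau>" "q j z \<noteq> q j x" using y by metis
    thus ?thesis using x True by metis
  qed
  then obtain a b where ab: "a \<in> P v \<tau>" "b \<in> P v \<tau>" "q i a \<noteq> q i b" "q j a \<noteq> q j b" by blast
  have ijS: "i \<in> S" "j \<in> S" using ij I_sub by auto
  let ?D = "{k \<in> S. q k a \<noteq> q k b}"
  have "{i, j} \<subseteq> ?D" using ab ijS by auto
  moreover have "card ?D \<le> card {i, j}" using P_diff_card[OF v ab(1,2)] ij(3) by simp
  ultimately have D: "?D = {i, j}" using S_fin card_seteq[of ?D "{i, j}"] by simp
  note Pa = P_D[OF ab(1)] and Pb = P_D[OF ab(2)]
  have "a - b = (\<Sum>k\<in>S. (q k a - q k b) *\<^sub>R k)" using same_fibre[of a b] Pa Pb by simp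
  also have "\<dots> = (\<Sum>k\<in>{i, j}. (q k a - q k b) *\<^sub>R k)" using S_fin ijS D by (intro sum.mono_neutral_right) auto
  finally have e: "a - b = (q i a - q i b) *\<^sub>R i + (q j a - q j b) *\<^sub>R j" using ij(3) by simp
  have c: "q i a - q i b = 1 \<or> q i a - q i b = -1" "q j a - q j b = 1 \<or> q j a - q j b = -1"
    using P_diff[OF ab(1,2) v ijS(1)] P_diff[OF ab(1,2) v ijS(2)] ab(3,4) by auto
  have "(\<exists>\<alpha>. (\<alpha> = 1 \<or> \<alpha> = (-1::real)) \<and> a = b + i + \<alpha> *\<^sub>R j) \<or> (\<exists>\<alpha>. (\<alpha> = 1 \<or> \<alpha> = (-1::real)) \<and> b = a + i + \<alpha> *\<^sub>R j)"
    using c(1)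
  proof
    assume h: "q i a - q i b = 1"
    have "a = b + i + x" if "a - b = 1 *\<^sub>R i + x" for x using that by (simp add: algebra_simps)
    from this[OF e[unfolded h]] have "a = b + i + (q j a - q j b) *\<^sub>R j" .
    thus ?thesis using c(2) by blast
  next
    assume h: "q i a - q i b = -1"
    have "b = a + i + (- k) *\<^sub>R j" if "a - b = (-1) *\<^sub>R i + k *\<^sub>R j" for k using that by (simp add: algebra_simps)
    from this[OF e[unfolded h]] have "b = a + i + (- (q j a - q j b)) *\<^sub>R j" .
    moreover have "- (q j a - q j b) = 1 \<or> - (q j a - q j b) = -1" using c(2) by auto
    ultimately show ?thesis by blast
  qed
  thus ?thesis using Pa Pb by blast
qed

lemma lo_attained: assumes u: "u \<in> U" and i: "i \<in> I u \<tau>" shows "\<exists>a\<in>P u \<tau>. q i a = lo i u" "hi i u = lo i u + 1"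
proof -
  have iS: "i \<in> S" using i I_sub by blast
  have "w i u = 2" using w_two_iff[OF u iS] i by (cases \<tau>) auto
  thus h: "hi i u = lo i u + 1" using w_real(1)[OF u iS] by simp
  obtain a b where ab: "a \<in> P u \<tau>" "b \<in> P u \<tau>" "q i a = q i b + 1" using I_attained[OF u i] by blast
  have "q i a \<le> hi i u" "lo i u \<le> q i b" using lohi(3)[OF u] P_D[OF ab(1)] P_D[OF ab(2)] by auto
  hence "q i b = lo i u" using h ab(3) by simp
  thus "\<exists>a\<in>P u \<tau>. q i a = lo i u" using ab(2) by blast
qed

text \<open>If \<open>u + v\<close> were in \<open>U\<close>, its fibre would be a single point, whose coordinates are determined by the fibres over \<open>u\<close> and \<open>v\<close>. Integrality then transfers the property of \<open>i\<close> and \<open>j\<close> to vary in points of the same type from \<open>u\<close> to \<open>v\<close>.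
  So the fibre over \<open>v\<close> contains a diagonal in the coordinates \<open>i\<close>, \<open>j\<close>, and the square over \<open>u\<close> contains the opposite diagonal; \<open>two_diag\<close> excludes this.\<close>

lemma covered_isolated:
  assumes NM: "\<And>i. i \<in> S \<Longrightarrow> N i = M" and u: "covered u" and v: "v \<in> M" "v \<noteq> u" "v \<noteq> - u"
  shows "u + v \<notin> U"
proof
  assume y: "u + v \<in> U"
  have uU: "u \<in> U" "v \<in> U" using u v unfolding covered_def M_def by auto
  obtain i0 where "i0 \<in> S" using S_ne by blast
  then obtain \<tau> where \<tau>: "square u \<tau>" using u unfolding covered_def by blast
  obtain i j where I: "I u \<tau> = {i, j}" "i \<noteq> j" using \<tau> unfolding square_def card_2_iff by blast
  have ij: "i \<in> S" "j \<in> S" "i \<in> I u \<tau>" "j \<in> I u \<tau>" using I_sub[of u \<tau>] I by auto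
  have ind: "independent {u, v}" using unimod_indep_pair[OF U_unimod uU v(2,3)] .
  have sub: "{u, v} \<subseteq> U" using uU by auto
  have sum: "u + v = \<Sum>{u, v}" "sum f {u, v} = f u + f v" for f :: "'a \<Rightarrow> real" using v(2) by auto
  have wu: "hi k u = lo k u + 1" "hi k v = lo k v + 1" if k: "k \<in> S" for k
  proof -
    obtain \<tau>' where "k \<in> I u \<tau>'" using u k unfolding covered_def by blast
    thus "hi k u = lo k u + 1" by (rule lo_attained[OF uU(1)])
    have "w k v = 2" using NM[OF k] v(1) unfolding N_def by auto
    thus "hi k v = lo k v + 1" using w_real(1)[OF uU(2) k] by simp
  qed
  \<comment> \<open>Width 1 over \<open>u\<close> and over \<open>v\<close> leaves width 0 over \<open>u + v\<close>, and fixes the point.\<close>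
  have loy: "lo k (u + v) = lo k u + lo k v + 1" "hi k (u + v) = lo k (u + v)" if k: "k \<in> S" for k
  proof -
    have "hi k (u + v) - (lo k u + lo k v) \<le> 1" "lo k (u + v) - (hi k u + hi k v) \<ge> -1"
      using circuit_lohi[OF sub ind y sum(1) k] unfolding sum(2) by auto
    moreover have "lo k (u + v) \<le> hi k (u + v)"
    proof -
      obtain a where "a \<in> A" "p a = u + v" using lohi(1)[OF y] by blast
      from lohi(3)[OF y this, of k] show ?thesis by linarith
    qed
    ultimately show "lo k (u + v) = lo k u + lo k v + 1" "hi k (u + v) = lo k (u + v)" using wu[OF k] by linarith+
  qed
  obtain a where a: "a \<in> A" "p a = u + v" using lohi(1)[OF y] by blast
  have qa: "q k a = lo k u + lo k v + 1" if "k \<in> S" for k using lohi(3)[OF y a, of k] loy[OF that] by linarith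
  have "q i a - q j a \<in> \<int>" using q_int(2)[OF AL[OF a(1)] ij(1,2)] .
  hence Z: "(lo i u - lo j u) + (lo i v - lo j v) \<in> \<int>" using qa ij by (simp add: algebra_simps)
  obtain b where b: "b \<in> P u \<tau>" "q i b = lo i u" using lo_attained(1)[OF uU(1) ij(3)] by blast
  obtain b' where b': "b' \<in> P u \<tau>" "q j b' = lo j u" using lo_attained(1)[OF uU(1) ij(4)] by blast
  have "q i b - q j b \<in> \<int>" using q_int(2)[OF P_D(4)[OF b(1)] ij(1,2)] .
  moreover have "q j b - q j b' \<in> \<int>" using int_coords_diff[of b b' j] P_D[OF b(1)] P_D[OF b'(1)] ij by simp
  ultimately have "(q i b - q j b) + (q j b - q j b') \<in> \<int>" by (rule Ints_add)
  hence "lo i u - lo j u \<in> \<int>" using b b' by simp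
  from Ints_diff[OF Z this] have Zv: "lo i v - lo j v \<in> \<int>" by simp
  have "w i v = 2" "w j v = 2" using NM[OF ij(1)] NM[OF ij(2)] v(1) unfolding N_def by auto
  hence "i \<in> I v True \<union> I v False" "j \<in> I v True \<union> I v False" using w_two_iff[OF uU(2)] ij by auto
  then obtain \<tau>1 \<tau>2 where t: "i \<in> I v \<tau>1" "j \<in> I v \<tau>2" by blast
  obtain c where c: "c \<in> P v \<tau>1" "q i c = lo i v" using lo_attained(1)[OF uU(2) t(1)] by blast
  obtain c' where c': "c' \<in> P v \<tau>2" "q j c' = lo j v" using lo_attained(1)[OF uU(2) t(2)] by blast
  have "q j c - q i c \<in> \<int>" using q_int(2)[OF P_D(4)[OF c(1)] ij(2,1)] .
  from Ints_add[OF this Zv] have "q j c - q j c' \<in> \<int>" using c c' by simp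
  hence "int_coords c = int_coords c'" using int_coords_diff[of c c' j] P_D[OF c(1)] P_D[OF c'(1)] ij by simp
  hence "\<tau>1 = \<tau>2" using P_D[OF c(1)] P_D[OF c'(1)] by simp
  then obtain \<alpha> a b where ab: "\<alpha> = 1 \<or> \<alpha> = (-1::real)" "a \<in> A" "b \<in> A" "p a = v" "p b = v" "a = b + i + \<alpha> *\<^sub>R j"
    using differ_both[OF uU(2) t(1) _ I(2)] t by blast
  have "- \<alpha> = 1 \<or> - \<alpha> = -1" using ab(1) by auto
  then obtain c d where cd: "c \<in> A" "d \<in> A" "p c = u" "p d = u" "c = d + i + (- \<alpha>) *\<^sub>R j" using square_diag[OF uU(1) \<tau> I] by blast
  have cd': "c = d + i - \<alpha> *\<^sub>R j" using cd(5) by simp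
  have "u \<noteq> v" "u \<noteq> - v" using v by auto
  from two_diag[OF uU(2,1) this ij(1,2) I(2) ab cd(1-4) cd'] show False .
qed

lemma covered_neg: assumes "covered u" shows "covered (- u)"
  using assms U_sym unfolding covered_def square_neg by auto

text \<open>All fibres of positive width have width 1, so their directions contain no circuit and form a basis \<open>T\<close> of \<open>U\<close> up to sign, with a covered element \<open>u1\<close>. An element of \<open>U\<close> involving \<open>u1\<close> is a sum of at most two elements of this basis by the circuit bound, and isolation of \<open>u1\<close> excludes two. So up to \<open>u1\<close> and \<open>- u1\<close>, the set \<open>U\<close> lies in the span of \<open>T - {u1}\<close>, and Heller's theorem bounds it.\<close>

lemma not_tight:
  assumes NM: "\<And>i. i \<in> S \<Longrightarrow> N i = M" and cM: "card M = 2 * dim U" and u: "covered u" and r: "dim U \<ge> 2"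
  shows "card U \<noteq> dim U * (dim U + 1)"
proof
  assume cU: "card U = dim U * (dim U + 1)"
  obtain i0 where i0: "i0 \<in> S" using S_ne by blast
  have MU: "M \<subseteq> U" unfolding M_def by auto
  have Msym: "- x \<in> M" if "x \<in> M" for x
    using that U_sym w_sym(3) unfolding NM[OF i0, symmetric] N_def by auto
  have w2: "w i0 x = 2" if "x \<in> M" for x using that unfolding NM[OF i0, symmetric] N_def by auto
  note W = circuit_boundedD[OF w_circuit[OF i0]]
  have nc: False if T: "T \<subseteq> M" "independent T" "card T \<ge> 2" "y \<in> M" "y = \<Sum>T" for T y
  proof -
    have "sum (w i0) T = 2 * card T" using w2 T(1) by (simp add: subset_iff)
    thus False using W(3)[of T y] T MU w2[OF T(4)] by auto
  qed
  have "\<exists>T\<subseteq>M. independent T \<and> M = T \<union> uminus ` T"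
  proof (rule card_acyclic(2)[OF U_unimod MU])
    show "- x \<in> M" if "x \<in> M" for x using that by (rule Msym)
    show False if "T \<subseteq> M" "independent T" "card T \<ge> 2" "y \<in> M" "y = \<Sum>T" for T y using that by (rule nc)
  qed
  then obtain T where T: "T \<subseteq> M" "independent T" "M = T \<union> uminus ` T" by metis
  have fT: "finite T" by (rule finite_subset[OF subset_trans[OF T(1) MU] U_fin])
  have "card M \<le> card T + card (uminus ` T)" unfolding T(3)[symmetric] using card_Un_le[of T "uminus ` T"] T(3) by simp
  moreover have "card (uminus ` T) = card T" by (rule card_image) simp
  ultimately have rT: "dim U \<le> card T" using cM by simp
  have TU: "T \<subseteq> U" using T MU by auto
  obtain B where B: "T \<subseteq> B" "B \<subseteq> U" "independent B" "U \<subseteq> span B" using maximal_independent_subset_extend[OF TU T(2)] by metis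
  have "card B = dim U" using B by (intro basis_card_eq_dim)
  moreover have "finite B" by (rule finite_subset[OF B(2) U_fin])
  ultimately have "T = B" using card_seteq[OF _ B(1)] rT by simp
  hence UT: "U \<subseteq> span T" and cT: "card T = dim U" using B \<open>card B = dim U\<close> by auto
  have uM: "u \<in> M"
  proof -
    obtain \<tau> where "i0 \<in> I u \<tau>" "u \<in> U" using u i0 unfolding covered_def by blast
    hence "w i0 u = 2" using w_two_iff[of u i0] i0 by (cases \<tau>) auto
    thus ?thesis using NM[OF i0] u unfolding N_def covered_def by auto
  qed
  have "u \<in> T \<or> - u \<in> T" using uM T(3) by auto
  hence "\<exists>u1. u1 \<in> T \<and> covered u1"
  proof
    assume "u \<in> T" thus ?thesis using u by (intro exI conjI)
  next
    assume "- u \<in> T" thus ?thesis using covered_neg[OF u] by (intro exI conjI)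
  qed
  then obtain u1 where u1: "u1 \<in> T" "covered u1" by (elim exE conjE)
  have u1U: "u1 \<in> U" using u1 TU by auto
  have key: "y \<in> span (T - {u1}) \<or> y \<in> {u1, - u1}" if y: "y \<in> U" for y
  proof -
    obtain R s where R: "R \<subseteq> T" "R \<noteq> {}" "\<forall>t\<in>R. s t = (1::real) \<or> s t = -1" "y = (\<Sum>t\<in>R. s t *\<^sub>R t)"
      using unimod_signed_sum[OF U_unimod TU T(2) y] UT y by blast
    have fR: "finite R" by (rule finite_subset[OF R(1) fT])
    show ?thesis
    proof (cases "u1 \<in> R")
      case False
      have "y \<in> span (T - {u1})" unfolding R(4) using R(1) False by (intro span_sum span_scale span_base) auto
      thus ?thesis by blast
    next
      case True
      let ?R = "(\<lambda>t. s t *\<^sub>R t) ` R"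
      have iR: "independent ?R" "inj_on (\<lambda>t. s t *\<^sub>R t) R" using indep_signs[OF T(2) R(1) fR] R(3) by auto
      have RM: "?R \<subseteq> M"
      proof
        fix x assume "x \<in> ?R"
        then obtain t where t: "t \<in> R" "x = s t *\<^sub>R t" by blast
        hence "x = t \<or> x = - t" using R(3) by auto
        moreover have "t \<in> M" using t R(1) T(1) by blast
        ultimately show "x \<in> M" using Msym by auto
      qed
      have cR: "card ?R = card R" by (rule card_image[OF iR(2)])
      have sR: "\<Sum>?R = y" unfolding R(4) using sum.reindex[OF iR(2), of id] by simp
      have "card R \<le> 2"
      proof (rule ccontr)
        assume c: "\<not> card R \<le> 2"
        have "sum (w i0) ?R = 2 * card R" using w2 RM cR by (simp add: subset_iff)
        moreover have "2 \<le> card ?R" using c cR by simp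
        ultimately show False using W(3)[OF subset_trans[OF RM MU] iR(1) _ y sR[symmetric]] c by simp
      qed
      moreover have "card R \<noteq> 0" using R(2) fR by simp
      ultimately consider "card R = 1" | "card R = 2" by linarith
      thus ?thesis
      proof cases
        case 1
        hence "R = {u1}" using True by (metis card_1_singletonE singletonD)
        thus ?thesis using R(3,4) by auto
      next
        case 2
        then obtain t where t: "R = {u1, t}" "t \<noteq> u1" using True by (metis card_2_iff doubleton_eq_iff insertE singletonD)
        have y': "y = s u1 *\<^sub>R u1 + s t *\<^sub>R t" unfolding R(4) t(1) using t(2) by simp
        have tT: "t \<in> T" using t R by auto
        have tu: "t \<noteq> - u1"
        proof
          assume "t = - u1"
          hence "t \<in> span {u1}" by (simp add: span_base span_neg)
          moreover have "t \<notin> span (T - {t})" using T(2) tT unfolding indep_iff by blast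
          moreover have "span {u1} \<subseteq> span (T - {t})" using u1 t(2) by (intro span_mono) auto
          ultimately show False by blast
        qed
        have tM: "t \<in> M" "- t \<in> M" using subsetD[OF T(1) tT] Msym[OF subsetD[OF T(1) tT]] .
        \<comment> \<open>With only two summands, isolation of \<open>u1\<close> applies to both signs of \<open>t\<close>.\<close>
        have n1: "u1 + t \<notin> U" by (rule covered_isolated[OF NM u1(2) tM(1) t(2) tu])
        have n2: "u1 + - t \<notin> U"
        proof (rule covered_isolated[OF NM u1(2) tM(2)])
          show "- t \<noteq> u1" using tu by auto
          show "- t \<noteq> - u1" using t(2) by simp
        qed
        have "s u1 = 1 \<or> s u1 = -1" "s t = 1 \<or> s t = -1" using R(3) t by auto
        hence "y = u1 + t \<or> y = u1 + - t \<or> - y = u1 + t \<or> - y = u1 + - t" using y' by auto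
        thus ?thesis using n1 n2 y U_sym[OF y] by (elim disjE) simp_all
      qed
    qed
  qed
  let ?V = "U \<inter> span (T - {u1})"
  have hV: "unimod ?V" by (rule unimod_restrict[OF U_unimod subspace_span])
  have "dim ?V \<le> card (T - {u1})" using fT by (intro dim_le_card) auto
  hence dV: "dim ?V \<le> dim U - 1" using u1 cT fT by simp
  have "U \<subseteq> {u1, - u1} \<union> ?V" using key by blast
  hence "card U \<le> card ({u1, - u1} \<union> ?V)" using U_fin by (intro card_mono) auto
  also have "\<dots> \<le> card {u1, - u1} + card ?V" by (rule card_Un_le)
  also have "card {u1, - u1} \<le> 2" using card_length[of "[u1, - u1]"] by simp
  also have "card ?V \<le> dim ?V * (dim ?V + 1)" by (rule heller[OF hV])
  also have "\<dots> \<le> (dim U - 1) * (dim U - 1 + 1)" using dV by (intro mult_mono) auto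
  finally have "card U \<le> 2 + (dim U - 1) * (dim U - 1 + 1)" by simp
  moreover obtain r where "dim U = r + 2" using r by (metis add.commute le_Suc_ex)
  ultimately show False using cU by (simp add: algebra_simps)
qed

text \<open>The bounds for the base and the squares, for the widths, and for \<open>U\<close> add up to \<open>m^2 + 3 m\<close>. Since \<open>A\<close> is symmetric, its size is even, so a failure of the sharper bound makes all three tight.\<close>

lemma flat_card:
  assumes s: "card S \<in> {2, 3, 4}"
  shows "card A \<le> dim A * dim A + 3 * dim A" "dim A \<notin> {3, 5} \<Longrightarrow> card A + 2 \<le> dim A * dim A + 3 * dim A"
proof -
  define r where "r = dim U"
  define s' where "s' = card S"
  define Q where "Q = card {a \<in> A. p a = 0} + card squares"
  define X where "X = (\<Sum>i\<in>S. card (N i)) + card M"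
  have A: "card A \<le> Q + card U + X" using card_A_le unfolding Q_def X_def by simp
  have U: "card U \<le> r * (r + 1)" unfolding r_def by (rule heller[OF U_unimod])
  have X: "X \<le> 2 * r * (s' + 1)" unfolding X_def r_def s'_def using s by (intro N_M_bound(1)) auto
  have Q: "Q + 2 \<le> s' * s' + 3 * s' \<or> (s' \<noteq> 3 \<and> (\<exists>u. covered u) \<and> Q \<le> s' * s' + 3 * s')"
    using Q_bound[OF s] unfolding Q_def s'_def by simp
  have m: "dim A * dim A + 3 * dim A = (s' * s' + 3 * s') + r * (r + 1) + 2 * r * (s' + 1)"
    unfolding dimA r_def[symmetric] s'_def[symmetric] by (simp add: algebra_simps)
  show 1: "card A \<le> dim A * dim A + 3 * dim A" unfolding m using A U X Q by linarith
  assume d: "dim A \<notin> {3, 5}"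
  have ev: "even (card A)" "even (dim A * dim A + 3 * dim A)" using even_card_sym[OF finA zeroA symA] by auto
  show "card A + 2 \<le> dim A * dim A + 3 * dim A"
  proof (rule ccontr)
    assume "\<not> card A + 2 \<le> dim A * dim A + 3 * dim A"
    hence c: "card A = dim A * dim A + 3 * dim A" using 1 ev by presburger
    hence nQ: "\<not> Q + 2 \<le> s' * s' + 3 * s'" using A U X unfolding m by linarith
    then obtain u where u: "covered u" "s' \<noteq> 3" "Q \<le> s' * s' + 3 * s'" using Q by blast
    have e: "card U = r * (r + 1)" "X = 2 * r * (s' + 1)" using c A U X u(3) unfolding m by linarith+
    have "r \<noteq> 0" using unimod_dim_0[OF U_unimod] u(1) unfolding r_def covered_def by auto
    moreover have "r \<noteq> 1" using d dimA s u(2) unfolding r_def s'_def by auto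
    ultimately have r2: "dim U \<ge> 2" unfolding r_def by linarith
    have s2: "card S \<ge> 2" using s by auto
    have NM: "N i = M" "card M = 2 * dim U" if "i \<in> S" for i
      using N_M_bound(2)[OF s2 _ that] e(2) unfolding X_def r_def s'_def by auto
    have cM: "card M = 2 * dim U" using NM(2) S_ne by blast
    from not_tight[OF NM(1) cM u(1) r2] e(1) show False unfolding r_def by simp
  qed
qed

end

section \<open>The bound for primitive bimodular sets\<close>

text \<open>Strong induction on the dimension, according to the size of a smallest even independent set.\<close>

theorem bimodular_card:
  fixes L :: "'a::real_vector set"
  assumes "bimodular L vol A"
  shows "card A \<le> dim A * dim A + 3 * dim A"
    and "dim A \<notin> {0, 3, 5} \<Longrightarrow> card A + 2 \<le> dim A * dim A + 3 * dim A"
proof -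
  have "card A \<le> dim A * dim A + 3 * dim A \<and> (dim A \<notin> {0, 3, 5} \<longrightarrow> card A + 2 \<le> dim A * dim A + 3 * dim A)"
    using assms
  proof (induction "dim A" arbitrary: L vol A rule: less_induct)
    case less
    interpret bimodular L vol A by (rule less(2))
    show ?case
    proof (cases "\<exists>S. even_indep S")
      case False
      hence "card A \<le> dim A * (dim A + 1)" using heller[OF unimod_of_no_even] by blast
      thus ?thesis by (cases "dim A") auto
    next
      case True
      then obtain S where S: "even_indep S" "\<And>T. even_indep T \<Longrightarrow> card S \<le> card T"
        using ex_has_least_nat[of even_indep _ card] by blast
      have SA: "S \<subseteq> A" "independent S" "S \<noteq> {}" using S(1) unfolding even_indep_def by auto
      have Sf: "finite S" by (rule finite_subset[OF SA(1) finA])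
      have S0: "card S \<noteq> 0" using SA(3) Sf by simp
      have S1: "card S \<noteq> 1"
      proof
        assume "card S = 1"
        then obtain a where a: "S = {a}" by (rule card_1_singletonE)
        obtain l where "l \<in> L" "\<Sum>S = 2 *\<^sub>R l" using S(1) unfolding even_indep_def by blast
        thus False using prim[of a l] SA(1) unfolding a by simp
      qed
      obtain a where aS: "a \<in> S" using SA(3) by blast
      hence aA: "a \<in> A" using SA(1) by blast
      show ?thesis
      proof (cases "card S \<ge> 5")
        case True
        have "a \<noteq> 0" using aA zeroA by auto
        from exists_projection[OF this] obtain p :: "'a \<Rightarrow> 'a" where p: "linear p" "\<And>v. p v = 0 \<longleftrightarrow> v \<in> span {a}" by blast
        interpret c: bimodular_contract L vol A a p
          using aA p True S(2) by unfold_locales (auto intro: le_trans simp: linear_add[OF p(1)] linear_scale[OF p(1)])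
        let ?A = "p ` A - {0}"
        have "dim ?A < dim A" using c.dim_contract by simp
        from less(1)[OF this c.contract_bimodular] have IH: "card ?A \<le> dim ?A * dim ?A + 3 * dim ?A" by blast
        have "card A + 2 \<le> dim A * dim A + 3 * dim A" using c.card_A_contract IH c.dim_contract by (simp add: algebra_simps)
        thus ?thesis by simp
      next
        case False
        hence s: "card S \<in> {2, 3, 4}" using S0 S1 by auto
        obtain Y where Y: "S \<subseteq> Y" "Y \<subseteq> A" "bas Y" using bas_extend[OF SA(1,2)] by blast
        have iY: "independent Y" using Y(3) unfolding lattice_basis_def by blast
        have "\<exists>g :: 'a \<Rightarrow> real. linear g \<and> (\<forall>y\<in>Y. g y = (if y = i then 1 else 0))" for i
          by (rule exists_functional[OF iY, of "\<lambda>y. if y = i then 1 else 0"]) blast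
        then obtain q :: "'a \<Rightarrow> 'a \<Rightarrow> real" where q: "\<And>i. linear (q i)" "\<And>i y. y \<in> Y \<Longrightarrow> q i y = (if y = i then 1 else 0)" by metis
        interpret f: flat L vol A S Y q
          using S Y q(2) by unfold_locales (auto simp: linear_add[OF q(1)] linear_scale[OF q(1)])
        show ?thesis using f.flat_card[OF s] by blast
      qed
    qed
  qed
  thus "card A \<le> dim A * dim A + 3 * dim A" "dim A \<notin> {0, 3, 5} \<Longrightarrow> card A + 2 \<le> dim A * dim A + 3 * dim A" by auto
qed

section \<open>Determinants of sparse integer matrices\<close>

text \<open>The index map of \<open>mat_delete\<close>.\<close>

definition skip_index :: "nat \<Rightarrow> nat \<Rightarrow> nat" where "skip_index k i = (if i < k then i else Suc i)"

lemma skip_index_simps: "skip_index k i \<noteq> k" "inj (skip_index k)" "i < n \<Longrightarrow> skip_index k i < Suc n" 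
  unfolding skip_index_def inj_on_def by (auto split: if_splits)

lemma skip_index_surj: assumes "k < Suc n" "j < Suc n" "j \<noteq> k" shows "\<exists>i<n. skip_index k i = j"
proof (cases "j < k")
  case True
  thus ?thesis using assms by (intro exI[of _ j]) (auto simp: skip_index_def)
next
  case False
  thus ?thesis using assms by (intro exI[of _ "j - 1"]) (auto simp: skip_index_def)
qed

lemma mat_delete_ins:
  assumes "B \<in> carrier_mat (Suc n) (Suc n)" "i < n" "j < n"
  shows "mat_delete B k l $$ (i, j) = B $$ (skip_index k i, skip_index l j)"
  using assms unfolding mat_delete_def skip_index_def by auto

lemma mat_delete_car: "B \<in> carrier_mat (Suc n) (Suc n) \<Longrightarrow> mat_delete B k l \<in> carrier_mat n n"
  unfolding mat_delete_def by auto

lemma det_expand_col_single: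
  fixes B :: "int mat"
  assumes B: "B \<in> carrier_mat n n" and k: "k < n" "j < n" and z: "\<And>i. i < n \<Longrightarrow> i \<noteq> k \<Longrightarrow> B $$ (i, j) = 0"
    and e: "\<bar>B $$ (k, j)\<bar> \<le> 1"
  shows "\<bar>det B\<bar> \<le> \<bar>det (mat_delete B k j)\<bar>"
proof -
  have "det B = (\<Sum>i<n. B $$ (i, j) * cofactor B i j)" by (rule laplace_expansion_column[OF B k(2)])
  also have "\<dots> = B $$ (k, j) * cofactor B k j + (\<Sum>i\<in>{..<n} - {k}. B $$ (i, j) * cofactor B i j)" using k(1) by (intro sum.remove) auto
  also have "(\<Sum>i\<in>{..<n} - {k}. B $$ (i, j) * cofactor B i j) = 0" using z by (intro sum.neutral) auto
  finally have "\<bar>det B\<bar> = \<bar>B $$ (k, j)\<bar> * \<bar>det (mat_delete B k j)\<bar>" by (simp add: cofactor_def abs_mult power_abs)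
  also have "\<dots> \<le> 1 * \<bar>det (mat_delete B k j)\<bar>" using e by (intro mult_right_mono) auto
  finally show ?thesis by simp
qed

lemma mat_delete_transpose: "B \<in> carrier_mat n n \<Longrightarrow> mat_delete (transpose_mat B) j k = transpose_mat (mat_delete B k j)"
  unfolding mat_delete_def by (intro eq_matI) auto

lemma det_expand_row_single:
  fixes B :: "int mat"
  assumes B: "B \<in> carrier_mat (Suc n) (Suc n)" and k: "k < Suc n" "i < Suc n" and z: "\<And>j. j < Suc n \<Longrightarrow> j \<noteq> k \<Longrightarrow> B $$ (i, j) = 0"
    and e: "\<bar>B $$ (i, k)\<bar> \<le> 1"
  shows "\<bar>det B\<bar> \<le> \<bar>det (mat_delete B i k)\<bar>"
proof -
  have "\<bar>det (transpose_mat B)\<bar> \<le> \<bar>det (mat_delete (transpose_mat B) k i)\<bar>"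
    by (rule det_expand_col_single[of _ "Suc n"]) (use assms in auto)
  thus ?thesis using det_transpose[OF B] det_transpose[OF mat_delete_car[OF B]] mat_delete_transpose[OF B] by metis
qed

text \<open>These are incidence matrices of directed graphs, with missing end points allowed. If every column has both end points, the rows add up to zero; otherwise expand along a column with at most one nonzero entry.\<close>

lemma det_network:
  fixes B :: "int mat"
  assumes "B \<in> carrier_mat n n"
    and "\<And>j. j < n \<Longrightarrow> \<exists>p r. \<forall>i<n. B $$ (i, j) = of_bool (i = p) - of_bool (i = r)"
  shows "\<bar>det B\<bar> \<le> 1"
  using assms
proof (induction n arbitrary: B)
  case 0
  thus ?case by simp
next
  case (Suc n)
  obtain p r where pr: "\<And>i j. j < Suc n \<Longrightarrow> i < Suc n \<Longrightarrow> B $$ (i, j) = of_bool (i = p j) - of_bool (i = r j)"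
    using Suc(3) by metis
  show ?case
  proof (cases "\<forall>j<Suc n. p j < Suc n \<and> r j < Suc n")
    case True
    let ?v = "vec (Suc n) (\<lambda>_. 1 :: int)"
    have "transpose_mat B *\<^sub>v ?v = 0\<^sub>v (Suc n)"
    proof (rule eq_vecI)
      fix j assume j: "j < dim_vec (0\<^sub>v (Suc n) :: int vec)"
      have "(transpose_mat B *\<^sub>v ?v) $ j = (\<Sum>i<Suc n. B $$ (i, j))"
        using Suc(2) j by (simp add: scalar_prod_def lessThan_atLeast0 del: sum.lessThan_Suc sum.op_ivl_Suc)
      also have "\<dots> = (\<Sum>i<Suc n. of_bool (i = p j)) - (\<Sum>i<Suc n. of_bool (i = r j))"
        using pr j by (simp add: sum_subtractf del: sum.lessThan_Suc)
      also have "\<dots> = 0" using True j by (simp add: of_bool_def sum.delta del: sum.lessThan_Suc)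
      finally show "(transpose_mat B *\<^sub>v ?v) $ j = 0\<^sub>v (Suc n) $ j" using j by simp
    qed (use Suc(2) in auto)
    moreover have "?v \<noteq> 0\<^sub>v (Suc n)"
    proof
      assume "?v = 0\<^sub>v (Suc n)"
      hence "?v $ 0 = 0\<^sub>v (Suc n) $ 0" by simp
      thus False by simp
    qed
    ultimately have "det (transpose_mat B) = 0"
      using det_0_iff_vec_prod_zero[of "transpose_mat B" "Suc n"] Suc(2) by (metis transpose_carrier_mat vec_carrier)
    thus ?thesis using det_transpose[OF Suc(2)] by simp
  next
    case False
    then obtain j where j: "j < Suc n" "p j \<ge> Suc n \<or> r j \<ge> Suc n" by force
    define k where "k = (if p j < Suc n then p j else if r j < Suc n then r j else 0)"
    have k: "k < Suc n" "\<And>i. i < Suc n \<Longrightarrow> i \<noteq> k \<Longrightarrow> B $$ (i, j) = 0" "\<bar>B $$ (k, j)\<bar> \<le> 1"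
      using j pr[OF j(1)] unfolding k_def by (auto split: if_splits)
    have "\<bar>det B\<bar> \<le> \<bar>det (mat_delete B k j)\<bar>" by (rule det_expand_col_single[OF Suc(2) k(1) j(1) k(2,3)])
    also have "\<dots> \<le> 1"
    proof (rule Suc(1)[OF mat_delete_car[OF Suc(2)]])
      fix l assume l: "l < n"
      define d where "d p = (if p < k then p else if p = k then Suc n else p - 1)" for p
      have "skip_index k i = p \<longleftrightarrow> i = d p" if "i < n" for i p using that unfolding skip_index_def d_def by auto
      thus "\<exists>p r. \<forall>i<n. mat_delete B k j $$ (i, l) = of_bool (i = p) - of_bool (i = r)"
        using mat_delete_ins[OF Suc(2) _ l] pr[OF skip_index_simps(3)[OF l] skip_index_simps(3)]
        by (intro exI[of _ "d (p (skip_index j l))"] exI[of _ "d (r (skip_index j l))"]) simp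
    qed
    finally show ?thesis .
  qed
qed

lemma sparse_delete:
  fixes B :: "int mat"
  assumes B: "B \<in> carrier_mat (Suc n) (Suc n)" and k: "k < Suc n" "l < Suc n"
    and e: "\<And>i j. i < Suc n \<Longrightarrow> j < Suc n \<Longrightarrow> \<bar>B $$ (i, j)\<bar> \<le> 1"
    and c: "\<And>j. j < Suc n \<Longrightarrow> card {i. i < Suc n \<and> B $$ (i, j) \<noteq> 0} \<le> 2"
  shows "\<And>i j. i < n \<Longrightarrow> j < n \<Longrightarrow> \<bar>mat_delete B k l $$ (i, j)\<bar> \<le> 1"
    "\<And>j. j < n \<Longrightarrow> card {i. i < n \<and> mat_delete B k l $$ (i, j) \<noteq> 0} \<le> 2"
proof -
  show "\<bar>mat_delete B k l $$ (i, j)\<bar> \<le> 1" if "i < n" "j < n" for i j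
    unfolding mat_delete_ins[OF B that] using that by (intro e skip_index_simps(3))
  show "card {i. i < n \<and> mat_delete B k l $$ (i, j) \<noteq> 0} \<le> 2" if j: "j < n" for j
  proof -
    have "card {i. i < n \<and> mat_delete B k l $$ (i, j) \<noteq> 0} \<le> card {i. i < Suc n \<and> B $$ (i, skip_index l j) \<noteq> 0}"
    proof (rule card_inj_on_le[of "skip_index k"])
      show "inj_on (skip_index k) {i. i < n \<and> mat_delete B k l $$ (i, j) \<noteq> 0}" using skip_index_simps(2) by (rule inj_on_subset) simp
      show "skip_index k ` {i. i < n \<and> mat_delete B k l $$ (i, j) \<noteq> 0} \<subseteq> {i. i < Suc n \<and> B $$ (i, skip_index l j) \<noteq> 0}"
        using mat_delete_ins[OF B _ j] skip_index_simps(3) by auto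
    qed simp
    thus ?thesis using c[OF skip_index_simps(3)[OF j]] by (meson le_trans)
  qed
qed

text \<open>A row or column with at most one nonzero entry can be expanded without loss. Otherwise counting nonzero entries shows that every row and column has exactly two. Expanding along a row then yields two minors, and each has a row with at most one nonzero entry left, where the other column met.\<close>

lemma det_sparse:
  fixes B :: "int mat"
  assumes "B \<in> carrier_mat n n"
    and "\<And>i j. i < n \<Longrightarrow> j < n \<Longrightarrow> \<bar>B $$ (i, j)\<bar> \<le> 1"
    and "\<And>j. j < n \<Longrightarrow> card {i. i < n \<and> B $$ (i, j) \<noteq> 0} \<le> 2"
  shows "\<bar>det B\<bar> \<le> 2 ^ (n div 2)"
  using assms
proof (induction n arbitrary: B rule: less_induct)
  case (less n)
  note B = less(2) and e = less(3) and c = less(4)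
  have single: "\<exists>k<n'. \<forall>j<n'. j \<noteq> k \<longrightarrow> j \<notin> X" if "card X \<le> 1" "X \<subseteq> {..<n'}" "0 < n'" for X and n' :: nat
  proof (cases "X = {}")
    case True thus ?thesis using that(3) by auto
  next
    case False
    then obtain k where k: "k \<in> X" by blast
    have "finite X" by (rule finite_subset[OF that(2)]) simp
    hence "\<forall>a\<in>X. \<forall>b\<in>X. a = b" using card_le_Suc0_iff_eq[of X] that(1) by (simp only: One_nat_def)
    thus ?thesis using that(2) k by blast
  qed
  have step: "\<bar>det C\<bar> \<le> \<bar>det (mat_delete C i k)\<bar>" 
    if "C \<in> carrier_mat (Suc n') (Suc n')" "\<And>i j. i < Suc n' \<Longrightarrow> j < Suc n' \<Longrightarrow> \<bar>C $$ (i, j)\<bar> \<le> 1" "i < Suc n'" "k < Suc n'" "\<And>j. j < Suc n' \<Longrightarrow> j \<noteq> k \<Longrightarrow> C $$ (i, j) = 0" for C :: "int mat" and n' i k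
    by (rule det_expand_row_single[OF that(1,4,3)]) (use that(5) that(2)[OF that(3,4)] in auto)
  have light: "\<bar>det C\<bar> \<le> 2 ^ (n' div 2)" if n': "Suc n' \<le> n" and C: "C \<in> carrier_mat (Suc n') (Suc n')" "\<And>i j. i < Suc n' \<Longrightarrow> j < Suc n' \<Longrightarrow> \<bar>C $$ (i, j)\<bar> \<le> 1"
      "\<And>j. j < Suc n' \<Longrightarrow> card {i. i < Suc n' \<and> C $$ (i, j) \<noteq> 0} \<le> 2" and i: "i < Suc n'" "card {j. j < Suc n' \<and> C $$ (i, j) \<noteq> 0} \<le> 1" for C :: "int mat" and n' i
  proof -
    obtain k where k: "k < Suc n'" "\<And>j. j < Suc n' \<Longrightarrow> j \<noteq> k \<Longrightarrow> C $$ (i, j) = 0" using single[OF i(2), of "Suc n'"] by auto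
    have "\<bar>det C\<bar> \<le> \<bar>det (mat_delete C i k)\<bar>" by (rule step[OF C(1,2) i(1) k])
    also have "\<dots> \<le> 2 ^ (n' div 2)"
      using sparse_delete[OF C(1) i(1) k(1) C(2,3)] n' mat_delete_car[OF C(1)] by (intro less(1)) auto
    finally show ?thesis .
  qed
  show ?case
  proof (cases n)
    case 0
    thus ?thesis using B by simp
  next
    case (Suc n')
    note B' = B[unfolded Suc] and e' = e[unfolded Suc] and c' = c[unfolded Suc]
    define R where "R i = {j. j < n \<and> B $$ (i, j) \<noteq> 0}" for i
    define C where "C j = {i. i < n \<and> B $$ (i, j) \<noteq> 0}" for j
    have mono: "(2::int) ^ (n' div 2) \<le> 2 ^ (n div 2)" unfolding Suc by (intro power_increasing div_le_mono) auto
    consider i where "i < n" "card (R i) \<le> 1" | j where "j < n" "card (C j) \<le> 1"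
      | "\<And>i. i < n \<Longrightarrow> card (R i) \<ge> 2" "\<And>j. j < n \<Longrightarrow> card (C j) \<ge> 2" by force
    thus ?thesis
    proof cases
      case (1 i)
      have "\<bar>det B\<bar> \<le> 2 ^ (n' div 2)" using light[OF _ B' e' c', of i] 1 unfolding Suc R_def by auto
      thus ?thesis by (rule order_trans[OF _ mono])
    next
      case (2 j)
      obtain k where k: "k < n" "\<And>i. i < n \<Longrightarrow> i \<noteq> k \<Longrightarrow> B $$ (i, j) = 0" using single[OF 2(2), of n] Suc unfolding C_def by auto
      have "\<bar>det B\<bar> \<le> \<bar>det (mat_delete B k j)\<bar>" by (rule det_expand_col_single[OF B k(1) 2(1) k(2) e[OF k(1) 2(1)]])
      also have "\<dots> \<le> 2 ^ (n' div 2)"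
        using sparse_delete[OF B' _ _ e' c', of k j] k(1) 2(1) Suc mat_delete_car[OF B'] by (intro less(1)) auto
      finally show ?thesis by (rule order_trans[OF _ mono])
    next
      case 3
      have cC: "card (C j) = 2" if "j < n" for j using 3(2)[OF that] c[OF that] unfolding C_def by simp
      have "(\<Sum>i<n. card (R i)) = (\<Sum>j<n. card (C j))"
      proof -
        have "(\<Sum>i<n. card (R i)) = (\<Sum>i<n. \<Sum>j<n. of_bool (B $$ (i, j) \<noteq> 0))" unfolding R_def by (simp add: of_bool_def sum.If_cases Int_def)
        also have "\<dots> = (\<Sum>j<n. \<Sum>i<n. of_bool (B $$ (i, j) \<noteq> 0))" by (rule sum.swap)
        also have "\<dots> = (\<Sum>j<n. card (C j))" unfolding C_def by (simp add: of_bool_def sum.If_cases Int_def)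
        finally show ?thesis .
      qed
      hence tot: "(\<Sum>i<n. card (R i)) = 2 * n" using cC by simp
      have cR: "card (R i) = 2" if "i < n" for i
      proof (rule ccontr)
        assume "card (R i) \<noteq> 2"
        hence "(\<Sum>i<n. 2) < (\<Sum>i<n. card (R i))" using 3(1) that by (intro sum_strict_mono_ex1) (auto intro!: bexI[of _ i] simp: le_neq_implies_less)
        thus False using tot by simp
      qed
      have n0: "0 < n" using Suc by simp
      obtain a b where ab: "R 0 = {a, b}" "a \<noteq> b" using cR[OF n0] unfolding card_2_iff by blast
      have abn: "a < n" "b < n" using ab unfolding R_def by auto
      then obtain n'' where n'': "n' = Suc n''" using Suc ab(2) by (cases n') auto
      have minor: "\<bar>det (mat_delete B 0 k)\<bar> \<le> 2 ^ (n'' div 2)" if k: "k \<in> R 0" for k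
      proof -
        have kn: "k < n" "0 \<in> C k" using k n0 unfolding R_def C_def by auto
        obtain i where i: "i \<in> C k" "i \<noteq> 0"
        proof -
          have "C k \<noteq> {0}"
          proof
            assume "C k = {0}"
            thus False using cC[OF kn(1)] by (simp only:) simp
          qed
          hence "\<exists>i. i \<in> C k \<and> i \<noteq> 0" using kn(2) by blast
          thus ?thesis using that by (elim exE conjE)
        qed
        have iN: "i < n" "B $$ (i, k) \<noteq> 0" using i unfolding C_def by auto
        obtain i' where i': "i' < n'" "skip_index 0 i' = i" using skip_index_surj[of 0 n' i] iN(1) i(2) Suc by auto
        have "card {j. j < n' \<and> mat_delete B 0 k $$ (i', j) \<noteq> 0} \<le> card (R i - {k})"
        proof (rule card_inj_on_le[of "skip_index k"])
          show "inj_on (skip_index k) {j. j < n' \<and> mat_delete B 0 k $$ (i', j) \<noteq> 0}" using skip_index_simps(2) by (rule inj_on_subset) simp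
          show "skip_index k ` {j. j < n' \<and> mat_delete B 0 k $$ (i', j) \<noteq> 0} \<subseteq> R i - {k}"
            using mat_delete_ins[OF B' i'(1), of _ 0 k] i'(2) skip_index_simps(1,3) unfolding R_def Suc by auto
          show "finite (R i - {k})" unfolding R_def by simp
        qed
        also have "\<dots> = 1" using cR[OF iN(1)] iN(2) kn(1) unfolding R_def by (subst card_Diff_singleton) auto
        finally have r: "card {j. j < n' \<and> mat_delete B 0 k $$ (i', j) \<noteq> 0} \<le> 1" .
        have k': "0 < Suc n'" "k < Suc n'" using kn(1) Suc by auto
        note sd = sparse_delete[OF B' k' e' c'] and md = mat_delete_car[OF B', of 0 k]
        show ?thesis using light[OF _ md[unfolded n''] sd[unfolded n''] i'(1)[unfolded n''] r[unfolded n'']] Suc n'' by simp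
      qed
      have "det B = (\<Sum>j<n. B $$ (0, j) * cofactor B 0 j)" by (rule laplace_expansion_row[OF B n0])
      also have "\<dots> = (\<Sum>j\<in>{a, b}. B $$ (0, j) * cofactor B 0 j)"
        using abn unfolding ab(1)[symmetric] R_def by (intro sum.mono_neutral_right) auto
      also have "\<dots> = B $$ (0, a) * cofactor B 0 a + B $$ (0, b) * cofactor B 0 b" using ab(2) by simp
      finally have "\<bar>det B\<bar> \<le> \<bar>B $$ (0, a) * cofactor B 0 a\<bar> + \<bar>B $$ (0, b) * cofactor B 0 b\<bar>" by simp
      also have "\<dots> \<le> 2 ^ (n'' div 2) + 2 ^ (n'' div 2)"
      proof (rule add_mono)
        have t: "\<bar>B $$ (0, k) * cofactor B 0 k\<bar> \<le> 2 ^ (n'' div 2)" if k: "k \<in> R 0" for k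
        proof -
          have "\<bar>B $$ (0, k) * cofactor B 0 k\<bar> = \<bar>B $$ (0, k)\<bar> * \<bar>det (mat_delete B 0 k)\<bar>" by (simp add: cofactor_def abs_mult power_abs)
          also have "\<dots> \<le> 1 * \<bar>det (mat_delete B 0 k)\<bar>" using e[OF n0, of k] k unfolding R_def by (intro mult_right_mono) auto
          finally show ?thesis using minor[OF k] by simp
        qed
        show "\<bar>B $$ (0, a) * cofactor B 0 a\<bar> \<le> 2 ^ (n'' div 2)" "\<bar>B $$ (0, b) * cofactor B 0 b\<bar> \<le> 2 ^ (n'' div 2)" using t ab(1) by auto
      qed
      also have "\<dots> = 2 ^ (n div 2)" unfolding Suc n'' by simp
      finally show ?thesis .
    qed
  qed
qed

section \<open>Constructing modular matrices\<close>

lemma exists_nonsingular_cols: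
  fixes A :: "real mat"
  assumes A: "A \<in> carrier_mat m n" and r: "vec_space.rank m A = m"
  shows "\<exists>xs. length xs = m \<and> set xs \<subseteq> set (cols A) \<and> det (mat_of_cols m xs) \<noteq> 0"
proof -
  interpret vec_space "TYPE(real)" m .
  let ?P = "\<lambda>T. T \<subseteq> set (cols A) \<and> lin_indpt T"
  obtain S where S: "finite S" "maximal S ?P"
    using maximal_exists_superset[of "set (cols A)" ?P "{}"] unfolding lin_dep_def by auto
  have PS: "S \<subseteq> set (cols A)" "lin_indpt S" using S(2) unfolding maximal_def by auto
  have c: "card S = m" using rank_card_indpt[OF A S(2)] r by simp
  obtain xs where xs: "set xs = S" "distinct xs" using finite_distinct_list[OF S(1)] by blast
  have l: "length xs = m" using xs c distinct_card by fastforce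
  have car: "set xs \<subseteq> carrier_vec m" using PS(1) xs(1) A cols_dim by blast
  have B: "mat_of_cols m xs \<in> carrier_mat m m" using l by (metis mat_of_cols_carrier(1))
  have "rank (mat_of_cols m xs) = m" using lin_indpt_full_rank[OF B] cols_mat_of_cols[OF car] xs PS by metis
  hence "det (mat_of_cols m xs) \<noteq> 0" using det_rank_iff[OF B] by blast
  thus ?thesis using l xs(1) PS(1) by blast
qed

lemma rank_of_nonsingular_cols:
  fixes A :: "real mat"
  assumes A: "A \<in> carrier_mat m n" and B: "B \<in> carrier_mat m m" "set (cols B) \<subseteq> set (cols A)" "det B \<noteq> 0"
  shows "vec_space.rank m A = m"
proof -
  interpret vec_space "TYPE(real)" m .
  have rB: "rank B = m" using det_rank_iff[OF B(1)] B(3) by blast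
  have d: "distinct (cols B)" using non_distinct_low_rank[OF B(1)] rB by fastforce
  have "lin_indpt (set (cols B))" by (rule full_rank_lin_indpt[OF B(1) rB d])
  hence "card (set (cols B)) \<le> rank A" by (rule rank_ge_card_indpt[OF A B(2)])
  moreover have "card (set (cols B)) = m" using distinct_card[OF d] B(1) by simp
  moreover have "rank A \<le> m"
  proof -
    let ?P = "\<lambda>T. T \<subseteq> set (cols A) \<and> lin_indpt T"
    obtain S where S: "finite S" "maximal S ?P"
      using maximal_exists_superset[of "set (cols A)" ?P "{}"] unfolding lin_dep_def by auto
    have PS: "S \<subseteq> set (cols A)" "lin_indpt S" using S(2) unfolding maximal_def by auto
    have "S \<subseteq> carrier_vec m" using PS(1) A cols_dim by blast
    hence "card S \<le> m" using li_le_dim(2)[OF fin_dim _ PS(2)] dim_is_n by simp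
    thus ?thesis using rank_card_indpt[OF A S(2)] by simp
  qed
  ultimately show ?thesis by simp
qed

lemma det_of_int: "det (map_mat real_of_int B) = real_of_int (det B)"
  by (rule of_int_hom.hom_det)

text \<open>The rank is attained by columns of \<open>A\<close>.\<close>

lemma full_row_rank_iff:
  assumes A: "A \<in> carrier_mat m n"
  shows "full_row_rank A \<longleftrightarrow> (\<exists>xs. length xs = m \<and> set xs \<subseteq> set (cols A) \<and> det (mat_of_cols m xs) \<noteq> 0)"
proof
  have A': "map_mat real_of_int A \<in> carrier_mat m n" using A by simp
  have cA: "cols (map_mat real_of_int A) = map (map_vec real_of_int) (cols A)" using A unfolding cols_def by (auto intro!: nth_equalityI)
  {
    assume "full_row_rank A"
    hence "vec_space.rank m (map_mat real_of_int A) = m" using A unfolding full_row_rank_def by auto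
    from exists_nonsingular_cols[OF A' this] obtain xs where xs: "length xs = m" "set xs \<subseteq> set (cols (map_mat real_of_int A))" "det (mat_of_cols m xs) \<noteq> 0" by blast
    hence "set xs \<subseteq> map_vec real_of_int ` set (cols A)" unfolding cA by simp
    then obtain ys where ys: "set ys \<subseteq> set (cols A)" "xs = map (map_vec real_of_int) ys"
    proof -
      let ?g = "inv_into (set (cols A)) (map_vec real_of_int)"
      have g: "?g x \<in> set (cols A)" "map_vec real_of_int (?g x) = x" if "x \<in> set xs" for x
        using subsetD[OF \<open>set xs \<subseteq> map_vec real_of_int ` set (cols A)\<close> that] inv_into_into f_inv_into_f by metis+
      have "xs = map (map_vec real_of_int) (map ?g xs)" using g(2) by (simp add: map_idI)
      thus ?thesis using that[of "map ?g xs"] g(1) by auto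
    qed
    have d: "y \<in> carrier_vec m" if "y \<in> set ys" for y using subsetD[OF ys(1) that] A cols_dim by blast
    have "mat_of_cols m xs = map_mat real_of_int (mat_of_cols m ys)"
    proof (rule eq_matI)
      fix i j assume "i < dim_row (map_mat real_of_int (mat_of_cols m ys))" "j < dim_col (map_mat real_of_int (mat_of_cols m ys))"
      hence ij: "i < m" "j < length ys" by auto
      have "i < dim_vec (ys ! j)" using d[OF nth_mem[OF ij(2)]] ij(1) by (simp only: carrier_vecD)
      thus "mat_of_cols m xs $$ (i, j) = map_mat real_of_int (mat_of_cols m ys) $$ (i, j)"
        using ij unfolding ys(2) by (simp add: mat_of_cols_index)
    qed (simp_all add: ys(2))
    hence "det (mat_of_cols m ys) \<noteq> 0" using xs(3) det_of_int by auto
    thus "\<exists>xs. length xs = m \<and> set xs \<subseteq> set (cols A) \<and> det (mat_of_cols m xs) \<noteq> 0" using ys xs(1) by (intro exI[of _ ys]) auto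
  }
  assume "\<exists>xs. length xs = m \<and> set xs \<subseteq> set (cols A) \<and> det (mat_of_cols m xs) \<noteq> 0"
  then obtain xs where xs: "length xs = m" "set xs \<subseteq> set (cols A)" "det (mat_of_cols m xs) \<noteq> 0" by blast
  have car: "set xs \<subseteq> carrier_vec m" using xs(2) A cols_dim by blast
  let ?B = "map_mat real_of_int (mat_of_cols m xs)"
  have B: "?B \<in> carrier_mat m m" using xs(1) by (metis map_carrier_mat mat_of_cols_carrier(1))
  have "cols ?B = map (map_vec real_of_int) (cols (mat_of_cols m xs))" unfolding cols_def by (auto intro!: nth_equalityI)
  hence "set (cols ?B) \<subseteq> set (cols (map_mat real_of_int A))" unfolding cA cols_mat_of_cols[OF car] using xs(2) by auto
  moreover have "det ?B \<noteq> 0" using xs(3) det_of_int by auto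
  ultimately have "vec_space.rank m (map_mat real_of_int A) = m" by (rule rank_of_nonsingular_cols[OF A' B])
  thus "full_row_rank A" using A unfolding full_row_rank_def by auto
qed

text \<open>Index sets are arbitrary sets of natural numbers, but only their parts inside the matrix matter; this makes the set of minors finite.\<close>

lemma submatrix_reduce:
  assumes A: "A \<in> carrier_mat m n"
  shows "submatrix A I J = submatrix A {i. i < m \<and> i \<in> I} {j. j < n \<and> j \<in> J}"
  using A unfolding submatrix_def by (intro eq_matI) (auto simp: pick_reduce_set[symmetric])

lemma minors_finite:
  assumes A: "A \<in> carrier_mat m n"
  shows "finite {\<bar>det B\<bar> |B I J. B = submatrix A I J \<and> B \<in> carrier_mat (dim_row A) (dim_row A)}"
proof -
  have "{\<bar>det B\<bar> |B I J. B = submatrix A I J \<and> B \<in> carrier_mat (dim_row A) (dim_row A)} \<subseteq> (\<lambda>(I, J). \<bar>det (submatrix A I J)\<bar>) ` (Pow {..<m} \<times> Pow {..<n})"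
  proof
    fix x assume "x \<in> {\<bar>det B\<bar> |B I J. B = submatrix A I J \<and> B \<in> carrier_mat (dim_row A) (dim_row A)}"
    then obtain I J where "x = \<bar>det (submatrix A I J)\<bar>" by blast
    hence "x = \<bar>det (submatrix A {i. i < m \<and> i \<in> I} {j. j < n \<and> j \<in> J})\<bar>" using submatrix_reduce[OF A] by metis
    thus "x \<in> (\<lambda>(I, J). \<bar>det (submatrix A I J)\<bar>) ` (Pow {..<m} \<times> Pow {..<n})"
      by (intro image_eqI[of _ _ "({i. i < m \<and> i \<in> I}, {j. j < n \<and> j \<in> J})"]) auto
  qed
  thus ?thesis by (rule finite_subset) simp
qed

lemma pick_lessThan: assumes "i < m" shows "pick {i. i < m \<and> i \<in> UNIV} i = i"
  using pick_reduce_set[of i m UNIV] assms pick_UNIV by simp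

lemma submatrix_square:
  assumes A: "A \<in> carrier_mat m n" and B: "submatrix A I J \<in> carrier_mat m m"
  shows "i < m \<Longrightarrow> j < m \<Longrightarrow> submatrix A I J $$ (i, j) = A $$ (i, pick J j)" "j < m \<Longrightarrow> pick J j < n"
proof -
  have c: "card {i. i < m \<and> i \<in> I} = m" "card {j. j < n \<and> j \<in> J} = m" using A B dim_submatrix[of A I J] by auto
  have "{i. i < m \<and> i \<in> I} = {..<m}" using c(1) by (intro card_subset_eq) auto
  hence e: "{i. i < m \<and> i \<in> I} = {i. i < m \<and> i \<in> UNIV}" by auto
  have p: "pick I i = i" if "i < m" for i using pick_reduce_set[of i m I] c(1) that pick_lessThan[OF that] unfolding e by simp
  show "i < m \<Longrightarrow> j < m \<Longrightarrow> submatrix A I J $$ (i, j) = A $$ (i, pick J j)" using submatrix_index[of i A I j J] A c p by auto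
  show "j < m \<Longrightarrow> pick J j < n" using pick_le[of j n J] c(2) by simp
qed

lemma max_minor_le:
  assumes A: "A \<in> carrier_mat m n" "m \<le> n"
    and d: "\<And>B. B \<in> carrier_mat m m \<Longrightarrow> (\<And>j. j < m \<Longrightarrow> col B j \<in> set (cols A)) \<Longrightarrow> \<bar>det B\<bar> \<le> \<Delta>"
  shows "max_minor A \<le> \<Delta>"
  unfolding max_minor_def
proof (rule Max.boundedI[OF minors_finite[OF A(1)]])
  let ?M = "{\<bar>det B\<bar> |B I J. B = submatrix A I J \<and> B \<in> carrier_mat (dim_row A) (dim_row A)}"
  have "{j. j < n \<and> j \<in> {..<m}} = {..<m}" using A(2) by auto
  hence "submatrix A UNIV {..<m} \<in> carrier_mat m m" using A(1) dim_submatrix[of A UNIV "{..<m}"] by (intro carrier_matI) auto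
  thus "?M \<noteq> {}" using A(1) by auto
  fix x assume "x \<in> ?M"
  then obtain I J where x: "x = \<bar>det (submatrix A I J)\<bar>" "submatrix A I J \<in> carrier_mat m m" using A(1) by auto
  note S = submatrix_square[OF A(1) x(2)]
  have "col (submatrix A I J) j \<in> set (cols A)" if j: "j < m" for j
  proof -
    have "col (submatrix A I J) j = col A (pick J j)" using S j x(2) A(1) by (intro eq_vecI) auto
    thus ?thesis using S(2)[OF j] A(1) unfolding cols_def by auto
  qed
  thus "x \<le> \<Delta>" using d[OF x(2)] x(1) by simp
qed

lemma le_num_differing:
  assumes "X \<subseteq># mset (cols A)" "differing_columns X"
  shows "size X \<le> num_differing A" "(\<forall>a\<in>#X. primitive_vec a) \<Longrightarrow> size X \<le> num_differing_primitive A"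
proof -
  have f: "finite {size X |X. X \<subseteq># mset (cols A) \<and> P X}" for P
    by (rule finite_subset[of _ "{..size (mset (cols A))}"]) (auto dest: size_mset_mono)
  show "size X \<le> num_differing A" unfolding num_differing_def using assms f[of differing_columns] by (intro Max_ge) auto
  assume "\<forall>a\<in>#X. primitive_vec a"
  thus "size X \<le> num_differing_primitive A" unfolding num_differing_primitive_def
    using assms f[of "\<lambda>X. differing_columns X \<and> (\<forall>a \<in># X. primitive_vec a)"] by (intro Max_ge) auto
qed

text \<open>The columns are arranged in an arbitrary order. The condition \<open>a \<noteq> - b\<close> includes \<open>a = b\<close>, which excludes the zero vector.\<close>

lemma exists_modular:
  fixes C :: "int vec set"
  assumes C: "finite C" "C \<subseteq> carrier_vec m" "\<And>a b. a \<in> C \<Longrightarrow> b \<in> C \<Longrightarrow> a \<noteq> - b"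
    and xs: "length xs = m" "set xs \<subseteq> C" "det (mat_of_cols m xs) \<noteq> 0"
    and d: "\<And>B. B \<in> carrier_mat m m \<Longrightarrow> (\<And>j. j < m \<Longrightarrow> col B j \<in> C) \<Longrightarrow> \<bar>det B\<bar> \<le> \<Delta>"
  shows "\<exists>A\<in>modular_mats \<Delta> m. card C \<le> num_differing A \<and> ((\<forall>c\<in>C. primitive_vec c) \<longrightarrow> card C \<le> num_differing_primitive A)"
proof -
  obtain cs where cs: "set cs = C" "distinct cs" using finite_distinct_list[OF C(1)] by blast
  let ?A = "mat_of_cols m cs"
  have A: "?A \<in> carrier_mat m (length cs)" by simp
  have cA: "cols ?A = cs" using C(2) cs by simp
  have fr: "full_row_rank ?A" unfolding full_row_rank_iff[OF A] cA cs(1) using xs by blast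
  have le: "m \<le> length cs"
  proof -
    have "vec_space.rank m (map_mat real_of_int ?A) \<le> length cs" by (intro vec_space.rank_le_nc) simp
    thus ?thesis using fr unfolding full_row_rank_def by simp
  qed
  have "max_minor ?A \<le> \<Delta>" by (rule max_minor_le[OF A le]) (use d cA cs in auto)
  hence "?A \<in> modular_mats \<Delta> m" using fr unfolding modular_mats_def by simp
  moreover have sz: "size (mset cs) = card C" using cs distinct_card by fastforce
  have "differing_columns (mset cs)"
    unfolding differing_columns_def
  proof (intro conjI allI impI ballI)
    fix a b assume ab: "{#a, b#} \<subseteq># mset cs"
    have "a \<in># mset cs" "b \<in># mset cs" using mset_subset_eqD[OF ab] by auto
    hence "a \<noteq> - b" using C(3) cs(1) by auto
    moreover have "a \<noteq> b"
    proof
      assume "a = b"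
      hence "2 \<le> count (mset cs) a" using mset_subset_eq_count[OF ab, of a] by simp
      moreover have "count (mset cs) a \<le> 1" using cs(2) by (simp add: distinct_count_atmost_1)
      ultimately show False by simp
    qed
    ultimately show "differ a b" unfolding differ_def by simp
  next
    fix a assume "a \<in># mset cs"
    hence a: "a \<in> C" using cs by simp
    show "a \<noteq> 0\<^sub>v (dim_vec a)"
    proof
      assume z: "a = 0\<^sub>v (dim_vec a)"
      have "a = - a" by (rule eq_vecI) (use arg_cong[OF z, of "\<lambda>v. v $ _"] in auto)
      thus False using C(3)[OF a a] by simp
    qed
  qed
  from le_num_differing[OF _ this, of ?A] have "card C \<le> num_differing ?A \<and> ((\<forall>c\<in>C. primitive_vec c) \<longrightarrow> card C \<le> num_differing_primitive ?A)"
    unfolding cA sz using cs(1) by auto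
  ultimately show ?thesis by blast
qed

lemma primitive_vecI: assumes "i < dim_vec v" "\<bar>v $ i\<bar> = 1" shows "primitive_vec v"
proof -
  have "v $ i \<in> set\<^sub>v v" using assms(1) by (intro vec_setI) auto
  hence "Gcd (set\<^sub>v v) dvd v $ i" by (rule Gcd_dvd)
  hence "Gcd (set\<^sub>v v) dvd 1" using assms(2) by (metis dvd_abs_iff)
  hence "\<bar>Gcd (set\<^sub>v v)\<bar> = 1" by simp
  thus ?thesis unfolding primitive_vec_def by simp
qed

section \<open>Extremal column sets\<close>

text \<open>An end point \<open>m\<close> or larger is invisible, so \<open>edge m (i, m)\<close> is a unit vector and \<open>pairs m\<close> stands for the edges of the complete graph on \<open>m + 1\<close> vertices.\<close>

definition edge :: "nat \<Rightarrow> nat \<times> nat \<Rightarrow> int vec" where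
  "edge m = (\<lambda>(i, j). vec m (\<lambda>k. of_bool (k = i) - of_bool (k = j)))"

definition plus_edge :: "nat \<Rightarrow> nat \<Rightarrow> int vec" where
  "plus_edge m j = vec m (\<lambda>k. of_bool (k = 0) + of_bool (k = j))"

definition pairs :: "nat \<Rightarrow> (nat \<times> nat) set" where "pairs m = {(i, j). i < j \<and> j \<le> m}"

lemma card_pairs: "finite (pairs m)" "card (pairs m) = m * (m + 1) div 2"
proof -
  have e: "pairs m = prod.swap ` (SIGMA j:{..m}. {..<j})" unfolding pairs_def by (auto simp: image_iff)
  show "finite (pairs m)" unfolding e by simp
  have "card (pairs m) = card (SIGMA j:{..m}. {..<j})" unfolding e by (rule card_image) simp
  also have "\<dots> = (\<Sum>j\<le>m. j)" by simp
  also have "\<dots> = m * (m + 1) div 2" using gauss_sum_nat[of m] by (simp add: atMost_atLeast0)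
  finally show "card (pairs m) = m * (m + 1) div 2" .
qed

lemma edge_carrier: "edge m x \<in> carrier_vec m" "plus_edge m j \<in> carrier_vec m"
  unfolding edge_def plus_edge_def by (auto split: prod.split)

lemma edge_index: "k < m \<Longrightarrow> edge m (i, j) $ k = of_bool (k = i) - of_bool (k = j)"
  "k < m \<Longrightarrow> plus_edge m j $ k = of_bool (k = 0) + of_bool (k = j)"
  unfolding edge_def plus_edge_def by auto

lemma edge_not_neg: assumes "x \<in> pairs m" "y \<in> pairs m" shows "edge m x \<noteq> - edge m y"
proof
  assume h: "edge m x = - edge m y"
  obtain i j k l where x: "x = (i, j)" "y = (k, l)" by (cases x; cases y)
  have b: "i < j" "j \<le> m" "k < l" "l \<le> m" using assms x unfolding pairs_def by auto
  have e: "edge m x $ t = - (edge m y $ t)" if "t < m" for t unfolding h using that edge_carrier(1)[of m y] by simp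
  have "i = l" using e[of i] b unfolding x by (auto simp: edge_index of_bool_def split: if_splits)
  moreover have "k = j" using e[of k] b unfolding x by (auto simp: edge_index of_bool_def split: if_splits)
  ultimately show False using b by simp
qed

lemma edge_inj: "inj_on (edge m) (pairs m)"
proof (rule inj_onI)
  fix x y assume a: "x \<in> pairs m" "y \<in> pairs m" "edge m x = edge m y"
  obtain i j k l where x: "x = (i, j)" "y = (k, l)" by (cases x; cases y)
  have b: "i < j" "j \<le> m" "k < l" "l \<le> m" using a x unfolding pairs_def by auto
  have e: "edge m (i, j) $ t = edge m (k, l) $ t" for t using a(3) x by simp
  have ik: "i = k" using e[of i] b by (auto simp: edge_index of_bool_def split: if_splits)
  have "j = l"
  proof (rule ccontr)
    assume n: "j \<noteq> l"
    hence "j < m \<or> l < m" using b by auto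
    thus False using e[of j] e[of l] b n ik by (auto simp: edge_index of_bool_def split: if_splits)
  qed
  thus "x = y" using ik x by simp
qed

lemma plus_edge_entry:
  assumes "1 \<le> j" "j < m"
  shows "plus_edge m j $ 0 = 1" "plus_edge m j $ j = 1"
  using assms by (auto simp: edge_index)

lemma plus_edge_ne:
  assumes j: "1 \<le> j" "j < m"
  shows "x \<in> pairs m \<Longrightarrow> plus_edge m j \<noteq> edge m x" "x \<in> pairs m \<Longrightarrow> plus_edge m j \<noteq> - edge m x"
    "x \<in> pairs m \<Longrightarrow> edge m x \<noteq> - plus_edge m j" "plus_edge m j \<noteq> - plus_edge m l"
proof -
  have n: "- edge m x \<noteq> plus_edge m j \<and> edge m x \<noteq> plus_edge m j" if x: "x \<in> pairs m" for x
  proof -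
    obtain i k where ik: "x = (i, k)" "i < k" "k \<le> m" using x unfolding pairs_def by auto
    show ?thesis
    proof (intro conjI notI)
      assume h: "- edge m x = plus_edge m j"
      have "- (edge m x $ t) = plus_edge m j $ t" if "t < m" for t using arg_cong[OF h, of "\<lambda>v. v $ t"] that edge_carrier(1)[of m x] by simp
      from this[of 0] this[of j] show False using plus_edge_entry[OF j] j ik by (auto simp: edge_index of_bool_def split: if_splits)
    next
      assume h: "edge m x = plus_edge m j"
      from arg_cong[OF h, of "\<lambda>v. v $ 0"] arg_cong[OF h, of "\<lambda>v. v $ j"] show False
        using plus_edge_entry[OF j] j ik by (auto simp: edge_index of_bool_def split: if_splits)
    qed
  qed
  show "x \<in> pairs m \<Longrightarrow> plus_edge m j \<noteq> edge m x" "x \<in> pairs m \<Longrightarrow> plus_edge m j \<noteq> - edge m x" using n by metis+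
  show "x \<in> pairs m \<Longrightarrow> edge m x \<noteq> - plus_edge m j" using n[of x] by auto
  show "plus_edge m j \<noteq> - plus_edge m l"
  proof
    assume h: "plus_edge m j = - plus_edge m l"
    have "plus_edge m j $ 0 = - (plus_edge m l $ 0)" unfolding h using edge_carrier(2)[of m l] j by simp
    thus False using j by (auto simp: edge_index of_bool_def split: if_splits)
  qed
qed

lemma det_mat_of_cols_unit: "det (mat_of_cols m (map (\<lambda>i. edge m (i, m)) [0..<m])) \<noteq> 0"
proof -
  have "mat_of_cols m (map (\<lambda>i. edge m (i, m)) [0..<m]) = 1\<^sub>m m"
    by (intro eq_matI) (auto simp: mat_of_cols_index edge_index)
  thus ?thesis by simp
qed

lemma col_index: "B \<in> carrier_mat m m \<Longrightarrow> j < m \<Longrightarrow> i < m \<Longrightarrow> B $$ (i, j) = col B j $ i"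
  by auto

lemma det_edges:
  assumes B: "B \<in> carrier_mat m m" "\<And>j. j < m \<Longrightarrow> col B j \<in> edge m ` pairs m"
  shows "\<bar>det B\<bar> \<le> 1"
proof (rule det_network[OF B(1)])
  fix j assume j: "j < m"
  obtain i k where "col B j = edge m (i, k)" using B(2)[OF j] by auto
  hence "B $$ (t, j) = of_bool (t = i) - of_bool (t = k)" if "t < m" for t
    using col_index[OF B(1) j that] edge_index(1)[OF that] by simp
  thus "\<exists>p r. \<forall>i<m. B $$ (i, j) = of_bool (i = p) - of_bool (i = r)" by blast
qed

lemma det_split_row:
  fixes B :: "int mat"
  assumes B: "B \<in> carrier_mat n n" "i < n" "B1 \<in> carrier_mat n n" "B2 \<in> carrier_mat n n"
    and r: "\<And>j. j < n \<Longrightarrow> B $$ (i, j) = B2 $$ (i, j) - B1 $$ (i, j)"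
    and o: "\<And>k j. k < n \<Longrightarrow> j < n \<Longrightarrow> k \<noteq> i \<Longrightarrow> B1 $$ (k, j) = B $$ (k, j) \<and> B2 $$ (k, j) = B $$ (k, j)"
  shows "det B = det B2 - det B1"
proof -
  have d: "mat_delete B1 i j = mat_delete B i j" "mat_delete B2 i j = mat_delete B i j" for j
    using B o unfolding mat_delete_def by (auto intro!: eq_matI)
  show ?thesis
    unfolding laplace_expansion_row[OF B(1,2)] laplace_expansion_row[OF B(3,2)] laplace_expansion_row[OF B(4,2)]
    using r d by (simp add: cofactor_def sum_subtractf[symmetric] left_diff_distrib)
qed

text \<open>Split the first row into the part coming from the columns \<open>plus_edge\<close> and the rest. By linearity the determinant is a difference of two, and both matrices are of the form treated in \<open>det_network\<close>.\<close>

lemma det_edges_plus: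
  assumes B: "B \<in> carrier_mat m m" "\<And>j. j < m \<Longrightarrow> col B j \<in> edge m ` pairs m \<union> plus_edge m ` {1..<m}" and m: "m \<ge> 1"
  shows "\<bar>det B\<bar> \<le> 2"
proof -
  define P where "P j \<longleftrightarrow> col B j \<in> plus_edge m ` {1..<m}" for j
  define B1 where "B1 = mat m m (\<lambda>(i, j). if i = 0 then (if P j then -1 else 0) else B $$ (i, j))"
  define B2 where "B2 = mat m m (\<lambda>(i, j). if i = 0 then (if P j then 0 else B $$ (i, j)) else B $$ (i, j))"
  have col: "\<exists>a b. a < b \<and> b \<le> m \<and> (\<forall>t<m. B $$ (t, j) = of_bool (t = a) - of_bool (t = b))" if j: "j < m" "\<not> P j" for j
  proof -
    obtain i k where "col B j = edge m (i, k)" "i < k" "k \<le> m" using B(2)[OF j(1)] j(2) unfolding P_def pairs_def by auto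
    moreover from this have "B $$ (t, j) = of_bool (t = i) - of_bool (t = k)" if "t < m" for t
      using col_index[OF B(1) j(1) that] edge_index(1)[OF that] by simp
    ultimately show ?thesis by blast
  qed
  have colP: "\<exists>a\<ge>1. a < m \<and> (\<forall>t<m. B $$ (t, j) = of_bool (t = 0) + of_bool (t = a))" if j: "j < m" "P j" for j
  proof -
    obtain a where "col B j = plus_edge m a" "1 \<le> a" "a < m" using j(2) unfolding P_def by auto
    moreover from this have "B $$ (t, j) = of_bool (t = 0) + of_bool (t = a)" if "t < m" for t
      using col_index[OF B(1) j(1) that] edge_index(2)[OF that] by simp
    ultimately show ?thesis by blast
  qed
  have "det B = det B2 - det B1"
  proof (rule det_split_row[OF B(1), of 0])
    show "B $$ (0, j) = B2 $$ (0, j) - B1 $$ (0, j)" if j: "j < m" for j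
      using colP[OF j] j m unfolding B1_def B2_def by auto
  qed (use m in \<open>auto simp: B1_def B2_def\<close>)
  moreover have "\<bar>det B1\<bar> \<le> 1"
  proof (rule det_network)
    fix j assume j: "j < m"
    show "\<exists>p r. \<forall>i<m. B1 $$ (i, j) = of_bool (i = p) - of_bool (i = r)"
    proof (cases "P j")
      case True
      then obtain a where a: "1 \<le> a" "a < m" "\<forall>t<m. B $$ (t, j) = of_bool (t = 0) + of_bool (t = a)" using colP[OF j] by blast
      have "B1 $$ (i, j) = of_bool (i = a) - of_bool (i = 0)" if i: "i < m" for i
        using a(3)[rule_format, OF i] i j a(1) True unfolding B1_def by auto
      thus ?thesis by blast
    next
      case False
      then obtain a b where a: "a < b" "b \<le> m" "\<forall>t<m. B $$ (t, j) = of_bool (t = a) - of_bool (t = b)" using col[OF j] by blast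
      have "B1 $$ (i, j) = of_bool (i = (if a = 0 then m else a)) - of_bool (i = b)" if i: "i < m" for i
        using a(3)[rule_format, OF i] i j a(1) False unfolding B1_def by auto
      thus ?thesis by blast
    qed
  qed (simp add: B1_def)
  moreover have "\<bar>det B2\<bar> \<le> 1"
  proof (rule det_network)
    fix j assume j: "j < m"
    show "\<exists>p r. \<forall>i<m. B2 $$ (i, j) = of_bool (i = p) - of_bool (i = r)"
    proof (cases "P j")
      case True
      then obtain a where a: "1 \<le> a" "a < m" "\<forall>t<m. B $$ (t, j) = of_bool (t = 0) + of_bool (t = a)" using colP[OF j] by blast
      have "B2 $$ (i, j) = of_bool (i = a) - of_bool (i = m)" if i: "i < m" for i
        using a(3)[rule_format, OF i] i j a(1) True unfolding B2_def by auto
      thus ?thesis by blast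
    next
      case False
      then obtain a b where a: "\<forall>t<m. B $$ (t, j) = of_bool (t = a) - of_bool (t = b)" using col[OF j] by blast
      have "B2 $$ (i, j) = of_bool (i = a) - of_bool (i = b)" if i: "i < m" for i
        using a[rule_format, OF i] i j False unfolding B2_def by auto
      thus ?thesis by blast
    qed
  qed (simp add: B2_def)
  ultimately show ?thesis by linarith
qed

lemma lower_unimodular:
  "\<exists>A\<in>modular_mats 1 m. m * (m + 1) div 2 \<le> num_differing A"
proof -
  have "\<exists>A\<in>modular_mats 1 m. card (edge m ` pairs m) \<le> num_differing A \<and> ((\<forall>c\<in>edge m ` pairs m. primitive_vec c) \<longrightarrow> card (edge m ` pairs m) \<le> num_differing_primitive A)"
  proof (rule exists_modular[where xs = "map (\<lambda>i. edge m (i, m)) [0..<m]"])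
    show "set (map (\<lambda>i. edge m (i, m)) [0..<m]) \<subseteq> edge m ` pairs m" unfolding pairs_def by auto
  qed (use card_pairs edge_carrier edge_not_neg det_mat_of_cols_unit det_edges in auto)
  moreover have "card (edge m ` pairs m) = m * (m + 1) div 2" using card_image[OF edge_inj] card_pairs by simp
  ultimately show ?thesis by auto
qed

lemma lower_bimodular:
  assumes m: "m \<ge> 1"
  shows "\<exists>A\<in>modular_mats 2 m. m * (m + 1) div 2 + (m - 1) \<le> num_differing_primitive A"
proof -
  let ?C = "edge m ` pairs m \<union> plus_edge m ` {1..<m}"
  have "\<exists>A\<in>modular_mats 2 m. card ?C \<le> num_differing A \<and> ((\<forall>c\<in>?C. primitive_vec c) \<longrightarrow> card ?C \<le> num_differing_primitive A)"
  proof (rule exists_modular[where xs = "map (\<lambda>i. edge m (i, m)) [0..<m]"])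
    show "set (map (\<lambda>i. edge m (i, m)) [0..<m]) \<subseteq> ?C" unfolding pairs_def by auto
    show "\<bar>det B\<bar> \<le> 2" if "B \<in> carrier_mat m m" "\<And>j. j < m \<Longrightarrow> col B j \<in> ?C" for B by (rule det_edges_plus[OF that m])
    show "a \<noteq> - b" if "a \<in> ?C" "b \<in> ?C" for a b
    proof -
      have c: "(\<exists>x\<in>pairs m. c = edge m x) \<or> (\<exists>j. 1 \<le> j \<and> j < m \<and> c = plus_edge m j)" if "c \<in> ?C" for c
        using that by auto
      show ?thesis using c[OF that(1)] c[OF that(2)] edge_not_neg plus_edge_ne(2-4) by metis
    qed
  qed (use card_pairs edge_carrier det_mat_of_cols_unit in auto)
  moreover have "card ?C = m * (m + 1) div 2 + (m - 1)"
  proof -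
    have inj: "inj_on (plus_edge m) {1..<m}"
    proof (rule inj_onI)
      fix j l assume h: "j \<in> {1..<m}" "l \<in> {1..<m}" "plus_edge m j = plus_edge m l"
      have "plus_edge m l $ j = 1" using plus_edge_entry(2)[of j m] h by simp
      thus "j = l" using h by (auto simp: edge_index of_bool_def split: if_splits)
    qed
    have "card ?C = card (edge m ` pairs m) + card (plus_edge m ` {1..<m})"
    proof (rule card_Un_disjoint)
      have "x \<notin> edge m ` pairs m" if "x \<in> plus_edge m ` {1..<m}" for x
        using that plus_edge_ne(1) by (metis imageE atLeastLessThan_iff)
      thus "edge m ` pairs m \<inter> plus_edge m ` {1..<m} = {}" by blast
    qed (use card_pairs in auto)
    thus ?thesis using card_image[OF edge_inj] card_pairs card_image[OF inj] by simp
  qed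
  moreover have "primitive_vec c" if "c \<in> ?C" for c
  proof -
    from that consider x where "x \<in> pairs m" "c = edge m x" | j where "1 \<le> j" "j < m" "c = plus_edge m j" by auto
    thus ?thesis
    proof cases
      case (1 x)
      then obtain i j where "c = edge m (i, j)" "i < j" "j \<le> m" unfolding pairs_def by auto
      thus ?thesis using edge_carrier(1)[of m "(i, j)"] by (intro primitive_vecI[of i]) (auto simp: edge_index)
    next
      case 2
      thus ?thesis using edge_carrier(2)[of m j] by (intro primitive_vecI[of 0]) (auto simp: edge_index)
    qed
  qed
  ultimately show ?thesis by auto
qed

text \<open>A version of \<open>exists_modular\<close> in which the conditions on the columns can be decided by evaluation.\<close>

lemma list_family:
  assumes cs: "distinct cs" "\<forall>a\<in>set cs. length a = m \<and> (\<exists>x\<in>set a. \<bar>x\<bar> = 1)" "\<forall>a\<in>set cs. \<forall>b\<in>set cs. a \<noteq> map uminus b"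
    and xs: "length xs = m" "set xs \<subseteq> set cs" "det (mat_of_cols m (map vec_of_list xs)) \<noteq> 0"
    and d: "\<And>B. B \<in> carrier_mat m m \<Longrightarrow> (\<And>j. j < m \<Longrightarrow> \<exists>a\<in>set cs. \<forall>i<m. B $$ (i, j) = a ! i) \<Longrightarrow> \<bar>det B\<bar> \<le> \<Delta>"
  shows "\<exists>A\<in>modular_mats \<Delta> m. length cs \<le> num_differing_primitive A"
proof -
  let ?C = "vec_of_list ` set cs"
  have inj: "inj (vec_of_list :: int list \<Rightarrow> _)" by (metis injI list_vec)
  have "\<exists>A\<in>modular_mats \<Delta> m. card ?C \<le> num_differing A \<and> ((\<forall>c\<in>?C. primitive_vec c) \<longrightarrow> card ?C \<le> num_differing_primitive A)"
  proof (rule exists_modular[where xs = "map vec_of_list xs"])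
    show "?C \<subseteq> carrier_vec m" using cs(2) by (auto intro!: carrier_vecI)
    show "a \<noteq> - b" if ab: "a \<in> ?C" "b \<in> ?C" for a b
    proof
      assume h: "a = - b"
      obtain x y where xy: "x \<in> set cs" "y \<in> set cs" "a = vec_of_list x" "b = vec_of_list y" using ab by auto
      have "vec_of_list x = vec_of_list (map uminus y)"
        using h cs(2) xy by (intro eq_vecI) (auto simp: vec_of_list_index)
      hence "x = map uminus y" using inj by (simp add: inj_eq del: vec_of_list_map)
      thus False using cs(3) xy by blast
    qed
    show "\<bar>det B\<bar> \<le> \<Delta>" if B: "B \<in> carrier_mat m m" "\<And>j. j < m \<Longrightarrow> col B j \<in> ?C" for B
    proof (rule d[OF B(1)])
      fix j assume j: "j < m"
      obtain a where a: "a \<in> set cs" "col B j = vec_of_list a" using B(2)[OF j] by auto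
      have "B $$ (i, j) = a ! i" if "i < m" for i using col_index[OF B(1) j that] a(2) by (simp add: vec_of_list_index)
      thus "\<exists>a\<in>set cs. \<forall>i<m. B $$ (i, j) = a ! i" using a(1) by blast
    qed
  qed (use xs in auto)
  moreover have "card ?C = length cs" using card_image[OF inj_on_subset[OF inj]] distinct_card[OF cs(1)] by (metis subset_UNIV)
  moreover have "primitive_vec c" if cC: "c \<in> ?C" for c
  proof -
    obtain a where a: "a \<in> set cs" "c = vec_of_list a" using cC by blast
    obtain i where "i < length a" "\<bar>a ! i\<bar> = 1" using cs(2) a(1) by (metis in_set_conv_nth)
    thus ?thesis unfolding a(2) by (intro primitive_vecI[of i]) (auto simp: vec_of_list_index)
  qed
  ultimately show ?thesis by auto
qed

text \<open>The positive roots of type B.\<close>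

definition B3_roots :: "int list list" where
  "B3_roots = [[1,0,0],[0,1,0],[0,0,1],[1,-1,0],[1,0,-1],[0,1,-1],[1,1,0],[1,0,1],[0,1,1]]"

lemma nonzero_count:
  assumes "length r = n"
  shows "card {i. i < n \<and> r ! i \<noteq> 0} = length (filter (\<lambda>x. x \<noteq> 0) r)"
  using assms by (simp add: length_filter_conv_card)

lemma lower_three: "\<exists>A\<in>modular_mats 2 3. 9 \<le> num_differing_primitive A"
proof -
  have "\<exists>A\<in>modular_mats 2 3. length B3_roots \<le> num_differing_primitive A"
  proof (rule list_family[where xs = "[[1,0,0],[0,1,0],[0,0,1]]"])
    have "mat_of_cols 3 (map vec_of_list [[1,0,0],[0,1,0],[0,0,1::int]]) = 1\<^sub>m 3"
    proof (rule eq_matI)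
      fix i j assume "i < dim_row (1\<^sub>m 3 :: int mat)" "j < dim_col (1\<^sub>m 3 :: int mat)"
      hence "i \<in> {0, 1, 2}" "j \<in> {0, 1, 2}" by auto
      thus "mat_of_cols 3 (map vec_of_list [[1,0,0],[0,1,0],[0,0,1::int]]) $$ (i, j) = 1\<^sub>m 3 $$ (i, j)"
        by (auto simp: mat_of_cols_index vec_of_list_index simp del: vec_of_list_Cons)
    qed auto
    thus "det (mat_of_cols 3 (map vec_of_list [[1,0,0],[0,1,0],[0,0,1::int]])) \<noteq> 0" by simp
    fix B :: "int mat" assume B: "B \<in> carrier_mat 3 3" "\<And>j. j < 3 \<Longrightarrow> \<exists>a\<in>set B3_roots. \<forall>i<3. B $$ (i, j) = a ! i"
    have p: "\<forall>a\<in>set B3_roots. length a = 3 \<and> (\<forall>x\<in>set a. \<bar>x\<bar> \<le> 1) \<and> length (filter (\<lambda>x. x \<noteq> 0) a) \<le> 2"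
      unfolding B3_roots_def by simp
    have "\<bar>det B\<bar> \<le> 2 ^ (3 div 2)"
    proof (rule det_sparse[OF B(1)])
      fix j :: nat assume j: "j < 3"
      obtain a where a: "a \<in> set B3_roots" "\<forall>i<3. B $$ (i, j) = a ! i" using B(2)[OF j] by blast
      have "{i. i < 3 \<and> B $$ (i, j) \<noteq> 0} = {i. i < 3 \<and> a ! i \<noteq> 0}" using a(2) by auto
      thus "card {i. i < 3 \<and> B $$ (i, j) \<noteq> 0} \<le> 2" using nonzero_count[of a 3] p a(1) by auto
      show "\<bar>B $$ (i, j)\<bar> \<le> 1" if "i < 3" for i using a p that nth_mem by metis
    qed
    thus "\<bar>det B\<bar> \<le> 2" by simp
  qed (simp_all add: B3_roots_def)
  moreover have "length B3_roots = 9" by (simp add: B3_roots_def)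
  ultimately show ?thesis by (simp only:)
qed

text \<open>The positive roots of type D in coordinates with respect to the columns of \<open>D5_basis\<close>, which generate the root lattice. Passing to this lattice divides determinants by 2; the bound 4 of \<open>det_sparse\<close> for the roots becomes 2.\<close>

definition D5_columns :: "int list list" where
  "D5_columns = [[0,-1,0,0,0],[0,0,-1,0,0],[0,0,0,-1,0],[0,0,0,0,-1],
         [1,1,0,0,0],[1,0,1,0,0],[1,0,0,1,0],[1,0,0,0,1],
         [0,1,-1,0,0],[0,1,0,-1,0],[0,1,0,0,-1],[0,0,1,-1,0],[0,0,1,0,-1],[0,0,0,1,-1],
         [1,1,1,0,0],[1,1,0,1,0],[1,1,0,0,1],[1,0,1,1,0],[1,0,1,0,1],[1,0,0,1,1]]"

definition D5_basis :: "int mat" where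
  "D5_basis = mat 5 5 (\<lambda>(i, j). if i = 0 then (if j = 0 then 2 else -1) else of_bool (i = j))"

definition D5_root :: "int list \<Rightarrow> int list" where
  "D5_root a = [2 * a ! 0 - a ! 1 - a ! 2 - a ! 3 - a ! 4, a ! 1, a ! 2, a ! 3, a ! 4]"

lemma upto5: "i < 5 \<longleftrightarrow> i \<in> {0, 1, 2, 3, 4 :: nat}"
  by auto

lemma upt5: "[0..<5] = [0, 1, 2, 3, 4 :: nat]"
  by (simp add: upt_conv_Cons)

lemma sum5: "(\<Sum>i = 0..<5. f i) = f 0 + f 1 + f 2 + f 3 + f 4" for f :: "nat \<Rightarrow> int"
  by (simp add: eval_nat_numeral)

lemma det_D5_basis: "det D5_basis = 2"
proof -
  have "det D5_basis = prod_list (diag_mat D5_basis)"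
    by (rule det_upper_triangular[of _ 5]) (auto simp: D5_basis_def upper_triangular_def)
  also have "diag_mat D5_basis = [2, 1, 1, 1, 1]"
    unfolding diag_mat_def D5_basis_def by (simp add: upt5)
  finally show ?thesis by simp
qed

lemma lower_five: "\<exists>A\<in>modular_mats 2 5. 20 \<le> num_differing_primitive A"
proof -
  \<comment> \<open>A triangular choice of columns witnesses full rank.\<close>
  let ?xs = "[[1,1,0,0,0],[0,-1,0,0,0],[0,0,-1,0,0],[0,0,0,-1,0],[0,0,0,0,-1]] :: int list list"
  have "\<exists>A\<in>modular_mats 2 5. length D5_columns \<le> num_differing_primitive A"
  proof (rule list_family[where xs = ?xs])
    let ?M = "mat_of_cols 5 (map vec_of_list ?xs)"
    have e: "?M $$ (i, j) = ?xs ! j ! i" if "i < 5" "j < 5" for i j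
      using that by (simp add: mat_of_cols_index vec_of_list_index del: vec_of_list_Cons list.map) 
    have "det ?M = prod_list (diag_mat ?M)"
    proof (rule det_lower_triangular[of 5])
      fix i j :: nat assume "i < j" "j < 5"
      moreover from this have "i \<in> {0, 1, 2, 3, 4}" "j \<in> {0, 1, 2, 3, 4}" by auto
      ultimately show "?M $$ (i, j) = 0" using e[of i j] by auto
    qed (simp add: carrier_matI)
    also have "diag_mat ?M = [1, -1, -1, -1, -1]"
    proof -
      have "diag_mat ?M = map (\<lambda>i. ?M $$ (i, i)) [0, 1, 2, 3, 4]" unfolding diag_mat_def by (simp only: mat_of_cols_carrier upt5)
      thus ?thesis using e by simp
    qed
    finally show "det ?M \<noteq> 0" by simp
    fix B :: "int mat" assume B: "B \<in> carrier_mat 5 5" "\<And>j. j < 5 \<Longrightarrow> \<exists>a\<in>set D5_columns. \<forall>i<5. B $$ (i, j) = a ! i"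
    have p: "\<forall>a\<in>set D5_columns. (\<forall>x\<in>set (D5_root a). \<bar>x\<bar> \<le> 1) \<and> length (filter (\<lambda>x. x \<noteq> 0) (D5_root a)) \<le> 2"
      unfolding D5_columns_def D5_root_def by simp
    let ?R = "D5_basis * B"
    have P: "D5_basis \<in> carrier_mat 5 5" unfolding D5_basis_def by simp
    have R: "?R $$ (i, j) = D5_root a ! i" if ij: "i < 5" "j < 5" and a: "\<forall>i<5. B $$ (i, j) = a ! i" for i j a
    proof -
      have "?R $$ (i, j) = (\<Sum>k = 0..<5. D5_basis $$ (i, k) * B $$ (k, j))"
        using ij P B(1) by (simp add: scalar_prod_def)
      also have "\<dots> = (\<Sum>k = 0..<5. D5_basis $$ (i, k) * a ! k)" using a by (intro sum.cong) auto
      also have "\<dots> = D5_root a ! i" using ij(1) unfolding upto5 sum5 D5_root_def D5_basis_def by auto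
      finally show ?thesis .
    qed
    have "\<bar>det ?R\<bar> \<le> 2 ^ (5 div 2)"
    proof (rule det_sparse)
      show "?R \<in> carrier_mat 5 5" using P B(1) by simp
      fix j :: nat assume j: "j < 5"
      obtain a where a: "a \<in> set D5_columns" "\<forall>i<5. B $$ (i, j) = a ! i" using B(2)[OF j] by blast
      have l: "length (D5_root a) = 5" unfolding D5_root_def by simp
      have "{i. i < 5 \<and> ?R $$ (i, j) \<noteq> 0} = {i. i < 5 \<and> D5_root a ! i \<noteq> 0}" using R[OF _ j a(2)] by auto
      thus "card {i. i < 5 \<and> ?R $$ (i, j) \<noteq> 0} \<le> 2" using nonzero_count[OF l] p a(1) by auto
      show "\<bar>?R $$ (i, j)\<bar> \<le> 1" if "i < 5" for i using R[OF that j a(2)] p a(1) nth_mem[of i "D5_root a"] that l by auto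
    qed
    thus "\<bar>det B\<bar> \<le> 2" using det_mult[OF P B(1)] det_D5_basis by (simp add: abs_mult)
  qed (simp_all add: D5_columns_def)
  moreover have "length D5_columns = 20" by (simp add: D5_columns_def)
  ultimately show ?thesis by (simp only:)
qed

section \<open>Columns as real functions\<close>

instantiation "fun" :: (type, real_vector) real_vector
begin
definition scaleR_fun :: "real \<Rightarrow> ('a \<Rightarrow> 'b) \<Rightarrow> 'a \<Rightarrow> 'b" where "scaleR_fun c f = (\<lambda>x. c *\<^sub>R f x)"
instance by standard (auto simp: scaleR_fun_def fun_eq_iff algebra_simps)
end

lemma scaleR_fun_apply [simp]: "(c *\<^sub>R f) x = c *\<^sub>R f x"
  by (simp add: scaleR_fun_def)

lemma sum_fun_apply: "(\<Sum>k\<in>K. f k) x = (\<Sum>k\<in>K. f k x)"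
  by (induction K rule: infinite_finite_induct) auto

text \<open>Integer vectors of length \<open>m\<close>, extended by zero, so that all dimensions live in one real vector space.\<close>

definition lat :: "nat \<Rightarrow> (nat \<Rightarrow> real) set" where
  "lat m = {f. (\<forall>i<m. f i \<in> \<int>) \<and> (\<forall>i\<ge>m. f i = 0)}"

definition unit :: "nat \<Rightarrow> nat \<Rightarrow> real" where "unit i = (\<lambda>k. of_bool (k = i))"

definition lmat :: "nat \<Rightarrow> (nat \<Rightarrow> real) list \<Rightarrow> real mat" where
  "lmat m ys = mat m m (\<lambda>(i, j). (ys ! j) i)"

text \<open>The determinant of a Gram matrix is the square of the determinant of the columns and needs no enumeration of them.\<close>

definition gram :: "nat \<Rightarrow> 'k set \<Rightarrow> ('k \<Rightarrow> nat \<Rightarrow> real) \<Rightarrow> real mat" where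
  "gram m K f = mat m m (\<lambda>(i, j). \<Sum>k\<in>K. f k i * f k j)"

definition gvol :: "nat \<Rightarrow> (nat \<Rightarrow> real) set \<Rightarrow> nat" where
  "gvol m Y = nat \<lfloor>sqrt (det (gram m Y (\<lambda>y. y)))\<rfloor>"

lemma det_gram:
  assumes g: "bij_betw g {0..<m} K"
  shows "det (gram m K f) = (det (mat m m (\<lambda>(i, j). f (g j) i)))\<^sup>2"
proof -
  let ?M = "mat m m (\<lambda>(i, j). f (g j) i)"
  have M: "?M \<in> carrier_mat m m" by simp
  have "gram m K f = ?M * transpose_mat ?M"
  proof (rule eq_matI)
    fix i j assume "i < dim_row (?M * transpose_mat ?M)" "j < dim_col (?M * transpose_mat ?M)"
    hence ij: "i < m" "j < m" by auto
    have "gram m K f $$ (i, j) = (\<Sum>k\<in>{0..<m}. f (g k) i * f (g k) j)"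
      using ij sum.reindex_bij_betw[OF g, of "\<lambda>k. f k i * f k j"] by (simp add: gram_def)
    thus "gram m K f $$ (i, j) = (?M * transpose_mat ?M) $$ (i, j)" using ij by (simp add: scalar_prod_def)
  qed (auto simp: gram_def)
  thus ?thesis using det_mult[OF M, of "transpose_mat ?M"] det_transpose[OF M] by (simp add: power2_eq_square)
qed

lemma lat_0: "0 \<in> lat m" and lat_add: "x \<in> lat m \<Longrightarrow> y \<in> lat m \<Longrightarrow> x + y \<in> lat m" and lat_neg: "x \<in> lat m \<Longrightarrow> - x \<in> lat m"
  unfolding lat_def by auto

lemma unit_lat: "i < m \<Longrightarrow> unit i \<in> lat m"
  unfolding lat_def unit_def by auto

lemma lat_expand: assumes "f \<in> lat m" shows "f = (\<Sum>i<m. f i *\<^sub>R unit i)"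
proof
  fix x
  have "(\<Sum>i<m. f i *\<^sub>R unit i) x = (\<Sum>i<m. if i = x then f i else 0)" unfolding sum_fun_apply by (intro sum.cong) (auto simp: unit_def)
  also have "\<dots> = f x" using assms unfolding lat_def by (simp add: sum.delta)
  finally show "f x = (\<Sum>i<m. f i *\<^sub>R unit i) x" by simp
qed

lemma unit_inj: "inj unit"
  by (rule injI) (metis (mono_tags, lifting) of_bool_eq_1_iff unit_def)

lemma units_indep: "independent (unit ` {..<m})"
proof -
  have f: "finite (unit ` {..<m})" by simp
  have "c (unit i) = 0" if z: "(\<Sum>v\<in>unit ` {..<m}. c v *\<^sub>R v) = 0" and i: "i < m" for c i
  proof -
    have "(\<Sum>v\<in>unit ` {..<m}. c v *\<^sub>R v) = (\<Sum>j<m. c (unit j) *\<^sub>R unit j)"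
      using unit_inj by (subst sum.reindex) (auto intro: inj_on_subset)
    hence "0 = (\<Sum>j<m. c (unit j) *\<^sub>R unit j) i" using z by (metis zero_fun_apply)
    also have "\<dots> = (\<Sum>j<m. if j = i then c (unit j) else 0)" unfolding sum_fun_apply by (intro sum.cong) (auto simp: unit_def)
    also have "\<dots> = c (unit i)" using i by (simp add: sum.delta)
    finally show ?thesis by simp
  qed
  thus ?thesis unfolding dependent_finite[OF f] by blast
qed

lemma lat_basis_card:
  assumes "lattice_basis (lat m) Y"
  shows "finite Y" "card Y = m"
proof -
  let ?U = "unit ` {..<m}"
  have Y: "Y \<subseteq> lat m" "independent Y" "lat m \<subseteq> span Y" using assms unfolding lattice_basis_def by auto
  have cU: "card ?U = m" using card_image[OF inj_on_subset[OF unit_inj]] by (metis card_lessThan subset_UNIV)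
  have "lat m \<subseteq> span ?U"
  proof
    fix f assume "f \<in> lat m"
    hence "f = (\<Sum>i<m. f i *\<^sub>R unit i)" by (rule lat_expand)
    moreover have "(\<Sum>i<m. f i *\<^sub>R unit i) \<in> span ?U" by (intro span_sum span_scale span_base) auto
    ultimately show "f \<in> span ?U" by metis
  qed
  hence "finite Y \<and> card Y \<le> card ?U" using Y by (intro independent_span_bound) auto
  moreover from this have "card ?U \<le> card Y" using Y(3) unit_lat by (intro conjunct2[OF independent_span_bound[OF _ units_indep]]) auto
  ultimately show "finite Y" "card Y = m" using cU by auto
qed

lemma bij_nth: "distinct ys \<Longrightarrow> length ys = m \<Longrightarrow> bij_betw ((!) ys) {0..<m} (set ys)"
  by (rule bij_betw_nth) (auto simp: atLeast0LessThan)

lemma gvol_eq: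
  assumes ys: "distinct ys" "length ys = m" "set ys \<subseteq> lat m"
  shows "real (gvol m (set ys)) = \<bar>det (lmat m ys)\<bar>"
proof -
  have "bij_betw ((!) ys) {0..<m} (set ys)" by (rule bij_nth[OF ys(1,2)])
  from det_gram[OF this, of "\<lambda>y. y"] have g: "det (gram m (set ys) (\<lambda>y. y)) = (det (lmat m ys))\<^sup>2" unfolding lmat_def by simp
  let ?Z = "mat m m (\<lambda>(i, j). \<lfloor>(ys ! j) i\<rfloor>) :: int mat"
  have "lmat m ys = map_mat real_of_int ?Z"
  proof (rule eq_matI)
    fix i j assume "i < dim_row (map_mat real_of_int ?Z)" "j < dim_col (map_mat real_of_int ?Z)"
    hence ij: "i < m" "j < m" by auto
    hence "ys ! j \<in> lat m" using ys nth_mem by fastforce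
    hence h: "(ys ! j) i \<in> \<int>" using ij unfolding lat_def by auto
    have "real_of_int \<lfloor>x\<rfloor> = x" if "x \<in> \<int>" for x :: real using that by (auto elim!: Ints_cases)
    note e = this[OF h]
    have e1: "lmat m ys $$ (i, j) = (ys ! j) i" using ij by (simp add: lmat_def)
    have e2: "map_mat real_of_int ?Z $$ (i, j) = real_of_int \<lfloor>(ys ! j) i\<rfloor>" using ij by simp
    show "lmat m ys $$ (i, j) = map_mat real_of_int ?Z $$ (i, j)" by (simp only: e1 e2 e)
  qed (auto simp: lmat_def)
  hence d: "det (lmat m ys) = of_int (det ?Z)" using det_of_int by simp
  have "gvol m (set ys) = nat \<lfloor>\<bar>det (lmat m ys)\<bar>\<rfloor>" unfolding gvol_def g by simp
  also have "\<dots> = nat \<bar>det ?Z\<bar>" unfolding d by (metis floor_of_int of_int_abs)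
  finally show ?thesis unfolding d by simp
qed

lemma lmat_nonsingular:
  assumes ys: "distinct ys" "length ys = m" "set ys \<subseteq> lat m" "independent (set ys)"
  shows "det (lmat m ys) \<noteq> 0"
proof
  have M: "lmat m ys \<in> carrier_mat m m" unfolding lmat_def by simp
  assume "det (lmat m ys) = 0"
  then obtain v where v: "v \<in> carrier_vec m" "v \<noteq> 0\<^sub>v m" "lmat m ys *\<^sub>v v = 0\<^sub>v m" using det_0_iff_vec_prod_zero[OF M] by blast
  have b: "bij_betw ((!) ys) {0..<m} (set ys)" by (rule bij_nth[OF ys(1,2)])
  define c where "c y = v $ (inv_into {0..<m} ((!) ys) y)" for y
  have cj: "c (ys ! j) = v $ j" if "j < m" for j unfolding c_def using bij_betw_inv_into_left[OF b, of j] that by simp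
  have "(\<Sum>y\<in>set ys. c y *\<^sub>R y) = (\<Sum>j\<in>{0..<m}. c (ys ! j) *\<^sub>R (ys ! j))" by (rule sum.reindex_bij_betw[OF b, symmetric])
  also have "\<dots> = (\<Sum>j\<in>{0..<m}. v $ j *\<^sub>R (ys ! j))" using cj by (intro sum.cong) auto
  also have "\<dots> = 0"
  proof
    fix i
    show "(\<Sum>j\<in>{0..<m}. v $ j *\<^sub>R (ys ! j)) i = 0 i"
    proof (cases "i < m")
      case True
      have "(lmat m ys *\<^sub>v v) $ i = (\<Sum>j\<in>{0..<m}. (ys ! j) i * v $ j)" using True v(1) by (simp add: scalar_prod_def lmat_def)
      thus ?thesis using v(3) True by (simp add: sum_fun_apply mult.commute)
    next
      case False
      hence "(ys ! j) i = 0" if "j < m" for j using ys(2,3) that nth_mem unfolding lat_def by fastforce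
      thus ?thesis by (simp add: sum_fun_apply)
    qed
  qed
  finally have z: "(\<Sum>y\<in>set ys. c y *\<^sub>R y) = 0" .
  obtain j where j: "j < m" "v $ j \<noteq> 0" using v(1,2) by (metis carrier_vecD eq_vecI index_zero_vec)
  have "ys ! j \<in> set ys" "c (ys ! j) \<noteq> 0" using j ys(2) cj by auto
  hence "dependent (set ys)" unfolding dependent_finite[OF finite_set] using z by blast
  thus False using ys(4) by blast
qed

lemma gvol_pos: assumes Y: "lattice_basis (lat m) Y" shows "gvol m Y > 0"
proof -
  obtain ys where ys: "set ys = Y" "distinct ys" using finite_distinct_list[OF lat_basis_card(1)[OF Y]] by blast
  have l: "length ys = m" using distinct_card[OF ys(2)] lat_basis_card(2)[OF Y] ys(1) by simp
  have "Y \<subseteq> lat m" "independent Y" using Y unfolding lattice_basis_def by auto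
  hence "det (lmat m ys) \<noteq> 0" "real (gvol m Y) = \<bar>det (lmat m ys)\<bar>" using lmat_nonsingular[OF ys(2) l] gvol_eq[OF ys(2) l] ys(1) by auto
  thus ?thesis by (metis abs_0_eq abs_eq_0 gr0I of_nat_0)
qed

text \<open>Exchanging one column is multiplication by a matrix that differs from the identity in that column only.\<close>

lemma gvol_exch:
  assumes Y: "lattice_basis (lat m) Y" and y: "y \<in> Y" and x: "x \<in> lat m" "x - c *\<^sub>R y \<in> span (Y - {y})" and c: "c \<noteq> 0"
  shows "real (gvol m (insert x (Y - {y}))) = \<bar>c\<bar> * real (gvol m Y)"
proof -
  note B = lat_basis_card[OF Y]
  have YL: "Y \<subseteq> lat m" "independent Y" using Y unfolding lattice_basis_def by auto
  have fz: "finite (Y - {y})" using B by simp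
  obtain zs where zs: "set zs = Y - {y}" "distinct zs" using finite_distinct_list[OF fz] by blast
  obtain m' where m': "m = Suc m'" using B y by (metis card_gt_0_iff empty_iff gr0_implies_Suc)
  have l: "length zs = m'" using distinct_card[OF zs(2)] B y zs(1) m' by simp
  have xn: "x \<notin> Y - {y}" using span_exchange_coeff(3)[OF YL(2) y x(2) c] .
  have v1: "real (gvol m Y) = \<bar>det (lmat m (y # zs))\<bar>"
    using gvol_eq[of "y # zs" m] zs l m' YL y by (simp add: insert_absorb)
  have v2: "real (gvol m (insert x (Y - {y}))) = \<bar>det (lmat m (x # zs))\<bar>"
    using gvol_eq[of "x # zs" m] zs l m' YL x(1) xn by auto
  obtain a where a: "x - c *\<^sub>R y = (\<Sum>z\<in>Y - {y}. a z *\<^sub>R z)" using span_finite_coeff[OF fz x(2)] by metis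
  define E where "E = mat m m (\<lambda>(i, j). if j = 0 then (if i = 0 then c else a (zs ! (i - 1))) else of_bool (i = j))"
  have E: "E \<in> carrier_mat m m" unfolding E_def by simp
  have L: "lmat m (y # zs) \<in> carrier_mat m m" unfolding lmat_def by simp
  have b: "bij_betw ((!) zs) {0..<m'} (Y - {y})" using bij_nth[OF zs(2) l] zs(1) by (simp only:)
  have "lmat m (x # zs) = lmat m (y # zs) * E"
  proof (rule eq_matI)
    fix i j assume "i < dim_row (lmat m (y # zs) * E)" "j < dim_col (lmat m (y # zs) * E)"
    hence ij: "i < m" "j < m" by (auto simp: lmat_def E_def)
    have "(lmat m (y # zs) * E) $$ (i, j) = (\<Sum>k = 0..<m. ((y # zs) ! k) i * E $$ (k, j))"
      using ij L E by (simp add: scalar_prod_def lmat_def)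
    also have "\<dots> = ((x # zs) ! j) i"
    proof (cases "j = 0")
      case True
      have "x i = c * y i + (\<Sum>z\<in>Y - {y}. a z * z i)" using fun_cong[OF a, of i] by (simp add: sum_fun_apply)
      also have "(\<Sum>z\<in>Y - {y}. a z * z i) = (\<Sum>k = 0..<m'. a (zs ! k) * (zs ! k) i)"
        by (rule sum.reindex_bij_betw[OF b, symmetric])
      finally show ?thesis using True unfolding m' sum.atLeast0_lessThan_Suc_shift by (simp add: E_def m' mult.commute)
    next
      case False
      have "(\<Sum>k = 0..<m. ((y # zs) ! k) i * E $$ (k, j)) = (\<Sum>k = 0..<m. if k = j then ((y # zs) ! k) i else 0)"
        using ij False by (intro sum.cong) (auto simp: E_def)
      thus ?thesis using ij False by (simp add: sum.delta)
    qed
    finally show "lmat m (x # zs) $$ (i, j) = (lmat m (y # zs) * E) $$ (i, j)" using ij by (simp add: lmat_def)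
  qed (auto simp: lmat_def E_def)
  moreover have "det E = c"
  proof -
    have "det E = prod_list (diag_mat E)" by (rule det_lower_triangular[OF _ E]) (auto simp: E_def)
    also have "\<dots> = (\<Prod>i = 0..<m. E $$ (i, i))" using E by (simp add: prod_list_diag_prod)
    also have "\<dots> = c" unfolding m' prod.atLeast0_lessThan_Suc_shift by (simp add: E_def m')
    finally show ?thesis .
  qed
  ultimately show ?thesis unfolding v1 v2 using det_mult[OF L E] by (simp add: abs_mult mult.commute)
qed

definition emb :: "int vec \<Rightarrow> nat \<Rightarrow> real" where "emb v i = (if i < dim_vec v then real_of_int (v $ i) else 0)"

lemma emb_inj: "inj_on emb (carrier_vec m)"
proof (rule inj_onI)
  fix x y assume h: "x \<in> carrier_vec m" "y \<in> carrier_vec m" "emb x = emb y"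
  show "x = y"
  proof (rule eq_vecI)
    fix i assume "i < dim_vec y"
    thus "x $ i = y $ i" using fun_cong[OF h(3), of i] h(1,2) by (simp add: emb_def)
  qed (use h in auto)
qed

lemma emb_neg: "emb (- v) = - emb v"
  by (auto simp: emb_def fun_eq_iff)

lemma bij_pick:
  assumes K: "finite K" "card K = m"
  shows "bij_betw (pick K) {0..<m} K"
proof -
  have s: "K \<subseteq> pick K ` {0..<m}"
  proof
    fix i assume i: "i \<in> K"
    have "card {a \<in> K. a < i} < card K" using K(1) i by (intro psubset_card_mono) auto
    thus "i \<in> pick K ` {0..<m}" using pick_card_in_set[OF i] K(2) by (intro image_eqI[of _ _ "card {a \<in> K. a < i}"]) auto
  qed
  have "pick K ` {0..<m} \<subseteq> K" using pick_in_set_le K(2) by auto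
  hence e: "pick K ` {0..<m} = K" using s by blast
  hence "inj_on (pick K) {0..<m}" using K by (intro eq_card_imp_inj_on) auto
  thus ?thesis using e unfolding bij_betw_def by blast
qed

text \<open>Cramer's rule, through the adjugate of a nonsingular matrix of columns.\<close>

lemma lat_span_cols:
  assumes A: "A \<in> carrier_mat m n" and r: "full_row_rank A" and C: "\<And>c. c \<in> set (cols A) \<Longrightarrow> emb c \<in> span C"
  shows "lat m \<subseteq> span C"
proof -
  obtain xs where xs: "length xs = m" "set xs \<subseteq> set (cols A)" "det (mat_of_cols m xs) \<noteq> 0" using full_row_rank_iff[OF A] r by blast
  let ?M = "mat_of_cols m xs"
  let ?d = "det ?M"
  let ?N = "adj_mat ?M"
  have M: "?M \<in> carrier_mat m m" using xs(1) by (metis mat_of_cols_carrier(1))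
  note N = adj_mat[OF M]
  have cd: "set (cols A) \<subseteq> carrier_vec m" using cols_dim[of A] A by simp
  have car: "xs ! j \<in> carrier_vec m" if "j < m" for j
    using that xs(1) by (intro subsetD[OF cd] subsetD[OF xs(2)] nth_mem) simp
  have u: "unit i \<in> span C" if i: "i < m" for i
  proof -
    have "(\<Sum>j = 0..<m. real_of_int (?N $$ (j, i)) *\<^sub>R emb (xs ! j)) = real_of_int ?d *\<^sub>R unit i"
    proof
      fix t
      show "(\<Sum>j = 0..<m. real_of_int (?N $$ (j, i)) *\<^sub>R emb (xs ! j)) t = (real_of_int ?d *\<^sub>R unit i) t"
      proof (cases "t < m")
        case True
        have "(?M * ?N) $$ (t, i) = (\<Sum>j = 0..<m. xs ! j $ t * ?N $$ (j, i))"
          using True i N(1) M xs(1) by (simp add: scalar_prod_def mat_of_cols_index)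
        hence e: "(\<Sum>j = 0..<m. xs ! j $ t * ?N $$ (j, i)) = ?d * of_bool (t = i)" unfolding N(2) using True i by auto
        have "(\<Sum>j = 0..<m. real_of_int (?N $$ (j, i)) *\<^sub>R emb (xs ! j)) t = (\<Sum>j = 0..<m. real_of_int (xs ! j $ t * ?N $$ (j, i)))"
          unfolding sum_fun_apply using True carrier_vecD[OF car] by (intro sum.cong) (auto simp: emb_def mult.commute)
        also have "\<dots> = real_of_int (?d * of_bool (t = i))" unfolding e[symmetric] by simp
        finally show ?thesis by (simp add: unit_def)
      next
        case False
        hence "emb (xs ! j) t = 0" if "j < m" for j using carrier_vecD[OF car[OF that]] by (simp add: emb_def)
        thus ?thesis using False i by (simp add: sum_fun_apply unit_def)
      qed
    qed
    moreover have "(\<Sum>j = 0..<m. real_of_int (?N $$ (j, i)) *\<^sub>R emb (xs ! j)) \<in> span C"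
      using xs(1) by (intro span_sum span_scale C subsetD[OF xs(2)] nth_mem) simp
    ultimately have "(1 / real_of_int ?d) *\<^sub>R (real_of_int ?d *\<^sub>R unit i) \<in> span C" by (metis span_scale)
    thus ?thesis using xs(3) by simp
  qed
  show ?thesis
  proof
    fix f assume "f \<in> lat m"
    hence "f = (\<Sum>i<m. f i *\<^sub>R unit i)" by (rule lat_expand)
    moreover have "(\<Sum>i<m. f i *\<^sub>R unit i) \<in> span C" using u by (intro span_sum span_scale) auto
    ultimately show "f \<in> span C" by metis
  qed
qed

text \<open>The columns of \<open>A\<close> parallel to the elements of \<open>Y\<close> form a submatrix whose determinant is a nonzero integral multiple of the volume of \<open>Y\<close>.\<close>

lemma gvol_le_minor:
  assumes A: "A \<in> carrier_mat m n" "max_minor A \<le> \<Delta>"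
    and Y: "lattice_basis (lat m) Y" and sc: "\<And>y. y \<in> Y \<Longrightarrow> \<exists>k<n. \<exists>s::int. s \<noteq> 0 \<and> emb (col A k) = real_of_int s *\<^sub>R y"
  shows "int (gvol m Y) \<le> \<Delta>"
proof -
  obtain ys where ys: "set ys = Y" "distinct ys" using finite_distinct_list[OF lat_basis_card(1)[OF Y]] by blast
  have l: "length ys = m" using distinct_card[OF ys(2)] lat_basis_card(2)[OF Y] ys(1) by simp
  have YL: "Y \<subseteq> lat m" "independent Y" using Y unfolding lattice_basis_def by auto
  obtain k s where ks: "\<And>y. y \<in> Y \<Longrightarrow> k y < n" "\<And>y. y \<in> Y \<Longrightarrow> s y \<noteq> (0::int)" "\<And>y. y \<in> Y \<Longrightarrow> emb (col A (k y)) = real_of_int (s y) *\<^sub>R y"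
    using sc by metis
  have kinj: "inj_on k Y"
  proof (rule inj_onI, rule ccontr)
    fix y y' assume h: "y \<in> Y" "y' \<in> Y" "k y = k y'" "y \<noteq> y'"
    have "real_of_int (s y) *\<^sub>R y = real_of_int (s y') *\<^sub>R y'" using ks(3)[OF h(1)] ks(3)[OF h(2)] h(3) by simp
    moreover have "real_of_int (s y') *\<^sub>R y' \<in> span (Y - {y})" using h by (intro span_scale span_base) auto
    ultimately have "(1 / real_of_int (s y)) *\<^sub>R (real_of_int (s y) *\<^sub>R y) \<in> span (Y - {y})" by (metis span_scale)
    hence "y \<in> span (Y - {y})" using ks(2)[OF h(1)] by simp
    thus False using YL(2) h(1) unfolding indep_iff by blast
  qed
  let ?K = "k ` Y"
  have K: "finite ?K" "card ?K = m" using lat_basis_card[OF Y] card_image[OF kinj] by auto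
  let ?B = "submatrix A UNIV ?K"
  have "{j. j < n \<and> j \<in> ?K} = ?K" using ks(1) by auto
  hence B: "?B \<in> carrier_mat m m" using A(1) K(2) dim_submatrix[of A UNIV ?K] by (intro carrier_matI) auto
  note S = submatrix_square[OF A(1) B]
  have "\<bar>det ?B\<bar> \<le> max_minor A" unfolding max_minor_def
    using A(1) B by (intro Max_ge[OF minors_finite[OF A(1)]]) auto
  hence dB: "\<bar>det ?B\<bar> \<le> \<Delta>" using A(2) by simp
  let ?f = "\<lambda>j. emb (col A j)"
  have "mat m m (\<lambda>(i, j). ?f (pick ?K j) i) = map_mat real_of_int ?B"
    using S A(1) B by (intro eq_matI) (auto simp: emb_def)
  hence g1: "det (gram m ?K ?f) = (real_of_int (det ?B))\<^sup>2" using det_gram[OF bij_pick[OF K], of ?f] det_of_int by simp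
  have b: "bij_betw (\<lambda>j. k (ys ! j)) {0..<m} ?K"
  proof -
    have "bij_betw ((!) ys) {0..<m} Y" using bij_nth[OF ys(2) l] ys(1) by (simp only:)
    moreover have "bij_betw k Y ?K" using kinj unfolding bij_betw_def by simp
    ultimately show ?thesis using bij_betw_trans[of "(!) ys"] unfolding comp_def by blast
  qed
  let ?D = "mat m m (\<lambda>(i, j). if i = j then real_of_int (s (ys ! j)) else 0)"
  have L: "lmat m ys \<in> carrier_mat m m" unfolding lmat_def by simp
  have "mat m m (\<lambda>(i, j). ?f (k (ys ! j)) i) = lmat m ys * ?D"
  proof (rule eq_matI)
    fix i j assume "i < dim_row (lmat m ys * ?D)" "j < dim_col (lmat m ys * ?D)"
    hence ij: "i < m" "j < m" by (auto simp: lmat_def)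
    have "(lmat m ys * ?D) $$ (i, j) = (\<Sum>t = 0..<m. (ys ! t) i * (if t = j then real_of_int (s (ys ! j)) else 0))"
      using ij L by (simp add: scalar_prod_def lmat_def)
    also have "\<dots> = (\<Sum>t = 0..<m. if t = j then (ys ! t) i * real_of_int (s (ys ! j)) else 0)" by (intro sum.cong) auto
    also have "\<dots> = (ys ! j) i * real_of_int (s (ys ! j))" using ij by (simp add: sum.delta)
    also have "\<dots> = ?f (k (ys ! j)) i" using ks(3)[of "ys ! j"] ij l ys(1) nth_mem[of j ys] by (simp add: mult.commute)
    finally show "mat m m (\<lambda>(i, j). ?f (k (ys ! j)) i) $$ (i, j) = (lmat m ys * ?D) $$ (i, j)" using ij by simp
  qed (auto simp: lmat_def)
  moreover have "det ?D = real_of_int (\<Prod>j = 0..<m. s (ys ! j))"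
  proof -
    have "det ?D = prod_list (diag_mat ?D)" by (rule det_upper_triangular[of _ m]) (auto simp: upper_triangular_def)
    also have "\<dots> = (\<Prod>j = 0..<m. ?D $$ (j, j))" by (simp add: prod_list_diag_prod)
    also have "\<dots> = real_of_int (\<Prod>j = 0..<m. s (ys ! j))" unfolding of_int_prod by (intro prod.cong) auto
    finally show ?thesis .
  qed
  ultimately have g2: "det (gram m ?K ?f) = (det (lmat m ys) * real_of_int (\<Prod>j = 0..<m. s (ys ! j)))\<^sup>2"
    using det_gram[OF b, of ?f] det_mult[OF L, of ?D] by simp
  define t where "t = (\<Prod>j = 0..<m. s (ys ! j))"
  have "t \<noteq> 0" unfolding t_def using ks(2) ys(1) l by (auto simp: prod_zero_iff)
  hence t: "\<bar>real_of_int t\<bar> \<ge> 1" by linarith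
  have "\<bar>real_of_int (det ?B)\<bar> = \<bar>det (lmat m ys)\<bar> * \<bar>real_of_int t\<bar>"
    using g1 g2 unfolding t_def[symmetric] by (metis abs_mult power2_eq_iff abs_minus_cancel)
  also have "\<bar>det (lmat m ys)\<bar> = real (gvol m Y)" using gvol_eq[OF ys(2) l] ys(1) YL(1) by simp
  finally have "real (gvol m Y) \<le> \<bar>real_of_int (det ?B)\<bar>" using mult_left_mono[OF t, of "real (gvol m Y)"] by simp
  hence "int (gvol m Y) \<le> \<bar>det ?B\<bar>" by linarith
  thus ?thesis using dB by simp
qed

section \<open>From matrices to sets\<close>

text \<open>The divisor \<open>g\<close> is 1 for the bound on all columns, and the gcd of the entries for the bound on primitive ones; the other columns are kept, divided by their gcd, so that the set still spans.\<close>

definition scaled_cols :: "int mat \<Rightarrow> (int vec \<Rightarrow> int) \<Rightarrow> (nat \<Rightarrow> real) set" where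
  "scaled_cols A g = (\<lambda>c. (1 / real_of_int (g c)) *\<^sub>R emb c) ` {c \<in> set (cols A). c \<noteq> 0\<^sub>v (dim_row A)}"

definition sym_cols :: "int mat \<Rightarrow> (int vec \<Rightarrow> int) \<Rightarrow> (nat \<Rightarrow> real) set" where
  "sym_cols A g = scaled_cols A g \<union> uminus ` scaled_cols A g"

locale modular_cols =
  fixes A :: "int mat" and m :: nat and \<Delta> :: int and g :: "int vec \<Rightarrow> int"
  assumes A: "A \<in> modular_mats \<Delta> m"
    and g: "\<And>c. c \<in> set (cols A) \<Longrightarrow> c \<noteq> 0\<^sub>v m \<Longrightarrow> g c \<ge> 1 \<and> (\<forall>i<m. g c dvd c $ i)"
begin

lemma A_car: "A \<in> carrier_mat m (dim_col A)" and A_rank: "full_row_rank A" and A_minor: "max_minor A \<le> \<Delta>"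
  using A unfolding modular_mats_def by auto

lemma col_car: "c \<in> set (cols A) \<Longrightarrow> c \<in> carrier_vec m"
  using cols_dim[of A] A_car by auto

lemma emb_eq_0: "c \<in> carrier_vec m \<Longrightarrow> emb c = 0 \<longleftrightarrow> c = 0\<^sub>v m"
proof -
  assume c: "c \<in> carrier_vec m"
  have "emb (0\<^sub>v m) = 0" by (auto simp: emb_def fun_eq_iff)
  thus ?thesis using inj_onD[OF emb_inj _ c, of "0\<^sub>v m"] by (metis zero_carrier_vec)
qed

lemma scaled_E:
  assumes "x \<in> scaled_cols A g"
  obtains c where "c \<in> set (cols A)" "c \<noteq> 0\<^sub>v m" "c \<in> carrier_vec m" "g c \<ge> 1" "\<And>i. i < m \<Longrightarrow> g c dvd c $ i" "x = (1 / real_of_int (g c)) *\<^sub>R emb c"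
    "emb c = real_of_int (g c) *\<^sub>R x"
proof -
  obtain c where c: "c \<in> set (cols A)" "c \<noteq> 0\<^sub>v m" "x = (1 / real_of_int (g c)) *\<^sub>R emb c"
    using assms A_car unfolding scaled_cols_def by auto
  show thesis using that[OF c(1,2) col_car[OF c(1)] _ _ c(3)] g[OF c(1,2)] c(3) by auto
qed

lemma scaled_lat: assumes "x \<in> scaled_cols A g" shows "x \<in> lat m" "x \<noteq> 0"
proof -
  obtain c where c: "c \<in> set (cols A)" "c \<noteq> 0\<^sub>v m" "c \<in> carrier_vec m" "g c \<ge> 1" "\<And>i. i < m \<Longrightarrow> g c dvd c $ i" "x = (1 / real_of_int (g c)) *\<^sub>R emb c"
    "emb c = real_of_int (g c) *\<^sub>R x" using scaled_E[OF assms] by blast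
  have "x i \<in> \<int>" if i: "i < m" for i
  proof -
    obtain k where k: "c $ i = g c * k" using c(5)[OF i] by (elim dvdE)
    have "x i = real_of_int k" using c(4) k i c(3) by (simp add: c(6) emb_def)
    thus ?thesis by simp
  qed
  moreover have "x i = 0" if "i \<ge> m" for i using that c(3) by (simp add: c(6) emb_def)
  ultimately show "x \<in> lat m" unfolding lat_def by auto
  show "x \<noteq> 0" using c(7) c(2) emb_eq_0[OF c(3)] by auto
qed

lemma sym_cols_lattice: "lattice_vol (lat m) (gvol m) (sym_cols A g)"
proof
  show "0 \<in> lat m" by (rule lat_0)
  show "x + y \<in> lat m" if "x \<in> lat m" "y \<in> lat m" for x y using that by (rule lat_add)
  show "- x \<in> lat m" if "x \<in> lat m" for x using that by (rule lat_neg)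
  show "sym_cols A g \<subseteq> lat m" unfolding sym_cols_def using scaled_lat(1) lat_neg by auto
  show "finite (sym_cols A g)" unfolding sym_cols_def scaled_cols_def by simp
  show "- a \<in> sym_cols A g" if "a \<in> sym_cols A g" for a using that unfolding sym_cols_def by auto
  show "0 \<notin> sym_cols A g" unfolding sym_cols_def using scaled_lat(2) by auto
  show "lat m \<subseteq> span (sym_cols A g)"
  proof (rule lat_span_cols[OF A_car A_rank])
    fix c assume c: "c \<in> set (cols A)"
    show "emb c \<in> span (sym_cols A g)"
    proof (cases "c = 0\<^sub>v m")
      case True
      thus ?thesis using emb_eq_0[OF col_car[OF c]] span_zero by metis
    next
      case False
      have "(1 / real_of_int (g c)) *\<^sub>R emb c \<in> sym_cols A g" unfolding sym_cols_def scaled_cols_def using c False A_car by auto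
      hence "real_of_int (g c) *\<^sub>R ((1 / real_of_int (g c)) *\<^sub>R emb c) \<in> span (sym_cols A g)" by (intro span_scale span_base)
      thus ?thesis using g[OF c False] by simp
    qed
  qed
  show "gvol m Y > 0" if "lattice_basis (lat m) Y" for Y using that by (rule gvol_pos)
  show "real (gvol m (insert x (Y - {y}))) = \<bar>c\<bar> * real (gvol m Y)"
    if "lattice_basis (lat m) Y" "y \<in> Y" "x \<in> lat m" "x - c *\<^sub>R y \<in> span (Y - {y})" "c \<noteq> 0" for Y y x c
    using that by (rule gvol_exch)
qed

sublocale lattice_vol "lat m" "gvol m" "sym_cols A g"
  by (rule sym_cols_lattice)

lemma gvol_le: assumes Y: "Y \<subseteq> sym_cols A g" "lattice_basis (lat m) Y" shows "int (gvol m Y) \<le> \<Delta>"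
proof (rule gvol_le_minor[OF A_car A_minor Y(2)])
  fix y assume "y \<in> Y"
  hence "y \<in> scaled_cols A g \<or> - y \<in> scaled_cols A g" using Y(1) unfolding sym_cols_def by auto
  hence "\<exists>x e. x \<in> scaled_cols A g \<and> x = real_of_int e *\<^sub>R y \<and> e \<noteq> 0"
  proof
    assume "y \<in> scaled_cols A g"
    moreover have "y = real_of_int 1 *\<^sub>R y" by (simp only: of_int_1 scaleR_one)
    ultimately show ?thesis by (intro exI[of _ y] exI[of _ 1] conjI) simp_all
  next
    assume h: "- y \<in> scaled_cols A g"
    have "- y = real_of_int (- 1) *\<^sub>R y" by (simp only: of_int_minus of_int_1 scaleR_minus_left scaleR_one)
    moreover have "- 1 \<noteq> (0 :: int)" by simp
    ultimately have "- y \<in> scaled_cols A g \<and> - y = real_of_int (- 1) *\<^sub>R y \<and> - 1 \<noteq> (0 :: int)" using h by (intro conjI)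
    thus ?thesis by (rule_tac x = "- y" in exI, rule_tac x = "- 1" in exI)
  qed
  then obtain x e where x: "x \<in> scaled_cols A g" "x = real_of_int e *\<^sub>R y" "e \<noteq> 0" by (elim exE conjE)
  obtain c where c: "c \<in> set (cols A)" "g c \<ge> 1" "emb c = real_of_int (g c) *\<^sub>R x" using scaled_E[OF x(1)] by metis
  obtain k where k: "k < dim_col A" "c = col A k" using c(1) by (metis cols_length cols_nth in_set_conv_nth)
  have "emb (col A k) = real_of_int (g c * e) *\<^sub>R y" using c(3) x(2) k(2) by simp
  moreover have "g c * e \<noteq> 0" using c(2) x(3) by simp
  ultimately show "\<exists>k<dim_col A. \<exists>s::int. s \<noteq> 0 \<and> emb (col A k) = real_of_int s *\<^sub>R y" using k(1) by blast
qed

lemma dim_cols: "dim (sym_cols A g) = m"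
proof -
  obtain Y where Y: "Y \<subseteq> sym_cols A g" "lattice_basis (lat m) Y" using bas_extend[of "{}"] independent_empty by blast
  show ?thesis using bas_fin(2)[OF Y(2)] lat_basis_card(2)[OF Y(2)] by simp
qed

text \<open>A multiset with differing columns has no repetitions, and its image under \<open>emb\<close> is disjoint from the negatives.\<close>

lemma size_le:
  assumes X: "X \<subseteq># mset (cols A)" "differing_columns X" and g1: "\<And>c. c \<in># X \<Longrightarrow> g c = 1"
  shows "2 * size X \<le> card (sym_cols A g)"
proof -
  have d: "a \<noteq> - b" "a \<noteq> b" if "{#a, b#} \<subseteq># X" for a b using X(2) that unfolding differing_columns_def differ_def by auto
  have sub: "c \<in> set (cols A)" if "c \<in># X" for c using mset_subset_eqD[OF X(1) that] by simp
  have nz: "c \<noteq> 0\<^sub>v m" if "c \<in># X" for c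
    using X(2) that carrier_vecD[OF col_car[OF sub[OF that]]] unfolding differing_columns_def by auto
  have c1: "count X c = 1" if "c \<in># X" for c
  proof (rule ccontr)
    assume "count X c \<noteq> 1"
    hence "count X c \<ge> 2" using that by (metis One_nat_def count_greater_eq_one_iff le_antisym not_less_eq_eq numeral_2_eq_2)
    hence "{#c, c#} \<subseteq># X" by (intro mset_subset_eqI) auto
    thus False using d(2) by blast
  qed
  have sz: "size X = card (set_mset X)" unfolding size_multiset_overloaded_eq using c1 by simp
  let ?E = "emb ` set_mset X"
  have inj: "inj_on emb (set_mset X)" using sub col_car by (intro inj_on_subset[OF emb_inj]) auto
  have E: "?E \<subseteq> scaled_cols A g"
  proof
    fix x assume "x \<in> ?E"
    then obtain c where c: "c \<in># X" "x = emb c" by auto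
    thus "x \<in> scaled_cols A g" unfolding scaled_cols_def using sub[OF c(1)] nz[OF c(1)] g1[OF c(1)] A_car
      by (intro image_eqI[of _ _ c]) auto
  qed
  have "?E \<inter> uminus ` ?E = {}"
  proof (rule ccontr)
    assume "?E \<inter> uminus ` ?E \<noteq> {}"
    then obtain a b where ab: "a \<in># X" "b \<in># X" "emb a = - emb b" by auto
    hence "emb a = emb (- b)" by (simp add: emb_neg)
    moreover have car: "a \<in> carrier_vec m" "b \<in> carrier_vec m" using ab sub col_car by auto
    ultimately have e: "a = - b" using inj_onD[OF emb_inj] by (metis uminus_carrier_vec)
    show False
    proof (cases "a = b")
      case True
      have "emb a = - emb a" using ab(3) True by simp
      hence "emb a = 0" by (auto simp: fun_eq_iff)
      thus False using nz[OF ab(1)] emb_eq_0[OF car(1)] by simp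
    next
      case False
      hence "{#a, b#} \<subseteq># X" using c1[OF ab(1)] c1[OF ab(2)] ab(1,2) by (intro mset_subset_eqI) auto
      thus False using d(1) e by blast
    qed
  qed
  hence "card (?E \<union> uminus ` ?E) = card ?E + card (uminus ` ?E)" by (intro card_Un_disjoint) auto
  also have "card (uminus ` ?E) = card ?E" by (rule card_image) simp
  also have "card ?E = size X" unfolding sz by (rule card_image[OF inj])
  finally have "2 * size X = card (?E \<union> uminus ` ?E)" by (simp only: mult_2)
  also have "\<dots> \<le> card (sym_cols A g)" using E finA unfolding sym_cols_def by (intro card_mono) auto
  finally show ?thesis .
qed

end

lemma num_differing_le:
  assumes A: "A \<in> modular_mats 1 m"
  shows "num_differing A \<le> m * (m + 1) div 2"
proof -
  interpret modular_cols A m 1 "\<lambda>_. 1" using A by unfold_locales auto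
  have "unimod (sym_cols A (\<lambda>_. 1))"
  proof (rule unimod_of_const)
    fix Y assume Y: "Y \<subseteq> sym_cols A (\<lambda>_. 1)" "lattice_basis (lat m) Y"
    show "gvol m Y = 1" using gvol_le[OF Y] vol_pos[OF Y(2)] by simp
  qed
  hence "card (sym_cols A (\<lambda>_. 1)) \<le> m * (m + 1)" using heller dim_cols by metis
  hence b: "size X \<le> m * (m + 1) div 2" if "X \<subseteq># mset (cols A)" "differing_columns X" for X
    using size_le[OF that] by simp
  show ?thesis unfolding num_differing_def
  proof (rule Max.boundedI)
    show "finite {size X |X. X \<subseteq># mset (cols A) \<and> differing_columns X}"
      by (rule finite_subset[of _ "{..m * (m + 1) div 2}"]) (use b in auto)
    have "differing_columns ({#} :: int vec multiset)" unfolding differing_columns_def by simp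
    thus "{size X |X. X \<subseteq># mset (cols A) \<and> differing_columns X} \<noteq> {}" by (auto intro!: exI[of _ "{#}"])
  qed (use b in auto)
qed

lemma num_differing_primitive_le:
  assumes A: "A \<in> modular_mats 2 m" and m: "m \<ge> 1"
  shows "num_differing_primitive A \<le> (if m \<in> {3, 5} then m * (m + 1) div 2 + m else m * (m + 1) div 2 + m - 1)"
    (is "_ \<le> ?b")
proof -
  let ?g = "\<lambda>c :: int vec. Gcd (set\<^sub>v c)"
  interpret modular_cols A m 2 ?g
  proof
    fix c assume c: "c \<in> set (cols A)" "c \<noteq> 0\<^sub>v m"
    have car: "c \<in> carrier_vec m" using subsetD[OF cols_dim c(1)] A unfolding modular_mats_def by simp
    have dv: "?g c dvd c $ i" if "i < m" for i using that car by (intro Gcd_dvd vec_setI[of c i]) auto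
    obtain i where i: "i < m" "c $ i \<noteq> 0" using c(2) car by (metis carrier_vecD eq_vecI index_zero_vec)
    have "?g c \<noteq> 0" using dv[OF i(1)] i(2) by auto
    moreover have "?g c \<ge> 0" by simp
    ultimately have "?g c \<ge> 1" by linarith
    thus "?g c \<ge> 1 \<and> (\<forall>i<m. ?g c dvd c $ i)" using dv by blast
  qed (rule A)
  let ?C = "sym_cols A ?g"
  interpret bimodular "lat m" "gvol m" ?C
  proof
    show "gvol m Y \<le> 2" if "Y \<subseteq> ?C" "lattice_basis (lat m) Y" for Y using gvol_le[OF that] by simp
    have key: "x \<noteq> 2 *\<^sub>R l" if x: "x \<in> scaled_cols A ?g" and l: "l \<in> lat m" for x l
    proof
      assume e: "x = 2 *\<^sub>R l"
      obtain c where c: "c \<in> carrier_vec m" "?g c \<ge> 1" "emb c = real_of_int (?g c) *\<^sub>R x" using scaled_E[OF x] by metis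
      have "2 * ?g c dvd c $ i" if i: "i < m" for i
      proof -
        have "l i \<in> \<int>" using l i unfolding lat_def by blast
        then obtain k where k: "l i = real_of_int k" by (rule Ints_cases)
        have "real_of_int (c $ i) = real_of_int (?g c * (2 * k))" using fun_cong[OF c(3), of i] i c(1) e k by (simp add: emb_def)
        hence "c $ i = ?g c * (2 * k)" by (simp only: of_int_eq_iff)
        thus ?thesis by simp
      qed
      hence "2 * ?g c dvd ?g c" using c(1) by (intro Gcd_greatest) (auto elim!: vec_setE)
      hence "2 * ?g c \<le> ?g c" using c(2) by (intro zdvd_imp_le) auto
      thus False using c(2) by simp
    qed
    show "a \<noteq> 2 *\<^sub>R l" if a: "a \<in> ?C" and l: "l \<in> lat m" for a l
    proof
      assume e: "a = 2 *\<^sub>R l"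
      from a consider "a \<in> scaled_cols A ?g" | "- a \<in> scaled_cols A ?g" unfolding sym_cols_def by auto
      thus False using key[of a l] key[of "- a" "- l"] l lat_neg[OF l] e by cases auto
    qed
  qed
  have bm: "bimodular (lat m) (gvol m) ?C" by (rule bimodular_axioms)
  have c: "card ?C \<le> m * m + 3 * m" "m \<notin> {0, 3, 5} \<Longrightarrow> card ?C + 2 \<le> m * m + 3 * m"
    using bimodular_card[OF bm] unfolding dim_cols by auto
  have b: "size X \<le> ?b" if X: "X \<subseteq># mset (cols A)" "differing_columns X" "\<forall>a\<in>#X. primitive_vec a" for X
  proof -
    have "2 * size X \<le> card ?C" using X(3) by (intro size_le[OF X(1,2)]) (auto simp: primitive_vec_def)
    moreover have "even (m * (m + 1))" by simp
    then obtain k where k: "m * (m + 1) = 2 * k" by blast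
    moreover have "m * m + 3 * m = m * (m + 1) + 2 * m" by (simp add: algebra_simps)
    ultimately show ?thesis using c m by (cases "m \<in> {3, 5}") auto
  qed
  show ?thesis unfolding num_differing_primitive_def
  proof (rule Max.boundedI)
    show "finite {size X |X. X \<subseteq># mset (cols A) \<and> differing_columns X \<and> (\<forall>a\<in>#X. primitive_vec a)}"
      by (rule finite_subset[of _ "{..?b}"]) (use b in auto)
    have "differing_columns ({#} :: int vec multiset)" unfolding differing_columns_def by simp
    thus "{size X |X. X \<subseteq># mset (cols A) \<and> differing_columns X \<and> (\<forall>a\<in>#X. primitive_vec a)} \<noteq> {}" by (auto intro!: exI[of _ "{#}"])
    show "x \<le> ?b" if "x \<in> {size X |X. X \<subseteq># mset (cols A) \<and> differing_columns X \<and> (\<forall>a\<in>#X. primitive_vec a)}" for x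
      using that b by blast
  qed
qed

lemma Max_image_eq:
  fixes b :: nat
  assumes "\<And>x. x \<in> S \<Longrightarrow> f x \<le> b" "\<exists>x\<in>S. b \<le> f x"
  shows "Max {f x |x. x \<in> S} = b"
proof (rule Max_eqI)
  show "finite {f x |x. x \<in> S}" by (rule finite_subset[of _ "{..b}"]) (use assms(1) in auto)
  show "y \<le> b" if "y \<in> {f x |x. x \<in> S}" for y using that assms(1) by auto
  obtain x where "x \<in> S" "b \<le> f x" using assms(2) by blast
  thus "b \<in> {f x |x. x \<in> S}" using assms(1)[of x] by (auto intro!: exI[of _ x])
qed

theorem mainTheorem7:
  fixes m :: nat
  assumes "m \<ge> 1"
  shows "max_differing_primitive 2 m =
    (if m \<in> {3, 5} then max_differing 1 m + m else max_differing 1 m + m - 1)"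
proof -
  have c: "max_differing 1 m = m * (m + 1) div 2"
    unfolding max_differing_def using num_differing_le lower_unimodular by (rule Max_image_eq)
  show ?thesis
    unfolding c max_differing_primitive_def
  proof (rule Max_image_eq[OF num_differing_primitive_le[OF _ assms]])
    show "\<exists>A\<in>modular_mats 2 m. (if m \<in> {3, 5} then m * (m + 1) div 2 + m else m * (m + 1) div 2 + m - 1) \<le> num_differing_primitive A"
      using lower_bimodular[OF assms] lower_three lower_five assms by (auto simp: Nat.add_diff_assoc)
  qed
qed

end
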